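(* Let $\Omega\subset\mathbb R^3$ be a bounded smooth domain, let $q\in C(\overline\Omega)\setminus\{0\}$ and let $p\in(2,10/3)$. Then there exists a sequence $\{(u_n,\omega_n,\phi_n)\}_n\subset B\times\mathbb R\times\mathbb H$ of (weak) solutions of the problem $$ \begin{cases} -\Delta u+q(x)\phi u-|u|^{p-2}u=\omega u & \text{in }\Omega,\\ -\Delta\phi+\Delta^2\phi=q(x)u^2 & \text{in }\Omega,\\ u=0,\quad \phi=0,\quad \Delta\phi=0 & \text{on }\partial\Omega,\\ \int_\Omega u^2\,dx=1, \end{cases} $$ such that $$\omega_n\to+\infty,\qquad \|u_n\|\to+\infty\qquad\text{as } n\to+\infty.$$
   Context: $H^1_0(\Omega)$ carries the norm $\|u\|=\left(\int_\Omega|\nabla u|^2dx\right)^{1/2}$; $B=\{u\in H^1_0(\Omega):\int_\Omega u^2dx=1\}$; $\mathbb H=H^1_0(\Omega)\cap H^2(\Omega)$ with norm $\left(\int_\Omega|\Delta\phi|^2dx+\int_\Omega|\nabla\phi|^2dx\right)^{1/2}$. A triple $(u,\omega,\phi)\in B\times\mathbb R\times\mathbb H$ is a (weak) solution of the problem if $$\int_\Omega\nabla u\nabla v\,dx+\int_\Omega q(x)\phi uv\,dx-\int_\Omega|u|^{p-2}uv\,dx=\omega\int_\Omega uv\,dx\quad\forall v\in H^1_0(\Omega),$$ $$\int_\Omega\Delta\phi\,\Delta\xi\,dx+\int_\Omega\nabla\phi\nabla\xi\,dx=\int_\Omega q(x)u^2\xi\,dx\quad\forall\xi\in\mathbb H.$$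 *)

theory Defs
  imports "HOL-Analysis.Analysis"
begin

section \<open>Smooth functions and smooth bounded domains\<close>

definition partial_deriv :: "'n::finite \<Rightarrow> (real^'n \<Rightarrow> real) \<Rightarrow> real^'n \<Rightarrow> real"
  where "partial_deriv i f x = frechet_derivative f (at x) (axis i 1)"

primrec iter_partial :: "'n::finite list \<Rightarrow> (real^'n \<Rightarrow> real) \<Rightarrow> real^'n \<Rightarrow> real" where
  "iter_partial [] f = f"
| "iter_partial (i # is) f = partial_deriv i (iter_partial is f)"

text \<open>All iterated partial derivatives exist and are everywhere differentiable, hence
  continuous; this is the class of infinitely often continuously differentiable functions.\<close>

definition smooth_fun :: "(real^'n::finite \<Rightarrow> real) \<Rightarrow> bool"
  where "smooth_fun f \<longleftrightarrow> (\<forall>is. iter_partial is f differentiable_on UNIV)"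

text \<open>Near each boundary point, after relabelling and reorienting the coordinate axes, the set is
  the region strictly above the graph of a smooth function. The graph function \<open>\<gamma>\<close> of
  the remaining coordinates is encoded as a function on the whole space that does not depend on
  the \<open>k\<close>-th coordinate; \<open>s\<close> is the orientation of the \<open>k\<close>-th axis.\<close>

definition smooth_boundary :: "(real^'n::finite) set \<Rightarrow> bool"
  where "smooth_boundary \<Omega> \<longleftrightarrow>
    (\<forall>x\<in>frontier \<Omega>. \<exists>r>0. \<exists>k. \<exists>s\<in>{1, -1}. \<exists>\<gamma>.
       smooth_fun \<gamma> \<and> (\<forall>y t. \<gamma> (y + t *\<^sub>R axis k 1) = \<gamma> y) \<and>
       \<Omega> \<inter> ball x r = {y \<in> ball x r. s * y $ k > \<gamma> y})"

definition bounded_smooth_domain :: "(real^'n::finite) set \<Rightarrow> bool"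
  where "bounded_smooth_domain \<Omega> \<longleftrightarrow>
    open \<Omega> \<and> connected \<Omega> \<and> \<Omega> \<noteq> {} \<and> bounded \<Omega> \<and> smooth_boundary \<Omega>"

definition test_functions :: "(real^'n::finite) set \<Rightarrow> (real^'n \<Rightarrow> real) set"
  where "test_functions \<Omega> = {\<eta>. smooth_fun \<eta> \<and>
    compact (closure {x. \<eta> x \<noteq> 0}) \<and> closure {x. \<eta> x \<noteq> 0} \<subseteq> \<Omega>}"

section \<open>Sobolev spaces\<close>

text \<open>Elements of the function spaces are represented by functions on the whole space of which
  only the values almost everywhere on \<open>\<Omega>\<close> matter.\<close>

definition L2 :: "(real^'n::finite) set \<Rightarrow> (real^'n \<Rightarrow> real) set"
  where "L2 \<Omega> = {u. u \<in> borel_measurable (lebesgue_on \<Omega>) \<and>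
    integrable (lebesgue_on \<Omega>) (\<lambda>x. (u x)\<^sup>2)}"

text \<open>A multi-index is given as the list of the directions of differentiation.\<close>

definition has_weak_deriv ::
  "(real^'n::finite) set \<Rightarrow> 'n list \<Rightarrow> (real^'n \<Rightarrow> real) \<Rightarrow> (real^'n \<Rightarrow> real) \<Rightarrow> bool"
  where "has_weak_deriv \<Omega> is u g \<longleftrightarrow> g \<in> L2 \<Omega> \<and>
    (\<forall>\<eta>\<in>test_functions \<Omega>.
       (LINT x|lebesgue_on \<Omega>. u x * iter_partial is \<eta> x)
         = (-1) ^ length is * (LINT x|lebesgue_on \<Omega>. g x * \<eta> x))"

text \<open>Weak derivatives are unique up to null sets, so the choice does not affect integrals.\<close>

definition weak_deriv ::
  "(real^'n::finite) set \<Rightarrow> 'n list \<Rightarrow> (real^'n \<Rightarrow> real) \<Rightarrow> real^'n \<Rightarrow> real"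
  where "weak_deriv \<Omega> is u = (SOME g. has_weak_deriv \<Omega> is u g)"

definition weak_grad :: "(real^'n::finite) set \<Rightarrow> (real^'n \<Rightarrow> real) \<Rightarrow> real^'n \<Rightarrow> real^'n"
  where "weak_grad \<Omega> u x = (\<chi> i. weak_deriv \<Omega> [i] u x)"

definition weak_laplacian :: "(real^'n::finite) set \<Rightarrow> (real^'n \<Rightarrow> real) \<Rightarrow> real^'n \<Rightarrow> real"
  where "weak_laplacian \<Omega> u x = (\<Sum>i\<in>UNIV. weak_deriv \<Omega> [i, i] u x)"

definition sobolev_H :: "nat \<Rightarrow> (real^'n::finite) set \<Rightarrow> (real^'n \<Rightarrow> real) set"
  where "sobolev_H k \<Omega> =
    {u \<in> L2 \<Omega>. \<forall>is. length is \<le> k \<longrightarrow> (\<exists>g. has_weak_deriv \<Omega> is u g)}"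

text \<open>The closure of the test functions in the full \<open>H\<^sup>1\<close> norm.\<close>

definition H10 :: "(real^'n::finite) set \<Rightarrow> (real^'n \<Rightarrow> real) set"
  where "H10 \<Omega> = {u \<in> sobolev_H 1 \<Omega>.
    \<exists>\<eta> :: nat \<Rightarrow> real^'n \<Rightarrow> real. (\<forall>m. \<eta> m \<in> test_functions \<Omega>) \<and>
      (\<lambda>m. (LINT x|lebesgue_on \<Omega>. (u x - \<eta> m x)\<^sup>2)
          + (LINT x|lebesgue_on \<Omega>. (norm (weak_grad \<Omega> (\<lambda>y. u y - \<eta> m y) x))\<^sup>2))
        \<longlonglongrightarrow> 0}"

definition H10_norm :: "(real^'n::finite) set \<Rightarrow> (real^'n \<Rightarrow> real) \<Rightarrow> real"
  where "H10_norm \<Omega> u = sqrt (LINT x|lebesgue_on \<Omega>. (norm (weak_grad \<Omega> u x))\<^sup>2)"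

section \<open>The eigenvalue problem\<close>

definition B_set :: "(real^'n::finite) set \<Rightarrow> (real^'n \<Rightarrow> real) set"
  where "B_set \<Omega> = {u \<in> H10 \<Omega>. (LINT x|lebesgue_on \<Omega>. (u x)\<^sup>2) = 1}"

definition HH :: "(real^'n::finite) set \<Rightarrow> (real^'n \<Rightarrow> real) set"
  where "HH \<Omega> = H10 \<Omega> \<inter> sobolev_H 2 \<Omega>"

definition weak_solution ::
  "(real^'n::finite) set \<Rightarrow> (real^'n \<Rightarrow> real) \<Rightarrow> real \<Rightarrow>
    (real^'n \<Rightarrow> real) \<Rightarrow> real \<Rightarrow> (real^'n \<Rightarrow> real) \<Rightarrow> bool"
  where "weak_solution \<Omega> q p u \<omega> \<phi> \<longleftrightarrow>
    u \<in> B_set \<Omega> \<and> \<phi> \<in> HH \<Omega> \<and>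
    (\<forall>v\<in>H10 \<Omega>.
       (LINT x|lebesgue_on \<Omega>. weak_grad \<Omega> u x \<bullet> weak_grad \<Omega> v x)
       + (LINT x|lebesgue_on \<Omega>. q x * \<phi> x * u x * v x)
       - (LINT x|lebesgue_on \<Omega>. \<bar>u x\<bar> powr (p - 2) * u x * v x)
       = \<omega> * (LINT x|lebesgue_on \<Omega>. u x * v x)) \<and>
    (\<forall>\<xi>\<in>HH \<Omega>.
       (LINT x|lebesgue_on \<Omega>. weak_laplacian \<Omega> \<phi> x * weak_laplacian \<Omega> \<xi> x)
       + (LINT x|lebesgue_on \<Omega>. weak_grad \<Omega> \<phi> x \<bullet> weak_grad \<Omega> \<xi> x)
       = (LINT x|lebesgue_on \<Omega>. q x * (u x)\<^sup>2 * \<xi> x))"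

end

theory Submission
  imports Defs "HOL-Complex_Analysis.Great_Picard" "HOL-Homology.Homology" "HOL-Real_Asymp.Real_Asymp"
begin

text \<open>Solving the second equation gives a bounded symmetric operator \<open>G\<close> with \<open>phi = G (q u\<^sup>2)\<close>, so solutions are the critical
  points on the unit sphere of \<open>L\<^sup>2\<close> of the even functional \<open>J u = \<parallel>\<nabla>u\<parallel>\<^sup>2 / 2 + \<langle>q u\<^sup>2, G (q u\<^sup>2)\<rangle> / 4 - \<integral>|u|\<^sup>p / p\<close>. As
  \<open>p < 10 / 3\<close>, Ladyzhenskaya's inequality makes \<open>J\<close> coercive, and \<open>J\<close> is large on subspaces of high codimension. The
  Borsuk-Ulam theorem turns this into almost critical points at arbitrarily high levels, and by Rellich compactness
  these converge to critical points. The space \<open>H\<^sup>2 \<inter> H\<^sup>1\<^sub>0\<close> is controlled by the \<open>L\<^sup>2\<close> norms of the Laplacian and of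
  the gradient: tangential derivatives of the gradient vanish on the boundary and satisfy an energy identity, and
  the remaining second derivative is recovered from the Laplacian.\<close>

section \<open>The Hilbert space of square integrable functions\<close>

text \<open>The exponent 10/3 enters at one place. On the unit sphere of L2, with D = max(1, |grad
  u|), splitting |u|^p at height D^(3/2) bounds its integral by 17 D^(3(p-2)/2), and this power is
  below 2 exactly when p < 10/3; the nonlocal term is nonnegative whatever the sign of q, because
  \<open>G\<close> is positive. The min-max argument runs as follows: a sublevel set is precompact
  in L2, so some n linear functionals never vanish together on it, while Borsuk-Ulam forbids
  deforming an odd image of the n-sphere into it. The derivative has a locally uniform quadratic
  remainder, so discrete descent steps serve as the deformation. The second equation rests on an a
  priori estimate, which is the coercivity in Lax-Milgram on the closed space of triples (function,
  gradient, Hessian). Functions are extended by zero, and vanishing on the boundary is expressed by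
  weak differentiability on the whole space. A critical point at level at least A has \<omega> >= A
  - C, by testing with u, and A <= C (1 + |grad u|)^3, so both sequences diverge.\<close>

definition sqint :: "('a::euclidean_space => real) => bool"
  where "sqint f \<longleftrightarrow> f \<in> borel_measurable lebesgue & integrable lebesgue (%x. (f x)\<^sup>2)"

lemma sqint_meas: "sqint f ==> f \<in> borel_measurable lebesgue"
  by (simp add: sqint_def)

lemma sqint_mult: assumes "sqint f" "sqint g" shows "integrable lebesgue (%x. f x * g x)"
proof (rule Bochner_Integration.integrable_bound)
  show "integrable lebesgue (%x. (f x)\<^sup>2 + (g x)\<^sup>2)"
    using assms by (simp add: sqint_def)
  show "(%x. f x * g x) \<in> borel_measurable lebesgue"
    using assms by (auto simp: sqint_def)
  have "\<bar>a * b\<bar> <= a\<^sup>2 + b\<^sup>2" for a b :: real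
  proof -
    have "2 * (\<bar>a\<bar> * \<bar>b\<bar>) <= a\<^sup>2 + b\<^sup>2"
      using sum_squares_bound[of "\<bar>a\<bar>" "\<bar>b\<bar>"] by simp
    moreover have "0 <= \<bar>a\<bar> * \<bar>b\<bar>" by simp
    ultimately show ?thesis unfolding abs_mult by linarith
  qed
  then show "AE x in lebesgue. norm (f x * g x) <= norm ((f x)\<^sup>2 + (g x)\<^sup>2)"
    by simp
qed

lemma sqint_bound:
  assumes "sqint g" "f \<in> borel_measurable lebesgue" "AE x in lebesgue. \<bar>f x\<bar> <= \<bar>g x\<bar>"
  shows "sqint f"
  unfolding sqint_def
proof
  show "integrable lebesgue (%x. (f x)\<^sup>2)"
  proof (rule Bochner_Integration.integrable_bound)
    show "integrable lebesgue (%x. (g x)\<^sup>2)" using assms by (simp add: sqint_def)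
    show "AE x in lebesgue. norm ((f x)\<^sup>2) <= norm ((g x)\<^sup>2)"
      using assms(3) by eventually_elim (simp add: abs_le_square_iff)
  qed (use assms(2) in measurable)
qed (use assms in simp)

lemma sqint_add: assumes "sqint f" "sqint g" shows "sqint (%x. f x + g x)"
proof -
  have "integrable lebesgue (%x. (f x)\<^sup>2 + (g x)\<^sup>2 + 2 * (f x * g x))"
    using assms sqint_mult[OF assms] by (simp add: sqint_def)
  then have "integrable lebesgue (%x. (f x + g x)\<^sup>2)"
    by (simp add: power2_sum algebra_simps)
  then show ?thesis
    using assms by (auto simp: sqint_def)
qed

lemma sqint_cmult: "sqint f ==> sqint (%x. c * f x)"
  by (auto simp: sqint_def power_mult_distrib)

lemma sqint_uminus: "sqint f ==> sqint (%x. - f x)"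
  by (auto simp: sqint_def)

lemma sqint_diff: "sqint f ==> sqint g ==> sqint (%x. f x - g x)"
  using sqint_add[of f "%x. - g x"] sqint_uminus[of g] by simp

lemma sqint_zero [simp]: "sqint (%x. 0)"
  by (simp add: sqint_def)

lemma sqint_abs: "sqint f ==> sqint (%x. \<bar>f x\<bar>)"
  by (auto simp: sqint_def)

lemma sqint_sum: "(!!i. i \<in> I ==> sqint (f i)) ==> sqint (%x. \<Sum>i\<in>I. f i x)"
  by (induction I rule: infinite_finite_induct) (auto intro!: sqint_add)

\<comment> \<open>The relation is \<open>partial\<close> because only square-integrable functions
  represent elements; identifying functions that are equal almost everywhere makes the norm
  definite.\<close>
quotient_type (overloaded) 'a l2 = "'a::euclidean_space => real" / partial:
  "%f g. sqint f & sqint g & (AE x in lebesgue. f x = g x)"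
proof (rule part_equivpI)
  show "\<exists>f :: 'a => real. sqint f & sqint f & (AE x in lebesgue. f x = f x)"
    by (rule exI[of _ "%x. 0"]) simp
  show "symp (%f (g :: 'a => real). sqint f & sqint g & (AE x in lebesgue. f x = g x))"
    by (auto simp: symp_def elim: eventually_mono)
  show "transp (%f (g :: 'a => real). sqint f & sqint g & (AE x in lebesgue. f x = g x))"
    unfolding transp_def by (auto elim: eventually_elim2)
qed

instantiation l2 :: (euclidean_space) real_inner
begin

lift_definition zero_l2 :: "'a l2" is "%x. 0" by simp

lift_definition plus_l2 :: "'a l2 => 'a l2 => 'a l2" is "%f g x. f x + g x"
  by (auto intro!: sqint_add elim: eventually_elim2)

lift_definition minus_l2 :: "'a l2 => 'a l2 => 'a l2" is "%f g x. f x - g x"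
  by (auto intro!: sqint_diff elim: eventually_elim2)

lift_definition uminus_l2 :: "'a l2 => 'a l2" is "%f x. - f x"
  by (auto intro!: sqint_uminus)

lift_definition scaleR_l2 :: "real => 'a l2 => 'a l2" is "%c f x. c * f x"
  by (auto intro!: sqint_cmult elim: eventually_mono)

lift_definition inner_l2 :: "'a l2 => 'a l2 => real" is "%f g. LINT x|lebesgue. f x * g x"
proof -
  fix f1 f2 g1 g2 :: "'a => real"
  assume 1: "sqint f1 & sqint f2 & (AE x in lebesgue. f1 x = f2 x)"
    and 2: "sqint g1 & sqint g2 & (AE x in lebesgue. g1 x = g2 x)"
  then have ae: "AE x in lebesgue. f1 x * g1 x = f2 x * g2 x"
    by (auto elim: eventually_elim2)
  show "(LINT x|lebesgue. f1 x * g1 x) = (LINT x|lebesgue. f2 x * g2 x)"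
    by (rule integral_cong_AE) (use 1 2 ae in \<open>auto dest!: sqint_meas\<close>)
qed

definition norm_l2 :: "'a l2 => real" where "norm_l2 u = sqrt (inner u u)"
definition dist_l2 :: "'a l2 => 'a l2 => real" where "dist_l2 u v = norm (u - v)"
definition sgn_l2 :: "'a l2 => 'a l2" where "sgn_l2 u = scaleR (inverse (norm u)) u"
definition uniformity_l2 :: "('a l2 \<times> 'a l2) filter"
  where "uniformity_l2 = (INF e\<in>{0 <..}. principal {(x, y). dist x y < e})"
definition open_l2 :: "'a l2 set => bool"
  where "open_l2 U = (\<forall>x\<in>U. eventually (%(x', y). x' = x --> y \<in> U) uniformity)"

instance
proof
  fix a b c :: "'a l2" and r s :: real
  show "a + b + c = a + (b + c)" by transfer (auto intro!: sqint_add simp: algebra_simps)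
  show "a + b = b + a" by transfer (auto intro!: sqint_add simp: algebra_simps)
  show "0 + a = a" by transfer auto
  show "- a + a = 0" by transfer auto
  show "a - b = a + - b" by transfer (auto intro!: sqint_add sqint_diff sqint_uminus)
  show "r *\<^sub>R (a + b) = r *\<^sub>R a + r *\<^sub>R b"
    by transfer (auto intro!: sqint_add sqint_cmult simp: algebra_simps)
  show "(r + s) *\<^sub>R a = r *\<^sub>R a + s *\<^sub>R a"
    by transfer (auto intro!: sqint_add sqint_cmult simp: distrib_right)
  show "r *\<^sub>R s *\<^sub>R a = (r * s) *\<^sub>R a"
    by transfer (auto intro!: sqint_cmult simp: mult.assoc sqint_cmult)
  show "1 *\<^sub>R a = a" by transfer auto
  show "dist a b = norm (a - b)" by (rule dist_l2_def)
  show "sgn a = inverse (norm a) *\<^sub>R a" by (rule sgn_l2_def)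
  show "inner a b = inner b a" by transfer (simp add: mult.commute)
  show "inner (a + b) c = inner a c + inner b c"
    by transfer (simp add: distrib_right Bochner_Integration.integral_add sqint_mult)
  show "inner (r *\<^sub>R a) b = r * inner a b"
    by transfer (simp add: mult.assoc)
  show "0 <= inner a a" by transfer simp
  show "(inner a a = 0) = (a = 0)"
  proof (transfer, goal_cases)
    case (1 a)
    then have i: "integrable lebesgue (%x. a x * a x)" by (simp add: sqint_mult)
    have "(LINT x|lebesgue. a x * a x) = 0 \<longleftrightarrow> (AE x in lebesgue. a x * a x = 0)"
      by (rule integral_nonneg_eq_0_iff_AE[OF i]) simp
    then show ?case using 1 by simp
  qed
  show "norm a = sqrt (inner a a)" by (rule norm_l2_def)
  show "uniformity = (INF e\<in>{0 <..}. principal {(x, y :: 'a l2). dist x y < e})"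
    by (rule uniformity_l2_def)
  show "open U = (\<forall>x\<in>U. eventually (%(x', y). x' = x --> y \<in> U) uniformity)" for U :: "'a l2 set"
    by (rule open_l2_def)
qed

end

text \<open>A total form of the quotient map. The junk value 0 off the square-integrable functions
  is the reason why the rules about \<open>mk\<close> mostly carry \<open>sqint\<close>
  premises.\<close>

definition mk :: "('a::euclidean_space => real) => 'a l2"
  where "mk f = (if sqint f then abs_l2 f else 0)"

definition rep :: "'a::euclidean_space l2 => 'a => real"
  where "rep = rep_l2"

lemma sqint_rep [simp]: "sqint (rep u)"
  using Quotient3_rep_reflp[OF Quotient3_l2, of u] by (simp add: rep_def)

lemma rep_meas [measurable, simp]: "rep u \<in> borel_measurable lebesgue"
  by (rule sqint_meas) simp

lemma mk_rep [simp]: "mk (rep u) = u"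
  using Quotient3_abs_rep[OF Quotient3_l2, of u] sqint_rep[of u] by (simp add: mk_def rep_def)

lemma mk_eq_iff: "sqint f ==> sqint g ==> mk f = mk g \<longleftrightarrow> (AE x in lebesgue. f x = g x)"
  using Quotient3_rel[OF Quotient3_l2, of f g] by (auto simp: mk_def)

lemma mk_cong_AE: "sqint f ==> sqint g ==> (AE x in lebesgue. f x = g x) ==> mk f = mk g"
  by (simp add: mk_eq_iff)

lemma rep_mk: "sqint f ==> AE x in lebesgue. rep (mk f) x = f x"
  using mk_eq_iff[of "rep (mk f)" f] by simp

lemma l2_eqI: "(AE x in lebesgue. rep u x = rep v x) ==> u = v"
  using mk_eq_iff[of "rep u" "rep v"] by simp

lemma inner_mk: "sqint f ==> sqint g ==> inner (mk f) (mk g) = (LINT x|lebesgue. f x * g x)"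
  by (simp add: mk_def inner_l2.abs_eq)

lemma mk_add: "sqint f ==> sqint g ==> mk f + mk g = mk (%x. f x + g x)"
  by (simp add: mk_def plus_l2.abs_eq sqint_add)

lemma mk_diff: "sqint f ==> sqint g ==> mk f - mk g = mk (%x. f x - g x)"
  by (simp add: mk_def minus_l2.abs_eq sqint_diff)

lemma mk_cmult: "sqint f ==> c *\<^sub>R mk f = mk (%x. c * f x)"
  by (simp add: mk_def scaleR_l2.abs_eq sqint_cmult)

lemma mk_uminus: "sqint f ==> - mk f = mk (%x. - f x)"
  by (simp add: mk_def uminus_l2.abs_eq sqint_uminus)

lemma mk_zero [simp]: "mk (%x. 0) = 0"
  by (simp add: mk_def zero_l2.abs_eq)

lemma mk_sum: "(!!i. i \<in> I ==> sqint (f i)) ==> (\<Sum>i\<in>I. mk (f i)) = mk (%x. \<Sum>i\<in>I. f i x)"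
  by (induction I rule: infinite_finite_induct) (auto simp: mk_add sqint_sum)

lemma inner_rep: "inner u v = (LINT x|lebesgue. rep u x * rep v x)"
  using inner_mk[of "rep u" "rep v"] by simp

lemma norm_l2_sq: "(norm u)\<^sup>2 = (LINT x|lebesgue. (rep u x)\<^sup>2)"
  by (subst power2_norm_eq_inner) (simp add: inner_rep power2_eq_square)

lemma norm_mk_sq: "sqint f ==> (norm (mk f))\<^sup>2 = (LINT x|lebesgue. (f x)\<^sup>2)"
  by (subst power2_norm_eq_inner) (simp add: inner_mk power2_eq_square)

lemma rep_add: "AE x in lebesgue. rep (u + v) x = rep u x + rep v x"
  using rep_mk[of "%x. rep u x + rep v x"] by (simp add: mk_add[symmetric] sqint_add)

lemma rep_diff: "AE x in lebesgue. rep (u - v) x = rep u x - rep v x"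
  using rep_mk[of "%x. rep u x - rep v x"] by (simp add: mk_diff[symmetric] sqint_diff)

lemma rep_uminus: "AE x in lebesgue. rep (- u) x = - rep u x"
  using rep_mk[of "%x. - rep u x"] by (simp add: mk_uminus[symmetric] sqint_uminus)

lemma rep_scaleR: "AE x in lebesgue. rep (c *\<^sub>R u) x = c * rep u x"
  using rep_mk[of "%x. c * rep u x"] by (simp add: mk_cmult[symmetric] sqint_cmult)

lemma rep_zero: "AE x in lebesgue. rep 0 x = 0"
  using rep_mk[of "%x. 0"] by simp

lemma nn_norm_mk: "sqint f ==> (\<integral>\<^sup>+x. ennreal ((f x)\<^sup>2) \<partial>lebesgue) = ennreal ((norm (mk f))\<^sup>2)"
  unfolding norm_mk_sq
  by (rule nn_integral_eq_integral) (auto simp: sqint_def)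

lemma norm_mk_mono:
  assumes "sqint g" "f \<in> borel_measurable lebesgue" "AE x in lebesgue. \<bar>f x\<bar> <= \<bar>g x\<bar>"
  shows "norm (mk f) <= norm (mk g)"
proof -
  have f: "sqint f" by (rule sqint_bound) fact+
  have "(norm (mk f))\<^sup>2 <= (norm (mk g))\<^sup>2"
    unfolding norm_mk_sq[OF f] norm_mk_sq[OF assms(1)]
  proof (rule integral_mono_AE)
    show "AE x in lebesgue. (f x)\<^sup>2 <= (g x)\<^sup>2"
      using assms(3) by eventually_elim (simp add: abs_le_square_iff)
  qed (use f assms(1) in \<open>auto simp: sqint_def\<close>)
  then show ?thesis by (rule power2_le_imp_le) simp
qed

section \<open>Completeness of L2 (Riesz-Fischer)\<close>

lemma l2_tendsto_dominated:
  fixes f :: "nat => 'a::euclidean_space => real"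
  assumes "!!n. f n \<in> borel_measurable lebesgue" "h \<in> borel_measurable lebesgue" "sqint g"
    and b: "!!n. AE x in lebesgue. \<bar>f n x\<bar> <= g x"
    and l: "AE x in lebesgue. (%n. f n x) \<longlonglongrightarrow> h x"
  shows "sqint h" "(%n. mk (f n)) \<longlonglongrightarrow> mk h"
proof -
  have f: "sqint (f n)" for n
    by (rule sqint_bound[OF assms(3) assms(1)]) (use b[of n] in \<open>auto elim: eventually_mono\<close>)
  have "AE x in lebesgue. \<forall>n. \<bar>f n x\<bar> <= g x"
    using b by (simp add: AE_all_countable)
  with l have hb: "AE x in lebesgue. \<bar>h x\<bar> <= g x"
  proof eventually_elim
    case (elim x)
    show ?case
      by (rule LIMSEQ_le_const2[OF tendsto_rabs[OF elim(1)]]) (use elim in auto)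
  qed
  then show h: "sqint h"
    by (intro sqint_bound[OF assms(3) assms(2)]) (auto elim: eventually_mono)
  have "(%n. LINT x|lebesgue. (f n x - h x)\<^sup>2) \<longlonglongrightarrow> (LINT x|(lebesgue::'a measure). 0)"
  proof (rule integral_dominated_convergence)
    show "integrable lebesgue (%x. (2 * g x)\<^sup>2)"
      using sqint_cmult[OF assms(3), of 2] by (simp add: sqint_def)
    show "AE x in lebesgue. (%n. (f n x - h x)\<^sup>2) \<longlonglongrightarrow> 0"
      using l
    proof eventually_elim
      case (elim x)
      have "(%n. (f n x - h x)\<^sup>2) \<longlonglongrightarrow> (h x - h x)\<^sup>2"
        by (intro tendsto_intros elim)
      then show ?case by simp
    qed
    show "AE x in lebesgue. norm ((f n x - h x)\<^sup>2) <= (2 * g x)\<^sup>2" for n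
      using b[of n] hb
    proof eventually_elim
      case (elim x)
      then have "\<bar>f n x - h x\<bar> <= \<bar>2 * g x\<bar>" by linarith
      then show ?case by (simp add: abs_le_square_iff)
    qed
  qed (use assms in measurable)
  then have "(%n. (norm (mk (f n) - mk h))\<^sup>2) \<longlonglongrightarrow> 0"
    by (simp add: mk_diff f h norm_mk_sq sqint_diff)
  then have "(%n. sqrt ((norm (mk (f n) - mk h))\<^sup>2)) \<longlonglongrightarrow> sqrt 0"
    by (rule tendsto_real_sqrt)
  then have "(%n. norm (mk (f n) - mk h)) \<longlonglongrightarrow> 0" by simp
  then show "(%n. mk (f n)) \<longlonglongrightarrow> mk h"
    by (rule LIM_zero_cancel[OF tendsto_norm_zero_cancel])
qed

lemma Cauchy_fast_subseq:
  fixes X :: "nat => 'b::real_normed_vector"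
  assumes "Cauchy X"
  obtains r :: "nat => nat" where "strict_mono r" "!!k. norm (X (r (Suc k)) - X (r k)) <= (1/2)^k"
proof -
  have "\<forall>k. \<exists>N. \<forall>m\<ge>N. \<forall>n\<ge>N. norm (X m - X n) < (1/2)^k"
    using CauchyD[OF assms] by simp
  then obtain N where N: "!!k m n. m >= N k ==> n >= N k ==> norm (X m - X n) < (1/2)^k"
    by metis
  define r where "r k = (\<Sum>j\<le>k. N j) + k" for k
  have "strict_mono r" by (rule strict_monoI_Suc) (simp add: r_def)
  moreover have "r k >= N k" for k
    using member_le_sum[of k "{..k}" N] by (simp add: r_def)
  then have "norm (X (r (Suc k)) - X (r k)) <= (1/2)^k" for k
    using N[of k "r (Suc k)" "r k"] strict_mono_leD[OF \<open>strict_mono r\<close>, of k "Suc k"]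
    by (meson dual_order.trans le_add2 le_SucI order_refl less_imp_le)
  ultimately show ?thesis using that by blast
qed

text \<open>The partial sums of the absolute increments have norm at most 2, so by monotone
  convergence the root \<open>H\<close> of their supremum of squares is square integrable and bounds
  them almost everywhere. Adding |X 0| gives a common majorant, and the telescoping series converges
  absolutely where \<open>H\<close> bounds the sums.\<close>

lemma l2_fast_AE:
  fixes X :: "nat => 'a::euclidean_space l2"
  assumes r: "!!k. norm (X (Suc k) - X k) <= (1/2)^k"
  shows "\<exists>g. sqint g & (\<forall>n. AE x in lebesgue. \<bar>rep (X n) x\<bar> <= g x) &
     (AE x in lebesgue. convergent (%n. rep (X n) x))"
proof -
  define d where "d k x = \<bar>rep (X (Suc k)) x - rep (X k) x\<bar>" for k x
  have sd: "sqint (d k)" for k unfolding d_def by (intro sqint_abs sqint_diff) simp_all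
  have nd: "norm (mk (d k)) <= (1/2)^k" for k
  proof -
    have "norm (mk (d k)) <= norm (mk (%x. rep (X (Suc k)) x - rep (X k) x))"
      by (rule norm_mk_mono) (use sqint_meas[OF sd] in \<open>auto simp: d_def intro!: sqint_diff\<close>)
    then show ?thesis using r[of k] by (simp add: mk_diff[symmetric])
  qed
  define G where "G K x = (\<Sum>k<K. d k x)" for K x
  have sG: "sqint (G K)" for K unfolding G_def by (intro sqint_sum sd)
  have nG: "norm (mk (G K)) <= 2" for K
  proof -
    have "norm (mk (G K)) <= (\<Sum>k<K. norm (mk (d k)))"
      unfolding G_def using mk_sum[of "{..<K}" d] sd by (metis norm_sum)
    also have "... <= (\<Sum>k<K. (1/2)^k)" by (intro sum_mono nd)
    also have "... <= 2" using sum_le_suminf[OF summable_geometric[of "1/2::real"], of "{..<K}"]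
      by (simp add: suminf_geometric)
    finally show ?thesis .
  qed
  have d0: "d k x >= 0" for k x by (simp add: d_def)
  have mG: "mono (%K. G K x)" for x
    unfolding G_def by (intro monoI sum_mono2) (auto simp: d0)
  have G0: "G K x >= 0" for K x by (simp add: G_def sum_nonneg d0)
  have mG': "G K \<in> borel_measurable lebesgue" for K using sG sqint_meas by blast
  define F where "F x = (SUP K. ennreal ((G K x)\<^sup>2))" for x
  have mF: "F \<in> borel_measurable lebesgue" unfolding F_def using mG' by measurable
  have "(\<integral>\<^sup>+x. F x \<partial>lebesgue) = (SUP K. \<integral>\<^sup>+x. ennreal ((G K x)\<^sup>2) \<partial>lebesgue)"
    unfolding F_def
  proof (rule nn_integral_monotone_convergence_SUP)
    show "incseq (%K x. ennreal ((G K x)\<^sup>2))"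
      using mG G0 by (auto simp: incseq_def le_fun_def mono_def intro!: ennreal_leI power_mono)
  qed (use mG' in measurable)
  also have "... <= ennreal 4"
  proof (rule SUP_least)
    fix K
    have "(norm (mk (G K)))\<^sup>2 <= 2\<^sup>2" by (rule power_mono[OF nG]) simp
    then show "(\<integral>\<^sup>+x. ennreal ((G K x)\<^sup>2) \<partial>lebesgue) <= ennreal 4"
      unfolding nn_norm_mk[OF sG] by (intro ennreal_leI) simp
  qed
  finally have F4: "(\<integral>\<^sup>+x. F x \<partial>lebesgue) <= ennreal 4" .
  then have Ffin: "AE x in lebesgue. F x ~= \<infinity>"
    by (intro nn_integral_PInf_AE mF) (auto simp: top_unique)
  define H where "H x = sqrt (enn2real (F x))" for x
  have mH: "H \<in> borel_measurable lebesgue" unfolding H_def using mF by measurable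
  have sH: "sqint H"
    unfolding sqint_def
  proof
    have eq: "(H x)\<^sup>2 = enn2real (F x)" for x by (simp add: H_def)
    have "(\<integral>\<^sup>+x. ennreal (norm (enn2real (F x))) \<partial>lebesgue) = (\<integral>\<^sup>+x. F x \<partial>lebesgue)"
      by (rule nn_integral_cong_AE) (use Ffin in eventually_elim, simp add: less_top)
    then show "integrable lebesgue (%x. (H x)\<^sup>2)"
      unfolding eq using F4 mF by (intro integrableI_bounded) (auto simp: le_less_trans)
  qed (rule mH)
  have GH: "AE x in lebesgue. \<forall>K. G K x <= H x"
    using Ffin
  proof eventually_elim
    case (elim x)
    show ?case
    proof
      fix K
      have "ennreal ((G K x)\<^sup>2) <= F x" unfolding F_def by (rule SUP_upper) simp
      then have "enn2real (ennreal ((G K x)\<^sup>2)) <= enn2real (F x)"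
        by (rule enn2real_mono) (use elim in \<open>simp add: less_top\<close>)
      then have "(G K x)\<^sup>2 <= enn2real (F x)" by simp
      then show "G K x <= H x" unfolding H_def by (rule real_le_rsqrt)
    qed
  qed
  have tele: "rep (X n) x = rep (X 0) x + (\<Sum>k<n. rep (X (Suc k)) x - rep (X k) x)" for n x
    by (simp add: sum_lessThan_telescope[of "%k. rep (X k) x"])
  show ?thesis
  proof (intro exI conjI allI)
    show "sqint (%x. \<bar>rep (X 0) x\<bar> + H x)" by (intro sqint_add sqint_abs sqint_rep sH)
    show "AE x in lebesgue. \<bar>rep (X n) x\<bar> <= \<bar>rep (X 0) x\<bar> + H x" for n
      using GH
    proof eventually_elim
      case (elim x)
      have "\<bar>\<Sum>k<n. rep (X (Suc k)) x - rep (X k) x\<bar> <= G n x"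
        unfolding G_def d_def by (rule sum_abs)
      then show ?case using elim[rule_format, of n] tele[of n x] by linarith
    qed
    show "AE x in lebesgue. convergent (%n. rep (X n) x)"
      using GH
    proof eventually_elim
      case (elim x)
      have "summable (%k. d k x)"
        by (rule summableI_nonneg_bounded[of _ "H x"]) (use elim d0 in \<open>auto simp: G_def\<close>)
      then have "summable (%k. rep (X (Suc k)) x - rep (X k) x)"
        unfolding d_def by (rule summable_rabs_cancel)
      then have "convergent (%n. (\<Sum>k<n. rep (X (Suc k)) x - rep (X k) x))"
        by (simp add: summable_iff_convergent)
      then have "convergent (%n. rep (X 0) x + (\<Sum>k<n. rep (X (Suc k)) x - rep (X k) x))"
        by (intro convergent_add convergent_const)
      then show ?case unfolding tele[symmetric] .
    qed
  qed
qed

instance l2 :: (euclidean_space) complete_space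
proof
  fix X :: "nat => 'a l2"
  assume C: "Cauchy X"
  obtain r where r: "strict_mono r" "!!k. norm (X (r (Suc k)) - X (r k)) <= (1/2)^k"
    using Cauchy_fast_subseq[OF C] by metis
  obtain g where g: "sqint g" "!!n. AE x in lebesgue. \<bar>rep (X (r n)) x\<bar> <= g x"
    and c: "AE x in lebesgue. convergent (%n. rep (X (r n)) x)"
    using l2_fast_AE[of "X \<circ> r"] r(2) by auto
  define h where "h x = lim (%n. rep (X (r n)) x)" for x
  have hm: "h \<in> borel_measurable lebesgue" unfolding h_def by measurable
  have "(%n. mk (rep (X (r n)))) \<longlonglongrightarrow> mk h"
    by (rule l2_tendsto_dominated(2)[OF _ hm g])
      (use c in \<open>auto simp: h_def convergent_LIMSEQ_iff elim!: eventually_mono\<close>)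
  then have "(X \<circ> r) \<longlonglongrightarrow> mk h" by (simp add: o_def)
  then show "convergent X"
    using Cauchy_converges_subseq[OF C r(1)] by (auto simp: convergent_def)
qed

lemma l2_tendsto_AE_subseq:
  fixes X :: "nat => 'a::euclidean_space l2"
  assumes "X \<longlonglongrightarrow> u"
  obtains r :: "nat => nat" where "strict_mono r" "AE x in lebesgue. (%n. rep (X (r n)) x) \<longlonglongrightarrow> rep u x"
proof -
  obtain r where r: "strict_mono r" "!!k. norm (X (r (Suc k)) - X (r k)) <= (1/2)^k"
    using Cauchy_fast_subseq[OF LIMSEQ_imp_Cauchy[OF assms]] by metis
  obtain g where g: "sqint g" "!!n. AE x in lebesgue. \<bar>rep (X (r n)) x\<bar> <= g x"
    and c: "AE x in lebesgue. convergent (%n. rep (X (r n)) x)"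
    using l2_fast_AE[of "X \<circ> r"] r(2) by auto
  define h where "h x = lim (%n. rep (X (r n)) x)" for x
  have hm: "h \<in> borel_measurable lebesgue" unfolding h_def by measurable
  have l: "AE x in lebesgue. (%n. rep (X (r n)) x) \<longlonglongrightarrow> h x"
    using c by (auto simp: h_def convergent_LIMSEQ_iff elim!: eventually_mono)
  note lim = l2_tendsto_dominated[OF _ hm g l, simplified]
  then have "u = mk h"
    using LIMSEQ_subseq_LIMSEQ[OF assms r(1)] by (auto simp: o_def intro: LIMSEQ_unique)
  with rep_mk[OF lim(1)] have "AE x in lebesgue. rep u x = h x" by simp
  with l have "AE x in lebesgue. (%n. rep (X (r n)) x) \<longlonglongrightarrow> rep u x" by eventually_elim simp
  with r(1) show ?thesis by (rule that)
qed

section \<open>Hilbert space tools\<close>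

text \<open>First variation at a minimum: if b were nonzero, the choice t = -b / c with c > 0 and c
  >= a would make the expression at most -b^2 / c.\<close>

lemma quadratic_pos_linear_zero:
  fixes a b :: real
  assumes "!!t. 0 <= t\<^sup>2 * a + 2 * t * b"
  shows "b = 0"
proof (rule ccontr)
  assume b: "b ~= 0"
  define c where "c = \<bar>a\<bar> + 1"
  have c: "c > 0" "a <= c" by (auto simp: c_def)
  have "0 <= (- b / c)\<^sup>2 * a + 2 * (- b / c) * b" by (rule assms)
  also have "... <= (- b / c)\<^sup>2 * c + 2 * (- b / c) * b"
    by (intro add_right_mono mult_left_mono) (use c in auto)
  also have "... = - (b\<^sup>2 / c)" using c by (simp add: power2_eq_square field_simps)
  finally have "b\<^sup>2 / c <= 0" by simp
  then show False using b c by (simp add: divide_le_0_iff not_le)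
qed

text \<open>By symmetry the solution is the minimiser over S of the energy a x x - 2 l x. Linearity
  and boundedness of l are assumed on S alone, so that functionals with good properties only there
  can be represented.\<close>

lemma lax_milgram_symmetric:
  fixes a :: "'b::{real_inner,complete_space} => 'b => real"
  assumes S: "subspace S" "closed S"
    and a: "bounded_bilinear a" and sym: "!!x y. a x y = a y x"
    and coer: "c > 0" "!!x. x \<in> S ==> c * (norm x)\<^sup>2 <= a x x"
    and ladd: "!!x y. x \<in> S ==> y \<in> S ==> l (x + y) = l x + l y"
    and lscale: "!!x r. x \<in> S ==> l (r *\<^sub>R x) = r * l x"
    and lbd: "!!x. x \<in> S ==> \<bar>l x\<bar> <= L * norm x"
  shows "\<exists>x\<in>S. \<forall>y\<in>S. a x y = l y"
proof -
  interpret a: bounded_bilinear a by (rule a)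
  define E where "E x = a x x - 2 * l x" for x
  have L0: "L * norm x <= \<bar>L\<bar> * norm x" for x :: 'b by (intro mult_right_mono) auto
  have lower: "E x >= - (\<bar>L\<bar>\<^sup>2 / c)" if "x \<in> S" for x
  proof -
    have "0 <= (c * norm x - \<bar>L\<bar>)\<^sup>2 / c" using coer(1) by simp
    also have "... = c * (norm x)\<^sup>2 - 2 * \<bar>L\<bar> * norm x + \<bar>L\<bar>\<^sup>2 / c"
      using coer(1) by (simp add: power2_eq_square field_simps)
    finally show ?thesis using coer(2)[OF that] lbd[OF that] L0[of x] unfolding E_def by argo
  qed
  define m where "m = Inf (E ` S)"
  have S0: "0 \<in> S" using S(1) by (rule subspace_0)
  have bdd: "bdd_below (E ` S)" using lower by (auto intro!: bdd_belowI)
  have m: "m <= E x" if "x \<in> S" for x unfolding m_def using bdd that by (auto intro!: cInf_lower)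
  have "\<exists>x\<in>S. E x < m + 1 / (real n + 1)" for n
  proof -
    have "m < m + 1 / (real n + 1)" by simp
    then show ?thesis unfolding m_def using cInf_lessD[of "E ` S"] S0 by blast
  qed
  then obtain x where x: "!!n. x n \<in> S" "!!n. E (x n) < m + 1 / (real n + 1)" by metis
  have l0: "l 0 = 0" using lscale[OF S0, of 0] by simp
  have lneg: "l (- y) = - l y" if "y \<in> S" for y using lscale[OF that, of "-1"] by simp
  have ldiff: "l (y - z) = l y - l z" if "y \<in> S" "z \<in> S" for y z
    using ladd[of y "- z"] lneg that subspace_neg[OF S(1)] by simp
  have par: "c * (norm (x i - x j))\<^sup>2 <= 2 / (real i + 1) + 2 / (real j + 1)" for i j
  proof -
    \<comment> \<open>The midpoint of two almost minimisers: the parallelogram identity bounds their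
      distance by the excess of their energies over m, so a minimising sequence is Cauchy.\<close>
    define y where "y = (1/2) *\<^sub>R (x i + x j)"
    have yS: "y \<in> S" unfolding y_def using x S(1) by (intro subspace_scale subspace_add)
    have ly: "l y = (l (x i) + l (x j)) / 2"
      unfolding y_def lscale[OF subspace_add[OF S(1) x(1) x(1)]] ladd[OF x(1) x(1)] by simp
    have "a (x i - x j) (x i - x j) = 2 * E (x i) + 2 * E (x j) - 4 * E y"
      unfolding E_def ly unfolding y_def
      by (simp add: a.diff_left a.diff_right a.add_left a.add_right
          a.scaleR_left a.scaleR_right sym[of "x j" "x i"] algebra_simps)
    also have "... <= 2 / (real i + 1) + 2 / (real j + 1)"
    proof -
      have "2 / (real i + 1) = 2 * (1 / (real i + 1))" "2 / (real j + 1) = 2 * (1 / (real j + 1))" by simp_all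
      then show ?thesis using x(2)[of i] x(2)[of j] m[OF yS] by linarith
    qed
    finally show ?thesis using coer(2)[of "x i - x j"] x S(1) by (meson order_trans subspace_diff)
  qed
  have "Cauchy x"
  proof (rule CauchyI)
    fix e :: real assume e: "e > 0"
    obtain N where N: "4 / (c * e\<^sup>2) < real N" using reals_Archimedean2 by blast
    show "\<exists>M. \<forall>i\<ge>M. \<forall>j\<ge>M. norm (x i - x j) < e"
    proof (intro exI allI impI)
      fix i j assume ij: "i >= N" "j >= N"
      have Npos: "real N > 0" using N e coer(1) by (smt (verit) divide_nonneg_pos zero_less_power mult_pos_pos)
      have "2 / (real i + 1) <= 2 / real N" "2 / (real j + 1) <= 2 / real N"
        using ij Npos by (auto intro!: divide_left_mono mult_pos_pos)
      then have "c * (norm (x i - x j))\<^sup>2 <= 4 / real N" using par[of i j] by linarith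
      also have "... < c * e\<^sup>2" using N Npos e coer(1) by (simp add: field_simps)
      finally have "(norm (x i - x j))\<^sup>2 < e\<^sup>2" using coer(1) by simp
      then show "norm (x i - x j) < e" using e by (simp add: power_less_imp_less_base)
    qed
  qed
  then obtain z where z: "x \<longlonglongrightarrow> z" by (auto simp: Cauchy_convergent_iff convergent_def)
  have zS: "z \<in> S" using S(2) x(1) z by (metis closed_sequentially)
  have lz: "(%n. l (x n)) \<longlonglongrightarrow> l z"
  proof (rule LIM_zero_cancel, rule Lim_null_comparison)
    show "\<forall>\<^sub>F n in sequentially. norm (l (x n) - l z) <= \<bar>L\<bar> * norm (x n - z)"
    proof (intro always_eventually allI)
      fix n
      show "norm (l (x n) - l z) <= \<bar>L\<bar> * norm (x n - z)"
        using lbd[OF subspace_diff[OF S(1) x(1)[of n] zS]] L0[of "x n - z"] ldiff[OF x(1)[of n] zS] by simp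
    qed
    show "(%n. \<bar>L\<bar> * norm (x n - z)) \<longlonglongrightarrow> 0"
      using z by (intro tendsto_mult_right_zero tendsto_norm_zero LIM_zero)
  qed
  have "(%n. E (x n)) \<longlonglongrightarrow> E z"
    unfolding E_def by (intro tendsto_intros a.tendsto z lz)
  moreover have "(%n. m + 1 / (real n + 1)) \<longlonglongrightarrow> m + 0"
    by (intro tendsto_intros) real_asymp
  ultimately have "E z <= m + 0"
    by (rule LIMSEQ_le) (use x(2) in \<open>auto intro!: exI[of _ 0] less_imp_le\<close>)
  then have Ez: "E z <= E y" if "y \<in> S" for y using m[OF that] by linarith
  have "a z y = l y" if y: "y \<in> S" for y
  proof -
    have "0 <= t\<^sup>2 * a y y + 2 * t * (a z y - l y)" for t
    proof -
      have "E z <= E (z + t *\<^sub>R y)" using y zS S(1) by (intro Ez subspace_add subspace_scale)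
      then show ?thesis unfolding E_def using y zS S(1)
        by (simp add: ladd lscale subspace_scale a.add_left a.add_right a.scaleR_left a.scaleR_right
            sym[of y z] power2_eq_square algebra_simps)
    qed
    then have "a z y - l y = 0" by (rule quadratic_pos_linear_zero)
    then show ?thesis by simp
  qed
  then show ?thesis using zS by blast
qed

lemma riesz_subspace:
  fixes l :: "'b::{real_inner,complete_space} => real"
  assumes "subspace S" "closed S"
    and "!!x y. x \<in> S ==> y \<in> S ==> l (x + y) = l x + l y"
    and "!!x r. x \<in> S ==> l (r *\<^sub>R x) = r * l x"
    and "!!x. x \<in> S ==> \<bar>l x\<bar> <= L * norm x"
  shows "\<exists>x\<in>S. \<forall>y\<in>S. inner x y = l y"
  by (rule lax_milgram_symmetric[OF assms(1,2) bounded_bilinear_inner inner_commute, of 1 l L])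
    (use assms in \<open>auto simp: power2_norm_eq_inner\<close>)

lemma riesz_subspace_unique:
  assumes "subspace S" "x \<in> S" "x' \<in> S" "!!y. y \<in> S ==> inner x y = inner x' y"
  shows "x = (x' :: 'b::real_inner)"
proof -
  have "inner (x - x') (x - x') = 0"
    using assms(4)[OF subspace_diff[OF assms(1-3)]] by (simp add: inner_diff_left)
  then show ?thesis by simp
qed

text \<open>The Riesz representative z is the orthogonal projection of x onto S; the residual x - z
  is orthogonal to S and hence zero.\<close>

lemma dense_if_orthogonal_trivial:
  fixes S :: "'b::{real_inner,complete_space} set"
  assumes S: "subspace S" "closed S"
    and triv: "!!g. (!!y. y \<in> S ==> inner g y = 0) ==> g = 0"
  shows "x \<in> S"
proof -
  have "\<bar>inner x y\<bar> <= norm x * norm y" for y by (rule Cauchy_Schwarz_ineq2)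
  then obtain z where z: "z \<in> S" "\<forall>y\<in>S. inner z y = inner x y"
    using riesz_subspace[OF S, of "inner x" "norm x"] by (auto simp: inner_add_right)
  have "x - z = 0" by (rule triv) (use z in \<open>simp add: inner_diff_left\<close>)
  then show ?thesis using z by simp
qed

section \<open>Smooth functions\<close>

lemma iter_partial_append: "iter_partial (is @ js) f = iter_partial is (iter_partial js f)"
  by (induction "is") simp_all

lemma smooth_fun_partial: "smooth_fun f ==> smooth_fun (partial_deriv i f)"
  unfolding smooth_fun_def
proof
  fix js assume "\<forall>is. iter_partial is f differentiable_on UNIV"
  then have "iter_partial (js @ [i]) f differentiable_on UNIV" by blast
  then show "iter_partial js (partial_deriv i f) differentiable_on UNIV"
    by (simp add: iter_partial_append)
qed

lemma smooth_fun_differentiable: "smooth_fun f ==> f differentiable (at x)"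
  unfolding smooth_fun_def differentiable_on_def
  by (metis UNIV_I iter_partial.simps(1))

lemma smooth_fun_continuous: "smooth_fun f ==> continuous_on S f"
  by (meson continuous_at_imp_continuous_on differentiable_imp_continuous_within smooth_fun_differentiable)

text \<open>Smoothness of finite order, peeling off the derivative that is applied first, whereas
  \<open>iter_partial\<close> peels off the last one. In this form the sum, product and chain rules
  follow by induction on the order.\<close>

primrec smoothk :: "nat => (real^'n::finite => real) => bool" where
  "smoothk 0 f \<longleftrightarrow> f differentiable_on UNIV"
| "smoothk (Suc k) f \<longleftrightarrow> f differentiable_on UNIV & (\<forall>i. smoothk k (partial_deriv i f))"

lemma smoothk_differentiable: "smoothk k f ==> f differentiable_on UNIV"
  by (cases k) auto

lemma smoothk_at: "smoothk k f ==> f differentiable (at x)"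
  using smoothk_differentiable[of k f] by (auto simp: differentiable_on_def)

lemma smoothk_Suc: "smoothk (Suc k) f ==> smoothk k f"
  by (induction k arbitrary: f) (auto dest: smoothk_differentiable)

lemma smooth_fun_iff_smoothk: "smooth_fun f \<longleftrightarrow> (\<forall>k. smoothk k f)"
proof
  assume "smooth_fun f"
  then show "\<forall>k. smoothk k f"
  proof (intro allI)
    fix k
    show "smooth_fun f ==> smoothk k f"
    proof (induction k arbitrary: f)
      case 0
      then show ?case by (auto simp: differentiable_on_def smooth_fun_differentiable)
    next
      case (Suc k)
      then show ?case by (auto simp: differentiable_on_def smooth_fun_differentiable smooth_fun_partial)
    qed
  qed
next
  assume "\<forall>k. smoothk k f"
  moreover have "smoothk (length is) f ==> iter_partial is f differentiable_on UNIV" for "is"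
  proof (induction "is" arbitrary: f rule: rev_induct)
    case (snoc i "is")
    then show ?case by (auto simp: iter_partial_append)
  qed simp
  ultimately show "smooth_fun f" by (simp add: smooth_fun_def)
qed

lemma partial_deriv_eq: "(f has_derivative f') (at x) ==> partial_deriv i f x = f' (axis i 1)"
  unfolding partial_deriv_def using frechet_derivative_at by fastforce

lemma has_derivative_partials:
  fixes f :: "real^'n::finite => real"
  assumes "f differentiable (at x)"
  shows "(f has_derivative (%h. \<Sum>i\<in>UNIV. h $ i * partial_deriv i f x)) (at x)"
proof -
  let ?f' = "frechet_derivative f (at x)"
  have d: "(f has_derivative ?f') (at x)" using assms frechet_derivative_works by blast
  interpret bounded_linear ?f' using d by (rule has_derivative_bounded_linear)
  have "?f' h = (\<Sum>i\<in>UNIV. h $ i * partial_deriv i f x)" for h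
  proof -
    have "?f' (\<Sum>i\<in>UNIV. (h $ i) *\<^sub>R axis i 1) = (\<Sum>i\<in>UNIV. h $ i * partial_deriv i f x)"
      by (simp add: sum scaleR partial_deriv_def)
    moreover have "(\<Sum>i\<in>UNIV. (h $ i) *\<^sub>R axis i 1) = h"
      using basis_expansion[of h] by (simp add: scalar_mult_eq_scaleR)
    ultimately show ?thesis by simp
  qed
  then have "?f' = (%h. \<Sum>i\<in>UNIV. h $ i * partial_deriv i f x)" by blast
  with d show ?thesis by simp
qed

lemmas smooth_fun_has_derivative = has_derivative_partials[OF smooth_fun_differentiable]

lemma partial_deriv_add:
  "f differentiable (at x) ==> g differentiable (at x) ==>
    partial_deriv i (%y. f y + g y) x = partial_deriv i f x + partial_deriv i g x"
proof -
  assume "f differentiable (at x)" "g differentiable (at x)"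
  then have "((%y. f y + g y) has_derivative (%h. frechet_derivative f (at x) h + frechet_derivative g (at x) h)) (at x)"
    by (intro has_derivative_add) (simp_all add: frechet_derivative_works)
  from partial_deriv_eq[OF this, of i] show ?thesis by (simp add: partial_deriv_def)
qed

lemma partial_deriv_mult:
  "f differentiable (at x) ==> g differentiable (at x) ==>
    partial_deriv i (%y. f y * g y) x = partial_deriv i f x * g x + f x * partial_deriv i g x"
proof -
  assume "f differentiable (at x)" "g differentiable (at x)"
  then have "((%y. f y * g y) has_derivative (%h. f x * frechet_derivative g (at x) h + frechet_derivative f (at x) h * g x)) (at x)"
    by (intro has_derivative_mult) (simp_all add: frechet_derivative_works)
  from partial_deriv_eq[OF this, of i] show ?thesis by (simp add: partial_deriv_def)
qed

lemma partial_deriv_const [simp]: "partial_deriv i (%y. c) = (%x. 0)"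
  using partial_deriv_eq[OF has_derivative_const] by fastforce

lemma partial_deriv_coord: "partial_deriv i (%y. y $ j) x = (if i = j then 1 else 0)"
proof -
  have "((%y. y $ j) has_derivative (%y. y $ j)) (at x)"
    by (rule bounded_linear_imp_has_derivative[OF bounded_linear_vec_nth])
  from partial_deriv_eq[OF this, of i] show ?thesis by (simp add: axis_def)
qed

lemma partial_deriv_compose:
  assumes "g differentiable (at x)" "(F has_real_derivative F') (at (g x))"
  shows "partial_deriv i (%y. F (g y)) x = F' * partial_deriv i g x"
proof -
  have "(F has_derivative (%h. F' * h)) (at (g x))" using assms(2) by (simp add: has_field_derivative_def)
  moreover have "(g has_derivative frechet_derivative g (at x)) (at x)"
    using assms(1) frechet_derivative_works by blast
  ultimately have "((%y. F (g y)) has_derivative (%h. F' * frechet_derivative g (at x) h)) (at x)"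
    using has_derivative_compose by blast
  from partial_deriv_eq[OF this, of i] show ?thesis by (simp add: partial_deriv_def)
qed

lemma smoothk_add: "smoothk k f ==> smoothk k g ==> smoothk k (%x. f x + g x)"
proof (induction k arbitrary: f g)
  case 0
  then show ?case by (auto intro: differentiable_on_add)
next
  case (Suc k)
  have "partial_deriv i (%x. f x + g x) = (%x. partial_deriv i f x + partial_deriv i g x)" for i
    using Suc.prems[THEN smoothk_at] by (intro ext partial_deriv_add)
  then show ?case using Suc by (auto intro: differentiable_on_add)
qed

lemma smoothk_mult: "smoothk k f ==> smoothk k g ==> smoothk k (%x. f x * g x)"
proof (induction k arbitrary: f g)
  case 0
  then show ?case by (auto intro: differentiable_on_mult)
next
  case (Suc k)
  have "partial_deriv i (%x. f x * g x) = (%x. partial_deriv i f x * g x + f x * partial_deriv i g x)" for i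
    using Suc.prems[THEN smoothk_at] by (intro ext partial_deriv_mult)
  moreover have "smoothk k f" "smoothk k g" using Suc.prems[THEN smoothk_Suc] by simp_all
  ultimately show ?case using Suc by (auto intro!: differentiable_on_mult smoothk_add)
qed

lemma smoothk_const: "smoothk k (%x. c)"
  by (induction k arbitrary: c) auto

lemma smooth_fun_add: "smooth_fun f ==> smooth_fun g ==> smooth_fun (%x. f x + g x)"
  by (simp add: smooth_fun_iff_smoothk smoothk_add)

lemma smooth_fun_mult: "smooth_fun f ==> smooth_fun g ==> smooth_fun (%x. f x * g x)"
  by (simp add: smooth_fun_iff_smoothk smoothk_mult)

lemma smooth_fun_const [simp]: "smooth_fun (%x. c)"
  by (simp add: smooth_fun_iff_smoothk smoothk_const)

lemma smooth_fun_cmult: "smooth_fun f ==> smooth_fun (%x. c * f x)"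
  by (intro smooth_fun_mult smooth_fun_const)

lemma smooth_fun_uminus: "smooth_fun f ==> smooth_fun (%x. - f x)"
  using smooth_fun_cmult[of f "-1"] by simp

lemma smooth_fun_diff: "smooth_fun f ==> smooth_fun g ==> smooth_fun (%x. f x - g x)"
  using smooth_fun_add[OF _ smooth_fun_uminus, of f g] by simp

lemma smooth_fun_sum: "(!!i. i \<in> I ==> smooth_fun (f i)) ==> smooth_fun (%x. \<Sum>i\<in>I. f i x)"
  by (induction I rule: infinite_finite_induct) (auto intro: smooth_fun_add)

lemma smooth_fun_prod: "(!!i. i \<in> I ==> smooth_fun (f i)) ==> smooth_fun (%x. \<Prod>i\<in>I. f i x)"
  by (induction I rule: infinite_finite_induct) (auto intro: smooth_fun_mult)

lemma smooth_fun_coord: "smooth_fun (%x::real^'n::finite. x $ j)"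
proof -
  have d: "(%x::real^'n. x $ j) differentiable_on UNIV"
    by (simp add: bounded_linear_vec_nth bounded_linear_imp_differentiable_on)
  have "smoothk k (%x::real^'n. x $ j)" for k
    using d by (cases k) (auto simp: partial_deriv_coord[abs_def] smoothk_const)
  then show ?thesis by (simp add: smooth_fun_iff_smoothk)
qed

text \<open>\<open>F\<close> is the whole sequence of successive derivatives of \<open>F 0\<close>:
  the chain rule turns \<open>F m\<close> into \<open>F (Suc m)\<close>, so the induction has to
  treat all \<open>m\<close> at once.\<close>

lemma smooth_fun_compose:
  fixes F :: "nat => real => real"
  assumes F: "!!k t. (F k has_real_derivative F (Suc k) t) (at t)" and g: "smooth_fun g"
  shows "smooth_fun (%x. F m (g x))"
proof -
  have d: "(%x. F m (g x)) differentiable_on UNIV" for m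
  proof -
    have "F m differentiable (at t)" for t
      using F[of m t] by (auto simp: real_differentiable_def)
    then have "(%x. F m (g x)) differentiable (at x)" for x
      using differentiable_chain_at[of g x "F m"] smooth_fun_differentiable[OF g] by (simp add: o_def)
    then show ?thesis by (simp add: differentiable_on_def)
  qed
  have "smoothk k (%x. F m (g x))" for k m
  proof (induction k arbitrary: m)
    case 0
    then show ?case by (simp add: d)
  next
    case (Suc k)
    have "partial_deriv i (%x. F m (g x)) = (%x. F (Suc m) (g x) * partial_deriv i g x)" for i
      by (intro ext partial_deriv_compose smooth_fun_differentiable[OF g] F)
    moreover have "smoothk k (partial_deriv i g)" for i
      using smooth_fun_partial[OF g] by (simp add: smooth_fun_iff_smoothk)
    ultimately show ?case using Suc d by (auto intro: smoothk_mult)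
  qed
  then show ?thesis by (simp add: smooth_fun_iff_smoothk)
qed

lemma partial_deriv_local:
  assumes "open U" "x \<in> U" "!!y. y \<in> U ==> f y = g y"
  shows "partial_deriv i f x = partial_deriv i g x"
proof -
  have "(f has_derivative f') (at x) \<longleftrightarrow> (g has_derivative f') (at x)" for f'
    using has_derivative_transform_within_open[of f f' x UNIV U g]
      has_derivative_transform_within_open[of g f' x UNIV U f] assms by auto
  then show ?thesis by (simp add: partial_deriv_def frechet_derivative_def)
qed

text \<open>The derivatives of \<open>t \<mapsto> exp (- 1 / t)\<close> for positive \<open>t\<close> are of the form \<open>P (1 / t) * exp (- 1 / t)\<close> with the polynomials below.\<close>

primrec bmp_poly :: "nat => real poly" where
  "bmp_poly 0 = 1"
| "bmp_poly (Suc k) = [:0, 0, 1:] * (bmp_poly k - pderiv (bmp_poly k))"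

definition bmpD :: "nat => real => real"
  where "bmpD k t = (if t <= 0 then 0 else poly (bmp_poly k) (1 / t) * exp (- (1 / t)))"

lemma poly_exp_tendsto_0: "((%s. poly P s * exp (- s)) \<longlongrightarrow> (0::real)) at_top"
proof (induction P)
  case (pCons a P)
  have 1: "((%s::real. s ^ n * exp (- s)) \<longlongrightarrow> 0) at_top" for n
    using tendsto_power_div_exp_0[of n] by (simp add: exp_minus field_simps)
  have poly1: "((%s. s * (poly Q s * exp (- s))) \<longlongrightarrow> (0::real)) at_top" for Q
  proof -
    have "(%s. s * (poly Q s * exp (- s))) = (%s. \<Sum>i\<le>degree Q. Polynomial.coeff Q i * (s ^ Suc i * exp (- s)))"
      by (simp add: poly_altdef sum_distrib_left sum_distrib_right algebra_simps)
    moreover have "((%s. \<Sum>i\<le>degree Q. Polynomial.coeff Q i * (s ^ Suc i * exp (- s))) \<longlongrightarrow> (\<Sum>i\<le>degree Q. Polynomial.coeff Q i * 0)) at_top"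
      by (intro tendsto_sum tendsto_mult tendsto_const 1)
    ultimately show ?thesis by simp
  qed
  have "((%s. a * (s ^ 0 * exp (- s)) + s * (poly P s * exp (- s))) \<longlongrightarrow> a * 0 + 0) at_top"
    by (intro tendsto_add tendsto_mult tendsto_const 1 poly1)
  then show ?case by (simp add: algebra_simps)
qed simp

text \<open>Only t = 0 needs an argument. With s = 1 / h, the right difference quotient is s times a
  polynomial in s times exp (-s), which tends to 0; from the left it vanishes.\<close>

lemma bmpD_deriv: "(bmpD k has_real_derivative bmpD (Suc k) t) (at t)"
proof -
  consider "t > 0" | "t < 0" | "t = 0" by linarith
  then show ?thesis
  proof cases
    case 1
    have "((%t. poly (bmp_poly k) (1 / t) * exp (- (1 / t))) has_real_derivative bmpD (Suc k) t) (at t)"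
      using 1 by (auto intro!: derivative_eq_intros poly_DERIV[THEN DERIV_chain2]
          simp: bmpD_def power2_eq_square field_simps)
    then show ?thesis
      by (rule has_field_derivative_transform_within_open[of _ _ _ "{0<..}"]) (use 1 in \<open>auto simp: bmpD_def\<close>)
  next
    case 2
    have "((%t::real. 0) has_real_derivative bmpD (Suc k) t) (at t)" using 2 by (simp add: bmpD_def)
    then show ?thesis
      by (rule has_field_derivative_transform_within_open[of _ _ _ "{..<0}"]) (use 2 in \<open>auto simp: bmpD_def\<close>)
  next
    case 3
    have R: "((%h. bmpD k h / h) \<longlongrightarrow> 0) (at_right 0)"
    proof -
      have "((%s. poly (pCons 0 (bmp_poly k)) s * exp (- s)) \<longlongrightarrow> 0) at_top" by (rule poly_exp_tendsto_0)
      then have "((%h. poly (pCons 0 (bmp_poly k)) (inverse h) * exp (- inverse h)) \<longlongrightarrow> 0) (at_right 0)"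
        by (rule filterlim_compose) (rule filterlim_inverse_at_top_right)
      then show ?thesis
        by (rule Lim_transform_eventually)
          (auto simp: bmpD_def eventually_at_right_field field_simps intro!: exI[of _ 1])
    qed
    have L: "((%h. bmpD k h / h) \<longlongrightarrow> 0) (at_left 0)"
      by (rule Lim_transform_eventually[OF tendsto_const])
        (auto simp: bmpD_def eventually_at_left_field intro!: exI[of _ "-1"])
    have "((%h. bmpD k h / h) \<longlongrightarrow> 0) (at 0)" using filterlim_split_at[OF L R] .
    then show ?thesis using 3 by (simp add: DERIV_def bmpD_def)
  qed
qed

definition bmp :: "real => real" where "bmp t = (if t <= 0 then 0 else exp (- (1 / t)))"

lemma smooth_fun_bmp: "smooth_fun g ==> smooth_fun (%x. bmp (g x))"
proof -
  assume g: "smooth_fun g"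
  have "bmpD 0 = bmp" by (auto simp: bmpD_def bmp_def fun_eq_iff)
  then show ?thesis using smooth_fun_compose[of bmpD g 0, OF bmpD_deriv g] by simp
qed

lemma bmp_pos: "0 < t ==> 0 < bmp t" and bmp_nonpos: "t <= 0 ==> bmp t = 0"
  and bmp_nonneg: "0 <= bmp t" and bmp_le1: "bmp t <= 1"
  by (auto simp: bmp_def)

lemma bmp_eq_0_iff: "bmp t = 0 \<longleftrightarrow> t <= 0"
  by (auto simp: bmp_def)

text \<open>The mixed second difference with step h is symmetric in the two directions, and two
  applications of the mean value theorem write it as h^2 times either mixed derivative at a nearby
  point. Continuity of both derivatives then lets h tend to 0.\<close>

lemma partial_deriv_symmetric:
  fixes f :: "real^'n::finite => real"
  assumes f: "smooth_fun f"
  shows "partial_deriv i (partial_deriv j f) x = partial_deriv j (partial_deriv i f) x"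
proof -
  have line: "((%t. g (y + t *\<^sub>R axis k 1)) has_real_derivative partial_deriv k g (y + t *\<^sub>R axis k 1)) (at t)"
    if "smooth_fun g" for g :: "real^'n => real" and y k t
  proof -
    have "((%t. g (y + t *\<^sub>R axis k 1)) has_derivative
       (%s. \<Sum>i\<in>UNIV. (s *\<^sub>R (axis k 1 :: real^'n)) $ i * partial_deriv i g (y + t *\<^sub>R axis k 1))) (at t)"
      by (rule has_derivative_compose[OF _ smooth_fun_has_derivative[OF that]])
        (auto intro!: derivative_eq_intros)
    moreover have "(\<Sum>i\<in>UNIV. (s *\<^sub>R (axis k 1 :: real^'n)) $ i * partial_deriv i g (y + t *\<^sub>R axis k 1))
        = partial_deriv k g (y + t *\<^sub>R axis k 1) * s" for s
    proof -
      have "(\<Sum>i\<in>UNIV. (s *\<^sub>R (axis k 1 :: real^'n)) $ i * partial_deriv i g (y + t *\<^sub>R axis k 1))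
        = (\<Sum>i\<in>UNIV. if i = k then partial_deriv k g (y + t *\<^sub>R axis k 1) * s else 0)"
        by (rule sum.cong) (auto simp: axis_def)
      then show ?thesis by simp
    qed
    ultimately show ?thesis by (simp add: has_field_derivative_def)
  qed
  have key: "\<exists>s t. 0 < s & s < h & 0 < t & t < h &
      f (x + h *\<^sub>R axis a 1 + h *\<^sub>R axis b 1) - f (x + h *\<^sub>R axis a 1) - f (x + h *\<^sub>R axis b 1) + f x
      = h * h * partial_deriv b (partial_deriv a f) (x + s *\<^sub>R axis a 1 + t *\<^sub>R axis b 1)"
    if h: "h > 0" for h :: real and a b
  proof -
    define g where "g s = f (x + h *\<^sub>R axis b 1 + s *\<^sub>R axis a 1) - f (x + s *\<^sub>R axis a 1)" for s
    have "\<exists>s. s > 0 & s < h & g h - g 0 = (h - 0) *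
        (partial_deriv a f (x + h *\<^sub>R axis b 1 + s *\<^sub>R axis a 1) - partial_deriv a f (x + s *\<^sub>R axis a 1))"
      by (rule MVT2[OF h]) (auto simp: g_def intro!: derivative_intros line[OF f])
    then obtain s where s: "s > 0" "s < h" "g h - g 0 = h *
        (partial_deriv a f (x + h *\<^sub>R axis b 1 + s *\<^sub>R axis a 1) - partial_deriv a f (x + s *\<^sub>R axis a 1))" by auto
    have "\<exists>t. t > 0 & t < h & partial_deriv a f (x + s *\<^sub>R axis a 1 + h *\<^sub>R axis b 1)
        - partial_deriv a f (x + s *\<^sub>R axis a 1 + 0 *\<^sub>R axis b 1)
        = (h - 0) * partial_deriv b (partial_deriv a f) (x + s *\<^sub>R axis a 1 + t *\<^sub>R axis b 1)"
      by (rule MVT2[OF h]) (auto intro!: line smooth_fun_partial f)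
    then obtain t where "t > 0" "t < h" "partial_deriv a f (x + s *\<^sub>R axis a 1 + h *\<^sub>R axis b 1)
        - partial_deriv a f (x + s *\<^sub>R axis a 1)
        = h * partial_deriv b (partial_deriv a f) (x + s *\<^sub>R axis a 1 + t *\<^sub>R axis b 1)" by auto
    moreover have "x + h *\<^sub>R axis b 1 + s *\<^sub>R axis a 1 = x + s *\<^sub>R axis a 1 + h *\<^sub>R axis b 1"
      "x + h *\<^sub>R axis b 1 + h *\<^sub>R axis a 1 = x + h *\<^sub>R axis a 1 + h *\<^sub>R axis b 1"
      by (simp_all add: algebra_simps)
    ultimately show ?thesis using s unfolding g_def
      by (intro exI[of _ s] exI[of _ t]) (simp add: algebra_simps)
  qed
  define F where "F = partial_deriv i (partial_deriv j f)"
  define G where "G = partial_deriv j (partial_deriv i f)"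
  have cont: "isCont F x" "isCont G x"
    unfolding F_def G_def using smooth_fun_partial[OF smooth_fun_partial[OF f]]
    by (meson differentiable_imp_continuous_within smooth_fun_differentiable)+
  have near: "\<exists>p q. dist p x < 2 * h & dist q x < 2 * h & F p = G q" if h: "h > 0" for h
  proof -
    obtain s t where 1: "0 < s" "s < h" "0 < t" "t < h"
      "f (x + h *\<^sub>R axis j 1 + h *\<^sub>R axis i 1) - f (x + h *\<^sub>R axis j 1) - f (x + h *\<^sub>R axis i 1) + f x
      = h * h * F (x + s *\<^sub>R axis j 1 + t *\<^sub>R axis i 1)"
      using key[OF h, of j i] unfolding F_def by blast
    obtain s' t' where 2: "0 < s'" "s' < h" "0 < t'" "t' < h"
      "f (x + h *\<^sub>R axis i 1 + h *\<^sub>R axis j 1) - f (x + h *\<^sub>R axis i 1) - f (x + h *\<^sub>R axis j 1) + f x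
      = h * h * G (x + s' *\<^sub>R axis i 1 + t' *\<^sub>R axis j 1)"
      using key[OF h, of i j] unfolding G_def by blast
    have sw: "x + h *\<^sub>R axis j 1 + h *\<^sub>R axis i 1 = x + h *\<^sub>R axis i 1 + h *\<^sub>R axis j 1"
      by (simp add: algebra_simps)
    have "h * h * F (x + s *\<^sub>R axis j 1 + t *\<^sub>R axis i 1) = h * h * G (x + s' *\<^sub>R axis i 1 + t' *\<^sub>R axis j 1)"
      using 1(5) 2(5) unfolding sw by linarith
    then have e: "F (x + s *\<^sub>R axis j 1 + t *\<^sub>R axis i 1) = G (x + s' *\<^sub>R axis i 1 + t' *\<^sub>R axis j 1)"
      using h by simp
    have n: "dist (x + a *\<^sub>R axis k 1 + b *\<^sub>R axis l 1) x < 2 * h" if "0 < a" "a < h" "0 < b" "b < h" for a b k l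
    proof -
      have "dist (x + a *\<^sub>R axis k 1 + b *\<^sub>R axis l 1) x = norm (a *\<^sub>R (axis k 1 :: real^'n) + b *\<^sub>R axis l 1)"
        by (simp add: dist_norm)
      also have "... <= norm (a *\<^sub>R (axis k 1 :: real^'n)) + norm (b *\<^sub>R (axis l 1 :: real^'n))" by (rule norm_triangle_ineq)
      also have "... < 2 * h" using that by (simp add: norm_axis_1)
      finally show ?thesis .
    qed
    show ?thesis using n 1 2 e by blast
  qed
  have "dist (F x) (G x) < e" if e: "e > 0" for e
  proof -
    obtain d1 where d1: "d1 > 0" "!!p. dist p x < d1 ==> dist (F p) (F x) < e / 2"
      using cont(1)[unfolded continuous_at_eps_delta, rule_format, of "e / 2"] e by auto
    obtain d2 where d2: "d2 > 0" "!!p. dist p x < d2 ==> dist (G p) (G x) < e / 2"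
      using cont(2)[unfolded continuous_at_eps_delta, rule_format, of "e / 2"] e by auto
    obtain p q where pq: "dist p x < min d1 d2" "dist q x < min d1 d2" "F p = G q"
      using near[of "min d1 d2 / 2"] d1(1) d2(1) by auto
    have "dist (F p) (F x) < e / 2" "dist (G q) (G x) < e / 2"
      using d1(2)[of p] d2(2)[of q] pq(1,2) by simp_all
    then show ?thesis using pq(3) dist_triangle3[of "F x" "G x" "F p"] by simp
  qed
  from this[of "dist (F x) (G x)"] have "F x = G x" by force
  then show ?thesis by (simp add: F_def G_def)
qed

section \<open>The Borsuk-Ulam theorem on the octahedron\<close>

text \<open>The unit sphere of the l1 norm: an n-sphere whose facets are images of the standard
  simplex under sign changes. Sequences with zero tail match the ambient space of
  \<open>standard_simplex\<close>.\<close>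

definition octahedron :: "nat => (nat => real) set"
  where "octahedron n = {x. (\<Sum>i\<le>n. \<bar>x i\<bar>) = 1 & (\<forall>i>n. x i = 0)}"

definition oct_simplex :: "nat => (nat => real) => (nat => real) => nat => real"
  where "oct_simplex p s = (\<lambda>x\<in>standard_simplex p. %i. s i * x i)"

abbreviation oct_top :: "nat => (nat => real) topology"
  where "oct_top n \<equiv> subtopology (powertop_real UNIV) (octahedron n)"

lemma singular_simplex_oct:
  assumes "p <= n" "!!i. i <= p ==> \<bar>s i\<bar> = 1"
  shows "singular_simplex p (oct_top n) (oct_simplex p s)"
  unfolding singular_simplex_def
proof
  have "continuous_map (subtopology (powertop_real UNIV) (standard_simplex p)) (powertop_real UNIV) (%x i. s i * x i)"
    by (auto simp: continuous_map_componentwise_UNIV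
        intro!: continuous_map_real_mult continuous_map_from_subtopology continuous_map_product_projection)
  moreover have "(%i. s i * x i) \<in> octahedron n" if x: "x \<in> standard_simplex p" for x
  proof -
    have z: "x i = 0" if "i > p" for i using x that by (auto simp: standard_simplex_def)
    have "(\<Sum>i\<le>n. \<bar>s i * x i\<bar>) = (\<Sum>i\<le>p. \<bar>s i * x i\<bar>)"
      by (rule sum.mono_neutral_right) (use assms(1) z in \<open>auto simp: not_le\<close>)
    also have "... = (\<Sum>i\<le>p. x i)"
      by (rule sum.cong) (use x assms in \<open>auto simp: standard_simplex_def abs_mult\<close>)
    finally show ?thesis using x z assms(1) by (auto simp: octahedron_def standard_simplex_def)
  qed
  ultimately have "continuous_map (subtopology (powertop_real UNIV) (standard_simplex p)) (oct_top n) (%x i. s i * x i)"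
    by (auto simp: continuous_map_in_subtopology topspace_standard_simplex)
  then show "continuous_map (subtopology (powertop_real UNIV) (standard_simplex p)) (oct_top n) (oct_simplex p s)"
    by (rule continuous_map_eq) (simp add: oct_simplex_def)
qed (simp add: oct_simplex_def)

lemma oct_simplex_cong: "(!!i. i <= p ==> s i = t i) ==> oct_simplex p s = oct_simplex p t"
proof -
  assume st: "!!i. i <= p ==> s i = t i"
  have "s i * x i = t i * x i" if "x \<in> standard_simplex p" for x i
    by (cases "i <= p") (use st that in \<open>auto simp: standard_simplex_def\<close>)
  then show ?thesis unfolding oct_simplex_def by (intro restrict_ext ext)
qed

lemma oct_face_last:
  assumes "p > 0" shows "singular_face p p (oct_simplex p s) = oct_simplex (p - Suc 0) s"
proof
  fix x
  show "singular_face p p (oct_simplex p s) x = oct_simplex (p - Suc 0) s x"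
  proof (cases "x \<in> standard_simplex (p - Suc 0)")
    case True
    then have "simplical_face p x = x"
      using assms by (auto simp: simplical_face_def standard_simplex_def fun_eq_iff)
    moreover have "simplical_face p x \<in> standard_simplex p"
      using True assms by (intro simplical_face_in_standard_simplex) auto
    ultimately show ?thesis using True by (simp add: singular_face_def oct_simplex_def)
  qed (simp add: singular_face_def oct_simplex_def)
qed

text \<open>On the k-th face the k-th coordinate is zero, so the sign there is invisible.\<close>

lemma oct_face_flip:
  assumes "k < p" shows "singular_face p k (oct_simplex p (s(k := c))) = singular_face p k (oct_simplex p s)"
proof
  fix x
  show "singular_face p k (oct_simplex p (s(k := c))) x = singular_face p k (oct_simplex p s) x"
  proof (cases "x \<in> standard_simplex (p - Suc 0)")
    case True
    have "simplical_face k x \<in> standard_simplex p"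
      using True assms by (intro simplical_face_in_standard_simplex) auto
    then show ?thesis using True by (auto simp: singular_face_def oct_simplex_def simplical_face_def)
  qed (simp add: singular_face_def)
qed

text \<open>Only the first p signs are free. Fixing the sign at p selects one hemisphere of the
  p-dimensional octahedron; fixing the values beyond p makes each facet occur once.\<close>

definition signs :: "nat => (nat => real) set"
  where "signs p = {s. (\<forall>i<p. s i = 1 \<or> s i = -1) & (\<forall>i\<ge>p. s i = 1)}"

lemma finite_signs: "finite (signs p)"
proof (rule finite_subset)
  show "signs p \<subseteq> (%A i. if i \<in> A then - 1 else 1) ` Pow {..<p}"
  proof
    fix s assume "s \<in> signs p"
    then have "s i = (if i \<in> {i. i < p & s i = -1} then - 1 else 1)" for i
      by (cases "i < p") (auto simp: signs_def)
    then have "s = (%i. if i \<in> {i. i < p & s i = -1} then - 1 else 1)" by (rule ext)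
    then show "s \<in> (%A i. if i \<in> A then - 1 else 1) ` Pow {..<p}" by blast
  qed
qed auto

text \<open>The upper \<open>p\<close>-dimensional hemisphere of the octahedron.\<close>

definition hemi :: "nat => (nat => real) chain"
  where "hemi p = (\<Sum>s\<in>signs p. frag_of (oct_simplex p s))"

lemma singular_chain_hemi: assumes "p <= n" shows "singular_chain p (oct_top n) (hemi p)"
  unfolding hemi_def
proof (rule singular_chain_sum)
  fix s assume "s \<in> signs p"
  then have "\<bar>s i\<bar> = 1" if "i <= p" for i by (cases "i < p") (auto simp: signs_def)
  then show "singular_chain p (oct_top n) (frag_of (oct_simplex p s))"
    using singular_simplex_oct[OF assms] by (simp add: singular_chain_of)
qed

text \<open>Modulo 2, the faces that omit a coordinate k < p cancel in pairs, since flipping the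
  sign at k does not change them. The face that omits the last coordinate runs through all facets of
  the (p-1)-dimensional octahedron, that is, the (p-1)-hemisphere and its antipodal image.
  Orientation signs are absorbed in d + d.\<close>

lemma hemi_boundary:
  assumes "p > 0"
  shows "\<exists>d. chain_boundary p (hemi p) =
     hemi (p - 1) + chain_map (p - 1) uminus (hemi (p - 1)) + (d + d)"
proof -
  obtain q where q: "p = Suc q" using assms by (cases p) auto
  have fin: "finite (signs r)" for r by (rule finite_signs)
  have b1: "chain_boundary p (frag_of f) = (\<Sum>k\<le>p. frag_cmul ((-1) ^ k) (frag_of (singular_face p k f)))"
    for f :: "(nat => real) => nat => real"
    using assms by (simp add: chain_boundary_def)
  have bs: "chain_boundary p (\<Sum>s\<in>I. g s) = (\<Sum>s\<in>I. chain_boundary p (g s))" if "finite I"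
    for I :: "(nat => real) set" and g :: "(nat => real) => (nat => real) chain"
    using that by (induction I) (auto simp: chain_boundary_add)
  have "chain_boundary p (hemi p) =
     (\<Sum>s\<in>signs p. \<Sum>k\<le>p. frag_cmul ((-1) ^ k) (frag_of (singular_face p k (oct_simplex p s))))"
    unfolding hemi_def bs[OF fin] b1 ..
  also have "... = (\<Sum>k\<le>p. \<Sum>s\<in>signs p. frag_cmul ((-1) ^ k) (frag_of (singular_face p k (oct_simplex p s))))"
    by (rule sum.swap)
  also have "... = (\<Sum>k\<le>q. \<Sum>s\<in>signs p. frag_cmul ((-1) ^ k) (frag_of (singular_face p k (oct_simplex p s))))
      + (\<Sum>s\<in>signs p. frag_cmul ((-1) ^ p) (frag_of (singular_face p p (oct_simplex p s))))"
    unfolding q by (simp only: sum.atMost_Suc)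
  finally have 1: "chain_boundary p (hemi p) = ..." .
  have "\<exists>d. (\<Sum>s\<in>signs p. frag_cmul ((-1) ^ k) (frag_of (singular_face p k (oct_simplex p s)))) = d + d"
    if k: "k <= q" for k
  proof -
    define F where "F s = frag_cmul ((-1) ^ k) (frag_of (singular_face p k (oct_simplex p s)))" for s
    let ?P = "{s\<in>signs p. s k = 1}" and ?N = "{s\<in>signs p. s k = -1}"
    have "s k = 1 \<or> s k = -1" if "s \<in> signs p" for s using k q that by (simp add: signs_def)
    then have "signs p = ?P \<union> ?N" by blast
    then have "sum F (signs p) = sum F (?P \<union> ?N)" by simp
    also have "... = sum F ?P + sum F ?N" by (rule sum.union_disjoint) (auto simp: fin)
    also have "sum F ?N = sum F ?P"
      by (rule sum.reindex_bij_witness[of _ "%s. s(k := -1)" "%s. s(k := 1)"])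
        (use k q oct_face_flip[of k p] in \<open>auto simp: signs_def F_def fun_upd_idem\<close>)
    finally show ?thesis unfolding F_def by blast
  qed
  then obtain d where d: "!!k. k <= q ==>
     (\<Sum>s\<in>signs p. frag_cmul ((-1) ^ k) (frag_of (singular_face p k (oct_simplex p s)))) = d k + d k" by metis
  have 2: "(\<Sum>k\<le>q. \<Sum>s\<in>signs p. frag_cmul ((-1) ^ k) (frag_of (singular_face p k (oct_simplex p s))))
     = (\<Sum>k\<le>q. d k) + (\<Sum>k\<le>q. d k)"
    by (simp add: d sum.distrib)
  define G where "G s = (frag_of (oct_simplex q s))" for s
  \<comment> \<open>The sign at q = p - 1 is free in \<open>signs p\<close>; its two values give the
    hemisphere and, after negating all signs, its antipode.\<close>
  let ?P = "signs q" and ?N = "{s\<in>signs p. s q = -1}"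
  have "sum G (signs p) = sum G (?P \<union> ?N)"
    by (rule arg_cong[of _ _ "sum G"]) (auto simp: signs_def q less_Suc_eq Suc_le_eq dest: le_neq_implies_less)
  also have "... = sum G ?P + sum G ?N"
  proof (rule sum.union_disjoint)
    show "finite ?N" by (rule finite_subset[OF _ fin[of p]]) auto
  qed (use fin in \<open>auto simp: signs_def\<close>)
  also have "sum G ?N = (\<Sum>s\<in>signs q. frag_of (oct_simplex q (%i. - s i)))"
    unfolding G_def
    by (rule sum.reindex_bij_witness[of _ "%s i. if i <= q then - s i else 1" "%s i. if i < q then - s i else 1"])
      (auto simp: signs_def q fun_eq_iff less_Suc_eq intro!: arg_cong[of _ _ frag_of] oct_simplex_cong)
  also have "... = chain_map q uminus (hemi q)"
  proof -
    have "simplex_map q uminus (oct_simplex q s) = oct_simplex q (%i. - s i)" for s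
      by (auto simp: simplex_map_def oct_simplex_def fun_eq_iff)
    moreover have "chain_map q uminus (\<Sum>s\<in>I. g s) = (\<Sum>s\<in>I. chain_map q uminus (g s))" if "finite I"
      for I :: "(nat => real) set" and g :: "(nat => real) => (nat => real) chain"
      using that by (induction I) (auto simp: chain_map_add)
    ultimately show ?thesis by (simp add: hemi_def fin)
  qed
  finally have 3: "sum G (signs p) = hemi q + chain_map q uminus (hemi q)" by (simp add: hemi_def G_def)
  have 4: "(\<Sum>s\<in>signs p. frag_cmul ((-1) ^ p) (frag_of (singular_face p p (oct_simplex p s))))
      = frag_cmul ((-1) ^ p) (sum G (signs p))"
    using oct_face_last[OF assms] q by (simp add: G_def frag_cmul_sum)
  have "\<exists>e. frag_cmul ((-1) ^ p) c = c + (e + e)" for c :: "(nat => real) chain"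
  proof (cases "even p")
    case True
    then show ?thesis by (intro exI[of _ 0]) simp
  next
    case False
    then show ?thesis by (intro exI[of _ "- c"]) simp
  qed
  then obtain e where "frag_cmul ((-1) ^ p) (sum G (signs p)) = sum G (signs p) + (e + e)" by blast
  then show ?thesis using 1 2 3 4 q
    by (intro exI[of _ "(\<Sum>k\<le>q. d k) + e"]) (simp add: algebra_simps)
qed

section \<open>Cochains modulo 2 and their cup products\<close>

definition ev :: "('a => int) => ('a \<Rightarrow>\<^sub>0 int) => int"
  where "ev phi c = (\<Sum>f\<in>Poly_Mapping.keys c. Poly_Mapping.lookup c f * phi f)"

lemma ev_superset:
  assumes "finite A" "Poly_Mapping.keys c \<subseteq> A"
  shows "ev phi c = (\<Sum>f\<in>A. Poly_Mapping.lookup c f * phi f)"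
  unfolding ev_def by (rule sum.mono_neutral_left) (use assms in \<open>auto simp: in_keys_iff\<close>)

lemma ev_zero [simp]: "ev phi 0 = 0"
  by (simp add: ev_def)

lemma ev_of [simp]: "ev phi (frag_of f) = phi f"
  by (simp add: ev_def)

lemma ev_add: "ev phi (a + b) = ev phi a + ev phi b"
proof -
  let ?A = "Poly_Mapping.keys a \<union> Poly_Mapping.keys b"
  have "Poly_Mapping.keys (a + b) \<subseteq> ?A" by (rule Poly_Mapping.keys_add)
  then show ?thesis
    using ev_superset[of ?A "a + b" phi] ev_superset[of ?A a phi] ev_superset[of ?A b phi]
    by (simp add: lookup_add distrib_right sum.distrib)
qed

lemma ev_uminus: "ev phi (- a) = - ev phi a"
  using ev_add[of phi a "- a"] by simp

lemma ev_diff: "ev phi (a - b) = ev phi a - ev phi b"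
  using ev_add[of phi a "- b"] by (simp add: ev_uminus)

lemma ev_sum: "ev phi (\<Sum>i\<in>I. g i) = (\<Sum>i\<in>I. ev phi (g i))"
  by (induction I rule: infinite_finite_induct) (auto simp: ev_add)

lemma ev_frag_extend: "ev phi (frag_extend g c) = ev (%f. ev phi (g f)) c"
proof -
  have "Poly_Mapping.keys c \<subseteq> UNIV" by simp
  then show ?thesis
  proof (induction rule: frag_induction)
    case (diff a b)
    then show ?case by (simp add: frag_extend_diff ev_diff)
  qed simp_all
qed

lemma even_ev: "(!!f. f \<in> Poly_Mapping.keys c ==> even (phi f)) ==> even (ev phi c)"
  unfolding ev_def by (intro dvd_sum) simp

lemma ev_cong_parity:
  assumes "!!f. f \<in> Poly_Mapping.keys c ==> even (phi f - psi f)"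
  shows "even (ev phi c - ev psi c)"
proof -
  have "ev phi c - ev psi c = (\<Sum>f\<in>Poly_Mapping.keys c. Poly_Mapping.lookup c f * (phi f - psi f))"
    by (simp add: ev_def sum_subtractf right_diff_distrib)
  then show ?thesis using assms by (auto intro!: dvd_sum)
qed

definition vert :: "nat => ((nat => real) => 'a) => 'a"
  where "vert i f = f (%j. if j = i then 1 else 0)"

text \<open>The vertex map of the inclusion of the k-th face.\<close>

definition skip :: "nat => nat => nat" where "skip k i = (if i < k then i else Suc i)"

lemma vertex_in_simplex: "i <= p ==> (%j. if j = i then 1 else 0) \<in> standard_simplex p"
  by (auto simp: standard_simplex_def)

lemma vert_face:
  assumes "p > 0" "k <= p" "i <= p - 1"
  shows "vert i (singular_face p k f) = vert (skip k i) f"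
proof -
  have "simplical_face k (%j. if j = i then 1 else (0::real)) = (%j. if j = skip k i then 1 else 0)"
    by (auto simp: simplical_face_def skip_def fun_eq_iff)
  then show ?thesis using vertex_in_simplex[of i "p - 1"] assms
    by (simp add: vert_def singular_face_def)
qed

text \<open>Modulo 2, \<open>s i (v 0) + s i (v 1)\<close> is the coboundary of the 0-cochain
  \<open>s i\<close> on an edge. The product is the cup product of p such coboundaries, with indices
  a, ..., a + p - 1, evaluated on the simplex with vertices v.\<close>

definition cup :: "(nat => 'a => int) => nat => nat => (nat => 'a) => int"
  where "cup s a p v = (\<Prod>i<p. s (a + i) (v i) + s (a + i) (v (Suc i)))"

lemma cup_Suc: "cup s a (Suc p) v = (s a (v 0) + s a (v (Suc 0))) * cup s (Suc a) p (v \<circ> Suc)"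
  unfolding cup_def by (subst prod.lessThan_Suc_shift) simp

text \<open>Faces 0 and 1 have the same vertices from the second one on, so modulo 2 their first
  factors add up to \<open>s a (v 0) + s a (v 1)\<close>, the first factor of all other faces. What
  is left is the same sum one dimension lower.\<close>

lemma cup_cocycle: "even (\<Sum>k\<le>Suc p. cup s a p (v \<circ> skip k))"
proof (induction p arbitrary: a v)
  case 0
  show ?case by (simp add: cup_def)
next
  case (Suc p)
  define w where "w = v \<circ> Suc"
  define C where "C k = cup s (Suc a) p (w \<circ> skip k)" for k
  have sk: "v \<circ> skip 0 = w" "v \<circ> skip (Suc k) \<circ> Suc = w \<circ> skip k" for k
    by (auto simp: skip_def w_def fun_eq_iff)
  have 0: "cup s a (Suc p) (v \<circ> skip 0) = (s a (v 1) + s a (v 2)) * C 0"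
    unfolding sk cup_Suc C_def by (simp add: w_def skip_def comp_def numeral_2_eq_2)
  have 1: "cup s a (Suc p) (v \<circ> skip 1) = (s a (v 0) + s a (v 2)) * C 0"
    unfolding cup_Suc One_nat_def sk C_def by (simp add: skip_def numeral_2_eq_2)
  have 2: "cup s a (Suc p) (v \<circ> skip (Suc (Suc k))) = (s a (v 0) + s a (v 1)) * C (Suc k)" for k
    unfolding cup_Suc sk C_def by (simp add: skip_def)
  have "(\<Sum>k\<le>Suc (Suc p). cup s a (Suc p) (v \<circ> skip k)) =
     (s a (v 1) + s a (v 2)) * C 0 + ((s a (v 0) + s a (v 2)) * C 0
       + (\<Sum>k\<le>p. (s a (v 0) + s a (v 1)) * C (Suc k)))"
    unfolding sum.atMost_Suc_shift[of _ "Suc p"] sum.atMost_Suc_shift[of _ p] using 0 1 2 by simp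
  also have "... = 2 * (s a (v 2) * C 0) + (s a (v 0) + s a (v 1)) * (\<Sum>k\<le>Suc p. C k)"
    unfolding sum.atMost_Suc_shift[of _ p] sum_distrib_left[symmetric] by (simp add: algebra_simps)
  also have "even ..."
  proof -
    have "even (\<Sum>k\<le>Suc p. C k)" unfolding C_def by (rule Suc.IH)
    then show ?thesis by (simp del: sum.atMost_Suc)
  qed
  finally show ?case .
qed

text \<open>Leibniz rule modulo 2 for the product of the 0-cochain \<open>s a\<close> with a
  cocycle: only the coboundary of \<open>s a\<close> survives, and it adds one factor to the cup
  product.\<close>

lemma cup_coboundary:
  "even ((\<Sum>k\<le>Suc p. s a (v (skip k 0)) * cup s (Suc a) p (v \<circ> skip k)) - cup s a (Suc p) v)"
proof -
  define C where "C k = cup s (Suc a) p (v \<circ> skip k)" for k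
  have s0: "v \<circ> skip 0 = v \<circ> Suc" by (auto simp: skip_def)
  have "(\<Sum>k\<le>Suc p. s a (v (skip k 0)) * C k) = s a (v 1) * C 0 + (\<Sum>k\<le>p. s a (v 0) * C (Suc k))"
    unfolding sum.atMost_Suc_shift by (simp add: skip_def)
  also have "... = s a (v 1) * C 0 + s a (v 0) * ((\<Sum>k\<le>Suc p. C k) - C 0)"
    unfolding sum.atMost_Suc_shift[of _ p] by (simp add: sum_distrib_left)
  also have "... - cup s a (Suc p) v = s a (v 0) * (\<Sum>k\<le>Suc p. C k) - 2 * (s a (v 0) * C 0)"
    unfolding cup_Suc C_def s0 by (simp add: algebra_simps)
  also have "even ..." using cup_cocycle[of s "Suc a" p v] by (simp add: C_def)
  finally show ?thesis by (simp add: C_def)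
qed

section \<open>Iterated subdivision of chains\<close>

lemma sd_add: "(singular_subdivision p ^^ m) (a + b) = (singular_subdivision p ^^ m) a + (singular_subdivision p ^^ m) b"
  by (induction m arbitrary: a b) (auto simp: singular_subdivision_add)

lemma sd_chain: "singular_chain p X c ==> singular_chain p X ((singular_subdivision p ^^ m) c)"
  by (induction m) (auto simp: singular_chain_singular_subdivision)

lemma sd_boundary:
  "singular_chain p X c ==> chain_boundary p ((singular_subdivision p ^^ m) c)
    = (singular_subdivision (p - Suc 0) ^^ m) (chain_boundary p c)"
  by (induction m) (auto simp: chain_boundary_singular_subdivision[OF sd_chain])

lemma sd_natural:
  "singular_chain p X c ==> (singular_subdivision p ^^ m) (chain_map p g c)
    = chain_map p g ((singular_subdivision p ^^ m) c)"
  by (induction m) (auto simp: naturality_singular_subdivision[OF sd_chain])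

text \<open>Without a common zero, the signs of the f i give 0-cochains s i with s i (-x) = 1 - s i
  x. Induction over hemispheres, with Stokes' formula modulo 2, shows that the cup product of all n
  coboundaries is odd on the subdivided n-hemisphere. A fine subdivision puts each simplex into a
  region where some f j has constant sign, and there the product is even: a contradiction.\<close>

theorem borsuk_ulam:
  fixes f :: "nat => (nat => real) => real"
  assumes cont: "!!i. i < n ==> continuous_on (octahedron n) (f i)"
    and odd: "!!i x. i < n ==> x \<in> octahedron n ==> f i (- x) = - f i x"
  shows "\<exists>x\<in>octahedron n. \<forall>i<n. f i x = 0"
proof (rule ccontr)
  assume neg: "\<not> ?thesis"
  define X where "X = oct_top n"
  have tX: "topspace X = octahedron n" by (simp add: X_def)
  have oct0: "x ~= (%_. 0)" if "x \<in> octahedron n" for x using that by (auto simp: octahedron_def)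
  have octm: "- x \<in> octahedron n" if "x \<in> octahedron n" for x using that by (auto simp: octahedron_def)
  \<comment> \<open>Tie-break at zeros of f i: the sign of the first nonzero coordinate changes
    under the antipodal map everywhere on the octahedron, so s i stays antisymmetric.\<close>
  define s0 where "s0 x = (if x (LEAST i. x i ~= 0) > 0 then 1 else (0::int))" for x :: "nat => real"
  have s0: "s0 (- x) = 1 - s0 x" if nz: "x ~= (%_. 0)" for x
  proof -
    obtain i where "x i ~= 0" using nz by (auto simp: fun_eq_iff)
    then have "x (LEAST i. x i ~= 0) ~= 0" by (rule LeastI)
    then show ?thesis by (auto simp: s0_def)
  qed
  define s where "s i x = (if f i x > 0 then 1 else if f i x < 0 then 0 else s0 x)" for i x
  have s: "s i (- x) = 1 - s i x" if "i < n" "x \<in> octahedron n" for i x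
    using odd[OF that] s0[OF oct0[OF that(2)]] by (auto simp: s_def)
  define \<C> where "\<C> = (%i. {x\<in>octahedron n. f i x > 0}) ` {..<n} \<union> (%i. {x\<in>octahedron n. f i x < 0}) ` {..<n}"
  have cm: "continuous_map X euclideanreal (f i)" if "i < n" for i
    using cont[OF that] by (simp add: X_def euclidean_product_topology)
  have opn: "openin X U" if "U \<in> \<C>" for U
    using that openin_continuous_map_preimage[OF cm, of _ "{0<..}"] openin_continuous_map_preimage[OF cm, of _ "{..<0}"]
    by (auto simp: \<C>_def tX)
  have cov: "topspace X \<subseteq> \<Union>\<C>"
  proof
    fix x assume x: "x \<in> topspace X"
    then obtain i where "i < n" "f i x ~= 0" using neg tX by auto
    then have "f i x > 0 \<or> f i x < 0" by linarith
    then show "x \<in> \<Union>\<C>" using x tX \<open>i < n\<close> unfolding \<C>_def by blast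
  qed
  have ch: "singular_chain p X (hemi p)" if "p <= n" for p
    unfolding X_def by (rule singular_chain_hemi[OF that])
  obtain m where m: "!!f. f \<in> Poly_Mapping.keys ((singular_subdivision n ^^ m) (hemi n)) ==>
      \<exists>V\<in>\<C>. f \<in> standard_simplex n \<rightarrow> V"
    using sufficient_iterated_singular_subdivision_exists[OF opn cov ch[OF order_refl]] by (metis order_refl)
  \<comment> \<open>The same number m of subdivisions in every dimension, so that subdivision
    commutes with the boundary.\<close>
  define c where "c p = (singular_subdivision p ^^ m) (hemi p)" for p
  \<comment> \<open>Dimension p uses the last p functions; passing to p + 1 then puts the new factor
    in front, as in \<open>cup_Suc\<close>.\<close>
  define W where "W p g = cup s (n - p) p (%i. vert i g)" for p and g :: "(nat => real) => nat => real"
  have cc: "singular_chain p X (c p)" if "p <= n" for p unfolding c_def by (rule sd_chain[OF ch[OF that]])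
  have "p <= n ==> \<not> even (ev (W p) (c p))" for p
  proof (induction p)
    case 0
    have "singular_subdivision 0 x = x" if "singular_chain 0 X x" for x
      using that by (rule singular_subdivision_zero)
    then have "(singular_subdivision 0 ^^ m) (hemi 0) = hemi 0"
      using ch[of 0] by (induction m) auto
    moreover have "signs 0 = {%i. 1}" by (auto simp: signs_def)
    ultimately show ?case by (simp add: c_def hemi_def W_def cup_def)
  next
    case (Suc p)
    \<comment> \<open>\<open>A\<close> is a p-cochain whose coboundary is \<open>W (Suc p)\<close>
      modulo 2, by \<open>cup_coboundary\<close>.\<close>
    define A where "A g = s (n - Suc p) (vert 0 g) * W p g" for g
    have np: "n - p = Suc (n - Suc p)" using Suc.prems by simp
    have "even (ev A (\<Sum>k\<le>Suc p. frag_cmul ((-1) ^ k) (frag_of (singular_face (Suc p) k g))) - W (Suc p) g)" for g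
    proof -
      define v where "v i = vert i g" for i
      have Af: "A (singular_face (Suc p) k g) = s (n - Suc p) (v (skip k 0)) * cup s (Suc (n - Suc p)) p (v \<circ> skip k)"
        if "k <= Suc p" for k
        using that vert_face[of "Suc p" k _ g]
        by (simp add: A_def W_def np v_def cup_def)
      have evc: "even (ev A (frag_cmul ((-1) ^ k) x) - ev A x)" for k and x :: "(nat => real) chain"
        by (cases "even k") (auto simp: ev_uminus)
      have "even (ev A (\<Sum>k\<le>Suc p. frag_cmul ((-1) ^ k) (frag_of (singular_face (Suc p) k g)))
          - (\<Sum>k\<le>Suc p. A (singular_face (Suc p) k g)))"
        unfolding ev_sum sum_subtractf[symmetric] using evc by (intro dvd_sum) (metis ev_of)
      moreover have "even ((\<Sum>k\<le>Suc p. A (singular_face (Suc p) k g)) - W (Suc p) g)"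
        using cup_coboundary[where s = s and a = "n - Suc p" and p = p and v = v]
        by (simp add: Af W_def v_def[abs_def] del: sum.atMost_Suc)
      ultimately show ?thesis by presburger
    qed
    note par = this
    have cb: "ev A (chain_boundary (Suc p) x) =
        ev (%g. ev A (\<Sum>k\<le>Suc p. frag_cmul ((-1) ^ k) (frag_of (singular_face (Suc p) k g)))) x" for x
      by (simp add: chain_boundary_def ev_frag_extend del: sum.atMost_Suc)
    have 1: "even (ev A (chain_boundary (Suc p) (c (Suc p))) - ev (W (Suc p)) (c (Suc p)))"
      unfolding cb by (rule ev_cong_parity) (rule par)
    obtain d where d: "chain_boundary (Suc p) (hemi (Suc p)) = hemi p + chain_map p uminus (hemi p) + (d + d)"
      using hemi_boundary[of "Suc p"] by auto
    define e where "e = (singular_subdivision p ^^ m) d"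
    have pn: "p <= n" using Suc.prems by simp
    have "chain_boundary (Suc p) (c (Suc p)) = c p + chain_map p uminus (c p) + (e + e)"
      unfolding c_def e_def sd_boundary[OF ch[OF Suc.prems]] d using sd_natural[OF ch[OF pn]]
      by (simp add: d sd_add)
    then have 2: "even (ev A (chain_boundary (Suc p) (c (Suc p))) - (ev A (c p) + ev A (chain_map p uminus (c p))))"
      by (simp add: ev_add)
    \<comment> \<open>Modulo 2 the boundary of the hemisphere is the hemisphere one dimension lower
      plus its antipode. The antipodal map flips the factor s in \<open>A\<close> and leaves
      \<open>W p\<close> unchanged modulo 2, so \<open>A\<close> on both parts adds up to
      \<open>W p\<close> on one.\<close>
    have "even (ev (%g. A g + A (simplex_map p uminus g)) (c p) - ev (W p) (c p))"
    proof (rule ev_cong_parity)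
      fix g assume "g \<in> Poly_Mapping.keys (c p)"
      then have g: "singular_simplex p X g" using cc[OF pn] by (auto simp: singular_chain_def)
      have vg: "vert i g \<in> octahedron n" if "i <= p" for i
        using g vertex_in_simplex[OF that] unfolding tX[symmetric] vert_def singular_simplex_def continuous_map_def
        by (auto simp: topspace_standard_simplex)
      define ug where "ug = simplex_map p uminus g"
      have vt: "vert i ug = - vert i g" if "i <= p" for i
        using vertex_in_simplex[OF that] by (simp add: ug_def vert_def simplex_map_def)
      have "even (cup s (n - p) p (%i. vert i ug) - cup s (n - p) p (%i. vert i g))"
      proof -
        have gen: "q <= p ==> even (cup s (n - p) q (%i. vert i ug) - cup s (n - p) q (%i. vert i g))" for q
        proof (induction q)
          case (Suc q)
          have "s (n - p + q) (vert i ug) = 1 - s (n - p + q) (vert i g)" if "i <= p" for i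
            using s[of "n - p + q" "vert i g"] vg vt that Suc.prems pn by simp
          then show ?case using Suc by (auto simp: cup_def)
        qed (simp add: cup_def)
        then show ?thesis by blast
      qed
      then have "even (W p ug - W p g)" by (simp add: W_def)
      moreover have su: "s (n - Suc p) (vert 0 ug) = 1 - s (n - Suc p) (vert 0 g)"
        using s[of "n - Suc p" "vert 0 g"] vg[of 0] vt[of 0] Suc.prems by simp
      have "A g + A ug - W p g = (1 - s (n - Suc p) (vert 0 g)) * (W p ug - W p g)"
        unfolding A_def su by (simp add: algebra_simps)
      ultimately have "even (A g + A ug - W p g)" by simp
      then show "even (A g + A (simplex_map p uminus g) - W p g)" by (simp only: ug_def)
    qed
    moreover have "ev (%g. A g + A (simplex_map p uminus g)) (c p) = ev A (c p) + ev A (chain_map p uminus (c p))"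
      unfolding chain_map_def ev_frag_extend by (simp add: ev_def sum.distrib distrib_left)
    ultimately show ?case using 1 2 Suc.IH[OF pn] by presburger
  qed
  from this[of n] obtain g where g: "g \<in> Poly_Mapping.keys (c n)" "\<not> even (W n g)"
    using even_ev[of "c n" "W n"] by auto
  obtain V where V: "V \<in> \<C>" "g \<in> standard_simplex n \<rightarrow> V" using m g(1) unfolding c_def by blast
  have vV: "vert i g \<in> V" if "i <= n" for i using vertex_in_simplex[OF that] V(2) by (auto simp: vert_def)
  obtain j where j: "j < n" "V = {x\<in>octahedron n. f j x > 0} \<or> V = {x\<in>octahedron n. f j x < 0}"
    using V(1) by (auto simp: \<C>_def)
  \<comment> \<open>All vertices of g lie in one set of the cover, so s j takes the same value at
    them and its factor in the product is 0 or 2.\<close>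
  have "even (s j (vert j g) + s j (vert (Suc j) g))"
    using j vV[of j] vV[of "Suc j"] by (auto simp: s_def)
  then have "even (W n g)" unfolding W_def cup_def using j(1) by (intro dvd_trans[OF _ dvd_prodI[of "{..<n}" j]]) auto
  then show False using g(2) by simp
qed

section \<open>Constrained critical points of even functionals\<close>

lemma bounded_imp_convergent_subseq:
  fixes a :: "nat => real"
  assumes "!!n. \<bar>a n\<bar> <= B"
  obtains r l where "strict_mono (r :: nat => nat)" "(a \<circ> r) \<longlonglongrightarrow> l"
proof -
  have "seq_compact (cball (0::real) B)" using compact_cball compact_imp_seq_compact by blast
  moreover have "\<forall>n. a n \<in> cball 0 B" using assms by (simp add: dist_norm)
  ultimately show ?thesis using that unfolding seq_compact_def by blast
qed

text \<open>\<open>S\<close> stands for the Sobolev space, \<open>pr\<close> for its compact map to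
  L2, and \<open>K\<close> for the derivative of \<open>Psi\<close>, as \<open>taylor\<close>
  expresses. \<open>K_cont\<close> measures the distance of the arguments only through
  \<open>pr\<close>, so that \<open>K\<close> inherits compactness; \<open>orthonormal\<close>
  provides spheres of every dimension on the constraint.\<close>

locale constrained_functional =
  fixes S :: "'w::{real_inner,complete_space} set"
    and pr :: "'w => 'l::{real_inner,complete_space}"
    and Psi :: "'w => real" and K :: "'w => 'w"
  assumes subspace: "subspace S" and closed: "closed S"
    and pr: "bounded_linear pr"
    and Psi_even: "!!U. U \<in> S ==> Psi (- U) = Psi U"
    and K_in: "!!U. U \<in> S ==> K U \<in> S"
    and K_odd: "!!U. U \<in> S ==> K (- U) = - K U"
    and taylor: "!!R. \<exists>C\<ge>0. \<forall>U\<in>S. \<forall>V\<in>S. norm U <= R --> norm V <= R -->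
          \<bar>Psi V - Psi U - inner (K U) (V - U)\<bar> <= C * (norm (V - U))\<^sup>2"
    and K_bdd: "!!R. \<exists>C\<ge>0. \<forall>U\<in>S. norm U <= R --> norm (K U) <= C"
    and K_cont: "!!R e. e > 0 ==> \<exists>d>0. \<forall>U\<in>S. \<forall>V\<in>S. norm U <= R --> norm V <= R -->
          norm (pr U - pr V) < d --> norm (K U - K V) < e"
    and pr_compact: "!!R. compact (closure (pr ` (S \<inter> cball 0 R)))"
    and coercive: "!!b. \<exists>R. \<forall>U\<in>S. norm (pr U) = 1 --> (norm U)\<^sup>2 / 2 - Psi U <= b --> norm U <= R"
    and orthonormal: "!!n. \<exists>e::nat => 'w. (\<forall>i\<le>n. e i \<in> S) &
          (\<forall>i\<le>n. \<forall>j\<le>n. inner (pr (e i)) (pr (e j)) = (if i = j then 1 else 0))"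
begin

sublocale pr: bounded_linear pr by (rule pr)

definition J :: "'w => real" where "J U = (norm U)\<^sup>2 / 2 - Psi U"

text \<open>The gradient in S of half the squared norm of \<open>pr U\<close>, hence the normal of
  the constraint set.\<close>

definition E :: "'w => 'w"
  where "E U = (SOME V. V \<in> S & (\<forall>W\<in>S. inner V W = inner (pr U) (pr W)))"

lemma E: shows E_in: "E U \<in> S" and E_inner: "W \<in> S ==> inner (E U) W = inner (pr U) (pr W)"
proof -
  obtain B where B: "!!x. norm (pr x) <= norm x * B" using pr.bounded by blast
  have "\<exists>V\<in>S. \<forall>W\<in>S. inner V W = inner (pr U) (pr W)"
  proof (rule riesz_subspace[OF subspace closed, where L = "norm (pr U) * B"])
    fix W
    have "\<bar>inner (pr U) (pr W)\<bar> <= norm (pr U) * norm (pr W)" by (rule Cauchy_Schwarz_ineq2)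
    also have "... <= norm (pr U) * (norm W * B)" by (intro mult_left_mono B norm_ge_zero)
    finally show "\<bar>inner (pr U) (pr W)\<bar> <= norm (pr U) * B * norm W" by (simp add: mult_ac)
  qed (simp_all add: pr.add pr.scaleR inner_add_right)
  then obtain V where "V \<in> S & (\<forall>W\<in>S. inner V W = inner (pr U) (pr W))" by blast
  then have "E U \<in> S & (\<forall>W\<in>S. inner (E U) W = inner (pr U) (pr W))"
    unfolding E_def by (rule someI)
  then show "E U \<in> S" "W \<in> S ==> inner (E U) W = inner (pr U) (pr W)" by auto
qed

lemma E_minus: "E (- U) = - E U"
  by (rule riesz_subspace_unique[OF subspace])
    (simp_all add: E_in E_inner subspace_neg[OF subspace] pr.neg)

text \<open>\<open>E U\<close> depends on U only through \<open>pr U\<close>, linearly; by duality a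
  bound for \<open>pr\<close> is also the Lipschitz constant.\<close>

lemma E_lipschitz: "\<exists>B>0. \<forall>U V. norm (E U - E V) <= B * norm (pr U - pr V)"
proof -
  obtain B where B: "B > 0" "!!x. norm (pr x) <= norm x * B" using pr.pos_bounded by blast
  have "norm (E U - E V) <= B * norm (pr U - pr V)" for U V
  proof -
    let ?d = "E U - E V"
    have dS: "?d \<in> S" by (intro subspace_diff[OF subspace] E_in)
    have "(norm ?d)\<^sup>2 = inner (pr U - pr V) (pr ?d)"
      using E_inner[OF dS, of U] E_inner[OF dS, of V]
      by (simp add: power2_norm_eq_inner inner_diff_left)
    also have "... <= norm (pr U - pr V) * norm (pr ?d)" by (rule norm_cauchy_schwarz)
    also have "... <= norm (pr U - pr V) * (norm ?d * B)" by (intro mult_left_mono B norm_ge_zero)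
    finally have "norm ?d * norm ?d <= norm ?d * (B * norm (pr U - pr V))"
      by (simp add: power2_eq_square mult_ac)
    then show ?thesis
      using B(1) by (cases "norm ?d = 0") (auto simp: mult_le_cancel_left)
  qed
  with B(1) show ?thesis by blast
qed

text \<open>The Lagrange multiplier for which \<open>T U\<close>, the gradient of \<open>J\<close>
  minus its normal part, is orthogonal to \<open>E U\<close>.\<close>

definition lam :: "'w => real"
  where "lam U = inner (U - K U) (E U) / (norm (E U))\<^sup>2"

definition T :: "'w => 'w"
  where "T U = U - K U - lam U *\<^sub>R E U"

definition S1 :: "'w set" where "S1 = {U\<in>S. norm (pr U) = 1}"

lemma S1_S: "U \<in> S1 ==> U \<in> S" by (simp add: S1_def)

lemma E_U: "U \<in> S1 ==> inner (E U) U = 1"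
  using E_inner[of U U] by (simp add: S1_def power2_norm_eq_inner[symmetric])

lemma E_nz: "U \<in> S1 ==> E U ~= 0"
  using E_U[of U] by auto

lemma T_in: "U \<in> S1 ==> T U \<in> S"
  unfolding T_def S1_def using subspace by (auto intro!: subspace_diff subspace_scale K_in E_in)

lemma E_T: "U \<in> S1 ==> inner (E U) (T U) = 0"
  using E_nz[of U] unfolding T_def lam_def
  by (simp add: inner_diff_right power2_norm_eq_inner inner_commute[of "E U" "K U"] inner_commute[of "E U" U] inner_diff_left)

lemma pr_T: "U \<in> S1 ==> inner (pr U) (pr (T U)) = 0"
  using E_T[of U] E_inner[of "T U" U] T_in[of U] by simp

lemma grad_T: "U \<in> S1 ==> inner (U - K U) (T U) = (norm (T U))\<^sup>2"
proof -
  assume U: "U \<in> S1"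
  have "U - K U = T U + lam U *\<^sub>R E U" by (simp add: T_def)
  then have "inner (U - K U) (T U) = inner (T U) (T U) + lam U * inner (E U) (T U)"
    by (simp only: inner_add_left inner_scaleR_left)
  then show ?thesis using E_T[OF U] by (simp add: power2_norm_eq_inner)
qed

lemma norm_T_le: assumes U: "U \<in> S1" shows "norm (T U) <= norm (U - K U)"
proof -
  have "norm (T U) * norm (T U) <= norm (U - K U) * norm (T U)"
    using grad_T[OF U] norm_cauchy_schwarz[of "U - K U" "T U"] by (simp add: power2_eq_square)
  then show ?thesis by (cases "norm (T U) = 0") (auto simp: mult_le_cancel_right)
qed

lemma J_minus: "U \<in> S ==> J (- U) = J U"
  by (simp add: J_def Psi_even)

lemma T_minus: "U \<in> S ==> T (- U) = - T U"
proof -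
  assume U: "U \<in> S"
  have "lam (- U) = lam U" using K_odd[OF U] by (simp add: lam_def E_minus inner_diff_left)
  then show ?thesis using K_odd[OF U] by (simp add: T_def E_minus)
qed

lemma continuous_E: "continuous_on A E"
proof -
  obtain B where B: "B > 0" "!!U V. norm (E U - E V) <= B * norm (pr U - pr V)" using E_lipschitz by blast
  have "continuous (at U within A) E" for U
  proof -
    have "((%V. B * norm (pr V - pr U)) \<longlongrightarrow> B * norm (pr U - pr U)) (at U within A)"
      by (intro tendsto_mult tendsto_const tendsto_norm tendsto_diff pr.tendsto tendsto_ident_at)
    then have l: "((%V. B * norm (pr V - pr U)) \<longlongrightarrow> 0) (at U within A)" by simp
    have "((%V. E V - E U) \<longlongrightarrow> 0) (at U within A)"
      by (rule Lim_null_comparison[OF always_eventually l]) (use B in blast)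
    then show ?thesis by (simp add: continuous_within LIM_zero_iff)
  qed
  then show ?thesis by (simp add: continuous_on_eq_continuous_within)
qed

lemma bounded_nhd: "\<exists>R. \<forall>\<^sub>F V in at U within A. norm V <= R & norm U <= (R::real)" for U :: 'w
proof -
  have "\<forall>\<^sub>F V in at U within A. dist V U < 1" by (rule eventually_at_ball'[THEN eventually_mono]) (auto simp: dist_commute)
  then have "\<forall>\<^sub>F V in at U within A. norm V <= norm U + 1 & norm U <= norm U + 1"
  proof eventually_elim
    case (elim V)
    then show ?case using norm_triangle_ineq2[of V U] by (simp add: dist_norm)
  qed
  then show ?thesis by blast
qed

lemma continuous_K: "continuous_on S K"
  unfolding continuous_on_eq_continuous_within
proof
  fix U assume U: "U \<in> S"
  obtain R where R: "\<forall>\<^sub>F V in at U within S. norm V <= R & norm U <= R" using bounded_nhd by blast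
  show "continuous (at U within S) K"
    unfolding continuous_within tendsto_iff
  proof (intro allI impI)
    fix e :: real assume "e > 0"
    then obtain d where d: "d > 0" "!!U V. U \<in> S ==> V \<in> S ==> norm U <= R ==> norm V <= R ==>
      norm (pr U - pr V) < d ==> norm (K U - K V) < e" using K_cont[of e R] by blast
    have "(pr \<longlongrightarrow> pr U) (at U within S)" by (intro pr.tendsto tendsto_ident_at)
    then have "\<forall>\<^sub>F V in at U within S. dist (pr V) (pr U) < d" using d(1) by (auto simp: tendsto_iff)
    moreover have "\<forall>\<^sub>F V in at U within S. V \<in> S" by (simp add: eventually_at_filter)
    ultimately show "\<forall>\<^sub>F V in at U within S. dist (K V) (K U) < e"
      using R by eventually_elim (auto simp: dist_norm intro!: d U)
  qed
qed

lemma continuous_J: "continuous_on S J"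
proof -
  have "continuous_on S Psi"
    unfolding continuous_on_eq_continuous_within
  proof
    fix U assume U: "U \<in> S"
    obtain R where R: "\<forall>\<^sub>F V in at U within S. norm V <= R & norm U <= R" using bounded_nhd by blast
    obtain C where C: "!!U V. U \<in> S ==> V \<in> S ==> norm U <= R ==> norm V <= R ==>
       \<bar>Psi V - Psi U - inner (K U) (V - U)\<bar> <= C * (norm (V - U))\<^sup>2" using taylor[of R] by blast
    have "((%V. \<bar>inner (K U) (V - U)\<bar> + C * (norm (V - U))\<^sup>2) \<longlongrightarrow> \<bar>inner (K U) (U - U)\<bar> + C * (norm (U - U))\<^sup>2) (at U within S)"
      by (intro tendsto_intros)
    then have l: "((%V. \<bar>inner (K U) (V - U)\<bar> + C * (norm (V - U))\<^sup>2) \<longlongrightarrow> 0) (at U within S)" by simp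
    have "\<forall>\<^sub>F V in at U within S. V \<in> S" by (simp add: eventually_at_filter)
    then have "\<forall>\<^sub>F V in at U within S. norm (Psi V - Psi U) <= \<bar>inner (K U) (V - U)\<bar> + C * (norm (V - U))\<^sup>2"
      using R
    proof eventually_elim
      case (elim V)
      then show ?case using C[OF U, of V] by simp
    qed
    then have "((%V. Psi V - Psi U) \<longlongrightarrow> 0) (at U within S)" by (rule Lim_null_comparison[OF _ l])
    then show "continuous (at U within S) Psi" by (simp add: continuous_within LIM_zero_iff)
  qed
  then show ?thesis unfolding J_def by (intro continuous_intros) auto
qed

lemma continuous_T: "continuous_on S1 T"
proof -
  have "S1 \<subseteq> S" by (auto simp: S1_def)
  then have "continuous_on S1 K" using continuous_K continuous_on_subset by blast
  then show ?thesis unfolding T_def lam_def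
    by (intro continuous_intros continuous_E) (use E_nz in auto)
qed

lemma gradient_bounded: "\<exists>G\<ge>0. \<forall>U\<in>S. norm U <= R --> norm (U - K U) <= G"
proof -
  obtain C where C: "C >= 0" "!!U. U \<in> S ==> norm U <= R ==> norm (K U) <= C" using K_bdd[of R] by blast
  have "norm (U - K U) <= \<bar>R\<bar> + C" if "U \<in> S" "norm U <= R" for U
    using norm_triangle_ineq4[of U "K U"] C(2)[OF that] that by linarith
  with C(1) show ?thesis by (intro exI[of _ "\<bar>R\<bar> + C"]) auto
qed

section \<open>Descent on the constraint set\<close>

definition N :: "'w => 'w" where "N Y = (1 / norm (pr Y)) *\<^sub>R Y"

lemma N_S1: "Y \<in> S ==> pr Y ~= 0 ==> N Y \<in> S1"
  by (simp add: N_def S1_def subspace_scale[OF subspace] pr.scaleR)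

lemma pr_step: assumes U: "U \<in> S1" shows "(norm (pr (U - t *\<^sub>R T U)))\<^sup>2 = 1 + t\<^sup>2 * (norm (pr (T U)))\<^sup>2"
proof -
  have "(norm (pr (U - t *\<^sub>R T U)))\<^sup>2 = inner (pr U) (pr U) - 2 * t * inner (pr U) (pr (T U)) + t\<^sup>2 * inner (pr (T U)) (pr (T U))"
    unfolding power2_norm_eq_inner
    by (simp add: pr.diff pr.scaleR inner_diff_left inner_diff_right inner_commute[of "pr (T U)" "pr U"]
        power2_eq_square algebra_simps)
  then show ?thesis using pr_T[OF U] U by (simp add: S1_def power2_norm_eq_inner[symmetric])
qed

lemma pr_step_ge: assumes U: "U \<in> S1" shows "norm (pr (U - t *\<^sub>R T U)) >= 1"
  by (rule power2_le_imp_le) (simp_all add: pr_step[OF U])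

text \<open>To first order a step t along -T lowers J by t |T|^2. Since pr (T U) is orthogonal to pr
  U, renormalising moves the point only by O(t^2), which together with the Taylor remainder goes
  into t^2 D; D is uniform on each ball.\<close>

lemma descent:
  "\<exists>D\<ge>0. \<forall>U\<in>S1. norm U <= R --> (\<forall>t. 0 <= t --> t <= 1 -->
      J (N (U - t *\<^sub>R T U)) <= J U - t * (norm (T U))\<^sup>2 + t\<^sup>2 * D)"
proof -
  obtain G where G: "G >= 0" "!!U. U \<in> S ==> norm U <= R ==> norm (U - K U) <= G"
    using gradient_bounded[of R] by blast
  obtain B where B: "B > 0" "!!x. norm (pr x) <= norm x * B" using pr.pos_bounded by blast
  \<comment> \<open>For t <= 1 this bounds the point, its step and the renormalised step, so one
    Taylor constant serves all of them.\<close>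
  define R2 where "R2 = \<bar>R\<bar> + G"
  obtain C where C: "C >= 0" "!!U V. U \<in> S ==> V \<in> S ==> norm U <= R2 ==> norm V <= R2 ==>
     \<bar>Psi V - Psi U - inner (K U) (V - U)\<bar> <= C * (norm (V - U))\<^sup>2" using taylor[of R2] by blast
  \<comment> \<open>t^2 c1 bounds the displacement caused by the renormalisation.\<close>
  define c1 where "c1 = (G * B)\<^sup>2 * R2"
  have c1: "c1 >= 0" using G(1) by (simp add: c1_def R2_def)
  define D where "D = G * c1 + (1/2 + C) * (c1 + G)\<^sup>2"
  have "J (N (U - t *\<^sub>R T U)) <= J U - t * (norm (T U))\<^sup>2 + t\<^sup>2 * D"
    if U: "U \<in> S1" and UR: "norm U <= R" and t: "0 <= t" "t <= 1" for U t
  proof -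
    define Y where "Y = U - t *\<^sub>R T U"
    define Z where "Z = N Y"
    define s where "s = norm (pr Y)"
    have s1: "s >= 1" unfolding s_def Y_def by (rule pr_step_ge[OF U])
    have g: "norm (U - K U) <= G" using G(2)[OF S1_S[OF U] UR] .
    have nT: "norm (T U) <= G" using norm_T_le[OF U] g by linarith
    have US: "U \<in> S" by (rule S1_S[OF U])
    have YS: "Y \<in> S" unfolding Y_def using subspace US T_in[OF U] by (intro subspace_diff subspace_scale)
    have ZS: "Z \<in> S" unfolding Z_def N_def using subspace YS by (intro subspace_scale)
    have "norm Y <= norm U + t * norm (T U)"
      unfolding Y_def using norm_triangle_ineq4[of U "t *\<^sub>R T U"] t by simp
    also have "t * norm (T U) <= 1 * G" using t nT by (intro mult_mono) auto
    finally have nY: "norm Y <= R2" using UR by (simp add: R2_def)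
    have "norm Z = norm Y / s" using s1 by (simp add: Z_def N_def s_def)
    also have "... <= norm Y" using s1 divide_left_mono[of 1 s "norm Y"] by simp
    finally have nZ: "norm Z <= R2" using nY by linarith
    have "s - 1 <= s\<^sup>2 - 1" using s1 by (simp add: power2_eq_square)
    also have "... = t\<^sup>2 * (norm (pr (T U)))\<^sup>2" unfolding s_def Y_def pr_step[OF U] by simp
    also have "... <= t\<^sup>2 * (G * B)\<^sup>2"
    proof (intro mult_left_mono power_mono)
      show "norm (pr (T U)) <= G * B" using B(2)[of "T U"] nT B(1) by (meson mult_right_mono less_imp_le order_trans)
    qed simp_all
    finally have s2: "s - 1 <= t\<^sup>2 * (G * B)\<^sup>2" .
    have "1 - 1 / s <= s - 1"
    proof -
      have "1 - 1 / s = (s - 1) / s" using s1 by (simp add: field_simps)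
      also have "... <= (s - 1) / 1" using s1 by (intro divide_left_mono) auto
      finally show ?thesis by simp
    qed
    then have sY: "1 - 1 / s <= t\<^sup>2 * (G * B)\<^sup>2" using s2 by linarith
    have "Y - Z = (1 - 1 / s) *\<^sub>R Y" by (simp add: Z_def N_def s_def algebra_simps)
    then have "norm (Y - Z) = (1 - 1 / s) * norm Y" using s1 by simp
    also have "... <= (t\<^sup>2 * (G * B)\<^sup>2) * R2" using sY nY s1 by (intro mult_mono) auto
    finally have YZ: "norm (Z - Y) <= t\<^sup>2 * c1" by (simp add: c1_def norm_minus_commute mult_ac)
    have "norm (Z - U) = norm ((Z - Y) - t *\<^sub>R T U)" by (simp add: Y_def)
    also have "... <= norm (Z - Y) + norm (t *\<^sub>R T U)" by (rule norm_triangle_ineq4)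
    also have "... <= t\<^sup>2 * c1 + t * G" using YZ nT t by (intro add_mono) (auto intro!: mult_left_mono)
    also have "... <= t * c1 + t * G"
      using t c1 by (intro add_right_mono mult_right_mono) (auto simp: power2_eq_square mult_left_le_one_le)
    finally have ZU: "norm (Z - U) <= t * (c1 + G)" by (simp add: algebra_simps)
    have ZU2: "(norm (Z - U))\<^sup>2 <= t\<^sup>2 * (c1 + G)\<^sup>2"
      using power_mono[OF ZU norm_ge_zero, of 2] by (simp add: power_mult_distrib)
    have "inner (U - K U) (Z - Y) <= norm (U - K U) * norm (Z - Y)" by (rule norm_cauchy_schwarz)
    also have "... <= G * (t\<^sup>2 * c1)" using g YZ G(1) by (intro mult_mono) auto
    finally have i1: "inner (U - K U) (Z - Y) <= G * (t\<^sup>2 * c1)" .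
    have "inner (U - K U) (Z - U) = inner (U - K U) (Z - Y) - t * inner (U - K U) (T U)"
      by (simp add: Y_def inner_diff_right inner_diff_left algebra_simps)
    then have i2: "inner (U - K U) (Z - U) <= G * (t\<^sup>2 * c1) - t * (norm (T U))\<^sup>2"
      using i1 grad_T[OF U] by simp
    have UR2: "norm U <= R2" using UR G(1) by (simp add: R2_def)
    have "(norm Z)\<^sup>2 = (norm U)\<^sup>2 + 2 * inner U (Z - U) + (norm (Z - U))\<^sup>2"
      by (simp add: power2_norm_eq_inner inner_diff_left inner_diff_right inner_commute)
    then have "J Z - J U = inner (U - K U) (Z - U) + (norm (Z - U))\<^sup>2 / 2 - (Psi Z - Psi U - inner (K U) (Z - U))"
      by (simp add: J_def inner_diff_left add_divide_distrib)
    also have "... <= (G * (t\<^sup>2 * c1) - t * (norm (T U))\<^sup>2) + (norm (Z - U))\<^sup>2 / 2 + C * (norm (Z - U))\<^sup>2"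
      using i2 C(2)[OF US ZS UR2 nZ] by linarith
    also have "... = G * (t\<^sup>2 * c1) - t * (norm (T U))\<^sup>2 + (1/2 + C) * (norm (Z - U))\<^sup>2" by (simp add: algebra_simps)
    also have "... <= G * (t\<^sup>2 * c1) - t * (norm (T U))\<^sup>2 + (1/2 + C) * (t\<^sup>2 * (c1 + G)\<^sup>2)"
      using C(1) by (intro add_left_mono mult_left_mono ZU2) auto
    finally show ?thesis unfolding D_def Z_def Y_def by (simp add: algebra_simps)
  qed
  moreover have "D >= 0" using G(1) c1 C(1) by (simp add: D_def)
  ultimately show ?thesis by blast
qed

text \<open>By coercivity the sublevel set has totally bounded image under \<open>pr\<close>. If g i
  is the centre of a ball of radius 1/2 that contains pr U, then inner (pr U) (g i) > 1 - 1/2,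
  because pr U is a unit vector.\<close>

lemma separating_functionals:
  obtains n :: nat and g :: "nat => 'l" where "!!U. U \<in> S1 ==> J U <= A ==> \<exists>i<n. inner (pr U) (g i) ~= 0"
proof -
  obtain R where R: "!!U. U \<in> S ==> norm (pr U) = 1 ==> J U <= A ==> norm U <= R"
    using coercive[of A] unfolding J_def by blast
  obtain k where k: "finite k" "closure (pr ` (S \<inter> cball 0 R)) \<subseteq> (\<Union>x\<in>k. ball x (1/2))"
    using pr_compact[of R] unfolding compact_eq_totally_bounded by (meson half_gt_zero zero_less_one)
  obtain n :: nat and g where g: "k = g ` {i. i < n}" using finite_imp_nat_seg_image_inj_on[OF k(1)] by blast
  have "\<exists>i<n. inner (pr U) (g i) ~= 0" if U: "U \<in> S1" "J U <= A" for U
  proof -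
    have "pr U \<in> closure (pr ` (S \<inter> cball 0 R))"
      using R[of U] U by (intro subsetD[OF closure_subset]) (auto simp: S1_def)
    then obtain i where i: "i < n" "dist (g i) (pr U) < 1/2" using k(2) g by auto
    have "inner (pr U) (g i) = inner (pr U) (pr U) - inner (pr U) (pr U - g i)" by (simp add: inner_diff_right)
    moreover have "inner (pr U) (pr U) = 1" using U(1) by (simp add: S1_def power2_norm_eq_inner[symmetric])
    moreover have "inner (pr U) (pr U - g i) <= 1 * norm (pr U - g i)"
      using norm_cauchy_schwarz[of "pr U" "pr U - g i"] U(1) by (simp add: S1_def)
    ultimately have "inner (pr U) (g i) > 0" using i(2) by (simp add: dist_norm norm_minus_commute)
    then show ?thesis using i(1) by force
  qed
  then show ?thesis by (rule that)
qed

text \<open>Linear coordinates with respect to n + 1 vectors with orthonormal images, followed by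
  renormalisation: an odd copy of the n-sphere on the constraint set.\<close>

lemma octahedron_embedding:
  obtains h :: "(nat => real) => 'w" and R :: real where
    "continuous_on (octahedron n) h" "!!x. x \<in> octahedron n ==> h x \<in> S1 & norm (h x) <= R"
    "!!x. x \<in> octahedron n ==> h (- x) = - h x"
proof -
  obtain e where e: "!!i. i <= n ==> e i \<in> S"
    "!!i j. i <= n ==> j <= n ==> inner (pr (e i)) (pr (e j)) = (if i = j then 1 else 0)"
    using orthonormal[of n] by blast
  define Y where "Y x = (\<Sum>i\<le>n. x i *\<^sub>R e i)" for x :: "nat => real"
  have YS: "Y x \<in> S" for x unfolding Y_def using subspace e(1) by (intro subspace_sum subspace_scale) auto
  have nY: "(norm (pr (Y x)))\<^sup>2 = (\<Sum>i\<le>n. (x i)\<^sup>2)" for x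
  proof -
    have "(norm (pr (Y x)))\<^sup>2 = (\<Sum>i\<le>n. \<Sum>j\<le>n. x i * (x j * inner (pr (e j)) (pr (e i))))"
      by (simp add: Y_def power2_norm_eq_inner pr.sum pr.scaleR inner_sum_left inner_sum_right sum_distrib_left mult_ac)
    also have "... = (\<Sum>i\<le>n. \<Sum>j\<le>n. if i = j then (x i)\<^sup>2 else 0)"
      by (intro sum.cong refl) (auto simp: e power2_eq_square)
    finally show ?thesis by simp
  qed
  have Ynz: "pr (Y x) ~= 0" if x: "x \<in> octahedron n" for x
  proof
    assume "pr (Y x) = 0"
    then have "(\<Sum>i\<le>n. (x i)\<^sup>2) = 0" using nY[of x] by simp
    then have "\<forall>i\<le>n. x i = 0" by (simp add: sum_nonneg_eq_0_iff)
    then have "(\<Sum>i\<le>n. \<bar>x i\<bar>) = 0" by simp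
    then show False using x by (simp add: octahedron_def)
  qed
  show ?thesis
  proof (rule that[of "%x. N (Y x)" "\<Sum>i\<le>n. norm (e i)"])
    have "continuous_on (octahedron n) (%x. x i)" for i
      by (rule continuous_on_subset[OF continuous_on_product_coordinates subset_UNIV])
    then have cY: "continuous_on (octahedron n) Y" unfolding Y_def by (intro continuous_intros)
    have "continuous_on (octahedron n) (%x. pr (Y x))" by (rule pr.continuous_on[OF cY])
    then show "continuous_on (octahedron n) (%x. N (Y x))"
      unfolding N_def by (intro continuous_intros cY) (use Ynz in auto)
  next
    fix x assume x: "x \<in> octahedron n"
    have "norm (N (Y x)) = norm (Y x) / norm (pr (Y x))" by (simp add: N_def)
    also have "... <= (\<Sum>i\<le>n. \<bar>x i\<bar> * norm (e i)) / norm (pr (Y x))"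
      unfolding Y_def by (intro divide_right_mono order_trans[OF norm_sum]) simp_all
    also have "... = (\<Sum>i\<le>n. \<bar>x i\<bar> / norm (pr (Y x)) * norm (e i))" by (simp add: sum_divide_distrib)
    also have "... <= (\<Sum>i\<le>n. 1 * norm (e i))"
    proof (intro sum_mono mult_right_mono)
      fix i assume i: "i \<in> {..n}"
      have "(x i)\<^sup>2 <= (norm (pr (Y x)))\<^sup>2" unfolding nY by (rule member_le_sum[OF i]) auto
      then have "\<bar>x i\<bar> <= norm (pr (Y x))" using abs_le_square_iff[of "x i" "norm (pr (Y x))"] by simp
      then show "\<bar>x i\<bar> / norm (pr (Y x)) <= 1" using Ynz[OF x] by simp
    qed simp
    finally show "N (Y x) \<in> S1 & norm (N (Y x)) <= (\<Sum>i\<le>n. norm (e i))" using N_S1[OF YS Ynz[OF x]] by simp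
    have "Y (- x) = - Y x" by (simp add: Y_def sum_negf)
    then show "N (Y (- x)) = - N (Y x)" by (simp add: N_def pr.neg)
  qed
qed

text \<open>Otherwise |T| >= m on all levels between A - 1 and b, and finitely many odd descent
  steps push the embedded octahedron below level A. There n functionals have no common zero, against
  Borsuk-Ulam. The number b bounds J on the octahedron and is thus the same for all m.\<close>

lemma almost_critical:
  "\<exists>b. \<forall>m>0. \<exists>U\<in>S1. A - 1 <= J U & J U <= b & norm (T U) < m"
proof -
  obtain n :: nat and g :: "nat => 'l" where g: "!!U. U \<in> S1 ==> J U <= A ==> \<exists>i<n. inner (pr U) (g i) ~= 0"
    using separating_functionals[of A] by metis
  obtain h R0 where h: "continuous_on (octahedron n) h" "!!x. x \<in> octahedron n ==> h x \<in> S1 & norm (h x) <= R0"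
    "!!x. x \<in> octahedron n ==> h (- x) = - h x" using octahedron_embedding[of n] by metis
  have "\<exists>b. \<forall>x\<in>octahedron n. J (h x) <= b"
  proof -
    obtain C where C: "!!U V. U \<in> S ==> V \<in> S ==> norm U <= \<bar>R0\<bar> ==> norm V <= \<bar>R0\<bar> ==>
       \<bar>Psi V - Psi U - inner (K U) (V - U)\<bar> <= C * (norm (V - U))\<^sup>2" "C >= 0" using taylor[of "\<bar>R0\<bar>"] by blast
    have "J (h x) <= R0\<^sup>2 / 2 + \<bar>Psi 0\<bar> + norm (K 0) * \<bar>R0\<bar> + C * R0\<^sup>2" if x: "x \<in> octahedron n" for x
    proof -
      have hx: "norm (h x) <= \<bar>R0\<bar>" "h x \<in> S" using h(2)[OF x] by (auto simp: S1_def)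
      have s: "(norm (h x))\<^sup>2 <= R0\<^sup>2" using power_mono[OF hx(1) norm_ge_zero, of 2] by simp
      have "\<bar>inner (K 0) (h x)\<bar> <= norm (K 0) * norm (h x)" by (rule Cauchy_Schwarz_ineq2)
      also have "... <= norm (K 0) * \<bar>R0\<bar>" by (intro mult_left_mono hx) simp
      finally have i: "\<bar>inner (K 0) (h x)\<bar> <= norm (K 0) * \<bar>R0\<bar>" .
      have "\<bar>Psi (h x) - Psi 0 - inner (K 0) (h x)\<bar> <= C * (norm (h x))\<^sup>2"
        using C(1)[of 0 "h x"] hx subspace_0[OF subspace] by simp
      moreover have "C * (norm (h x))\<^sup>2 <= C * R0\<^sup>2" by (intro mult_left_mono s C)
      ultimately show ?thesis using s i unfolding J_def by linarith
    qed
    then show ?thesis by blast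
  qed
  then obtain b where b: "!!x. x \<in> octahedron n ==> J (h x) <= b" by blast
  have "\<exists>U\<in>S1. A - 1 <= J U & J U <= b & norm (T U) < m" if m: "m > 0" for m
  proof (rule ccontr)
    assume "\<not> ?thesis"
    then have big: "m <= norm (T U)" if "U \<in> S1" "A - 1 <= J U" "J U <= b" for U using that by (auto simp: not_less)
    obtain R where R: "!!U. U \<in> S ==> norm (pr U) = 1 ==> J U <= b ==> norm U <= R"
      using coercive[of b] unfolding J_def by blast
    obtain D where D: "D >= 0" "!!U t. U \<in> S1 ==> norm U <= R ==> 0 <= t ==> t <= 1 ==>
      J (N (U - t *\<^sub>R T U)) <= J U - t * (norm (T U))\<^sup>2 + t\<^sup>2 * D" using descent[of R] by blast
    \<comment> \<open>Small enough that the quadratic error costs at most half of the first-order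
      gain.\<close>
    define t0 where "t0 = min 1 (m\<^sup>2 / (2 * (D + 1)))"
    have t0: "0 < t0" "t0 <= 1" "t0 * D <= m\<^sup>2 / 2"
    proof -
      show "0 < t0" "t0 <= 1" using m D(1) by (auto simp: t0_def)
      have "t0 * D <= m\<^sup>2 / (2 * (D + 1)) * (D + 1)" using D(1) by (intro mult_mono) (auto simp: t0_def)
      also have "... = m\<^sup>2 / 2" using D(1) by (simp add: field_simps)
      finally show "t0 * D <= m\<^sup>2 / 2" .
    qed
    \<comment> \<open>Full step above level A and none below A - 1, with a continuous transition, so
      that |T| >= m is used only on the levels where it is known.\<close>
    define tau where "tau U = t0 * min 1 (max 0 (J U - (A - 1)))" for U
    define sig where "sig U = N (U - tau U *\<^sub>R T U)" for U
    define Rg where "Rg = {U\<in>S1. J U <= b}"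
    have tau: "0 <= tau U" "tau U <= t0" for U
      using t0(1) by (auto simp: tau_def mult_left_le)
    have dec: "J (sig U) <= J U - tau U * (m\<^sup>2 / 2)" if U: "U \<in> Rg" for U
    proof (cases "J U < A - 1")
      case True
      then have "tau U = 0" by (simp add: tau_def)
      moreover have "N U = U" using U by (simp add: N_def Rg_def S1_def)
      ultimately show ?thesis by (simp add: sig_def)
    next
      case False
      have U1: "U \<in> S1" "norm U <= R" using U R[of U] by (auto simp: Rg_def S1_def)
      have "m\<^sup>2 <= (norm (T U))\<^sup>2" using big[of U] U False m by (intro power_mono) (auto simp: Rg_def)
      then have "tau U * m\<^sup>2 <= tau U * (norm (T U))\<^sup>2" using tau(1) by (rule mult_left_mono)
      moreover have "(tau U)\<^sup>2 * D <= tau U * (m\<^sup>2 / 2)"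
      proof -
        have "tau U * D <= t0 * D" using tau(2) D(1) by (rule mult_right_mono)
        then have "tau U * (tau U * D) <= tau U * (m\<^sup>2 / 2)" using t0(3) tau(1) by (intro mult_left_mono) auto
        then show ?thesis by (simp add: power2_eq_square mult_ac)
      qed
      moreover have "J (sig U) <= J U - tau U * (norm (T U))\<^sup>2 + (tau U)\<^sup>2 * D"
        unfolding sig_def using tau(1)[of U] tau(2)[of U] t0(2) by (intro D(2) U1) auto
      ultimately show ?thesis by (simp add: field_simps)
    qed
    have sigS1: "sig U \<in> S1" if "U \<in> S1" for U
    proof -
      have "pr (U - tau U *\<^sub>R T U) ~= 0" using pr_step_ge[OF that, of "tau U"] by auto
      then show ?thesis unfolding sig_def using that subspace T_in[OF that]
        by (intro N_S1) (auto simp: S1_def intro!: subspace_diff subspace_scale)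
    qed
    have sigRg: "sig U \<in> Rg" if "U \<in> Rg" for U
    proof -
      have "0 <= tau U * (m\<^sup>2 / 2)" using tau(1) by simp
      then show ?thesis using dec[OF that] sigS1[of U] that by (auto simp: Rg_def)
    qed
    have sigodd: "sig (- U) = - sig U" if "U \<in> S1" for U
    proof -
      have "tau (- U) = tau U" using J_minus[OF S1_S[OF that]] by (simp add: tau_def)
      then have "- U - tau (- U) *\<^sub>R T (- U) = - (U - tau U *\<^sub>R T U)" using T_minus[OF S1_S[OF that]] by simp
      then have "sig (- U) = N (- (U - tau U *\<^sub>R T U))" unfolding sig_def by (rule arg_cong)
      also have "... = - sig U" unfolding sig_def N_def pr.neg norm_minus_cancel scaleR_minus_right ..
      finally show ?thesis .
    qed
    have cont: "continuous_on Rg sig"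
    proof -
      have sub: "Rg \<subseteq> S1" "Rg \<subseteq> S" by (auto simp: Rg_def S1_def)
      have c: "continuous_on Rg T" "continuous_on Rg J"
        using continuous_T continuous_J sub continuous_on_subset by blast+
      have cY: "continuous_on Rg (%U. U - tau U *\<^sub>R T U)" unfolding tau_def by (intro continuous_intros c)
      have "\<forall>U\<in>Rg. norm (pr (U - tau U *\<^sub>R T U)) ~= 0"
        using pr_step_ge sub by (metis not_one_le_zero subsetD)
      then show ?thesis unfolding sig_def N_def by (intro continuous_intros cY pr.continuous_on) auto
    qed
    have it: "(sig ^^ k) U \<in> Rg" if "U \<in> Rg" for k U
      using that sigRg by (induction k) auto
    have itc: "continuous_on Rg (sig ^^ k)" for k
    proof (induction k)
      case (Suc k)
      have "continuous_on Rg (sig \<circ> (sig ^^ k))"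
        by (rule continuous_on_compose[OF Suc]) (use it in \<open>auto intro: continuous_on_subset[OF cont]\<close>)
      then show ?case by simp
    qed (simp add: id_def)
    have ito: "(sig ^^ k) (- U) = - (sig ^^ k) U" if U: "U \<in> Rg" for k U
    proof (induction k)
      case (Suc k)
      have "(sig ^^ k) U \<in> S1" using it[OF U, of k] by (simp add: Rg_def)
      then show ?case using Suc sigodd by simp
    qed simp
    define delta where "delta = t0 * (m\<^sup>2 / 2)"
    have delta: "delta > 0" using t0(1) m by (simp add: delta_def)
    have itJ: "J ((sig ^^ k) U) <= max A (b - real k * delta)" if U: "U \<in> Rg" for k U
    proof (induction k)
      case 0
      then show ?case using U by (auto simp: Rg_def max_def)
    next
      case (Suc k)
      let ?V = "(sig ^^ k) U"
      have V: "?V \<in> Rg" by (rule it[OF U])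
      show ?case
      proof (cases "J ?V <= A")
        case True
        then have "J (sig ?V) <= A" using dec[OF V] mult_nonneg_nonneg[OF tau(1)[of ?V], of "m\<^sup>2 / 2"] by simp
        then show ?thesis by simp
      next
        case False
        then have "tau ?V = t0" by (simp add: tau_def)
        then have "J (sig ?V) <= J ?V - delta" using dec[OF V] by (simp add: delta_def)
        then show ?thesis using Suc False by (simp add: algebra_simps)
      qed
    qed
    obtain k where "(b - A) / delta < real k" using reals_Archimedean2 by blast
    then have "b - real k * delta <= A" using delta by (simp add: field_simps)
    then have itA: "J ((sig ^^ k) U) <= A" if "U \<in> Rg" for U using itJ[OF that, of k] by simp
    have hR: "h x \<in> Rg" if "x \<in> octahedron n" for x using h(2)[OF that] b[OF that] by (simp add: Rg_def)
    have "\<exists>x\<in>octahedron n. \<forall>i<n. inner (pr ((sig ^^ k) (h x))) (g i) = 0"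
    proof (rule borsuk_ulam)
      fix i
      have "continuous_on (octahedron n) ((sig ^^ k) \<circ> h)"
        by (rule continuous_on_compose[OF h(1)]) (use hR in \<open>auto intro: continuous_on_subset[OF itc]\<close>)
      then show "continuous_on (octahedron n) (%x. inner (pr ((sig ^^ k) (h x))) (g i))"
        by (intro continuous_intros pr.continuous_on) (simp add: o_def)
    qed (simp add: h(3) ito hR pr.neg)
    then obtain x where x: "x \<in> octahedron n" "\<forall>i<n. inner (pr ((sig ^^ k) (h x))) (g i) = 0" by blast
    have "(sig ^^ k) (h x) \<in> S1" using it[OF hR[OF x(1)], of k] by (simp add: Rg_def)
    then show False using g[OF _ itA[OF hR[OF x(1)]]] x(2) by blast
  qed
  then show ?thesis by blast
qed

text \<open>A Palais-Smale argument. Coercivity bounds the almost critical points, compactness makes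
  \<open>pr\<close>, \<open>K\<close>, \<open>E\<close> and the multipliers converge along a
  subsequence, and then the points themselves, equal to T + K + lam E, converge because T tends to
  0.\<close>

theorem critical_point:
  "\<exists>U\<in>S. \<exists>\<omega>. norm (pr U) = 1 & A <= J U & (\<forall>V\<in>S. inner (U - K U) V = \<omega> * inner (pr U) (pr V))"
proof -
  \<comment> \<open>A + 1 compensates for the loss of one level in
    \<open>almost_critical\<close>.\<close>
  obtain b where b: "!!m. m > 0 ==> \<exists>U\<in>S1. (A + 1) - 1 <= J U & J U <= b & norm (T U) < m"
    using almost_critical by blast
  have "\<exists>U\<in>S1. A <= J U & J U <= b & norm (T U) < 1 / (real k + 1)" for k using b[of "1 / (real k + 1)"] by simp
  then obtain X where X: "!!k. X k \<in> S1" "!!k. A <= J (X k)" "!!k. J (X k) <= b" "!!k. norm (T (X k)) < 1 / (real k + 1)"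
    by metis
  obtain R where R: "!!U. U \<in> S ==> norm (pr U) = 1 ==> J U <= b ==> norm U <= R"
    using coercive[of b] unfolding J_def by blast
  have XS: "X k \<in> S" and XR: "norm (X k) <= R" for k using X R by (auto simp: S1_def)
  have R0: "R > 0"
  proof (rule ccontr)
    assume "\<not> R > 0"
    then have "X 0 = 0" using XR[of 0] by (metis le_zero_eq norm_le_zero_iff not_less order_trans)
    then show False using X(1)[of 0] by (simp add: S1_def)
  qed
  obtain G where G: "G >= 0" "!!U. U \<in> S ==> norm U <= R ==> norm (U - K U) <= G" using gradient_bounded[of R] by blast
  \<comment> \<open>From inner (E U) U = 1 follows |E U| >= 1 / R, which keeps the multipliers
    bounded.\<close>
  have lamb: "\<bar>lam (X k)\<bar> <= G * R" for k
  proof -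
    let ?U = "X k"
    have nE: "norm (E ?U) > 0" using E_nz[OF X(1)] by simp
    have "1 <= norm (E ?U) * norm ?U" using norm_cauchy_schwarz[of "E ?U" ?U] E_U[OF X(1)] by simp
    also have "... <= norm (E ?U) * R" by (intro mult_left_mono XR norm_ge_zero)
    finally have "1 / norm (E ?U) <= R" using nE by (simp add: field_simps)
    have "\<bar>lam ?U\<bar> <= norm (?U - K ?U) * norm (E ?U) / (norm (E ?U))\<^sup>2"
      unfolding lam_def abs_divide by (intro divide_mono Cauchy_Schwarz_ineq2) (use nE in auto)
    also have "... = norm (?U - K ?U) * (1 / norm (E ?U))" using nE by (simp add: power2_eq_square field_simps)
    also have "... <= G * R" using G(2)[OF XS XR] G(1) \<open>1 / norm (E ?U) <= R\<close> by (intro mult_mono) auto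
    finally show ?thesis .
  qed
  have sc: "seq_compact (closure (pr ` (S \<inter> cball 0 R)))" using pr_compact compact_imp_seq_compact by blast
  have "pr (X k) \<in> closure (pr ` (S \<inter> cball 0 R))" for k
    using XS XR by (auto intro!: subsetD[OF closure_subset])
  then obtain l r where r: "strict_mono r" "((%k. pr (X k)) \<circ> r) \<longlonglongrightarrow> l"
    using sc[unfolded seq_compact_def, rule_format, of "%k. pr (X k)"] by blast
  obtain r' \<mu> where r': "strict_mono r'" "((%k. lam (X (r k))) \<circ> r') \<longlonglongrightarrow> \<mu>"
    using bounded_imp_convergent_subseq[of "%k. lam (X (r k))" "G * R"] lamb by blast
  define Z where "Z k = X (r (r' k))" for k
  have Z: "Z k \<in> S1" "A <= J (Z k)" "Z k \<in> S" "norm (Z k) <= R" for k using X XS XR by (auto simp: Z_def)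
  have prZ: "(%k. pr (Z k)) \<longlonglongrightarrow> l" using LIMSEQ_subseq_LIMSEQ[OF r(2) r'(1)] by (simp add: o_def Z_def)
  have lamZ: "(%k. lam (Z k)) \<longlonglongrightarrow> \<mu>" using r'(2) by (simp add: o_def Z_def)
  have CprZ: "Cauchy (%k. pr (Z k))" using prZ by (rule LIMSEQ_imp_Cauchy)
  have "Cauchy (%k. K (Z k))"
  proof (rule CauchyI)
    fix e :: real assume "e > 0"
    then obtain d where d: "d > 0" "!!U V. U \<in> S ==> V \<in> S ==> norm U <= R ==> norm V <= R ==>
      norm (pr U - pr V) < d ==> norm (K U - K V) < e" using K_cont[of e R] by blast
    show "\<exists>M. \<forall>m\<ge>M. \<forall>n\<ge>M. norm (K (Z m) - K (Z n)) < e"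
      using CauchyD[OF CprZ d(1)] d(2) Z by meson
  qed
  then obtain \<kappa> where \<kappa>: "(%k. K (Z k)) \<longlonglongrightarrow> \<kappa>" by (auto simp: Cauchy_convergent_iff convergent_def)
  obtain B where B: "B > 0" "!!U V. norm (E U - E V) <= B * norm (pr U - pr V)" using E_lipschitz by blast
  have "Cauchy (%k. E (Z k))"
  proof (rule CauchyI)
    fix e :: real assume e: "e > 0"
    then have "e / B > 0" using B by simp
    from CauchyD[OF CprZ this] obtain M where M: "!!m n. m >= M ==> n >= M ==> norm (pr (Z m) - pr (Z n)) < e / B" by blast
    have "norm (E (Z m) - E (Z n)) < e" if "m >= M" "n >= M" for m n
    proof -
      have "norm (E (Z m) - E (Z n)) <= B * norm (pr (Z m) - pr (Z n))" by (rule B)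
      also have "... < B * (e / B)" using M[OF that] B(1) by (rule mult_strict_left_mono)
      finally show ?thesis using B(1) by simp
    qed
    then show "\<exists>M. \<forall>m\<ge>M. \<forall>n\<ge>M. norm (E (Z m) - E (Z n)) < e" by blast
  qed
  then obtain eps where eps: "(%k. E (Z k)) \<longlonglongrightarrow> eps" by (auto simp: Cauchy_convergent_iff convergent_def)
  have TZ: "(%k. T (Z k)) \<longlonglongrightarrow> 0"
  proof (rule Lim_null_comparison[OF always_eventually])
    show "\<forall>k. norm (T (Z k)) <= 1 / (real (r (r' k)) + 1)" using X(4) by (auto simp: Z_def intro: less_imp_le)
    have "(%k. 1 / (real k + 1)) \<longlonglongrightarrow> 0" by real_asymp
    then have "((%k. 1 / (real k + 1)) \<circ> (r \<circ> r')) \<longlonglongrightarrow> 0"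
      by (rule LIMSEQ_subseq_LIMSEQ) (intro strict_mono_o r r')
    then show "(%k. 1 / (real (r (r' k)) + 1)) \<longlonglongrightarrow> 0" by (simp add: o_def)
  qed
  define U where "U = 0 + \<kappa> + \<mu> *\<^sub>R eps"
  have "(%k. T (Z k) + K (Z k) + lam (Z k) *\<^sub>R E (Z k)) \<longlonglongrightarrow> U"
    unfolding U_def by (intro tendsto_intros TZ \<kappa> eps lamZ)
  then have ZU: "Z \<longlonglongrightarrow> U" by (simp add: T_def)
  have US: "U \<in> S" using closed Z(3) ZU by (metis closed_sequentially)
  have "(%k. norm (pr (Z k))) \<longlonglongrightarrow> norm (pr U)" by (intro tendsto_norm pr.tendsto ZU)
  moreover have "(%k. norm (pr (Z k))) = (%k. 1)" using Z(1) by (auto simp: S1_def)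
  ultimately have prU: "norm (pr U) = 1" using LIMSEQ_unique by (metis tendsto_const)
  then have US1: "U \<in> S1" using US by (simp add: S1_def)
  have "(%k. J (Z k)) \<longlonglongrightarrow> J U"
    by (rule continuous_on_tendsto_compose[OF continuous_J ZU US]) (use Z in auto)
  then have JU: "A <= J U" by (rule LIMSEQ_le_const) (use Z in auto)
  have "(%k. T (Z k)) \<longlonglongrightarrow> T U"
    by (rule continuous_on_tendsto_compose[OF continuous_T ZU US1]) (use Z in auto)
  then have "T U = 0" using TZ LIMSEQ_unique by blast
  then have eq: "U - K U = lam U *\<^sub>R E U" by (simp add: T_def)
  show ?thesis
    using US prU JU by (intro bexI[of _ U] exI[of _ "lam U"]) (auto simp: eq E_inner)
qed

end

section \<open>Test functions\<close>

lemma test_functions_iff: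
  "eta \<in> test_functions \<Omega> \<longleftrightarrow> smooth_fun eta & (\<exists>K. compact K & K \<subseteq> \<Omega> & (\<forall>x. x \<notin> K --> eta x = 0))"
proof
  assume "eta \<in> test_functions \<Omega>"
  then show "smooth_fun eta & (\<exists>K. compact K & K \<subseteq> \<Omega> & (\<forall>x. x \<notin> K --> eta x = 0))"
    using closure_subset[of "{x. eta x ~= 0}"] unfolding test_functions_def
    by (auto intro!: exI[of _ "closure {x. eta x ~= 0}"])
next
  assume "smooth_fun eta & (\<exists>K. compact K & K \<subseteq> \<Omega> & (\<forall>x. x \<notin> K --> eta x = 0))"
  then obtain K where K: "smooth_fun eta" "compact K" "K \<subseteq> \<Omega>" "\<forall>x. x \<notin> K --> eta x = 0" by blast
  have cl: "closure {x. eta x ~= 0} \<subseteq> K"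
    by (rule closure_minimal) (use K compact_imp_closed in auto)
  then have "closure {x. eta x ~= 0} = K \<inter> closure {x. eta x ~= 0}" by blast
  then have "compact (closure {x. eta x ~= 0})" using compact_Int_closed[OF K(2) closed_closure] by metis
  then show "eta \<in> test_functions \<Omega>" using K cl by (auto simp: test_functions_def)
qed

lemma test_functionsI:
  "smooth_fun eta ==> compact K ==> K \<subseteq> \<Omega> ==> (!!x. x \<notin> K ==> eta x = 0) ==> eta \<in> test_functions \<Omega>"
  by (auto simp: test_functions_iff)

lemma test_functionsE:
  assumes "eta \<in> test_functions \<Omega>"
  obtains K where "smooth_fun eta" "compact K" "K \<subseteq> \<Omega>" "!!x. x \<notin> K ==> eta x = 0"
  using assms by (auto simp: test_functions_iff)

lemma test_smooth: "eta \<in> test_functions \<Omega> ==> smooth_fun eta"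
  by (simp add: test_functions_def)

lemma test_mono: "\<Omega> \<subseteq> \<Omega>' ==> eta \<in> test_functions \<Omega> ==> eta \<in> test_functions \<Omega>'"
  by (auto simp: test_functions_def)

lemma test_zero: "(%x. 0) \<in> test_functions \<Omega>"
  by (rule test_functionsI[of _ "{}"]) auto

lemma test_mult: "smooth_fun a ==> eta \<in> test_functions \<Omega> ==> (%x. a x * eta x) \<in> test_functions \<Omega>"
  by (elim test_functionsE, rule test_functionsI) (auto intro: smooth_fun_mult)

lemma test_add: "eta \<in> test_functions \<Omega> ==> zeta \<in> test_functions \<Omega> ==> (%x. eta x + zeta x) \<in> test_functions \<Omega>"
proof (elim test_functionsE)
  fix K L assume "smooth_fun eta" "smooth_fun zeta" "compact K" "compact L" "K \<subseteq> \<Omega>" "L \<subseteq> \<Omega>"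
    "!!x. x \<notin> K ==> eta x = 0" "!!x. x \<notin> L ==> zeta x = 0"
  then show ?thesis by (intro test_functionsI[of _ "K \<union> L"]) (auto intro: smooth_fun_add)
qed

lemma partial_deriv_off:
  assumes "closed K" "!!x. x \<notin> K ==> eta x = 0" "x \<notin> K"
  shows "partial_deriv i eta x = 0"
  using partial_deriv_local[of "- K" x eta "%_. 0" i] assms by (simp add: open_Compl)

lemma test_partial: "eta \<in> test_functions \<Omega> ==> partial_deriv i eta \<in> test_functions \<Omega>"
proof (elim test_functionsE)
  fix K assume "smooth_fun eta" "compact K" "K \<subseteq> \<Omega>" "!!x. x \<notin> K ==> eta x = 0"
  then show ?thesis
    by (intro test_functionsI[of _ K] smooth_fun_partial partial_deriv_off) (auto intro: compact_imp_closed)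
qed

lemma test_cmult: "eta \<in> test_functions \<Omega> ==> (%x. c * eta x) \<in> test_functions \<Omega>"
  by (rule test_mult) simp

lemma test_sum: "(!!i. i \<in> I ==> f i \<in> test_functions \<Omega>) ==> (%x. \<Sum>i\<in>I. f i x) \<in> test_functions \<Omega>"
  by (induction I rule: infinite_finite_induct) (auto intro: test_add test_zero)

lemma cc_integrable:
  fixes f :: "'a::euclidean_space => real"
  assumes "continuous_on UNIV f" "compact K" "!!x. x \<notin> K ==> f x = 0"
  shows "integrable lborel f" "f \<in> borel_measurable borel" "integrable lebesgue f" "f \<in> borel_measurable lebesgue"
proof -
  have "f = (%x. indicator K x *\<^sub>R f x)" using assms(3) by (auto simp: indicator_def fun_eq_iff)
  then show 1: "integrable lborel f"
    using borel_integrable_compact[OF assms(2), of f] assms(1) continuous_on_subset by (metis subset_UNIV)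
  show 2: "f \<in> borel_measurable borel" by (rule borel_measurable_continuous_onI[OF assms(1)])
  show "integrable lebesgue f" using 1 2 by (simp add: integrable_completion)
  show "f \<in> borel_measurable lebesgue" using 2 by (simp add: measurable_completion)
qed

lemma cc_sqint:
  fixes f :: "'a::euclidean_space => real"
  assumes "continuous_on UNIV f" "compact K" "!!x. x \<notin> K ==> f x = 0"
  shows "sqint f"
  unfolding sqint_def
  by (intro conjI cc_integrable(4)[OF assms] cc_integrable(3)[of _ K])
    (use assms in \<open>auto intro!: continuous_intros\<close>)

lemma cc_bounded:
  fixes f :: "'a::euclidean_space => real"
  assumes "continuous_on UNIV f" "compact K" "!!x. x \<notin> K ==> f x = 0"
  obtains B where "B >= 0" "!!x. \<bar>f x\<bar> <= B"
proof -
  have "bounded (f ` K)"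
    using assms by (intro compact_imp_bounded compact_continuous_image continuous_on_subset[OF assms(1)]) auto
  then obtain B where "!!x. x \<in> K ==> \<bar>f x\<bar> <= B" unfolding bounded_iff by auto
  then have "\<bar>f x\<bar> <= \<bar>B\<bar>" for x using assms(3)[of x] by (cases "x \<in> K") force+
  then show ?thesis using that[of "\<bar>B\<bar>"] by auto
qed

lemma test_sqint [simp]: "eta \<in> test_functions \<Omega> ==> sqint eta"
  by (elim test_functionsE) (rule cc_sqint[OF smooth_fun_continuous])

lemma test_integrable:
  assumes "eta \<in> test_functions \<Omega>"
  shows "integrable lborel eta" "integrable lebesgue eta" "eta \<in> borel_measurable borel" "eta \<in> borel_measurable lebesgue"
  using assms by (auto elim!: test_functionsE intro: cc_integrable smooth_fun_continuous)

section \<open>Translation invariance and integration by parts\<close>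

lemma lborel_integral_translation:
  fixes f :: "'a::euclidean_space => real"
  assumes "f \<in> borel_measurable borel"
  shows "(LINT x|lborel. f (h + x)) = (LINT x|lborel. f x)"
    and "integrable lborel (%x. f (h + x)) \<longleftrightarrow> integrable lborel f"
proof -
  have "(LINT x|distr lborel borel ((+) h). f x) = (LINT x|lborel. f (h + x))"
    by (rule integral_distr) (use assms in auto)
  then show "(LINT x|lborel. f (h + x)) = (LINT x|lborel. f x)" by (simp add: lborel_distr_plus)
  have "integrable (distr lborel borel ((+) h)) f \<longleftrightarrow> integrable lborel (%x. f (h + x))"
    by (rule integrable_distr_eq) (use assms in auto)
  then show "integrable lborel (%x. f (h + x)) \<longleftrightarrow> integrable lborel f" by (simp add: lborel_distr_plus)
qed

lemma nn_integral_translation: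
  fixes f :: "'a::euclidean_space => ennreal"
  assumes "f \<in> borel_measurable borel"
  shows "(\<integral>\<^sup>+x. f (h + x) \<partial>lborel) = (\<integral>\<^sup>+x. f x \<partial>lborel)"
proof -
  have "(\<integral>\<^sup>+x. f x \<partial>distr lborel borel ((+) h)) = (\<integral>\<^sup>+x. f (h + x) \<partial>lborel)"
    by (rule nn_integral_distr) (use assms in auto)
  then show ?thesis by (simp add: lborel_distr_plus)
qed

lemma has_real_derivative_line:
  fixes g :: "real^'n::finite => real"
  assumes "smooth_fun g"
  shows "((%t. g (y + t *\<^sub>R h)) has_real_derivative (\<Sum>i\<in>UNIV. h $ i * partial_deriv i g (y + t *\<^sub>R h))) (at t)"
proof -
  have "((%t. g (y + t *\<^sub>R h)) has_derivative
     (%s. \<Sum>i\<in>UNIV. (s *\<^sub>R h) $ i * partial_deriv i g (y + t *\<^sub>R h))) (at t)"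
    by (rule has_derivative_compose[OF _ smooth_fun_has_derivative[OF assms]])
      (auto intro!: derivative_eq_intros)
  moreover have "(%s. \<Sum>i\<in>UNIV. (s *\<^sub>R h) $ i * partial_deriv i g (y + t *\<^sub>R h))
      = (*) (\<Sum>i\<in>UNIV. h $ i * partial_deriv i g (y + t *\<^sub>R h))"
    by (auto simp: sum_distrib_left sum_distrib_right mult_ac)
  ultimately show ?thesis by (simp add: has_field_derivative_def)
qed

lemma sum_axis: "(\<Sum>i\<in>UNIV. (axis k 1 :: real^'n::finite) $ i * f i) = (f k :: real)"
proof -
  have "(\<Sum>i\<in>UNIV. (axis k 1 :: real^'n) $ i * f i) = (\<Sum>i\<in>UNIV. if i = k then f k else 0)"
    by (rule sum.cong) (auto simp: axis_def)
  then show ?thesis by simp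
qed

lemma test_difference_bound:
  fixes eta :: "real^'n::finite => real"
  assumes s: "smooth_fun eta" and B: "!!x i. \<bar>partial_deriv i eta x\<bar> <= B"
  shows "\<bar>eta (x + h) - eta x\<bar> <= real CARD('n) * B * norm h"
proof -
  have "\<exists>t>0. t < 1 & eta (x + 1 *\<^sub>R h) - eta (x + 0 *\<^sub>R h) = (1 - 0) * (\<Sum>i\<in>UNIV. h $ i * partial_deriv i eta (x + t *\<^sub>R h))"
    by (rule MVT2) (auto intro!: has_real_derivative_line s)
  then obtain t where "eta (x + h) - eta x = (\<Sum>i\<in>UNIV. h $ i * partial_deriv i eta (x + t *\<^sub>R h))" by auto
  then have "\<bar>eta (x + h) - eta x\<bar> <= (\<Sum>i\<in>UNIV. \<bar>h $ i * partial_deriv i eta (x + t *\<^sub>R h)\<bar>)" by (simp add: sum_abs)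
  also have "... <= (\<Sum>i\<in>(UNIV::'n set). norm h * B)"
    unfolding abs_mult by (intro sum_mono mult_mono B component_le_norm_cart) auto
  finally show ?thesis by (simp add: mult_ac)
qed

lemma test_grad_bound:
  assumes "eta \<in> test_functions \<Omega>"
  obtains B where "B >= 0" "!!x i. \<bar>partial_deriv i eta x\<bar> <= B"
proof -
  have "\<exists>B\<ge>0. \<forall>x. \<bar>partial_deriv i eta x\<bar> <= B" for i
    using test_partial[OF assms, of i] by (elim test_functionsE) (metis cc_bounded smooth_fun_continuous)
  then obtain B where B: "!!i. B i >= 0" "!!i x. \<bar>partial_deriv i eta x\<bar> <= B i" by metis
  have "\<bar>partial_deriv i eta x\<bar> <= (\<Sum>i\<in>UNIV. B i)" for i x
    using member_le_sum[of i UNIV B] B(2)[of i x] B(1) by auto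
  then show ?thesis using that[of "\<Sum>i\<in>UNIV. B i"] B(1) by (simp add: sum_nonneg)
qed

text \<open>Difference quotients have integral zero by translation invariance, and dominated
  convergence passes to the derivative. Shifts have length at most 1, so the majorant lives on a
  ball of radius R + 1.\<close>

lemma integral_partial_deriv_zero:
  fixes eta :: "real^'n::finite => real"
  assumes eta: "eta \<in> test_functions \<Omega>"
  shows "(LINT x|lebesgue. partial_deriv i eta x) = 0"
proof -
  obtain K where K: "smooth_fun eta" "compact K" "!!x. x \<notin> K ==> eta x = 0" using test_functionsE[OF eta] by metis
  obtain B where B: "B >= 0" "!!x i. \<bar>partial_deriv i eta x\<bar> <= B" using test_grad_bound[OF eta] by metis
  obtain R where R: "K \<subseteq> cball 0 R" using compact_imp_bounded[OF K(2)] by (auto simp: bounded_iff subset_iff)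
  let ?e = "axis i 1 :: real^'n"
  define g where "g m x = real (Suc m) * (eta ((1 / real (Suc m)) *\<^sub>R ?e + x) - eta x)" for m x
  note [measurable] = test_integrable(3)[OF eta] test_integrable(3)[OF test_partial[OF eta]]
  have gm: "g m \<in> borel_measurable borel" for m unfolding g_def by measurable
  have gi: "(LINT x|lborel. g m x) = 0" for m
    unfolding g_def using lborel_integral_translation[OF test_integrable(3)[OF eta]] test_integrable(1)[OF eta]
    by simp
  have "(%m. LINT x|lborel. g m x) \<longlonglongrightarrow> (LINT x|lborel. partial_deriv i eta x)"
  proof (rule integral_dominated_convergence)
    show "integrable lborel (%x. indicator (cball 0 (R + 1)) x *\<^sub>R (real CARD('n) * B))"
      by (intro borel_integrable_compact) auto
    show "AE x in lborel. (%m. g m x) \<longlonglongrightarrow> partial_deriv i eta x"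
    proof (rule AE_I2)
      fix x
      have "((%t. eta (x + t *\<^sub>R ?e)) has_real_derivative partial_deriv i eta x) (at 0)"
        using has_real_derivative_line[OF K(1), of x ?e 0] by (simp add: sum_axis)
      then have "((%h. (eta (x + h *\<^sub>R ?e) - eta x) / h) \<longlongrightarrow> partial_deriv i eta x) (at 0)" by (simp add: DERIV_def)
      moreover have "filterlim (%m. 1 / real (Suc m)) (at 0) sequentially" by real_asymp
      ultimately have "(%m. (eta (x + (1 / real (Suc m)) *\<^sub>R ?e) - eta x) / (1 / real (Suc m))) \<longlonglongrightarrow> partial_deriv i eta x"
        by (rule filterlim_compose)
      then show "(%m. g m x) \<longlonglongrightarrow> partial_deriv i eta x" by (simp add: g_def mult_ac add.commute)
    qed
    show "AE x in lborel. norm (g m x) <= indicator (cball 0 (R + 1)) x *\<^sub>R (real CARD('n) * B)" for m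
    proof (rule AE_I2)
      fix x
      have b: "\<bar>eta (x + (1 / real (Suc m)) *\<^sub>R ?e) - eta x\<bar> <= real CARD('n) * B * (1 / real (Suc m))"
        using test_difference_bound[OF K(1) B(2), of x "(1 / real (Suc m)) *\<^sub>R ?e"] by (simp add: norm_axis_1)
      have "\<bar>g m x\<bar> = real (Suc m) * \<bar>eta (x + (1 / real (Suc m)) *\<^sub>R ?e) - eta x\<bar>" by (simp add: g_def abs_mult add.commute)
      also have "... <= real (Suc m) * (real CARD('n) * B * (1 / real (Suc m)))" by (intro mult_left_mono b) simp
      finally have 1: "\<bar>g m x\<bar> <= real CARD('n) * B" by simp
      have "g m x = 0" if "x \<notin> cball 0 (R + 1)"
      proof -
        have nx: "norm x > R + 1" using that by simp
        have "norm ((1 / real (Suc m)) *\<^sub>R ?e) <= 1" by (simp add: norm_axis_1)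
        then have "norm ((1 / real (Suc m)) *\<^sub>R ?e + x) > R" using nx norm_diff_ineq[of x "(1 / real (Suc m)) *\<^sub>R ?e"]
          unfolding add.commute[of x] by linarith
        then have "(1 / real (Suc m)) *\<^sub>R ?e + x \<notin> K" "x \<notin> K" using R nx by auto
        then show ?thesis using K(3) by (simp add: g_def)
      qed
      then show "norm (g m x) <= indicator (cball 0 (R + 1)) x *\<^sub>R (real CARD('n) * B)" using 1 by (auto simp: indicator_def)
    qed
  qed (use gm test_integrable(3)[OF test_partial[OF eta]] in auto)
  then have "(LINT x|lborel. partial_deriv i eta x) = 0" by (simp add: gi LIMSEQ_const_iff)
  then show ?thesis using test_integrable(3)[OF test_partial[OF eta, of i]] by (simp add: integral_completion)
qed

lemma inner_parts:
  assumes a: "smooth_fun a" and eta: "eta \<in> test_functions \<Omega>"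
  shows "(LINT x|lebesgue. a x * partial_deriv i eta x) = - (LINT x|lebesgue. partial_deriv i a x * eta x)"
proof -
  have "(%x. a x * eta x) \<in> test_functions \<Omega>" by (rule test_mult[OF a eta])
  then have "(LINT x|lebesgue. partial_deriv i (%x. a x * eta x) x) = 0" by (rule integral_partial_deriv_zero)
  moreover have "partial_deriv i (%x. a x * eta x) x = partial_deriv i a x * eta x + a x * partial_deriv i eta x" for x
    using a test_smooth[OF eta] by (intro partial_deriv_mult smooth_fun_differentiable)
  moreover have "integrable lebesgue (%x. partial_deriv i a x * eta x)" "integrable lebesgue (%x. a x * partial_deriv i eta x)"
    using test_mult[OF smooth_fun_partial[OF a] eta] test_mult[OF a test_partial[OF eta]] test_integrable by blast+
  ultimately show ?thesis by simp
qed

lemma inner_parts_test: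
  assumes eta: "eta \<in> test_functions \<Omega>" and zeta: "zeta \<in> test_functions \<Omega>'"
  shows "inner (mk eta) (mk (partial_deriv i zeta)) = - inner (mk (partial_deriv i eta)) (mk zeta)"
  using inner_parts[OF test_smooth[OF eta] zeta, of i] eta zeta test_partial[OF eta, of i] test_partial[OF zeta, of i]
  by (simp add: inner_mk)

section \<open>Multiplication operators on L2\<close>

definition Mop :: "('a::euclidean_space => real) => 'a l2 => 'a l2"
  where "Mop a u = mk (%x. a x * rep u x)"

definition bmult :: "('a::euclidean_space => real) => bool"
  where "bmult a \<longleftrightarrow> a \<in> borel_measurable lebesgue & (\<exists>B. \<forall>x. \<bar>a x\<bar> <= B)"

lemma sqint_bmult: assumes "bmult a" "sqint f" shows "sqint (%x. a x * f x)"
proof -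
  obtain B where B: "!!x. \<bar>a x\<bar> <= B" using assms by (auto simp: bmult_def)
  have "\<bar>a x * f x\<bar> <= \<bar>B * f x\<bar>" for x
  proof -
    have "\<bar>a x\<bar> * \<bar>f x\<bar> <= \<bar>B\<bar> * \<bar>f x\<bar>" using B[of x] by (intro mult_right_mono) auto
    then show ?thesis by (simp add: abs_mult)
  qed
  moreover have "(%x. a x * f x) \<in> borel_measurable lebesgue"
    using assms sqint_meas[of f] by (auto simp: bmult_def)
  ultimately show ?thesis by (intro sqint_bound[OF sqint_cmult[OF assms(2)]]) auto
qed

lemma rep_Mop: "bmult a ==> AE x in lebesgue. rep (Mop a u) x = a x * rep u x"
  unfolding Mop_def by (rule rep_mk) (simp add: sqint_bmult)

lemma Mop_mk: assumes "bmult a" "sqint f" shows "Mop a (mk f) = mk (%x. a x * f x)"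
  unfolding Mop_def
  by (rule mk_cong_AE) (use assms rep_mk[OF assms(2)] in \<open>auto simp: sqint_bmult elim: eventually_mono\<close>)

lemma inner_Mop: assumes "bmult a" shows "inner (Mop a u) v = inner u (Mop a v)"
  using inner_mk[of "%x. a x * rep u x" "rep v"] inner_mk[of "rep u" "%x. a x * rep v x"] assms
  by (simp add: Mop_def sqint_bmult mult_ac)

lemma Mop_norm:
  assumes "bmult a" "!!x. \<bar>a x\<bar> <= B" shows "norm (Mop a u) <= B * norm u"
proof -
  have B0: "B >= 0" using assms(2) by (meson abs_ge_zero order_trans)
  have "norm (Mop a u) <= norm (mk (%x. B * rep u x))"
    unfolding Mop_def
  proof (rule norm_mk_mono)
    show "(%x. a x * rep u x) \<in> borel_measurable lebesgue" using assms(1) by (auto simp: bmult_def)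
    show "AE x in lebesgue. \<bar>a x * rep u x\<bar> <= \<bar>B * rep u x\<bar>"
      using assms(2) B0 by (auto simp: abs_mult intro!: mult_right_mono)
  qed (simp add: sqint_cmult)
  also have "... = B * norm u" using mk_cmult[of "rep u" B] B0 by (simp flip: mk_cmult)
  finally show ?thesis .
qed

lemma Mop_linear:
  assumes "bmult a" shows "bounded_linear (Mop a)"
proof -
  obtain B where B: "!!x. \<bar>a x\<bar> <= B" using assms by (auto simp: bmult_def)
  show ?thesis
  proof (rule bounded_linear_intro)
    fix u v :: "'a l2" and r :: real
    show "Mop a (u + v) = Mop a u + Mop a v"
      unfolding Mop_def using mk_add[of "%x. a x * rep u x" "%x. a x * rep v x"] assms rep_add[of u v]
      by (auto simp: sqint_bmult sqint_add distrib_left intro!: mk_cong_AE elim!: eventually_mono)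
    show "Mop a (r *\<^sub>R u) = r *\<^sub>R Mop a u"
      unfolding Mop_def using mk_cmult[of "%x. a x * rep u x" r] assms rep_scaleR[of r u]
      by (auto simp: sqint_bmult sqint_cmult intro!: mk_cong_AE elim!: eventually_mono)
    show "norm (Mop a u) <= norm u * B" using Mop_norm[OF assms B] by (simp add: mult.commute)
  qed
qed

lemma bmult_cc:
  fixes f :: "'a::euclidean_space => real"
  assumes "continuous_on UNIV f" "compact K" "!!x. x \<notin> K ==> f x = 0"
  shows "bmult f"
  using cc_integrable(4)[OF assms] cc_bounded[OF assms] unfolding bmult_def by metis

lemma bmult_test: "eta \<in> test_functions \<Omega> ==> bmult eta"
  by (elim test_functionsE) (rule bmult_cc[OF smooth_fun_continuous])

lemma bmult_mult: assumes "bmult a" "bmult b" shows "bmult (%x. a x * b x)"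
proof -
  obtain A B where AB: "!!x. \<bar>a x\<bar> <= A" "!!x. \<bar>b x\<bar> <= B" using assms by (auto simp: bmult_def)
  have "\<bar>a x * b x\<bar> <= \<bar>A\<bar> * \<bar>B\<bar>" for x
    unfolding abs_mult using AB[of x] by (intro mult_mono) auto
  then show ?thesis using assms by (auto simp: bmult_def)
qed

lemma bmult_indicator [simp]: "A \<in> sets lebesgue ==> bmult (indicator A)"
  by (auto simp: bmult_def intro!: exI[of _ 1] simp: indicator_def)

lemma Mop_Mop: assumes "bmult a" "bmult b" shows "Mop a (Mop b u) = Mop (%x. a x * b x) u"
proof -
  have "Mop a (mk (%x. b x * rep u x)) = mk (%x. a x * (b x * rep u x))"
    by (rule Mop_mk) (use assms in \<open>auto simp: sqint_bmult\<close>)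
  then show ?thesis by (simp add: Mop_def mult_ac)
qed

text \<open>A Borel representative: translations, reflections and Fubini are applied over
  \<open>lborel\<close>, where Borel measurability is the right notion.\<close>

definition brep :: "'a::euclidean_space l2 => 'a => real"
  where "brep u = (SOME g. g \<in> borel_measurable borel & (AE x in lborel. rep u x = g x))"

lemma brep: shows brep_meas [measurable]: "brep u \<in> borel_measurable borel"
  and brep_AE: "AE x in lborel. rep u x = brep u x"
proof -
  have "\<exists>g. g \<in> borel_measurable borel & (AE x in lborel. rep u x = g x)"
    using completion_ex_borel_measurable_real[OF rep_meas[of u]] by auto
  from someI_ex[OF this] show "brep u \<in> borel_measurable borel" "AE x in lborel. rep u x = brep u x"
    unfolding brep_def by auto
qed

lemma brep_AE': "AE x in lebesgue. rep u x = brep u x"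
  using brep_AE by (rule AE_completion)

lemma brep_meas' [measurable, simp]: "brep u \<in> borel_measurable lebesgue"
  by (simp add: measurable_completion brep_meas)

lemma sqint_brep [simp]: "sqint (brep u)"
  by (rule sqint_bound[OF sqint_rep[of u]]) (use brep_AE'[of u] in \<open>auto elim!: eventually_mono\<close>)

lemma mk_brep [simp]: "mk (brep u) = u"
  using mk_cong_AE[OF sqint_rep sqint_brep brep_AE', symmetric] by simp

lemma inner_brep_mk: "sqint f ==> inner u (mk f) = (LINT x|lebesgue. brep u x * f x)"
  using inner_mk[of "brep u" f] by simp

text \<open>The positive and negative parts of k are densities of two finite measures that agree on
  boxes. Boxes are stable under intersection and generate the Borel sets, so the measures and hence
  the densities coincide.\<close>

lemma zero_integrals_boxes:
  fixes k :: "'a::euclidean_space => real"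
  assumes k: "integrable lborel k" and z: "!!a b. (LINT x|lborel. indicator (box a b) x * k x) = 0"
  shows "AE x in lborel. k x = 0"
proof -
  have km [measurable]: "k \<in> borel_measurable borel" using k by auto
  define M where "M = density lborel (%x. ennreal (k x))"
  define N where "N = density lborel (%x. ennreal (- k x))"
  have fin: "(\<integral>\<^sup>+x. ennreal (k x) \<partial>lborel) < \<infinity>" "(\<integral>\<^sup>+x. ennreal (- k x) \<partial>lborel) < \<infinity>"
    using k by (auto simp: real_integrable_def less_top)
  have "M = N"
  proof (rule measure_eqI_generator_eq)
    let ?E = "range (%(a, b). box a b::'a set)"
    show "Int_stable ?E" by (auto simp: Int_stable_def box_Int_box)
    show "?E \<subseteq> Pow UNIV" "sets M = sigma_sets UNIV ?E" "sets N = sigma_sets UNIV ?E"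
      by (simp_all add: borel_eq_box M_def N_def)
    let ?A = "%n::nat. box (- (real n *\<^sub>R One)) (real n *\<^sub>R One) :: 'a set"
    show "range ?A \<subseteq> ?E" "(\<Union>i. ?A i) = UNIV" unfolding UN_box_eq_UNIV by auto
    show "emeasure M (?A n) ~= \<infinity>" for n
    proof -
      have "emeasure M (?A n) <= emeasure M UNIV" by (rule emeasure_mono) (auto simp: M_def)
      also have "... < \<infinity>" using fin by (simp add: M_def emeasure_density)
      finally show ?thesis by simp
    qed
    fix X assume "X \<in> ?E"
    then obtain a b where X: "X = box a b" by auto
    let ?f = "%x. indicator (box a b) x * k x"
    have i: "integrable lborel ?f" using integrable_mult_indicator[OF _ k, of "box a b"] by (simp add: mult.commute)
    have e1: "emeasure M X = (\<integral>\<^sup>+x. ennreal (?f x) \<partial>lborel)"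
      unfolding M_def X by (subst emeasure_density) (auto intro!: nn_integral_cong simp: indicator_def)
    have e2: "emeasure N X = (\<integral>\<^sup>+x. ennreal (- ?f x) \<partial>lborel)"
      unfolding N_def X by (subst emeasure_density) (auto intro!: nn_integral_cong simp: indicator_def)
    have f: "(\<integral>\<^sup>+x. ennreal (?f x) \<partial>lborel) < top_class.top" "(\<integral>\<^sup>+x. ennreal (- ?f x) \<partial>lborel) < top_class.top"
      using i by (auto simp: real_integrable_def less_top)
    have "enn2real (\<integral>\<^sup>+x. ennreal (?f x) \<partial>lborel) = enn2real (\<integral>\<^sup>+x. ennreal (- ?f x) \<partial>lborel)"
      using z[of a b] real_lebesgue_integral_def[OF i] by simp
    then show "emeasure M X = emeasure N X" unfolding e1 e2 using f
      by (metis ennreal_enn2real)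
  qed
  then have "AE x in lborel. ennreal (k x) = ennreal (- k x)"
    unfolding M_def N_def by (intro sigma_finite_measure.density_unique[OF sigma_finite_lborel]) auto
  then show ?thesis
  proof eventually_elim
    case (elim x)
    then show ?case by (cases "k x >= 0") (auto simp: ennreal_neg ennreal_eq_0_iff dest: sym)
  qed
qed

text \<open>A product of one-dimensional bumps with arguments scaled by m + 1: since
  \<open>bmp\<close> tends to 1 at infinity, these smooth functions converge pointwise to the
  indicator of the box.\<close>

definition box_bump :: "real^'n::finite => real^'n => nat => real^'n => real"
  where "box_bump a b m x =
    (\<Prod>i\<in>UNIV. bmp (real (Suc m) * (x $ i - a $ i)) * bmp (real (Suc m) * (b $ i - x $ i)))"

lemma box_bump:
  fixes a b x :: "real^'n::finite"
  shows "smooth_fun (box_bump a b m)" "0 <= box_bump a b m x" "box_bump a b m x <= 1" "x \<notin> box a b ==> box_bump a b m x = 0"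
    "(%m. box_bump a b m x) \<longlonglongrightarrow> indicator (box a b) x"
proof -
  show "smooth_fun (box_bump a b m)"
    unfolding box_bump_def[abs_def] by (intro smooth_fun_prod smooth_fun_mult smooth_fun_bmp smooth_fun_diff smooth_fun_coord smooth_fun_const)
  show "0 <= box_bump a b m x" unfolding box_bump_def[abs_def] by (intro prod_nonneg mult_nonneg_nonneg ballI bmp_nonneg)
  show "box_bump a b m x <= 1" unfolding box_bump_def[abs_def] by (intro prod_le_1 conjI mult_nonneg_nonneg mult_le_one bmp_nonneg bmp_le1)
  show z: "box_bump a b m x = 0" if x: "x \<notin> box a b" for m
  proof -
    obtain i where i: "x $ i <= a $ i \<or> b $ i <= x $ i" using x by (auto simp: mem_box_cart not_less)
    then have "bmp (real (Suc m) * (x $ i - a $ i)) * bmp (real (Suc m) * (b $ i - x $ i)) = 0"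
      by (auto simp: bmp_eq_0_iff mult_le_0_iff)
    then show ?thesis unfolding box_bump_def[abs_def] by (intro prod_zero) auto
  qed
  show "(%m. box_bump a b m x) \<longlonglongrightarrow> indicator (box a b) x"
  proof (cases "x \<in> box a b")
    case False
    then show ?thesis by (simp add: z)
  next
    case True
    have 1: "(%m. bmp (real (Suc m) * t)) \<longlonglongrightarrow> 1" if "t > 0" for t
    proof -
      have "(%m. exp (- (1 / (real (Suc m) * t)))) \<longlonglongrightarrow> 1" using that by real_asymp
      moreover have "bmp (real (Suc m) * t) = exp (- (1 / (real (Suc m) * t)))" for m
        using that by (simp add: bmp_def mult_le_0_iff)
      ultimately show ?thesis by simp
    qed
    have "(%m. box_bump a b m x) \<longlonglongrightarrow> (\<Prod>i\<in>(UNIV::'n set). 1 * 1)"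
      unfolding box_bump_def[abs_def] by (intro tendsto_prod tendsto_mult 1) (use True in \<open>auto simp: mem_box_cart\<close>)
    then show ?thesis using True by simp
  qed
qed

lemma sqint_indicator_box: "sqint (indicator (box a b) :: 'a::euclidean_space => real)"
proof -
  have "integrable lebesgue (indicator (box a b) :: 'a => real)"
    by (subst integrable_completion) (auto intro!: integrable_real_indicator simp: emeasure_lborel_box_eq)
  then show ?thesis by (simp add: sqint_def power2_eq_square indicator_inter_arith[symmetric])
qed

lemma box_in_test_closure:
  fixes a b :: "real^'n::finite"
  assumes ab: "cbox a b \<subseteq> \<Omega>" and g: "!!eta. eta \<in> test_functions \<Omega> ==> inner g (mk eta) = 0"
  shows "inner g (mk (indicator (box a b))) = 0"
proof -
  define theta where "theta = box_bump a b"
  note theta = box_bump[where a = a and b = b, folded theta_def]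
  have bb: "x \<in> cbox a b" if "x \<in> box a b" for x using that box_subset_cbox by blast
  have t: "theta m \<in> test_functions \<Omega>" for m
    by (rule test_functionsI[OF theta(1) compact_cbox ab]) (use bb theta(4) in blast)
  have "(%m. mk (theta m)) \<longlonglongrightarrow> mk (indicator (box a b))"
  proof (rule l2_tendsto_dominated(2)[OF _ _ sqint_indicator_box[of a b]])
    show "AE x in lebesgue. \<bar>theta m x\<bar> <= indicator (box a b) x" for m
    proof (rule AE_I2)
      fix x
      show "\<bar>theta m x\<bar> <= indicator (box a b) x"
        using theta(2,3,4)[where m = m and x = x] by (cases "x \<in> box a b") auto
    qed
    show "theta m \<in> borel_measurable lebesgue" for m by (rule test_integrable(4)[OF t])
    show "indicat_real (box a b) \<in> borel_measurable lebesgue" by (rule sqint_meas[OF sqint_indicator_box])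
    show "AE x in lebesgue. (%m. theta m x) \<longlonglongrightarrow> indicat_real (box a b) x" by (rule AE_I2) (rule theta(5))
  qed
  then have "(%m. inner g (mk (theta m))) \<longlonglongrightarrow> inner g (mk (indicator (box a b)))" by (intro tendsto_intros)
  then show ?thesis by (simp add: g[OF t] LIMSEQ_const_iff)
qed

text \<open>Orthogonality to test functions passes to indicators of boxes with closed box in
  \<Omega>. The restriction of g to one such box integrates to zero over every box, as intersections
  of boxes are boxes, so it vanishes; countably many of these boxes cover \<Omega>.\<close>

lemma fundamental_lemma:
  fixes g :: "(real^'n::finite) l2"
  assumes \<Omega>: "open \<Omega>" and g: "!!eta. eta \<in> test_functions \<Omega> ==> inner g (mk eta) = 0"
  shows "AE x in lebesgue. x \<in> \<Omega> --> rep g x = 0"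
proof -
  have boxz: "(LINT x|lborel. indicator (box a b) x * brep g x) = 0" if "cbox a b \<subseteq> \<Omega>" for a b
  proof -
    have "(LINT x|lebesgue. brep g x * indicator (box a b) x) = 0"
      using box_in_test_closure[OF that g] by (simp add: inner_brep_mk sqint_indicator_box)
    then show ?thesis by (subst (asm) integral_completion) (auto simp: mult.commute)
  qed
  have loc: "AE x in lborel. x \<in> box c d --> brep g x = 0" if cd: "cbox c d \<subseteq> \<Omega>" for c d
  proof -
    define k where "k x = indicator (box c d) x * brep g x" for x
    have "integrable lebesgue (%x. indicator (box c d) x * brep g x)"
      by (rule sqint_mult[OF sqint_indicator_box]) simp
    then have ki: "integrable lborel k" unfolding k_def[abs_def] by (subst (asm) integrable_completion) auto
    have "AE x in lborel. k x = 0"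
    proof (rule zero_integrals_boxes[OF ki])
      fix a b
      let ?a = "\<Sum>i\<in>Basis. max (a\<bullet>i) (c\<bullet>i) *\<^sub>R i" and ?b = "\<Sum>i\<in>Basis. min (b\<bullet>i) (d\<bullet>i) *\<^sub>R i"
      have eq: "indicator (box a b) x * k x = indicator (box ?a ?b) x * brep g x" for x
        unfolding k_def box_Int_box[symmetric] by (auto simp: indicator_def)
      show "(LINT x|lborel. indicator (box a b) x * k x) = 0"
      proof (cases "box ?a ?b = {}")
        case True
        then show ?thesis unfolding eq by simp
      next
        case False
        have "closure (box ?a ?b) \<subseteq> closure (box c d)" unfolding box_Int_box[symmetric] by (intro closure_mono) auto
        then have "cbox ?a ?b \<subseteq> closure (box c d)" using False by (simp add: closure_box)
        also have "... \<subseteq> cbox c d" by (intro closure_minimal box_subset_cbox closed_cbox)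
        finally show ?thesis unfolding eq using cd by (intro boxz) auto
      qed
    qed
    then show ?thesis by eventually_elim (auto simp: k_def indicator_def)
  qed
  define F where "F = {box c d | c d. cbox c d \<subseteq> \<Omega>}"
  obtain F' where F': "F' \<subseteq> F" "countable F'" "\<Union>F' = \<Union>F"
    using Lindelof[of F] by (auto simp: F_def)
  have "\<Omega> \<subseteq> \<Union>F"
  proof
    fix x assume "x \<in> \<Omega>"
    then obtain c d where "cbox c d \<subseteq> \<Omega>" "x \<in> box c d" using open_contains_cbox[OF \<Omega>] by metis
    then show "x \<in> \<Union>F" by (auto simp: F_def)
  qed
  moreover have "AE x in lborel. \<forall>B\<in>F'. x \<in> B --> brep g x = 0"
    using F' loc by (subst AE_ball_countable) (auto simp: F_def)
  ultimately have "AE x in lborel. x \<in> \<Omega> --> brep g x = 0"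
    using F'(3) by (auto elim!: eventually_mono)
  then have "AE x in lebesgue. x \<in> \<Omega> --> brep g x = 0" by (rule AE_completion)
  then show ?thesis using brep_AE'[of g] by eventually_elim simp
qed

section \<open>Density of the test functions\<close>

lemma test_subspace: "subspace (mk ` test_functions \<Omega>)"
  unfolding subspace_def
proof (intro conjI ballI allI)
  show "0 \<in> mk ` test_functions \<Omega>" using test_zero mk_zero by (metis image_eqI)
next
  fix x y assume "x \<in> mk ` test_functions \<Omega>" "y \<in> mk ` test_functions \<Omega>"
  then show "x + y \<in> mk ` test_functions \<Omega>" by (auto simp: mk_add intro!: imageI test_add)
next
  fix c x assume "x \<in> mk ` test_functions \<Omega>"
  then show "c *\<^sub>R x \<in> mk ` test_functions \<Omega>" by (auto simp: mk_cmult intro!: imageI test_cmult)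
qed

lemma subspace_closure:
  fixes A :: "'b::real_normed_vector set"
  assumes "subspace A" shows "subspace (closure A)"
  unfolding subspace_def
proof (intro conjI ballI allI)
  show "0 \<in> closure A" using subspace_0[OF assms] closure_subset by blast
next
  fix x y assume "x \<in> closure A" "y \<in> closure A"
  then obtain X Y where "!!n. X n \<in> A" "X \<longlonglongrightarrow> x" "!!n. Y n \<in> A" "Y \<longlonglongrightarrow> y"
    unfolding closure_sequential by blast
  then show "x + y \<in> closure A"
    unfolding closure_sequential
    by (intro exI[of _ "%n. X n + Y n"] conjI allI subspace_add[OF assms] tendsto_add)
next
  fix c x assume "x \<in> closure A"
  then obtain X where "!!n. X n \<in> A" "X \<longlonglongrightarrow> x" unfolding closure_sequential by blast
  then show "c *\<^sub>R x \<in> closure A"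
    unfolding closure_sequential
    by (intro exI[of _ "%n. c *\<^sub>R X n"] conjI allI subspace_scale[OF assms] tendsto_scaleR tendsto_const)
qed

lemma test_dense: "(u :: (real^'n::finite) l2) \<in> closure (mk ` test_functions UNIV)"
proof (rule dense_if_orthogonal_trivial)
  show "subspace (closure (mk ` test_functions (UNIV :: (real^'n) set)))"
    by (rule subspace_closure[OF test_subspace])
  fix g :: "(real^'n) l2"
  assume "!!y. y \<in> closure (mk ` test_functions UNIV) ==> inner g y = 0"
  then have "inner g (mk eta) = 0" if "eta \<in> test_functions UNIV" for eta using that closure_subset by blast
  then have "AE x in lebesgue. rep g x = 0" using fundamental_lemma[of UNIV g] by simp
  then show "g = 0" using rep_zero by (intro l2_eqI) (auto elim: eventually_elim2)
qed simp

section \<open>Translations and gradients\<close>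

lemma lborel_nn_norm_mk: "f \<in> borel_measurable borel ==> sqint f ==>
    (\<integral>\<^sup>+x. ennreal ((f x)\<^sup>2) \<partial>lborel) = ennreal ((norm (mk f))\<^sup>2)"
  using nn_norm_mk[of f] by (simp add: nn_integral_completion)

lemma sqint_iff_lborel:
  assumes [measurable]: "f \<in> borel_measurable borel"
  shows "sqint f \<longleftrightarrow> (\<integral>\<^sup>+x. ennreal ((f x)\<^sup>2) \<partial>lborel) < \<infinity>"
proof -
  have "integrable lebesgue (%x. (f x)\<^sup>2) \<longleftrightarrow> integrable lborel (%x. (f x)\<^sup>2)"
    by (rule integrable_completion) measurable
  then show ?thesis
    using assms by (simp add: sqint_def measurable_completion integrable_iff_bounded)
qed

lemma norm_mk_le:
  assumes f: "f \<in> borel_measurable borel" and le: "(\<integral>\<^sup>+x. ennreal ((f x)\<^sup>2) \<partial>lborel) <= ennreal (B\<^sup>2)" and B: "B >= 0"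
  shows "sqint f" "norm (mk f) <= B"
proof -
  show s: "sqint f" using le by (simp add: sqint_iff_lborel[OF f] le_less_trans)
  have "(norm (mk f))\<^sup>2 <= B\<^sup>2" using le unfolding lborel_nn_norm_mk[OF f s] by simp
  then show "norm (mk f) <= B" using B by (rule power2_le_imp_le)
qed

definition shf :: "'a::euclidean_space => 'a l2 => 'a l2"
  where "shf h u = mk (%x. brep u (h + x))"

lemma norm_translate:
  assumes f [measurable]: "f \<in> borel_measurable borel" and s: "sqint f"
  shows "sqint (%x. f (h + x))" "norm (mk (%x. f (h + x))) = norm (mk f)"
proof -
  have eq: "(\<integral>\<^sup>+x. ennreal ((f (h + x))\<^sup>2) \<partial>lborel) = (\<integral>\<^sup>+x. ennreal ((f x)\<^sup>2) \<partial>lborel)"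
    by (rule nn_integral_translation) measurable
  show s': "sqint (%x. f (h + x))"
    using s sqint_iff_lborel[of "%x. f (h + x)"] sqint_iff_lborel[OF f] eq by simp
  have "(norm (mk (%x. f (h + x))))\<^sup>2 = (norm (mk f))\<^sup>2"
    using eq lborel_nn_norm_mk[OF f s] lborel_nn_norm_mk[OF _ s'] by simp
  then show "norm (mk (%x. f (h + x))) = norm (mk f)" by simp
qed

lemma shf_mk:
  assumes f [measurable]: "f \<in> borel_measurable borel" and s: "sqint f"
  shows "shf h (mk f) = mk (%x. f (h + x))"
proof -
  let ?g = "%x. brep (mk f) x - f x"
  have sg: "sqint ?g" using s by (intro sqint_diff) auto
  have "norm (shf h (mk f) - mk (%x. f (h + x))) = norm (mk (%x. ?g (h + x)))"
    unfolding shf_def by (subst mk_diff) (auto intro: norm_translate s)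
  also have "... = norm (mk ?g)" by (rule norm_translate(2)[OF _ sg]) measurable
  also have "... = norm (mk (brep (mk f)) - mk f)" using s by (subst mk_diff) auto
  finally show ?thesis by simp
qed

lemma shf_linear: "bounded_linear (shf h)"
proof (rule bounded_linear_intro)
  fix u v :: "'a l2" and r :: real
  have "u + v = mk (%x. brep u x + brep v x)" using mk_add[of "brep u" "brep v"] by simp
  then show "shf h (u + v) = shf h u + shf h v"
    by (simp add: shf_mk sqint_add) (simp add: shf_def mk_add norm_translate)
  have "r *\<^sub>R u = mk (%x. r * brep u x)" using mk_cmult[of "brep u" r] by simp
  then show "shf h (r *\<^sub>R u) = r *\<^sub>R shf h u"
    by (simp add: shf_mk sqint_cmult) (simp add: shf_def mk_cmult norm_translate)
  show "norm (shf h u) <= norm u * 1" unfolding shf_def using norm_translate(2)[of "brep u" h] by simp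
qed

definition grd :: "(real^'n::finite => real) => (real^'n) l2 ^ 'n"
  where "grd eta = (\<chi> i. mk (partial_deriv i eta))"

lemma norm_vec_sq: "(norm (D :: ('b::real_normed_vector)^'n::finite))\<^sup>2 = (\<Sum>i\<in>UNIV. (norm (D $ i))\<^sup>2)"
  unfolding norm_vec_def L2_set_def by (simp add: sum_nonneg)

lemma norm_comp_le: "norm (D $ i) <= norm (D :: ('b::real_normed_vector)^'n::finite)"
  by (rule Finite_Cartesian_Product.norm_nth_le)

lemma nn_norm_grd:
  assumes eta: "eta \<in> test_functions \<Omega>"
  shows "(\<integral>\<^sup>+x. ennreal (\<Sum>i\<in>UNIV. (partial_deriv i eta x)\<^sup>2) \<partial>lborel) = ennreal ((norm (grd eta))\<^sup>2)"
proof -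
  note [measurable] = test_integrable(3)[OF test_partial[OF eta]]
  have "(\<integral>\<^sup>+x. ennreal (\<Sum>i\<in>UNIV. (partial_deriv i eta x)\<^sup>2) \<partial>lborel)
     = (\<Sum>i\<in>UNIV. \<integral>\<^sup>+x. ennreal ((partial_deriv i eta x)\<^sup>2) \<partial>lborel)"
  proof -
    have e: "(\<integral>\<^sup>+x. ennreal (\<Sum>i\<in>UNIV. (partial_deriv i eta x)\<^sup>2) \<partial>lborel)
      = (\<integral>\<^sup>+x. (\<Sum>i\<in>UNIV. ennreal ((partial_deriv i eta x)\<^sup>2)) \<partial>lborel)"
      by (intro nn_integral_cong) (simp add: sum_ennreal)
    show ?thesis unfolding e by (rule nn_integral_sum) measurable
  qed
  also have "... = (\<Sum>i\<in>UNIV. ennreal ((norm (mk (partial_deriv i eta)))\<^sup>2))"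
    by (intro sum.cong refl lborel_nn_norm_mk test_sqint[OF test_partial[OF eta]]) measurable
  also have "... = ennreal ((norm (grd eta))\<^sup>2)" by (simp add: norm_vec_sq grd_def sum_ennreal)
  finally show ?thesis .
qed

text \<open>The difference is the integral of the directional derivative along the segment from x to
  x + h. Cauchy-Schwarz in the segment parameter, Fubini and translation invariance give the bound;
  with nonnegative extended integrals the exchange is free.\<close>

lemma translation_test:
  fixes eta :: "real^'n::finite => real"
  assumes eta: "eta \<in> test_functions \<Omega>"
  shows "norm (shf h (mk eta) - mk eta) <= norm h * norm (grd eta)"
proof -
  have sm: "smooth_fun eta" by (rule test_smooth[OF eta])
  note [measurable] = test_integrable(3)[OF eta] test_integrable(3)[OF test_partial[OF eta]]
  define d where "d x t = (\<Sum>i\<in>UNIV. h $ i * partial_deriv i eta (x + t *\<^sub>R h))" for x t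
  have cd: "continuous_on UNIV (d x)" for x
    unfolding d_def
    by (intro continuous_intros continuous_on_compose2[OF smooth_fun_continuous[OF smooth_fun_partial[OF sm], of UNIV]]) auto
  have dm [measurable]: "(%p. d (fst p) (snd p)) \<in> borel_measurable (lborel \<Otimes>\<^sub>M lborel)" unfolding d_def by measurable
  let ?I = "indicator {0..1} :: real => ennreal"
  have pt: "ennreal ((eta (h + x) - eta x)\<^sup>2) <= (\<integral>\<^sup>+t. ?I t * ennreal ((d x t)\<^sup>2) \<partial>lborel)" for x
  proof -
    have "(LINT t|lborel. d x t * indicator {0..1} t) = eta (x + 1 *\<^sub>R h) - eta (x + 0 *\<^sub>R h)"
      by (rule integral_FTC_Icc_real)
        (use cd[of x] has_real_derivative_line[OF sm, of x h] in \<open>auto simp: d_def continuous_on_eq_continuous_at\<close>)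
    then have e: "eta (h + x) - eta x = (LINT t|lborel. d x t * indicator {0..1} t)" by (simp add: add.commute)
    have "integrable lborel (%t. indicator {0..1} t *\<^sub>R d x t)"
      by (rule borel_integrable_compact) (use cd[of x] in \<open>auto intro: continuous_on_subset\<close>)
    then have "ennreal (norm (eta (h + x) - eta x)) <= (\<integral>\<^sup>+t. ennreal (norm (d x t * indicator {0..1} t)) \<partial>lborel)"
      unfolding e by (intro integral_norm_bound_ennreal) (simp add: mult.commute)
    also have "... = (\<integral>\<^sup>+t. ?I t * ennreal (\<bar>d x t\<bar> * indicator {0..1} t) \<partial>lborel)"
      by (intro nn_integral_cong) (auto simp: indicator_def)
    finally have "(ennreal \<bar>eta (h + x) - eta x\<bar>)\<^sup>2 <= (\<integral>\<^sup>+t. ?I t * ennreal (\<bar>d x t\<bar> * indicator {0..1} t) \<partial>lborel)\<^sup>2"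
      by (intro power_mono) auto
    also have "... <= (\<integral>\<^sup>+t. (?I t)\<^sup>2 \<partial>lborel) * (\<integral>\<^sup>+t. (ennreal (\<bar>d x t\<bar> * indicator {0..1} t))\<^sup>2 \<partial>lborel)"
    proof (rule Cauchy_Schwarz_nn_integral)
      have [measurable]: "d x \<in> borel_measurable borel" by (rule borel_measurable_continuous_onI[OF cd])
      show "(%t. ennreal (\<bar>d x t\<bar> * indicator {0..1} t)) \<in> borel_measurable lborel" by measurable
    qed simp
    also have "(\<integral>\<^sup>+t. (?I t)\<^sup>2 \<partial>lborel) = (\<integral>\<^sup>+t. ?I t \<partial>lborel)" by (intro nn_integral_cong) (auto simp: indicator_def)
    also have "... = 1" by simp
    also have "1 * (\<integral>\<^sup>+t. (ennreal (\<bar>d x t\<bar> * indicator {0..1} t))\<^sup>2 \<partial>lborel) = (\<integral>\<^sup>+t. ?I t * ennreal ((d x t)\<^sup>2) \<partial>lborel)"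
      unfolding mult_1 by (intro nn_integral_cong) (auto simp: indicator_def ennreal_power)
    finally show ?thesis by (simp add: ennreal_power)
  qed
  have "(\<integral>\<^sup>+x. ennreal ((eta (h + x) - eta x)\<^sup>2) \<partial>lborel) <= (\<integral>\<^sup>+x. \<integral>\<^sup>+t. ?I t * ennreal ((d x t)\<^sup>2) \<partial>lborel \<partial>lborel)"
    by (intro nn_integral_mono pt)
  also have "... = (\<integral>\<^sup>+t. \<integral>\<^sup>+x. ?I t * ennreal ((d x t)\<^sup>2) \<partial>lborel \<partial>lborel)"
    by (rule lborel_pair.Fubini'[symmetric, of "%x t. ?I t * ennreal ((d x t)\<^sup>2)"]) (simp add: case_prod_beta')
  also have "... <= (\<integral>\<^sup>+t. ?I t * ennreal ((norm h * norm (grd eta))\<^sup>2) \<partial>lborel)"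
  proof (intro nn_integral_mono)
    fix t
    show "(\<integral>\<^sup>+x. ?I t * ennreal ((d x t)\<^sup>2) \<partial>lborel) <= ?I t * ennreal ((norm h * norm (grd eta))\<^sup>2)"
    proof -
      define k where "k y = ennreal ((\<Sum>i\<in>UNIV. h $ i * partial_deriv i eta y)\<^sup>2)" for y
      have [measurable]: "k \<in> borel_measurable borel" unfolding k_def by measurable
      have "(\<integral>\<^sup>+x. ennreal ((d x t)\<^sup>2) \<partial>lborel) = (\<integral>\<^sup>+x. k (t *\<^sub>R h + x) \<partial>lborel)"
        by (simp add: k_def d_def add.commute)
      also have "... = (\<integral>\<^sup>+x. k x \<partial>lborel)" by (rule nn_integral_translation) measurable
      also have "... <= (\<integral>\<^sup>+x. ennreal ((norm h)\<^sup>2) * ennreal (\<Sum>i\<in>UNIV. (partial_deriv i eta x)\<^sup>2) \<partial>lborel)"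
      proof (intro nn_integral_mono)
        fix x
        have "(inner h (\<chi> i. partial_deriv i eta x))\<^sup>2 <= inner h h * inner (\<chi> i. partial_deriv i eta x) (\<chi> i. partial_deriv i eta x)"
          by (rule Cauchy_Schwarz_ineq)
        then have "(\<Sum>i\<in>UNIV. h $ i * partial_deriv i eta x)\<^sup>2 <= (norm h)\<^sup>2 * (\<Sum>i\<in>UNIV. (partial_deriv i eta x)\<^sup>2)"
          unfolding power2_norm_eq_inner by (simp add: inner_vec_def power2_eq_square)
        then show "k x <= ennreal ((norm h)\<^sup>2) * ennreal (\<Sum>i\<in>UNIV. (partial_deriv i eta x)\<^sup>2)"
          unfolding k_def by (simp add: ennreal_mult'[symmetric] sum_nonneg)
      qed
      also have "... = ennreal ((norm h * norm (grd eta))\<^sup>2)"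
        by (simp add: nn_integral_cmult nn_norm_grd[OF eta] power_mult_distrib ennreal_mult')
      finally have le: "(\<integral>\<^sup>+x. ennreal ((d x t)\<^sup>2) \<partial>lborel) <= ennreal ((norm h * norm (grd eta))\<^sup>2)" .
      have [measurable]: "(%x. d x t) \<in> borel_measurable borel" unfolding d_def by measurable
      show ?thesis by (subst nn_integral_cmult) (use le in \<open>auto intro!: mult_left_mono\<close>)
    qed
  qed
  also have "... = ennreal ((norm h * norm (grd eta))\<^sup>2)" by (simp add: nn_integral_multc)
  finally have le: "(\<integral>\<^sup>+x. ennreal ((eta (h + x) - eta x)\<^sup>2) \<partial>lborel) <= ennreal ((norm h * norm (grd eta))\<^sup>2)" .
  have "norm (mk (%x. eta (h + x) - eta x)) <= norm h * norm (grd eta)" by (rule norm_mk_le(2)[OF _ le]) auto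
  then show ?thesis using eta norm_translate(1)[of eta h]
    by (simp add: shf_mk test_integrable[OF eta] mk_diff)
qed

section \<open>Ladyzhenskaya's inequality\<close>

text \<open>The third coordinate comes first in the triple, so that iterated integrals have the
  planes x3 = c as inner domains.\<close>

definition vec3 :: "real \<times> real \<times> real => real^3"
  where "vec3 p = vector [fst (snd p), snd (snd p), fst p]"

lemma vec3_nth [simp]: "vec3 p $ 1 = fst (snd p)" "vec3 p $ 2 = snd (snd p)" "vec3 p $ 3 = fst p"
  by (simp_all add: vec3_def)

lemma vec3_measurable [measurable]: "vec3 \<in> borel_measurable borel"
proof -
  have "continuous_on UNIV (%p. vec3 p $ i)" for i
    using exhaust_3[of i] by (auto intro!: continuous_on_fst continuous_on_snd continuous_on_id)
  then have "continuous_on UNIV (%p. \<chi> i. vec3 p $ i)" by (rule continuous_on_vec_lambda)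
  then show ?thesis by (intro borel_measurable_continuous_onI) (simp add: vec_lambda_eta)
qed

lemma box_Pair_eq: "box (a, c) (b, d) = box a b \<times> box c d"
  by (force simp: box_def Basis_prod_def)

lemma emeasure_box_Pair:
  "emeasure lborel (box (a, c) (b, d)) = emeasure lborel (box a b) * emeasure lborel (box c d)"
proof -
  have "emeasure (lborel \<Otimes>\<^sub>M lborel) (box a b \<times> box c d) = emeasure lborel (box a b) * emeasure lborel (box c d)"
    by (rule lborel.emeasure_pair_measure_Times) auto
  then show ?thesis by (simp add: lborel_prod box_Pair_eq)
qed

lemma lborel_vec3: "lborel = distr (lborel :: (real \<times> real \<times> real) measure) borel vec3"
proof (rule lborel_eqI)
  fix l u :: "real^3" assume le: "!!b. b \<in> Basis ==> l \<bullet> b <= u \<bullet> b"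
  have le': "l $ i <= u $ i" for i using le[of "axis i 1"] by (simp add: inner_axis axis_in_Basis_iff)
  have eq: "vec3 -` box l u = box (l $ 3, l $ 1, l $ 2) (u $ 3, u $ 1, u $ 2)"
    by (auto simp: mem_box_cart forall_3 box_Pair_eq)
  have B: "(\<Prod>b\<in>(Basis :: (real^3) set). (u - l) \<bullet> b) = (u - l) $ 1 * (u - l) $ 2 * (u - l) $ 3"
  proof -
    have "(\<Prod>b\<in>(Basis :: (real^3) set). (u - l) \<bullet> b) = (\<Prod>i\<in>UNIV. (u - l) $ i)"
      unfolding Basis_vec_def by (simp add: prod.reindex inner_axis inj_on_def axis_eq_axis UNION_singleton_eq_range)
    then show ?thesis unfolding UNIV_3 by (simp add: mult_ac)
  qed
  have "emeasure (distr lborel borel vec3) (box l u) = emeasure lborel (box (l $ 3, l $ 1, l $ 2) (u $ 3, u $ 1, u $ 2))"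
    by (subst emeasure_distr) (simp_all add: eq)
  also have "... = ennreal ((u - l) $ 3) * (ennreal ((u - l) $ 1) * ennreal ((u - l) $ 2))"
    using le' by (simp add: emeasure_box_Pair)
  also have "... = ennreal (\<Prod>b\<in>Basis. (u - l) \<bullet> b)"
    unfolding B using le' by (simp add: ennreal_mult mult_ac)
  finally show "emeasure (distr lborel borel vec3) (box l u) = ennreal (\<Prod>b\<in>Basis. (u - l) \<bullet> b)" .
qed simp

lemma nn_integral_vec3:
  assumes [measurable]: "f \<in> borel_measurable borel"
  shows "(\<integral>\<^sup>+x. f x \<partial>lborel) = (\<integral>\<^sup>+c. \<integral>\<^sup>+p. f (vec3 (c, p)) \<partial>(lborel \<Otimes>\<^sub>M lborel) \<partial>lborel)"
proof -
  have "(\<integral>\<^sup>+x. f x \<partial>lborel) = (\<integral>\<^sup>+p. f (vec3 p) \<partial>lborel)"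
    by (subst lborel_vec3) (simp add: nn_integral_distr)
  also have "... = (\<integral>\<^sup>+p. f (vec3 p) \<partial>((lborel :: real measure) \<Otimes>\<^sub>M (lborel :: (real \<times> real) measure)))"
    by (simp add: lborel_prod)
  also have "... = (\<integral>\<^sup>+c. \<integral>\<^sup>+p. f (vec3 (c, p)) \<partial>lborel \<partial>lborel)"
    by (rule lborel.nn_integral_fst[symmetric]) (simp add: lborel_prod)
  finally show ?thesis by (simp add: lborel_prod)
qed

text \<open>v^2 is the integral of its derivative 2 v v' from a point to the left of the
  support.\<close>

lemma square_le_line_integral:
  fixes v v' :: "real => real"
  assumes d: "!!t. (v has_real_derivative v' t) (at t)" and c: "continuous_on UNIV v'"
    and supp: "!!t. \<bar>t\<bar> > R ==> v t = 0"
  shows "ennreal ((v t)\<^sup>2) <= (\<integral>\<^sup>+s. ennreal (2 * \<bar>v s * v' s\<bar>) \<partial>lborel)"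
proof -
  define a where "a = min t (- \<bar>R\<bar> - 1)"
  have a: "a <= t" "v a = 0" using supp[of a] by (auto simp: a_def)
  have cv: "continuous_on UNIV v" using d by (meson DERIV_isCont continuous_at_imp_continuous_on)
  have "(LINT s|lborel. (2 * (v s * v' s)) * indicator {a..t} s) = (v t)\<^sup>2 - (v a)\<^sup>2"
    by (rule integral_FTC_Icc_real[OF a(1)])
      (use d c cv in \<open>auto intro!: derivative_eq_intros continuous_intros simp: continuous_on_eq_continuous_at\<close>)
  then have "(v t)\<^sup>2 = (LINT s|lborel. (2 * (v s * v' s)) * indicator {a..t} s)" using a by simp
  then have "ennreal ((v t)\<^sup>2) <= ennreal (norm (LINT s|lborel. (2 * (v s * v' s)) * indicator {a..t} s))"
    by (intro ennreal_leI) simp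
  also have "... <= (\<integral>\<^sup>+s. ennreal (norm ((2 * (v s * v' s)) * indicator {a..t} s)) \<partial>lborel)"
  proof (rule integral_norm_bound_ennreal)
    have "integrable lborel (%s. indicator {a..t} s *\<^sub>R (2 * (v s * v' s)))"
      by (rule borel_integrable_compact) (use c cv in \<open>auto intro!: continuous_intros intro: continuous_on_subset\<close>)
    then show "integrable lborel (%s. (2 * (v s * v' s)) * indicator {a..t} s)" by (simp add: mult.commute)
  qed
  also have "... <= (\<integral>\<^sup>+s. ennreal (2 * \<bar>v s * v' s\<bar>) \<partial>lborel)"
    by (intro nn_integral_mono ennreal_leI) (auto simp: indicator_def abs_mult)
  finally show ?thesis .
qed

text \<open>From a b <= (a + b)^2; a way to extract a square root without leaving
  \<open>ennreal\<close>.\<close>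

lemma ennreal_sq_le: "x\<^sup>2 <= a * b ==> x <= (a + b :: ennreal)"
proof (rule ccontr)
  assume x: "x\<^sup>2 <= a * b" and "\<not> x <= a + b"
  then have l: "a + b < x" by simp
  then have "a + b < top_class.top" by (rule less_le_trans) simp
  then have "a < top_class.top" "b < top_class.top" by (auto simp: ennreal_add_eq_top less_top)
  then obtain r s where rs: "a = ennreal r" "0 <= r" "b = ennreal s" "0 <= s"
    by (metis ennreal_cases less_irrefl)
  have ab: "a * b = ennreal (r * s)" using rs by (simp add: ennreal_mult)
  show False
  proof (cases x)
    case (real t)
    have "ennreal (t\<^sup>2) <= ennreal (r * s)" using x real unfolding ab by (simp add: ennreal_power)
    then have t: "t\<^sup>2 <= r * s" using rs by (simp add: ennreal_le_iff)
    have "ennreal (r + s) < ennreal t" using l real rs by simp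
    then have "r + s < t" using rs by (simp add: ennreal_less_iff del: ennreal_plus)
    then have "(r + s)\<^sup>2 < t\<^sup>2" using rs by (intro power_strict_mono) auto
    moreover have "r * s <= (r + s)\<^sup>2" using rs by (simp add: power2_sum)
    ultimately show False using t by linarith
  next
    case top
    then show False using x unfolding ab by (simp add: top_unique power2_eq_square)
  qed
qed

text \<open>In the plane x3 = c, u^2 is at most a function of x1 alone and also at most one of x2
  alone, so the integral of u^4 is at most the product of their integrals; Cauchy-Schwarz bounds it
  by 4 mc (Dc 1 + Dc 2). The slice mass mc is at most \<open>M3\<close>, by the line bound in
  direction 3, and the square of \<open>M3\<close> is at most 4 m (D 3). Integrating over c and
  squaring give the constant 64.\<close>

lemma ladyzhenskaya_ennreal:
  fixes u :: "real^3 => real"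
  assumes u: "u \<in> test_functions UNIV"
  defines "D \<equiv> (%i. \<integral>\<^sup>+x. ennreal ((partial_deriv i u x)\<^sup>2) \<partial>lborel)"
    and "m \<equiv> \<integral>\<^sup>+x. ennreal ((u x)\<^sup>2) \<partial>lborel"
  shows "((\<integral>\<^sup>+x. ennreal ((u x) ^ 4) \<partial>lborel))\<^sup>2 <= 64 * m * D 3 * (D 1 + D 2)\<^sup>2"
proof -
  obtain K where K: "smooth_fun u" "compact K" "!!x. x \<notin> K ==> u x = 0" using test_functionsE[OF u] by metis
  obtain R where R: "K \<subseteq> cball 0 R" using compact_imp_bounded[OF K(2)] by (auto simp: bounded_iff subset_iff)
  note um [measurable] = test_integrable(3)[OF u] test_integrable(3)[OF test_partial[OF u]]
  let ?u = "%a b c. u (vec3 (c, a, b))"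
  let ?d = "%i a b c. partial_deriv i u (vec3 (c, a, b))"
  have line: "((%t. u (y + t *\<^sub>R axis i 1)) has_real_derivative partial_deriv i u (y + t *\<^sub>R axis i 1)) (at t)" for y i t
    using has_real_derivative_line[OF K(1), of y "axis i 1" t] by (simp add: sum_axis)
  have v1: "vec3 (c, a, b) = vec3 (c, 0, b) + a *\<^sub>R axis 1 1" for a b c by (simp add: vec_eq_iff forall_3 axis_def)
  have v2: "vec3 (c, a, b) = vec3 (c, a, 0) + b *\<^sub>R axis 2 1" for a b c by (simp add: vec_eq_iff forall_3 axis_def)
  have v3: "vec3 (c, a, b) = vec3 (0, a, b) + c *\<^sub>R axis 3 1" for a b c by (simp add: vec_eq_iff forall_3 axis_def)
  have z: "u x = 0" if "\<bar>x $ i\<bar> > R" for x i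
  proof -
    have "norm x > R" using component_le_norm_cart[of x i] that by linarith
    then show ?thesis using K(3) R by (metis mem_cball_0 not_less subsetD)
  qed
  have cd: "continuous_on UNIV (%t. partial_deriv i u (y + t *\<^sub>R axis i 1))" for y i
    by (rule continuous_on_compose2[OF smooth_fun_continuous[OF smooth_fun_partial[OF K(1)], of UNIV]])
      (auto intro!: continuous_intros)
  have bl: "ennreal ((u (y + t *\<^sub>R axis i 1))\<^sup>2) <= (\<integral>\<^sup>+s. ennreal (2 * \<bar>u (y + s *\<^sub>R axis i 1) * partial_deriv i u (y + s *\<^sub>R axis i 1)\<bar>) \<partial>lborel)"
    if "y $ i = 0" for y i t
    by (rule square_le_line_integral[of "%t. u (y + t *\<^sub>R axis i 1)" _ R, OF line cd])
      (use that in \<open>auto intro!: z[of _ i] simp: axis_def\<close>)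
  define A1 where "A1 b c = (\<integral>\<^sup>+a. ennreal (2 * \<bar>?u a b c * ?d 1 a b c\<bar>) \<partial>lborel)" for b c
  define A2 where "A2 a c = (\<integral>\<^sup>+b. ennreal (2 * \<bar>?u a b c * ?d 2 a b c\<bar>) \<partial>lborel)" for a c
  define A3 where "A3 a b = (\<integral>\<^sup>+c. ennreal (2 * \<bar>?u a b c * ?d 3 a b c\<bar>) \<partial>lborel)" for a b
  have b1: "ennreal ((?u a b c)\<^sup>2) <= A1 b c" for a b c
    using bl[of "vec3 (c, 0, b)" 1 a] by (simp add: A1_def v1[symmetric])
  have b2: "ennreal ((?u a b c)\<^sup>2) <= A2 a c" for a b c
    using bl[of "vec3 (c, a, 0)" 2 b] by (simp add: A2_def v2[symmetric])
  have b3: "ennreal ((?u a b c)\<^sup>2) <= A3 a b" for a b c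
    using bl[of "vec3 (0, a, b)" 3 c] by (simp add: A3_def v3[symmetric])
  have [measurable]: "(%p. u (vec3 p)) \<in> borel_measurable borel" "(%p. partial_deriv i u (vec3 p)) \<in> borel_measurable borel" for i
    by measurable
  let ?L = "lborel \<Otimes>\<^sub>M lborel :: (real \<times> real) measure"
  have um2 [measurable]: "(%p. u (vec3 (c, p))) \<in> borel_measurable ?L" "(%p. partial_deriv i u (vec3 (c, p))) \<in> borel_measurable ?L" for i c
    unfolding lborel_prod by measurable
  have um3 [measurable]: "(%p. u (vec3 (f p, g p, h p))) \<in> borel_measurable M" "(%p. partial_deriv i u (vec3 (f p, g p, h p))) \<in> borel_measurable M"
    if [measurable]: "f \<in> borel_measurable M" "g \<in> borel_measurable M" "h \<in> borel_measurable M" for f g h i and M :: "'x measure"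
    by measurable
  have A2m [measurable]: "(%a. A2 a c) \<in> borel_measurable lborel" for c unfolding A2_def by measurable
  have A1m [measurable]: "(%b. A1 b c) \<in> borel_measurable lborel" for c unfolding A1_def by measurable
  define mc where "mc c = (\<integral>\<^sup>+p. ennreal ((u (vec3 (c, p)))\<^sup>2) \<partial>?L)" for c
  define Dc where "Dc i c = (\<integral>\<^sup>+p. ennreal ((partial_deriv i u (vec3 (c, p)))\<^sup>2) \<partial>?L)" for i c
  define G where "G i c = (\<integral>\<^sup>+p. ennreal (2 * \<bar>u (vec3 (c, p)) * partial_deriv i u (vec3 (c, p))\<bar>) \<partial>?L)" for i c
  have CS: "(\<integral>\<^sup>+x. ennreal (2 * \<bar>f x * g x\<bar>) \<partial>M)\<^sup>2 <= 4 * (\<integral>\<^sup>+x. ennreal ((f x)\<^sup>2) \<partial>M) * (\<integral>\<^sup>+x. ennreal ((g x)\<^sup>2) \<partial>M)"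
    if [measurable]: "f \<in> borel_measurable M" "g \<in> borel_measurable M" for f g :: "'y => real" and M :: "'y measure"
  proof -
    have "(\<integral>\<^sup>+x. ennreal (2 * \<bar>f x * g x\<bar>) \<partial>M) = 2 * (\<integral>\<^sup>+x. ennreal \<bar>f x\<bar> * ennreal \<bar>g x\<bar> \<partial>M)"
      by (subst nn_integral_cmult[symmetric]) (auto intro!: nn_integral_cong simp: ennreal_mult'' abs_mult ennreal_mult)
    then have "(\<integral>\<^sup>+x. ennreal (2 * \<bar>f x * g x\<bar>) \<partial>M)\<^sup>2 = 4 * (\<integral>\<^sup>+x. ennreal \<bar>f x\<bar> * ennreal \<bar>g x\<bar> \<partial>M)\<^sup>2"
      by (simp add: power_mult_distrib)
    also have "... <= 4 * ((\<integral>\<^sup>+x. (ennreal \<bar>f x\<bar>)\<^sup>2 \<partial>M) * (\<integral>\<^sup>+x. (ennreal \<bar>g x\<bar>)\<^sup>2 \<partial>M))"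
      by (intro mult_left_mono Cauchy_Schwarz_nn_integral) auto
    finally show ?thesis by (simp add: ennreal_power mult.assoc)
  qed
  have GCS: "(G i c)\<^sup>2 <= 4 * mc c * Dc i c" for i c
    unfolding G_def mc_def Dc_def by (rule CS) measurable
  have G1: "(\<integral>\<^sup>+b. A1 b c \<partial>lborel) = G 1 c" for c
    unfolding G_def A1_def
    using lborel_pair.nn_integral_snd[of "%p. ennreal (2 * \<bar>u (vec3 (c, p)) * partial_deriv 1 u (vec3 (c, p))\<bar>)"] by simp
  have G2: "(\<integral>\<^sup>+a. A2 a c \<partial>lborel) = G 2 c" for c
    unfolding G_def A2_def
    using lborel.nn_integral_fst[of "%p. ennreal (2 * \<bar>u (vec3 (c, p)) * partial_deriv 2 u (vec3 (c, p))\<bar>)" lborel] by simp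
  define M3 where "M3 = (\<integral>\<^sup>+x. ennreal (2 * \<bar>u x * partial_deriv 3 u x\<bar>) \<partial>lborel)"
  have M3: "M3\<^sup>2 <= 4 * m * D 3" unfolding M3_def m_def D_def by (rule CS) measurable
  have mcM: "mc c <= M3" for c
  proof -
    have "mc c <= (\<integral>\<^sup>+p. \<integral>\<^sup>+s. ennreal (2 * \<bar>u (vec3 (s, p)) * partial_deriv 3 u (vec3 (s, p))\<bar>) \<partial>lborel \<partial>?L)"
      unfolding mc_def using b3 unfolding A3_def by (intro nn_integral_mono) (auto split: prod.split)
    also have "... = (\<integral>\<^sup>+s. \<integral>\<^sup>+p. ennreal (2 * \<bar>u (vec3 (s, p)) * partial_deriv 3 u (vec3 (s, p))\<bar>) \<partial>?L \<partial>lborel)"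
      unfolding lborel_prod
      by (rule lborel_pair.Fubini'[of "%s p. ennreal (2 * \<bar>u (vec3 (s, p)) * partial_deriv 3 u (vec3 (s, p))\<bar>)"])
        (simp add: lborel_prod case_prod_beta')
    also have "... = M3" unfolding M3_def by (rule nn_integral_vec3[symmetric]) measurable
    finally show ?thesis .
  qed
  have slice: "(\<integral>\<^sup>+p. ennreal ((u (vec3 (c, p))) ^ 4) \<partial>?L) <= 4 * M3 * (Dc 1 c + Dc 2 c)" for c
  proof -
    have "ennreal ((?u a b c) ^ 4) <= A2 a c * A1 b c" for a b
    proof -
      have "ennreal ((?u a b c) ^ 4) = ennreal ((?u a b c)\<^sup>2) * ennreal ((?u a b c)\<^sup>2)"
        by (simp add: ennreal_mult[symmetric] power_add[symmetric])
      also have "... <= A2 a c * A1 b c" by (intro mult_mono b1 b2) auto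
      finally show ?thesis .
    qed
    then have "(\<integral>\<^sup>+p. ennreal ((u (vec3 (c, p))) ^ 4) \<partial>?L) <= (\<integral>\<^sup>+p. A2 (fst p) c * A1 (snd p) c \<partial>?L)"
      by (intro nn_integral_mono) (auto split: prod.split)
    also have "... = (\<integral>\<^sup>+a. \<integral>\<^sup>+b. A2 a c * A1 b c \<partial>lborel \<partial>lborel)"
      by (subst lborel.nn_integral_fst[symmetric]) auto
    also have "... = G 2 c * G 1 c" by (simp add: nn_integral_cmult nn_integral_multc G1 G2)
    also have "... <= 4 * mc c * Dc 2 c + 4 * mc c * Dc 1 c"
    proof (rule ennreal_sq_le)
      show "(G 2 c * G 1 c)\<^sup>2 <= 4 * mc c * Dc 2 c * (4 * mc c * Dc 1 c)"
        unfolding power_mult_distrib by (intro mult_mono GCS) auto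
    qed
    also have "... = 4 * mc c * (Dc 1 c + Dc 2 c)" by (simp add: distrib_left add.commute)
    also have "... <= 4 * M3 * (Dc 1 c + Dc 2 c)" by (intro mult_mono mcM) auto
    finally show ?thesis .
  qed
  have DcD: "(\<integral>\<^sup>+c. Dc i c \<partial>lborel) = D i" for i
    unfolding D_def Dc_def by (rule nn_integral_vec3[symmetric]) measurable
  have [measurable]: "Dc i \<in> borel_measurable lborel" for i
    unfolding Dc_def lborel_prod by measurable
  have "(\<integral>\<^sup>+x. ennreal ((u x) ^ 4) \<partial>lborel) = (\<integral>\<^sup>+c. \<integral>\<^sup>+p. ennreal ((u (vec3 (c, p))) ^ 4) \<partial>?L \<partial>lborel)"
    by (rule nn_integral_vec3) measurable
  also have "... <= (\<integral>\<^sup>+c. 4 * M3 * (Dc 1 c + Dc 2 c) \<partial>lborel)" by (intro nn_integral_mono slice)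
  also have "... = 4 * M3 * (D 1 + D 2)" by (simp add: nn_integral_cmult nn_integral_add DcD)
  finally have "(\<integral>\<^sup>+x. ennreal ((u x) ^ 4) \<partial>lborel)\<^sup>2 <= (4 * M3 * (D 1 + D 2))\<^sup>2" by (intro power_mono) auto
  also have "... = 16 * M3\<^sup>2 * (D 1 + D 2)\<^sup>2" by (simp add: power_mult_distrib)
  also have "... <= 16 * (4 * m * D 3) * (D 1 + D 2)\<^sup>2" by (intro mult_mono M3) auto
  also have "... = 64 * m * D 3 * (D 1 + D 2)\<^sup>2" by (simp add: mult_ac)
  finally show ?thesis .
qed

section \<open>The Sobolev space\<close>

definition jet :: "(real^'n::finite => real) => (real^'n) l2 \<times> ((real^'n) l2 ^ 'n)"
  where "jet eta = (mk eta, grd eta)"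

text \<open>The space \<open>H\<^sup>1\<^sub>0\<close>, as a space of pairs of a function and its gradient.\<close>

definition Sob :: "(real^'n::finite) set => ((real^'n) l2 \<times> ((real^'n) l2 ^ 'n)) set"
  where "Sob \<Omega> = closure (jet ` test_functions \<Omega>)"

lemma jet_add: "eta \<in> test_functions \<Omega> ==> zeta \<in> test_functions \<Omega> ==> jet (%x. eta x + zeta x) = jet eta + jet zeta"
proof -
  assume eta: "eta \<in> test_functions \<Omega>" and zeta: "zeta \<in> test_functions \<Omega>"
  have "partial_deriv i (%x. eta x + zeta x) = (%x. partial_deriv i eta x + partial_deriv i zeta x)" for i
    using eta zeta by (intro ext partial_deriv_add smooth_fun_differentiable test_smooth)
  then show ?thesis
    using eta zeta test_sqint[OF test_partial[OF eta]] test_sqint[OF test_partial[OF zeta]]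
    by (simp add: jet_def grd_def vec_eq_iff mk_add)
qed

lemma jet_cmult: "eta \<in> test_functions \<Omega> ==> jet (%x. c * eta x) = c *\<^sub>R jet eta"
proof -
  assume eta: "eta \<in> test_functions \<Omega>"
  have "partial_deriv i (%x. c * eta x) = (%x. c * partial_deriv i eta x)" for i
    using partial_deriv_mult[OF smooth_fun_differentiable[OF smooth_fun_const] smooth_fun_differentiable[OF test_smooth[OF eta]], of i c]
    by (simp add: fun_eq_iff)
  then show ?thesis
    using eta test_sqint[OF test_partial[OF eta]] by (simp add: jet_def grd_def vec_eq_iff mk_cmult)
qed

lemma jet_zero: "jet (%x. 0) = 0"
  by (simp add: jet_def grd_def zero_prod_def vec_eq_iff)

lemma Sob_subspace: "subspace (Sob \<Omega>)"
  unfolding Sob_def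
proof (rule subspace_closure)
  show "subspace (jet ` test_functions \<Omega>)"
    unfolding subspace_def
  proof (intro conjI ballI allI)
    show "0 \<in> jet ` test_functions \<Omega>" using test_zero jet_zero by (metis image_eqI)
  next
    fix x y assume "x \<in> jet ` test_functions \<Omega>" "y \<in> jet ` test_functions \<Omega>"
    then show "x + y \<in> jet ` test_functions \<Omega>" by (auto simp: jet_add[symmetric] intro!: imageI test_add)
  next
    fix c x assume "x \<in> jet ` test_functions \<Omega>"
    then show "c *\<^sub>R x \<in> jet ` test_functions \<Omega>" by (auto simp: jet_cmult[symmetric] intro!: imageI test_cmult)
  qed
qed

lemma Sob_closed: "closed (Sob \<Omega>)"
  by (simp add: Sob_def)

lemma jet_Sob: "eta \<in> test_functions \<Omega> ==> jet eta \<in> Sob \<Omega>"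
  unfolding Sob_def by (rule subsetD[OF closure_subset]) (rule imageI)

text \<open>\<open>Sob\<close> is a closure, so an inequality between continuous functionals has to
  be checked on test functions only; \<open>Sob_induct_eq\<close> is the analogue for
  equations.\<close>

lemma Sob_induct_le:
  fixes f g :: "_ => real"
  assumes "U \<in> Sob \<Omega>" "!!eta. eta \<in> test_functions \<Omega> ==> f (jet eta) <= g (jet eta)"
    "continuous_on UNIV f" "continuous_on UNIV g"
  shows "f U <= g U"
proof -
  have "closure (jet ` test_functions \<Omega>) \<subseteq> {U. f U <= g U}"
    by (rule closure_minimal) (use assms in \<open>auto intro: closed_Collect_le\<close>)
  then show ?thesis using assms(1) by (auto simp: Sob_def)
qed

lemma Sob_induct_eq:
  fixes f g :: "_ => 'b::t2_space"
  assumes "U \<in> Sob \<Omega>" "!!eta. eta \<in> test_functions \<Omega> ==> f (jet eta) = g (jet eta)"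
    "continuous_on UNIV f" "continuous_on UNIV g"
  shows "f U = g U"
proof -
  have "closure (jet ` test_functions \<Omega>) \<subseteq> {U. f U = g U}"
    by (rule closure_minimal) (use assms in \<open>auto intro: closed_Collect_eq\<close>)
  then show ?thesis using assms(1) by (auto simp: Sob_def)
qed

lemma continuous_Mop: "bmult a ==> continuous_on A f ==> continuous_on A (%x. Mop a (f x))"
  by (rule bounded_linear.continuous_on[OF Mop_linear])

text \<open>The domain \<Omega>' of the second test function is arbitrary: extended by zero, an
  element of \<open>Sob\<close> is weakly differentiable on the whole space, which expresses its
  vanishing on the boundary.\<close>

lemma Sob_weak_deriv:
  assumes "U \<in> Sob \<Omega>" and zeta: "zeta \<in> test_functions \<Omega>'"
  shows "inner (fst U) (mk (partial_deriv i zeta)) = - inner (snd U $ i) (mk zeta)"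
  by (rule Sob_induct_eq[OF assms(1), where f = "%U. inner (fst U) (mk (partial_deriv i zeta))"])
    (auto simp: jet_def grd_def inner_parts_test[OF _ zeta] intro!: continuous_intros)

lemma Mop_indicator_test:
  assumes eta: "eta \<in> test_functions \<Omega>" and \<Omega>: "\<Omega> \<in> sets lebesgue"
  shows "Mop (indicator \<Omega>) (mk eta) = mk eta"
proof -
  have "indicator \<Omega> x * eta x = eta x" for x using eta by (cases "x \<in> \<Omega>") (auto elim: test_functionsE)
  then have eq: "(%x. indicator \<Omega> x * eta x) = eta" by (rule ext)
  show ?thesis using Mop_mk[OF bmult_indicator[OF \<Omega>] test_sqint[OF eta]] unfolding eq .
qed

lemma Sob_support:
  assumes U: "U \<in> Sob \<Omega>" and \<Omega>: "\<Omega> \<in> sets lebesgue"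
  shows "Mop (indicator \<Omega>) (fst U) = fst U" "Mop (indicator \<Omega>) (snd U $ i) = snd U $ i"
proof -
  show "Mop (indicator \<Omega>) (fst U) = fst U"
    by (rule Sob_induct_eq[OF U, where f = "%U. Mop (indicator \<Omega>) (fst U)"])
      (use \<Omega> in \<open>auto simp: jet_def Mop_indicator_test intro!: continuous_intros continuous_Mop\<close>)
  show "Mop (indicator \<Omega>) (snd U $ i) = snd U $ i"
    by (rule Sob_induct_eq[OF U, where f = "%U. Mop (indicator \<Omega>) (snd U $ i)"])
      (use \<Omega> in \<open>auto simp: jet_def grd_def Mop_indicator_test test_partial intro!: continuous_intros continuous_Mop\<close>)
qed

text \<open>A translation by more than the diameter makes the two supports disjoint.\<close>

lemma poincare:
  fixes \<Omega> :: "(real^'n::finite) set"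
  assumes "bounded \<Omega>"
  obtains C where "C > 0" "!!U. U \<in> Sob \<Omega> ==> norm (fst U) <= C * norm (snd U)"
proof -
  obtain R where R: "R > 0" "!!x. x \<in> \<Omega> ==> norm x <= R" using assms by (auto simp: bounded_pos)
  define h :: "real^'n" where "h = (3 * R) *\<^sub>R axis undefined 1"
  have nh: "norm h = 3 * R" using R(1) by (simp add: h_def norm_axis_1)
  have "norm (fst (jet eta)) <= 3 * R * norm (snd (jet eta))" if eta: "eta \<in> test_functions \<Omega>" for eta
  proof -
    have z: "eta x = 0" if "norm x > R" for x
      using eta R(2)[of x] that by (auto elim!: test_functionsE)
    have "eta (h + x) * eta x = 0" for x
    proof (cases "norm x > R")
      case False
      then have "norm (h + x) > R" using norm_diff_ineq[of h x] nh R(1) by linarith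
      then show ?thesis using z by simp
    qed (simp add: z)
    then have zz: "(%x. eta (h + x) * eta x) = (%x. 0)" by (rule ext)
    have "inner (shf h (mk eta)) (mk eta) = (LINT x|lebesgue. eta (h + x) * eta x)"
      unfolding shf_mk[OF test_integrable(3)[OF eta] test_sqint[OF eta]]
      by (rule inner_mk[OF norm_translate(1)[OF test_integrable(3)[OF eta] test_sqint[OF eta]] test_sqint[OF eta]])
    then have "inner (shf h (mk eta)) (mk eta) = 0" unfolding zz by simp
    then have "(norm (shf h (mk eta) - mk eta))\<^sup>2 = (norm (shf h (mk eta)))\<^sup>2 + (norm (mk eta))\<^sup>2"
      by (simp add: power2_norm_eq_inner inner_diff_left inner_diff_right inner_commute)
    then have "(norm (mk eta))\<^sup>2 <= (norm (shf h (mk eta) - mk eta))\<^sup>2" by simp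
    then have "norm (mk eta) <= norm (shf h (mk eta) - mk eta)" by (rule power2_le_imp_le) simp
    then show ?thesis using translation_test[OF eta, of h] nh by (simp add: jet_def)
  qed
  then have "norm (fst U) <= 3 * R * norm (snd U)" if "U \<in> Sob \<Omega>" for U
    by (rule Sob_induct_le[OF that, where f = "%U. norm (fst U)"]) (auto intro!: continuous_intros)
  then show ?thesis using that[of "3 * R"] R(1) by simp
qed

subsection \<open>Convolution\<close>

lemma partial_deriv_affine:
  fixes f :: "real^'n::finite => real"
  assumes "f differentiable (at (x + c *\<^sub>R y))"
  shows "partial_deriv i (%y. f (x + c *\<^sub>R y)) y = c * partial_deriv i f (x + c *\<^sub>R y)"
    "(%y. f (x + c *\<^sub>R y)) differentiable (at y)"
proof -
  have aff: "((%y. x + c *\<^sub>R y) has_derivative (%h. c *\<^sub>R h)) (at y)"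
    by (auto intro!: derivative_eq_intros)
  have d: "((%y. f (x + c *\<^sub>R y)) has_derivative (%h. \<Sum>i\<in>UNIV. (c *\<^sub>R h) $ i * partial_deriv i f (x + c *\<^sub>R y))) (at y)"
    by (rule has_derivative_compose[where g = f and f = "%y. x + c *\<^sub>R y" and f' = "%h. c *\<^sub>R h", OF aff has_derivative_partials[OF assms]])
  then show "(%y. f (x + c *\<^sub>R y)) differentiable (at y)" by (rule differentiableI)
  show "partial_deriv i (%y. f (x + c *\<^sub>R y)) y = c * partial_deriv i f (x + c *\<^sub>R y)"
    unfolding partial_deriv_eq[OF d] using sum_axis[of i "%j. c * partial_deriv j f (x + c *\<^sub>R y)"]
    by (simp add: mult_ac)
qed

lemma smooth_fun_affine:
  fixes f :: "real^'n::finite => real"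
  assumes "smooth_fun f" shows "smooth_fun (%y. f (x + c *\<^sub>R y))"
proof -
  have "smoothk k f ==> smoothk k (%y. f (x + c *\<^sub>R y))" for k
  proof (induction k arbitrary: f)
    case 0
    then show ?case by (auto simp: differentiable_on_def intro: partial_deriv_affine(2))
  next
    case (Suc k)
    have "partial_deriv i (%y. f (x + c *\<^sub>R y)) = (%y. c * partial_deriv i f (x + c *\<^sub>R y))" for i
      using smoothk_at[OF Suc.prems] by (intro ext partial_deriv_affine(1))
    then show ?case using Suc.IH Suc.prems
      by (auto simp: differentiable_on_def intro!: partial_deriv_affine(2) smoothk_mult smoothk_const)
  qed
  then show ?thesis using assms by (simp add: smooth_fun_iff_smoothk)
qed

lemma test_reflect:
  fixes eta :: "real^'n::finite => real"
  assumes eta: "eta \<in> test_functions \<Omega>"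
  shows "(%y. eta (x - y)) \<in> test_functions UNIV"
    "partial_deriv i (%y. eta (x - y)) y = - partial_deriv i eta (x - y)"
proof -
  obtain K where K: "smooth_fun eta" "compact K" "!!x. x \<notin> K ==> eta x = 0" using test_functionsE[OF eta] by metis
  have "compact ((%z. x - z) ` K)" by (intro compact_continuous_image continuous_intros K)
  then show "(%y. eta (x - y)) \<in> test_functions UNIV"
  proof (rule test_functionsI[rotated])
    show "smooth_fun (%y. eta (x - y))" using smooth_fun_affine[OF K(1), of x "-1"] by simp
    show "eta (x - y) = 0" if "y \<notin> (%z. x - z) ` K" for y
      using that K(3)[of "x - y"] by (metis diff_diff_eq2 add_diff_cancel_left' image_eqI)
  qed simp
  show "partial_deriv i (%y. eta (x - y)) y = - partial_deriv i eta (x - y)"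
    using partial_deriv_affine(1)[of eta x "-1" y i] smooth_fun_differentiable[OF K(1)] by simp
qed

lemma lborel_reflect: "distr lborel borel (%x. t - x) = (lborel :: 'a::euclidean_space measure)"
  using lborel_affine[of "-1" t] by (simp add: density_1)

lemma nn_integral_reflect:
  fixes f :: "'a::euclidean_space => ennreal"
  assumes "f \<in> borel_measurable borel"
  shows "(\<integral>\<^sup>+x. f (t - x) \<partial>lborel) = (\<integral>\<^sup>+x. f x \<partial>lborel)"
proof -
  have "(\<integral>\<^sup>+x. f x \<partial>distr lborel borel (%x. t - x)) = (\<integral>\<^sup>+x. f (t - x) \<partial>lborel)"
    by (rule nn_integral_distr) (use assms in auto)
  then show ?thesis by (simp add: lborel_reflect)
qed

lemma lborel_integral_reflect:
  fixes f :: "'a::euclidean_space => real"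
  assumes "f \<in> borel_measurable borel"
  shows "(LINT x|lborel. f (t - x)) = (LINT x|lborel. f x)"
proof -
  have "(LINT x|distr lborel borel (%x. t - x). f x) = (LINT x|lborel. f (t - x))"
    by (rule integral_distr) (use assms in auto)
  then show ?thesis by (simp add: lborel_reflect)
qed

lemma norm_mk_reflect:
  assumes eta: "eta \<in> test_functions \<Omega>" shows "norm (mk (%y. eta (x - y))) = norm (mk eta)"
proof -
  have "ennreal ((norm (mk (%y. eta (x - y))))\<^sup>2) = ennreal ((norm (mk eta))\<^sup>2)"
    using nn_integral_reflect[of "%y. ennreal ((eta y)\<^sup>2)" x] test_integrable(3)[OF eta]
      lborel_nn_norm_mk[of eta] lborel_nn_norm_mk[of "%y. eta (x - y)"] test_reflect(1)[OF eta, of x] eta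
    by (simp add: test_integrable)
  then show ?thesis by simp
qed

text \<open>Convolution with rho, written as a pairing with the reflected kernel, so that pointwise
  bounds follow from Cauchy-Schwarz.\<close>

definition cv :: "(real^'n::finite => real) => (real^'n) l2 => real^'n => real"
  where "cv rho u x = inner u (mk (%y. rho (x - y)))"

lemma cv_bound: "rho \<in> test_functions \<Omega> ==> \<bar>cv rho u x\<bar> <= norm u * norm (mk rho)"
  unfolding cv_def using Cauchy_Schwarz_ineq2[of u "mk (%y. rho (x - y))"] norm_mk_reflect by metis

lemma has_derivative_quadratic_remainder:
  fixes f :: "'a::real_normed_vector => real"
  assumes "bounded_linear f'" and b: "!!h. norm h <= 1 ==> \<bar>f (x + h) - f x - f' h\<bar> <= C * (norm h)\<^sup>2"
  shows "(f has_derivative f') (at x)"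
  unfolding has_derivative_iff_norm
proof
  show "((%y. norm (f y - f x - f' (y - x)) / norm (y - x)) \<longlongrightarrow> 0) (at x)"
  proof (rule Lim_null_comparison)
    have l: "((%y. C * norm (y - x)) \<longlongrightarrow> C * norm (x - x)) (at x)" by (intro tendsto_intros)
    then show "((%y. C * norm (y - x)) \<longlongrightarrow> 0) (at x)" by simp
    have "\<forall>\<^sub>F y in at x. dist y x < 1" by (rule eventually_at_ball'[THEN eventually_mono]) (auto simp: dist_commute)
    then show "\<forall>\<^sub>F y in at x. norm (norm (f y - f x - f' (y - x)) / norm (y - x)) <= C * norm (y - x)"
    proof eventually_elim
      case (elim y)
      then have "\<bar>f y - f x - f' (y - x)\<bar> <= C * (norm (y - x))\<^sup>2" using b[of "y - x"] by (simp add: dist_norm)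
      then show ?case by (cases "y = x") (auto simp: field_simps power2_eq_square)
    qed
  qed
qed fact

lemma test_taylor:
  fixes eta :: "real^'n::finite => real"
  assumes eta: "eta \<in> test_functions \<Omega>"
  obtains C where "C >= 0" "!!x h. \<bar>eta (x + h) - eta x - (\<Sum>i\<in>UNIV. h $ i * partial_deriv i eta x)\<bar> <= C * (norm h)\<^sup>2"
proof -
  have "\<exists>B\<ge>0. \<forall>x j. \<bar>partial_deriv j (partial_deriv i eta) x\<bar> <= B" for i
    using test_grad_bound[OF test_partial[OF eta, of i]] by metis
  then obtain B where B: "!!i. B i >= 0" "!!i x j. \<bar>partial_deriv j (partial_deriv i eta) x\<bar> <= B i" by metis
  define C where "C = (\<Sum>i\<in>(UNIV::'n set). real CARD('n) * B i)"
  have "\<bar>eta (x + h) - eta x - (\<Sum>i\<in>UNIV. h $ i * partial_deriv i eta x)\<bar> <= C * (norm h)\<^sup>2" for x h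
  proof -
    have "\<exists>t>0. t < 1 & eta (x + 1 *\<^sub>R h) - eta (x + 0 *\<^sub>R h) = (1 - 0) * (\<Sum>i\<in>UNIV. h $ i * partial_deriv i eta (x + t *\<^sub>R h))"
      by (rule MVT2) (auto intro!: has_real_derivative_line test_smooth[OF eta])
    then obtain t where t: "0 < t" "t < 1" "eta (x + h) - eta x = (\<Sum>i\<in>UNIV. h $ i * partial_deriv i eta (x + t *\<^sub>R h))" by auto
    have "\<bar>eta (x + h) - eta x - (\<Sum>i\<in>UNIV. h $ i * partial_deriv i eta x)\<bar>
       = \<bar>\<Sum>i\<in>UNIV. h $ i * (partial_deriv i eta (x + t *\<^sub>R h) - partial_deriv i eta x)\<bar>"
      unfolding t(3) by (simp add: sum_subtractf right_diff_distrib)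
    also have "... <= (\<Sum>i\<in>UNIV. \<bar>h $ i * (partial_deriv i eta (x + t *\<^sub>R h) - partial_deriv i eta x)\<bar>)" by (rule sum_abs)
    also have "... <= (\<Sum>i\<in>UNIV. norm h * (real CARD('n) * B i * norm h))"
      unfolding abs_mult
    proof (intro sum_mono mult_mono component_le_norm_cart)
      fix i
      have "\<bar>partial_deriv i eta (x + t *\<^sub>R h) - partial_deriv i eta x\<bar> <= real CARD('n) * B i * norm (t *\<^sub>R h)"
        by (rule test_difference_bound[OF smooth_fun_partial[OF test_smooth[OF eta]] B(2)])
      also have "... <= real CARD('n) * B i * norm h" using t B(1) by (intro mult_left_mono) (auto simp: mult_left_le_one_le)
      finally show "\<bar>partial_deriv i eta (x + t *\<^sub>R h) - partial_deriv i eta x\<bar> <= real CARD('n) * B i * norm h" .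
    qed auto
    also have "... = C * (norm h)\<^sup>2" by (simp add: C_def sum_distrib_right sum_distrib_left power2_eq_square mult_ac)
    finally show ?thesis .
  qed
  moreover have "C >= 0" unfolding C_def using B(1) by (intro sum_nonneg) auto
  ultimately show ?thesis using that by blast
qed

lemma sqint_indicator_cball: "sqint (indicator (cball a r) :: 'a::euclidean_space => real)"
proof -
  have "integrable lebesgue (indicator (cball a r) :: 'a => real)"
    by (subst integrable_completion, measurable)
      (auto intro!: integrable_real_indicator emeasure_compact_finite)
  then show ?thesis by (simp add: sqint_def power2_eq_square indicator_inter_arith[symmetric])
qed

text \<open>For |h| <= 1 the Taylor remainder of the kernel is at most C |h|^2 and vanishes outside
  a fixed ball, so its L2 norm, and with it the pairing with u, is of order |h|^2.\<close>

lemma cv_has_derivative: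
  fixes rho :: "real^'n::finite => real"
  assumes rho: "rho \<in> test_functions \<Omega>"
  shows "(cv rho u has_derivative (%h. \<Sum>i\<in>UNIV. h $ i * cv (partial_deriv i rho) u x)) (at x)"
proof -
  obtain C where C: "C >= 0" "!!x h. \<bar>rho (x + h) - rho x - (\<Sum>i\<in>UNIV. h $ i * partial_deriv i rho x)\<bar> <= C * (norm h)\<^sup>2"
    using test_taylor[OF rho] by metis
  obtain K where K: "smooth_fun rho" "compact K" "!!x. x \<notin> K ==> rho x = 0" using test_functionsE[OF rho] by metis
  obtain R where R: "!!x. x \<in> K ==> norm x <= R" using compact_imp_bounded[OF K(2)] by (auto simp: bounded_iff)
  let ?I = "mk (indicator (cball x (R + 1))) :: (real^'n) l2"
  show ?thesis
  proof (rule has_derivative_quadratic_remainder)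
    show "bounded_linear (%h::real^'n. \<Sum>i\<in>UNIV. h $ i * cv (partial_deriv i rho) u x)"
      by (intro bounded_linear_sum bounded_linear_mult_const bounded_linear_vec_nth)
    fix h :: "real^'n" assume h: "norm h <= 1"
    have t0: "(%y. rho (x + h - y)) \<in> test_functions UNIV" "(%y. rho (x - y)) \<in> test_functions UNIV"
      "(%y. partial_deriv i rho (x - y)) \<in> test_functions UNIV" for i
      by (intro test_reflect(1)[OF rho] test_reflect(1)[OF test_partial[OF rho]])+
    have t1: "(%y. \<Sum>i\<in>UNIV. h $ i * partial_deriv i rho (x - y)) \<in> test_functions UNIV"
      by (intro test_sum test_cmult t0)
    define g where "g y = rho (x + h - y) - rho (x - y) - (\<Sum>i\<in>UNIV. h $ i * partial_deriv i rho (x - y))" for y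
    have sg: "sqint g" unfolding g_def by (intro sqint_diff test_sqint[OF t0(1)] test_sqint[OF t0(2)] test_sqint[OF t1])
    have "cv rho u (x + h) - cv rho u x - (\<Sum>i\<in>UNIV. h $ i * cv (partial_deriv i rho) u x) = inner u (mk g)"
    proof -
      have "(\<Sum>i\<in>UNIV. h $ i * cv (partial_deriv i rho) u x) = inner u (\<Sum>i\<in>UNIV. mk (%y. h $ i * partial_deriv i rho (x - y)))"
        unfolding cv_def inner_sum_right using test_sqint[OF t0(3)] by (simp add: mk_cmult[symmetric])
      also have "(\<Sum>i\<in>UNIV. mk (%y. h $ i * partial_deriv i rho (x - y))) = mk (%y. \<Sum>i\<in>UNIV. h $ i * partial_deriv i rho (x - y))"
        by (rule mk_sum) (intro sqint_cmult test_sqint[OF t0(3)])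
      finally show ?thesis
        unfolding g_def cv_def using test_sqint[OF t0(1)] test_sqint[OF t0(2)] test_sqint[OF t1]
        by (simp add: mk_diff[symmetric] sqint_diff inner_diff_right)
    qed
    moreover have "norm (mk g) <= norm (mk (%y. C * (norm h)\<^sup>2 * indicator (cball x (R + 1)) y))"
    proof (rule norm_mk_mono[OF sqint_cmult[OF sqint_indicator_cball] sqint_meas[OF sg]], rule AE_I2)
      fix y
      show "\<bar>g y\<bar> <= \<bar>C * (norm h)\<^sup>2 * indicator (cball x (R + 1)) y\<bar>"
      proof (cases "y \<in> cball x (R + 1)")
        case True
        have "g y = rho ((x - y) + h) - rho (x - y) - (\<Sum>i\<in>UNIV. h $ i * partial_deriv i rho (x - y))"
          by (simp add: g_def algebra_simps)
        then show ?thesis using C(2)[of "x - y" h] C(1) True by simp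
      next
        case False
        then have n: "norm (x - y) > R + 1" by (simp add: dist_norm)
        have "norm (x + h - y) > R" using norm_diff_ineq[of "x - y" h] n h by (simp add: algebra_simps)
        then have "x + h - y \<notin> K" "x - y \<notin> K" using R[of "x + h - y"] R[of "x - y"] n by auto
        then have "g y = 0" using K(3) partial_deriv_off[OF compact_imp_closed[OF K(2)] K(3)] by (simp add: g_def)
        then show ?thesis by simp
      qed
    qed
    moreover have "mk (%y. C * (norm h)\<^sup>2 * indicator (cball x (R + 1)) y) = (C * (norm h)\<^sup>2) *\<^sub>R ?I"
      by (rule mk_cmult[symmetric]) (rule sqint_indicator_cball)
    ultimately have "\<bar>cv rho u (x + h) - cv rho u x - (\<Sum>i\<in>UNIV. h $ i * cv (partial_deriv i rho) u x)\<bar> <= norm u * (C * (norm h)\<^sup>2 * norm ?I)"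
      using Cauchy_Schwarz_ineq2[of u "mk g"] C(1) mult_left_mono[of "norm (mk g)" _ "norm u"] by (fastforce intro: order_trans)
    then show "\<bar>cv rho u (x + h) - cv rho u x - (\<Sum>i\<in>UNIV. h $ i * cv (partial_deriv i rho) u x)\<bar> <= (norm u * C * norm ?I) * (norm h)\<^sup>2"
      by (simp add: mult_ac)
  qed
qed

lemma partial_deriv_cv: "rho \<in> test_functions \<Omega> ==> partial_deriv i (cv rho u) = cv (partial_deriv i rho) u"
  by (rule ext, subst partial_deriv_eq[OF cv_has_derivative]) (auto simp: sum_axis)

lemma cv_differentiable: "rho \<in> test_functions \<Omega> ==> cv rho u differentiable (at x)"
  by (rule differentiableI[OF cv_has_derivative])

lemma smooth_cv: assumes "rho \<in> test_functions \<Omega>" shows "smooth_fun (cv rho u)"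
proof -
  have "rho \<in> test_functions \<Omega> ==> smoothk k (cv rho u)" for k
  proof (induction k arbitrary: rho)
    case 0
    then show ?case by (auto simp: differentiable_on_def cv_differentiable)
  next
    case (Suc k)
    then show ?case
      by (auto simp: differentiable_on_def cv_differentiable partial_deriv_cv intro!: Suc.IH test_partial)
  qed
  then show ?thesis using assms by (simp add: smooth_fun_iff_smoothk)
qed

lemma cv_meas [measurable]: "rho \<in> test_functions \<Omega> ==> cv rho u \<in> borel_measurable borel"
  by (intro borel_measurable_continuous_onI smooth_fun_continuous smooth_cv)

text \<open>Cauchy-Schwarz for the factors sqrt rho and sqrt rho |f|. Without integrability the left
  side is 0 by convention.\<close>

lemma jensen_density:
  fixes rho f :: "'a => real"
  assumes [measurable]: "rho \<in> borel_measurable M" "f \<in> borel_measurable M"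
    and rho: "!!y. rho y >= 0" "(\<integral>\<^sup>+y. ennreal (rho y) \<partial>M) <= 1"
  shows "ennreal ((LINT y|M. f y * rho y)\<^sup>2) <= (\<integral>\<^sup>+y. ennreal (rho y) * ennreal ((f y)\<^sup>2) \<partial>M)"
proof (cases "integrable M (%y. f y * rho y)")
  case False
  then show ?thesis by (simp add: not_integrable_integral_eq)
next
  case True
  have "ennreal (norm (LINT y|M. f y * rho y)) <= (\<integral>\<^sup>+y. ennreal (norm (f y * rho y)) \<partial>M)"
    by (rule integral_norm_bound_ennreal[OF True])
  also have "... = (\<integral>\<^sup>+y. ennreal (sqrt (rho y)) * ennreal (sqrt (rho y) * \<bar>f y\<bar>) \<partial>M)"
  proof (rule nn_integral_cong)
    fix y
    have "norm (f y * rho y) = sqrt (rho y) * (sqrt (rho y) * \<bar>f y\<bar>)"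
      using rho(1)[of y] by (simp add: abs_mult mult.assoc[symmetric])
    then show "ennreal (norm (f y * rho y)) = ennreal (sqrt (rho y)) * ennreal (sqrt (rho y) * \<bar>f y\<bar>)"
      using rho(1)[of y] by (simp only:) (rule ennreal_mult; simp)
  qed
  finally have "(ennreal \<bar>LINT y|M. f y * rho y\<bar>)\<^sup>2 <= (\<integral>\<^sup>+y. ennreal (sqrt (rho y)) * ennreal (sqrt (rho y) * \<bar>f y\<bar>) \<partial>M)\<^sup>2"
    by (intro power_mono) auto
  also have "... <= (\<integral>\<^sup>+y. (ennreal (sqrt (rho y)))\<^sup>2 \<partial>M) * (\<integral>\<^sup>+y. (ennreal (sqrt (rho y) * \<bar>f y\<bar>))\<^sup>2 \<partial>M)"
    by (rule Cauchy_Schwarz_nn_integral) measurable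
  also have "... = (\<integral>\<^sup>+y. ennreal (rho y) \<partial>M) * (\<integral>\<^sup>+y. ennreal (rho y) * ennreal ((f y)\<^sup>2) \<partial>M)"
    using rho(1) by (simp add: ennreal_power power_mult_distrib ennreal_mult)
  also have "... <= 1 * (\<integral>\<^sup>+y. ennreal (rho y) * ennreal ((f y)\<^sup>2) \<partial>M)" by (intro mult_right_mono rho) auto
  finally show ?thesis by (simp add: ennreal_power)
qed

text \<open>Jensen's inequality at each point, then Fubini: the kernel has mass 1 in either
  variable.\<close>

lemma cv_l2:
  assumes rho: "rho \<in> test_functions \<Omega>" "!!y. rho y >= 0" "(\<integral>\<^sup>+y. ennreal (rho y) \<partial>lborel) = 1"
  shows "sqint (cv rho u)" "norm (mk (cv rho u)) <= norm u"
proof -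
  note [measurable] = test_integrable(3)[OF rho(1)] cv_meas[OF rho(1)]
  have pt: "ennreal ((cv rho u x)\<^sup>2) <= (\<integral>\<^sup>+y. ennreal (rho (x - y)) * ennreal ((brep u y)\<^sup>2) \<partial>lborel)" for x
  proof -
    have "cv rho u x = (LINT y|lborel. brep u y * rho (x - y))"
      unfolding cv_def using test_sqint[OF test_reflect(1)[OF rho(1)]]
      by (subst inner_brep_mk) (auto intro!: integral_completion)
    moreover have "(\<integral>\<^sup>+y. ennreal (rho (x - y)) \<partial>lborel) <= 1" using nn_integral_reflect[of "%y. ennreal (rho y)" x] rho(3) by simp
    ultimately show ?thesis using jensen_density[of "%y. rho (x - y)" lborel "brep u"] rho(2) by simp
  qed
  have "(\<integral>\<^sup>+x. ennreal ((cv rho u x)\<^sup>2) \<partial>lborel) <= (\<integral>\<^sup>+x. \<integral>\<^sup>+y. ennreal (rho (x - y)) * ennreal ((brep u y)\<^sup>2) \<partial>lborel \<partial>lborel)"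
    by (intro nn_integral_mono pt)
  also have "... = (\<integral>\<^sup>+y. \<integral>\<^sup>+x. ennreal (rho (x - y)) * ennreal ((brep u y)\<^sup>2) \<partial>lborel \<partial>lborel)"
    by (rule lborel_pair.Fubini'[symmetric]) (simp add: case_prod_beta')
  also have "... = (\<integral>\<^sup>+y. ennreal ((brep u y)\<^sup>2) \<partial>lborel)"
  proof (rule nn_integral_cong)
    fix y
    have "(\<integral>\<^sup>+x. ennreal (rho (x - y)) \<partial>lborel) = 1"
      using nn_integral_translation[of "%x. ennreal (rho x)" "- y"] rho(3) by simp
    then show "(\<integral>\<^sup>+x. ennreal (rho (x - y)) * ennreal ((brep u y)\<^sup>2) \<partial>lborel) = ennreal ((brep u y)\<^sup>2)"
      by (simp add: nn_integral_multc)
  qed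
  also have "... = ennreal ((norm u)\<^sup>2)" using lborel_nn_norm_mk[of "brep u"] by simp
  finally show "sqint (cv rho u)" "norm (mk (cv rho u)) <= norm u" using norm_mk_le[of "cv rho u" "norm u"] by auto
qed

text \<open>The difference is an average of translation differences by vectors of length at most
  eps, each controlled by \<open>translation_test\<close>.\<close>

lemma cv_diff_test:
  assumes rho: "rho \<in> test_functions \<Omega>" "!!y. rho y >= 0" "(\<integral>\<^sup>+y. ennreal (rho y) \<partial>lborel) = 1"
    and supp: "!!y. rho y ~= 0 ==> norm y <= eps" and eps: "eps >= 0" and eta: "eta \<in> test_functions \<Omega>'"
  shows "norm (mk (cv rho (mk eta)) - mk eta) <= eps * norm (grd eta)"
proof -
  note [measurable] = test_integrable(3)[OF rho(1)] test_integrable(3)[OF eta] cv_meas[OF rho(1)]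
  have i1: "(LINT y|lborel. rho y) = 1"
    using rho by (simp add: integral_eq_nn_integral)
  have pt: "ennreal ((cv rho (mk eta) x - eta x)\<^sup>2) <= (\<integral>\<^sup>+y. ennreal (rho y) * ennreal ((eta (x - y) - eta x)\<^sup>2) \<partial>lborel)" for x
  proof -
    have "cv rho (mk eta) x = (LINT y|lebesgue. eta y * rho (x - y))"
      unfolding cv_def using test_sqint[OF test_reflect(1)[OF rho(1)]] eta by (simp add: inner_mk)
    also have "... = (LINT y|lborel. eta y * rho (x - y))" by (rule integral_completion) measurable
    also have "... = (LINT y|lborel. eta (x - y) * rho y)"
      using lborel_integral_reflect[of "%y. eta y * rho (x - y)" x] by simp
    finally have "cv rho (mk eta) x - eta x = (LINT y|lborel. eta (x - y) * rho y) - eta x * (LINT y|lborel. rho y)" using i1 by simp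
    also have "... = (LINT y|lborel. eta (x - y) * rho y - eta x * rho y)"
    proof -
      have "integrable lborel (%y. rho y * eta (x - y))"
        by (rule test_integrable(1)[OF test_mult[OF test_smooth[OF rho(1)] test_reflect(1)[OF eta]]])
      then show ?thesis using test_integrable(1)[OF rho(1)] by (simp add: mult.commute)
    qed
    finally have "cv rho (mk eta) x - eta x = (LINT y|lborel. (eta (x - y) - eta x) * rho y)" by (simp add: left_diff_distrib)
    then show ?thesis using jensen_density[of rho lborel "%y. eta (x - y) - eta x"] rho by simp
  qed
  have "(\<integral>\<^sup>+x. ennreal ((cv rho (mk eta) x - eta x)\<^sup>2) \<partial>lborel) <= (\<integral>\<^sup>+x. \<integral>\<^sup>+y. ennreal (rho y) * ennreal ((eta (x - y) - eta x)\<^sup>2) \<partial>lborel \<partial>lborel)"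
    by (intro nn_integral_mono pt)
  also have "... = (\<integral>\<^sup>+y. \<integral>\<^sup>+x. ennreal (rho y) * ennreal ((eta (x - y) - eta x)\<^sup>2) \<partial>lborel \<partial>lborel)"
    by (rule lborel_pair.Fubini'[symmetric]) (simp add: case_prod_beta')
  also have "... <= (\<integral>\<^sup>+y. ennreal (rho y) * ennreal ((eps * norm (grd eta))\<^sup>2) \<partial>lborel)"
  proof (rule nn_integral_mono)
    fix y
    show "(\<integral>\<^sup>+x. ennreal (rho y) * ennreal ((eta (x - y) - eta x)\<^sup>2) \<partial>lborel) <= ennreal (rho y) * ennreal ((eps * norm (grd eta))\<^sup>2)"
    proof (cases "rho y = 0")
      case False
      have s: "sqint (%x. eta (- y + x))" by (rule norm_translate(1)) (use eta in auto)
      have "(\<integral>\<^sup>+x. ennreal ((eta (x - y) - eta x)\<^sup>2) \<partial>lborel) = ennreal ((norm (mk (%x. eta (- y + x) - eta x)))\<^sup>2)"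
        using lborel_nn_norm_mk[of "%x. eta (- y + x) - eta x"] s eta by (simp add: sqint_diff)
      also have "mk (%x. eta (- y + x) - eta x) = shf (- y) (mk eta) - mk eta"
        using s eta by (simp add: shf_mk test_integrable mk_diff)
      also have "ennreal ((norm (shf (- y) (mk eta) - mk eta))\<^sup>2) <= ennreal ((eps * norm (grd eta))\<^sup>2)"
      proof (intro ennreal_leI power_mono norm_ge_zero)
        have "norm (shf (- y) (mk eta) - mk eta) <= norm (- y) * norm (grd eta)" by (rule translation_test[OF eta])
        also have "... <= eps * norm (grd eta)" using supp[OF False] by (intro mult_right_mono) auto
        finally show "norm (shf (- y) (mk eta) - mk eta) <= eps * norm (grd eta)" .
      qed
      finally show ?thesis by (subst nn_integral_cmult) (auto intro: mult_left_mono)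
    qed simp
  qed
  also have "... = ennreal ((eps * norm (grd eta))\<^sup>2)" by (simp add: nn_integral_multc rho(3))
  finally have le: "(\<integral>\<^sup>+x. ennreal ((cv rho (mk eta) x - eta x)\<^sup>2) \<partial>lborel) <= ennreal ((eps * norm (grd eta))\<^sup>2)" .
  have "norm (mk (%x. cv rho (mk eta) x - eta x)) <= eps * norm (grd eta)" by (rule norm_mk_le(2)[OF _ le]) (use eps in auto)
  then show ?thesis using cv_l2(1)[OF rho] eta by (simp add: mk_diff)
qed

lemma cv_linear:
  fixes rho :: "real^'n::finite => real"
  assumes rho: "rho \<in> test_functions \<Omega>" "!!y. rho y >= 0" "(\<integral>\<^sup>+y. ennreal (rho y) \<partial>lborel) = 1"
  shows "bounded_linear (%u. mk (cv rho u))"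
proof (rule bounded_linear_intro)
  fix u v :: "(real^'n) l2" and r :: real
  have "cv rho (u + v) = (%x. cv rho u x + cv rho v x)" by (simp add: cv_def inner_add_left fun_eq_iff)
  then show "mk (cv rho (u + v)) = mk (cv rho u) + mk (cv rho v)" using cv_l2(1)[OF rho] by (simp add: mk_add)
  have "cv rho (r *\<^sub>R u) = (%x. r * cv rho u x)" by (simp add: cv_def fun_eq_iff)
  then show "mk (cv rho (r *\<^sub>R u)) = r *\<^sub>R mk (cv rho u)" using cv_l2(1)[OF rho] by (simp add: mk_cmult)
  show "norm (mk (cv rho u)) <= norm u * 1" using cv_l2(2)[OF rho] by simp
qed

text \<open>The support lies in the ball of radius eps around 0 but may sit on one side of it, so
  kernels that push supports in a direction are included.\<close>

definition mollifier :: "real => (real^'n::finite => real) => bool"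
  where "mollifier eps rho \<longleftrightarrow> rho \<in> test_functions UNIV & (\<forall>y. rho y >= 0) &
    (\<integral>\<^sup>+y. ennreal (rho y) \<partial>lborel) = 1 & (\<forall>y. rho y ~= 0 --> norm y <= eps)"

lemma smooth_fun_norm_sq: "smooth_fun (%x::real^'n::finite. (norm (x - a))\<^sup>2)"
proof -
  have "(%x::real^'n. (norm (x - a))\<^sup>2) = (%x. \<Sum>i\<in>UNIV. (x $ i - a $ i) * (x $ i - a $ i))"
    unfolding norm_vec_sq by (simp add: power2_eq_square fun_eq_iff)
  then show ?thesis
    by (simp only:) (intro smooth_fun_sum smooth_fun_mult smooth_fun_diff smooth_fun_coord smooth_fun_const)
qed

definition ball_bump :: "real^'n::finite => real => real^'n => real"
  where "ball_bump a r x = bmp (r\<^sup>2 - (norm (x - a))\<^sup>2)"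

lemma ball_bump:
  fixes a :: "real^'n::finite"
  assumes "r > 0"
  shows "smooth_fun (ball_bump a r)" "0 <= ball_bump a r x" "x \<in> ball a r ==> 0 < ball_bump a r x"
    "x \<notin> ball a r ==> ball_bump a r x = 0"
proof -
  show "smooth_fun (ball_bump a r)"
    unfolding ball_bump_def[abs_def] by (intro smooth_fun_bmp smooth_fun_diff smooth_fun_const smooth_fun_norm_sq)
  show "0 <= ball_bump a r x" unfolding ball_bump_def by (rule bmp_nonneg)
  show "0 < ball_bump a r x" if "x \<in> ball a r"
    unfolding ball_bump_def
  proof (rule bmp_pos)
    have "norm (x - a) < r" using that by (simp add: dist_norm norm_minus_commute)
    then have "(norm (x - a))\<^sup>2 < r\<^sup>2" by (intro power_strict_mono) auto
    then show "0 < r\<^sup>2 - (norm (x - a))\<^sup>2" by simp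
  qed
  show "ball_bump a r x = 0" if "x \<notin> ball a r"
    unfolding ball_bump_def
  proof (rule bmp_nonpos)
    have "r <= norm (x - a)" using that by (simp add: dist_norm norm_minus_commute)
    then have "r\<^sup>2 <= (norm (x - a))\<^sup>2" using assms by (intro power_mono) auto
    then show "r\<^sup>2 - (norm (x - a))\<^sup>2 <= 0" by simp
  qed
qed

lemma ball_bump_test:
  assumes "r > 0" "cball a r \<subseteq> \<Omega>" shows "ball_bump a r \<in> test_functions \<Omega>"
  by (rule test_functionsI[OF ball_bump(1)[OF assms(1)] compact_cball assms(2)])
    (use ball_bump(4)[OF assms(1)] ball_subset_cball in blast)

lemma mollifier_exists:
  assumes "eps > 0" shows "\<exists>rho :: real^'n::finite => real. mollifier eps rho"
proof -
  let ?b = "ball_bump (0::real^'n) eps"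
  have b: "?b \<in> test_functions UNIV" by (rule ball_bump_test[OF assms]) simp
  note [measurable] = test_integrable(3)[OF b]
  define c where "c = (LINT x|lborel. ?b x)"
  have nn: "(\<integral>\<^sup>+x. ennreal (?b x) \<partial>lborel) = ennreal c"
    unfolding c_def by (rule nn_integral_eq_integral[OF test_integrable(1)[OF b]]) (simp add: ball_bump(2)[OF assms])
  have c0: "c >= 0" unfolding c_def by (rule integral_nonneg_AE) (simp add: ball_bump(2)[OF assms])
  have "c ~= 0"
  proof
    assume "c = 0"
    then have "(\<integral>\<^sup>+x. ennreal (?b x) \<partial>lborel) = 0" using nn by simp
    then have "AE x in lborel. ennreal (?b x) = 0" by (subst (asm) nn_integral_0_iff_AE) simp_all
    then have "AE x in lborel. x \<notin> ball (0::real^'n) eps"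
    proof eventually_elim
      case (elim x)
      then show ?case using ball_bump(3)[OF assms, of x 0] by (auto simp: ennreal_eq_0_iff)
    qed
    then have "ball (0::real^'n) eps \<in> null_sets lborel" by (subst AE_iff_null_sets) auto
    then have "negligible (ball (0::real^'n) eps)" by (simp add: negligible_iff_null_sets null_sets_completionI)
    then show False using open_not_negligible[of "ball (0::real^'n) eps"] assms by auto
  qed
  then have c: "c > 0" using c0 by simp
  define rho where "rho x = (1 / c) * ?b x" for x
  have "mollifier eps rho"
    unfolding mollifier_def
  proof (intro conjI allI impI)
    show "rho \<in> test_functions UNIV" unfolding rho_def by (rule test_cmult[OF b])
    show "0 <= rho y" for y unfolding rho_def by (intro mult_nonneg_nonneg ball_bump(2)[OF assms]) (use c in auto)
    have "(\<integral>\<^sup>+y. ennreal (rho y) \<partial>lborel) = (\<integral>\<^sup>+y. ennreal (1 / c) * ennreal (?b y) \<partial>lborel)"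
      unfolding rho_def by (intro nn_integral_cong ennreal_mult ball_bump(2)[OF assms]) (use c in auto)
    also have "... = ennreal (1 / c) * ennreal c" unfolding nn[symmetric] by (rule nn_integral_cmult) measurable
    finally have "(\<integral>\<^sup>+y. ennreal (rho y) \<partial>lborel) = ennreal (1 / c) * ennreal c" .
    then show "(\<integral>\<^sup>+y. ennreal (rho y) \<partial>lborel) = 1" using c by (simp add: ennreal_mult[symmetric])
    show "norm y <= eps" if "rho y ~= 0" for y
      using that ball_bump(4)[OF assms, of y 0] by (force simp: rho_def)
  qed
  then show ?thesis by blast
qed

lemma mollifierD:
  assumes "mollifier eps rho"
  shows "rho \<in> test_functions UNIV" "!!y. rho y >= 0" "(\<integral>\<^sup>+y. ennreal (rho y) \<partial>lborel) = 1"
    "!!y. rho y ~= 0 ==> norm y <= eps"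
  using assms by (auto simp: mollifier_def)

text \<open>The error is controlled by the gradient alone, hence uniformly on bounded subsets of
  \<open>Sob\<close>, as \<open>rellich\<close> requires.\<close>

lemma mollify_Sob:
  assumes "mollifier eps rho" "eps >= 0" "U \<in> Sob \<Omega>"
  shows "norm (mk (cv rho (fst U)) - fst U) <= eps * norm (snd U)"
proof (rule Sob_induct_le[OF assms(3), where f = "%U. norm (mk (cv rho (fst U)) - fst U)"])
  show "norm (mk (cv rho (fst (jet eta))) - fst (jet eta)) <= eps * norm (snd (jet eta))"
    if "eta \<in> test_functions \<Omega>" for eta
    using cv_diff_test[OF mollifierD[OF assms(1)] assms(2) that] by (simp add: jet_def)
  show "continuous_on UNIV (%U. norm (mk (cv rho (fst U)) - fst U))"
    by (intro continuous_on_norm continuous_on_diff continuous_on_fst continuous_on_id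
        bounded_linear.continuous_on[OF cv_linear[OF mollifierD(1,2,3)[OF assms(1)]]])
qed (intro continuous_intros)

lemma norm_add_diff_le: "norm (a + b - c) <= norm a + norm b + norm (c :: 'b::real_normed_vector)"
  using norm_triangle_ineq4[of "a + b" c] norm_triangle_ineq[of a b] by linarith

lemma mollify_tendsto:
  fixes u :: "(real^'n::finite) l2"
  assumes m: "!!k. mollifier (e k) (rho k)" and e: "e \<longlonglongrightarrow> 0" "!!k. e k >= 0"
  shows "(%k. mk (cv (rho k) u)) \<longlonglongrightarrow> u"
proof (rule LIMSEQ_I)
  fix r :: real assume r: "r > 0"
  obtain eta where eta: "eta \<in> test_functions UNIV" "norm (u - mk eta) < r / 3"
    using test_dense[of u] r unfolding closure_approachable by (auto simp: dist_norm norm_minus_commute dest!: spec[of _ "r / 3"])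
  have "(%k. e k * norm (grd eta)) \<longlonglongrightarrow> 0" by (intro tendsto_mult_left_zero e)
  from LIMSEQ_D[OF this, of "r / 3"] r
  obtain N where N: "!!k. k >= N ==> norm (e k * norm (grd eta) - 0) < r / 3" by auto
  have "norm (mk (cv (rho k) u) - u) < r" if k: "k >= N" for k
  proof -
    interpret L: bounded_linear "%u. mk (cv (rho k) u)" by (rule cv_linear[OF mollifierD(1,2,3)[OF m]])
    have "mk (cv (rho k) u) - u = mk (cv (rho k) (u - mk eta)) + (mk (cv (rho k) (mk eta)) - mk eta) - (u - mk eta)"
      by (simp add: L.diff)
    then have "norm (mk (cv (rho k) u) - u) <= norm (mk (cv (rho k) (u - mk eta))) + norm (mk (cv (rho k) (mk eta)) - mk eta) + norm (u - mk eta)"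
      by (simp only: norm_add_diff_le)
    moreover have "norm (mk (cv (rho k) (u - mk eta))) <= norm (u - mk eta)" by (rule cv_l2(2)[OF mollifierD(1,2,3)[OF m]])
    moreover have "norm (mk (cv (rho k) (mk eta)) - mk eta) <= e k * norm (grd eta)"
      by (rule cv_diff_test[OF mollifierD[OF m] e(2) eta(1)])
    moreover have "e k * norm (grd eta) < r / 3" using N[OF k] by simp
    ultimately show ?thesis using eta(2) by linarith
  qed
  then show "\<exists>N. \<forall>k\<ge>N. norm (mk (cv (rho k) u) - u) < r" by blast
qed

section \<open>Compactness and integrability\<close>

lemma separated_sequence:
  fixes A :: "'b::metric_space set"
  assumes ass: "!!k. finite k ==> \<not> A \<subseteq> (\<Union>x\<in>k. ball x e)"
  shows "\<exists>X :: nat => 'b. (\<forall>n. X n \<in> A) & (\<forall>m n. m < n --> e <= dist (X m) (X n))"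
proof -
  let ?Q = "%x n r. r \<in> A & (\<forall>m<(n::nat). \<not> (dist (x m) r < e))"
  have "\<exists>x. \<forall>n::nat. ?Q x n (x n)"
  proof (rule dependent_wellorder_choice)
    fix n x assume "!!y. y < n ==> ?Q x y (x y)"
    have "\<not> A \<subseteq> (\<Union>x\<in>x ` {0..<n}. ball x e)" by (rule ass) simp
    then obtain z where "z \<in> A" "z \<notin> (\<Union>x\<in>x ` {0..<n}. ball x e)" by blast
    then show "\<exists>r. ?Q x n r" by auto
  qed simp
  then obtain x where "\<forall>n::nat. ?Q x n (x n)" by blast
  then show ?thesis by (intro exI[of _ x]) (auto simp: not_less)
qed

text \<open>If the image were not totally bounded, it would contain an e-separated sequence.
  Mollified at a scale where the error is at most e / 4, the sequence becomes uniformly bounded,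
  equi-Lipschitz and supported in one ball, so by Arzela-Ascoli two of its members come within e / 4
  in L2. Their originals are then closer than e.\<close>

lemma rellich:
  fixes \<Omega> :: "(real^'n::finite) set"
  assumes \<Omega>: "open \<Omega>" "bounded \<Omega>"
  shows "compact (closure (fst ` (Sob \<Omega> \<inter> cball 0 R)))"
proof -
  define A where "A = fst ` (Sob \<Omega> \<inter> cball 0 R)"
  have \<Omega>m: "\<Omega> \<in> sets lebesgue" using \<Omega>(1) by simp
  have net: "\<exists>k. finite k & A \<subseteq> (\<Union>x\<in>k. ball x e)" if e: "e > 0" for e
  proof (rule ccontr)
    assume "\<not> ?thesis"
    then have nf: "\<not> A \<subseteq> (\<Union>x\<in>k. ball x e)" if "finite k" for k using that by simp
    have "\<exists>X :: nat => _. (\<forall>n. X n \<in> A) & (\<forall>m n. m < n --> e <= dist (X m) (X n))"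
      by (rule separated_sequence) (rule nf)
    then obtain X :: "nat => (real^'n) l2" where "(\<forall>n. X n \<in> A) & (\<forall>m n. m < n --> e <= dist (X m) (X n))"
      by (rule exE)
    note X = this[THEN conjunct1, rule_format] this[THEN conjunct2, rule_format]
    have "\<exists>V. V \<in> Sob \<Omega> & norm V <= R & X n = fst V" for n
    proof -
      obtain V where "V \<in> Sob \<Omega> \<inter> cball 0 R" "X n = fst V" using X(1)[of n] unfolding A_def by (rule imageE)
      then show ?thesis by (intro exI[of _ V]) simp
    qed
    then have "\<exists>U. \<forall>n. U n \<in> Sob \<Omega> & norm (U n) <= R & X n = fst (U n)"
      by (intro choice allI)
    then obtain U where U: "!!n. U n \<in> Sob \<Omega>" "!!n. norm (U n) <= R" "!!n. X n = fst (U n)" by blast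
    have R0: "R >= 0" using U(2)[of 0] norm_ge_zero order_trans by blast
    \<comment> \<open>Gives the mollification error eps R <= e / 4; the 1 keeps the denominator
      positive when R = 0.\<close>
    define eps where "eps = e / (4 * (R + 1))"
    have eps: "eps > 0" "eps * R <= e / 4"
    proof -
      show "eps > 0" using e R0 by (simp add: eps_def)
      have "eps * R <= eps * (R + 1)" using \<open>eps > 0\<close> by simp
      also have "... = e / 4" using R0 by (simp add: eps_def field_simps)
      finally show "eps * R <= e / 4" .
    qed
    obtain rho :: "real^'n => real" where m: "mollifier eps rho" using mollifier_exists[OF eps(1)] by blast
    note rho = mollifierD[OF m]
    obtain R1 where R1: "!!x. x \<in> \<Omega> ==> norm x <= R1" using \<Omega>(2) by (auto simp: bounded_iff)
    define S where "S = cball (0::real^'n) (R1 + eps)"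
    define F where "F n = cv rho (X n)" for n
    have nX: "norm (X n) <= R" for n
      using norm_fst_le[of "fst (U n)" "snd (U n)"] U(2)[of n] U(3)[of n] by simp
    have nD: "norm (snd (U n)) <= R" for n
      using norm_snd_le[of "snd (U n)" "fst (U n)"] U(2)[of n] by simp
    have Foff: "F n x = 0" if "x \<notin> S" for n x
    proof -
      have "(%y. indicator \<Omega> y * rho (x - y)) = (%y. 0)"
      proof
        fix y
        have "rho (x - y) = 0" if "y \<in> \<Omega>"
        proof (rule ccontr)
          assume "rho (x - y) ~= 0"
          then have "norm (x - y) <= eps" by (rule rho(4))
          then have "norm x <= R1 + eps" using R1[OF that] norm_triangle_ineq2[of x y] by linarith
          then show False using \<open>x \<notin> S\<close> by (simp add: S_def)
        qed
        then show "indicator \<Omega> y * rho (x - y) = 0" by (auto simp: indicator_def)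
      qed
      then have "Mop (indicator \<Omega>) (mk (%y. rho (x - y))) = 0"
        using Mop_mk[OF bmult_indicator[OF \<Omega>m] test_sqint[OF test_reflect(1)[OF rho(1)]], of x] by simp
      moreover have "F n x = inner (Mop (indicator \<Omega>) (X n)) (mk (%y. rho (x - y)))"
        unfolding F_def cv_def U(3) using Sob_support(1)[OF U(1) \<Omega>m] by simp
      ultimately show ?thesis by (simp add: inner_Mop \<Omega>m)
    qed
    have Fb: "norm (F n x) <= R * norm (mk rho)" for n x
    proof -
      have "norm (F n x) <= norm (X n) * norm (mk rho)" unfolding F_def using cv_bound[OF rho(1)] by simp
      also have "... <= R * norm (mk rho)" by (intro mult_right_mono nX) simp
      finally show ?thesis .
    qed
    define B where "B = (\<Sum>i\<in>(UNIV::'n set). R * norm (mk (partial_deriv i rho)))"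
    have B0: "B >= 0" unfolding B_def using R0 by (intro sum_nonneg) auto
    have dF: "\<bar>partial_deriv i (F n) x\<bar> <= B" for i n x
    proof -
      have "\<bar>partial_deriv i (F n) x\<bar> <= norm (X n) * norm (mk (partial_deriv i rho))"
        unfolding F_def partial_deriv_cv[OF rho(1)] by (rule cv_bound[OF test_partial[OF rho(1)]])
      also have "... <= R * norm (mk (partial_deriv i rho))" by (intro mult_right_mono nX) simp
      also have "... <= B" unfolding B_def by (rule member_le_sum) (use R0 in auto)
      finally show ?thesis .
    qed
    define L where "L = real CARD('n) * B + 1"
    have L: "L > 0" using B0 by (simp add: L_def add_nonneg_pos)
    have lip: "norm (F n x - F n y) <= L * norm (x - y)" for n x y
    proof -
      have "\<bar>F n (y + (x - y)) - F n y\<bar> <= real CARD('n) * B * norm (x - y)"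
        by (rule test_difference_bound) (use smooth_cv[OF rho(1)] dF in \<open>auto simp: F_def\<close>)
      also have "... <= L * norm (x - y)" by (intro mult_right_mono) (auto simp: L_def)
      finally show ?thesis by simp
    qed
    obtain g k where gk: "strict_mono (k :: nat => nat)"
      "!!d. 0 < d ==> \<exists>N. \<forall>n x. n >= N & x \<in> S --> norm (F (k n) x - g x) < d"
    proof (rule Arzela_Ascoli[of S F "R * norm (mk rho)"])
      show "compact S" by (simp add: S_def)
      show "norm (F n x) <= R * norm (mk rho)" for n x by (rule Fb)
      fix x and d :: real assume "0 < d"
      then show "\<exists>d'. 0 < d' & (\<forall>n y. y \<in> S & norm (x - y) < d' --> norm (F n x - F n y) < d)"
      proof (intro exI[of _ "d / L"] conjI allI impI)
        show "0 < d / L" using L \<open>0 < d\<close> by simp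
        fix n y assume "y \<in> S & norm (x - y) < d / L"
        then have "L * norm (x - y) < d" using L by (simp add: field_simps)
        then show "norm (F n x - F n y) < d" using lip[of n x y] by linarith
      qed
    qed (rule that)
    define I where "I = norm (mk (indicator S) :: (real^'n) l2)"
    have I0: "I >= 0" by (simp add: I_def)
    \<comment> \<open>Two members within d of the uniform limit on \<open>S\<close> differ there by
      at most 2 d, that is by at most e / 4 in L2, where I is the norm of the indicator of
      \<open>S\<close>.\<close>
    define d where "d = e / (8 * (I + 1))"
    have d: "d > 0" using e I0 by (simp add: d_def)
    have dI: "2 * d * I <= e / 4"
    proof -
      have "2 * d * I <= 2 * d * (I + 1)" using d by simp
      also have "... = e / 4" using I0 by (simp add: d_def field_simps)
      finally show ?thesis .
    qed
    obtain N where N: "!!n x. n >= N ==> x \<in> S ==> norm (F (k n) x - g x) < d" using gk(2)[OF d] by blast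
    let ?a = "k N" and ?b = "k (Suc N)"
    have sS: "sqint (indicator S :: real^'n => real)" unfolding S_def by (rule sqint_indicator_cball)
    have sF: "sqint (F n)" for n unfolding F_def by (rule cv_l2(1)[OF rho(1,2,3)])
    have "norm (mk (%x. F ?a x - F ?b x)) <= norm (mk (%x. 2 * d * indicator S x))"
    proof (rule norm_mk_mono[OF sqint_cmult[OF sS] sqint_meas[OF sqint_diff[OF sF sF]]], rule AE_I2)
      fix x
      show "\<bar>F ?a x - F ?b x\<bar> <= \<bar>2 * d * indicator S x\<bar>"
      proof (cases "x \<in> S")
        case True
        then show ?thesis using N[of N x] N[of "Suc N" x] d by simp
      qed (simp add: Foff)
    qed
    also have "... = 2 * d * I" using mk_cmult[OF sS, of "2 * d"] d by (simp add: I_def flip: mk_cmult[OF sS])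
    finally have ab: "norm (mk (F ?a) - mk (F ?b)) <= e / 4" using dI sF by (simp add: mk_diff)
    have near: "norm (mk (F n) - X n) <= e / 4" for n
    proof -
      have "norm (mk (F n) - X n) <= eps * norm (snd (U n))"
        unfolding F_def U(3) by (rule mollify_Sob[OF m _ U(1)]) (use eps in simp)
      also have "... <= eps * R" using eps(1) by (intro mult_left_mono nD) simp
      finally show ?thesis using eps(2) by linarith
    qed
    have "X ?a - X ?b = (mk (F ?a) - mk (F ?b)) + (mk (F ?b) - X ?b) - (mk (F ?a) - X ?a)" by simp
    then have "norm (X ?a - X ?b) <= norm (mk (F ?a) - mk (F ?b)) + norm (mk (F ?b) - X ?b) + norm (mk (F ?a) - X ?a)"
      by (simp only: norm_add_diff_le)
    then have "norm (X ?a - X ?b) < e" using ab near[of ?a] near[of ?b] e by linarith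
    moreover have "?a < ?b" using gk(1) by (simp add: strict_mono_Suc_iff)
    ultimately show False using X(2)[of ?a ?b] by (simp add: dist_norm)
  qed
  show ?thesis
    unfolding A_def[symmetric] compact_eq_totally_bounded complete_eq_closed
  proof (intro conjI allI impI)
    fix e :: real assume "e > 0"
    from net[OF half_gt_zero[OF \<open>e > 0\<close>]]
    obtain k where kk: "finite k & A \<subseteq> (\<Union>x\<in>k. ball x (e / 2))" ..
    note k = conjunct1[OF kk] conjunct2[OF kk]
    have "closure A \<subseteq> (\<Union>x\<in>k. cball x (e / 2))"
    proof (rule closure_minimal)
      show "A \<subseteq> (\<Union>x\<in>k. cball x (e / 2))" by (rule order_trans[OF k(2)]) (intro UN_mono order_refl ball_subset_cball)
      show "closed (\<Union>x\<in>k. cball x (e / 2))" using k(1) by (intro closed_UN) auto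
    qed
    also have "... \<subseteq> (\<Union>x\<in>k. ball x e)" using \<open>e > 0\<close> by (intro UN_mono) auto
    finally show "\<exists>k. finite k & closure A \<subseteq> (\<Union>x\<in>k. ball x e)" using k(1) by (intro exI[of _ k] conjI)
  qed simp
qed

section \<open>Ladyzhenskaya's inequality on the Sobolev space\<close>

lemma ladyzhenskaya_test:
  fixes eta :: "real^3 => real"
  assumes eta: "eta \<in> test_functions \<Omega>"
  shows "(\<integral>\<^sup>+x. ennreal ((eta x) ^ 4) \<partial>lborel) <= ennreal (16 * norm (mk eta) * norm (grd eta) ^ 3)"
proof -
  have etaU: "eta \<in> test_functions UNIV" by (rule test_mono[OF _ eta]) simp
  define D where "D i = norm (mk (partial_deriv i eta))" for i
  define m where "m = norm (mk eta)"
  define G where "G = norm (grd eta)"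
  have nn: "D i >= 0" "m >= 0" "G >= 0" for i by (auto simp: D_def m_def G_def)
  have G2: "G\<^sup>2 = (D 1)\<^sup>2 + (D 2)\<^sup>2 + (D 3)\<^sup>2"
    by (simp add: G_def grd_def norm_vec_sq sum_3 D_def)
  have e1: "(\<integral>\<^sup>+x. ennreal ((partial_deriv i eta x)\<^sup>2) \<partial>lborel) = ennreal ((D i)\<^sup>2)" for i
    unfolding D_def by (rule lborel_nn_norm_mk[OF test_integrable(3)[OF test_partial[OF eta]] test_sqint[OF test_partial[OF eta]]])
  have e2: "(\<integral>\<^sup>+x. ennreal ((eta x)\<^sup>2) \<partial>lborel) = ennreal (m\<^sup>2)"
    unfolding m_def by (rule lborel_nn_norm_mk[OF test_integrable(3)[OF eta] test_sqint[OF eta]])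
  have "(\<integral>\<^sup>+x. ennreal ((eta x) ^ 4) \<partial>lborel)\<^sup>2 <= 64 * ennreal (m\<^sup>2) * ennreal ((D 3)\<^sup>2) * (ennreal ((D 1)\<^sup>2) + ennreal ((D 2)\<^sup>2))\<^sup>2"
    using ladyzhenskaya_ennreal[OF etaU] unfolding e1 e2 .
  also have "... = ennreal (64 * m\<^sup>2 * (D 3)\<^sup>2 * ((D 1)\<^sup>2 + (D 2)\<^sup>2)\<^sup>2)"
  proof -
    have "(ennreal ((D 1)\<^sup>2) + ennreal ((D 2)\<^sup>2))\<^sup>2 = ennreal (((D 1)\<^sup>2 + (D 2)\<^sup>2)\<^sup>2)"
      by (simp add: ennreal_plus[symmetric] ennreal_power del: ennreal_plus)
    moreover have "(64::ennreal) = ennreal 64" by simp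
    ultimately show ?thesis by (simp only: ennreal_mult[symmetric] zero_le_power2 mult_nonneg_nonneg zero_le_numeral)
  qed
  also have "... <= ennreal ((8 * m * G ^ 3) * (8 * m * G ^ 3))"
  proof (rule ennreal_leI)
    have "(D 3)\<^sup>2 * ((D 1)\<^sup>2 + (D 2)\<^sup>2)\<^sup>2 <= G\<^sup>2 * (G\<^sup>2)\<^sup>2"
      unfolding G2 by (intro mult_mono power_mono) auto
    then have "64 * m\<^sup>2 * ((D 3)\<^sup>2 * ((D 1)\<^sup>2 + (D 2)\<^sup>2)\<^sup>2) <= 64 * m\<^sup>2 * (G\<^sup>2 * (G\<^sup>2)\<^sup>2)"
      by (intro mult_left_mono) auto
    also have "... = (8 * m * G ^ 3) * (8 * m * G ^ 3)" by (simp add: power2_eq_square power3_eq_cube mult_ac)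
    finally show "64 * m\<^sup>2 * (D 3)\<^sup>2 * ((D 1)\<^sup>2 + (D 2)\<^sup>2)\<^sup>2 <= (8 * m * G ^ 3) * (8 * m * G ^ 3)" by (simp add: mult_ac)
  qed
  also have "... = ennreal (8 * m * G ^ 3) * ennreal (8 * m * G ^ 3)" using nn by (intro ennreal_mult) auto
  \<comment> \<open>\<open>ennreal_sq_le\<close> with equal factors: the constant 16 is twice the
    root of 64.\<close>
  finally have "(\<integral>\<^sup>+x. ennreal ((eta x) ^ 4) \<partial>lborel) <= ennreal (8 * m * G ^ 3) + ennreal (8 * m * G ^ 3)"
    by (rule ennreal_sq_le)
  also have "... = ennreal (16 * m * G ^ 3)" using nn by (simp add: ennreal_plus[symmetric] del: ennreal_plus)
  finally show ?thesis by (simp add: m_def G_def)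
qed

text \<open>Fatou's lemma along approximating test functions that converge almost everywhere; the
  right side is continuous in the norms.\<close>

lemma ladyzhenskaya:
  fixes U :: "(real^3) l2 \<times> ((real^3) l2 ^ 3)"
  assumes U: "U \<in> Sob \<Omega>"
  shows "sqint (%x. (rep (fst U) x)\<^sup>2)"
    "(norm (mk (%x. (rep (fst U) x)\<^sup>2)))\<^sup>2 <= 16 * norm (fst U) * norm (snd U) ^ 3"
proof -
  obtain J where J: "!!k. J k \<in> jet ` test_functions \<Omega>" "J \<longlonglongrightarrow> U"
    using U unfolding Sob_def closure_sequential by blast
  then have "\<exists>eta. \<forall>k. eta k \<in> test_functions \<Omega> & J k = jet (eta k)" by (intro choice) auto
  then obtain eta where eta: "!!k. eta k \<in> test_functions \<Omega>" "!!k. J k = jet (eta k)" by blast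
  have lim: "(%k. mk (eta k)) \<longlonglongrightarrow> fst U" "(%k. grd (eta k)) \<longlonglongrightarrow> snd U"
    using tendsto_fst[OF J(2)] tendsto_snd[OF J(2)] by (simp_all add: eta(2) jet_def)
  obtain r where r: "strict_mono r" "AE x in lebesgue. (%n. rep (mk (eta (r n))) x) \<longlonglongrightarrow> rep (fst U) x"
    by (rule l2_tendsto_AE_subseq[OF lim(1)]) (rule that)
  have "AE x in lebesgue. \<forall>n. rep (mk (eta (r n))) x = eta (r n) x"
    unfolding AE_all_countable using rep_mk[OF test_sqint[OF eta(1)]] by blast
  with r(2) have ae: "AE x in lebesgue. (%n. ennreal ((eta (r n) x) ^ 4)) \<longlonglongrightarrow> ennreal ((rep (fst U) x) ^ 4)"
    by eventually_elim (auto intro!: tendsto_intros)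
  define b where "b n = 16 * norm (mk (eta (r n))) * norm (grd (eta (r n))) ^ 3" for n
  have bl: "b \<longlonglongrightarrow> 16 * norm (fst U) * norm (snd U) ^ 3"
    unfolding b_def using LIMSEQ_subseq_LIMSEQ[OF lim(1) r(1)] LIMSEQ_subseq_LIMSEQ[OF lim(2) r(1)]
    by (intro tendsto_intros) (simp_all add: o_def)
  have "(\<integral>\<^sup>+x. ennreal ((rep (fst U) x) ^ 4) \<partial>lebesgue) = (\<integral>\<^sup>+x. liminf (%n. ennreal ((eta (r n) x) ^ 4)) \<partial>lebesgue)"
  proof (rule nn_integral_cong_AE)
    show "AE x in lebesgue. ennreal ((rep (fst U) x) ^ 4) = liminf (%n. ennreal ((eta (r n) x) ^ 4))"
      using ae
    proof eventually_elim
      case (elim x)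
      then show ?case by (rule lim_imp_Liminf[OF trivial_limit_sequentially, symmetric])
    qed
  qed
  also have "... <= liminf (%n. \<integral>\<^sup>+x. ennreal ((eta (r n) x) ^ 4) \<partial>lebesgue)"
    by (rule nn_integral_liminf) (use test_integrable(4)[OF eta(1)] in measurable)
  also have "... <= liminf (%n. ennreal (b n))"
    unfolding b_def using ladyzhenskaya_test[OF eta(1)] by (intro Liminf_mono always_eventually) (simp add: nn_integral_completion)
  also have "... = ennreal (16 * norm (fst U) * norm (snd U) ^ 3)"
    using bl by (intro lim_imp_Liminf tendsto_ennrealI) auto
  finally have le: "(\<integral>\<^sup>+x. ennreal ((rep (fst U) x) ^ 4) \<partial>lebesgue) <= ennreal (16 * norm (fst U) * norm (snd U) ^ 3)" .
  have p: "((rep (fst U) x)\<^sup>2)\<^sup>2 = (rep (fst U) x) ^ 4" for x by simp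
  have im: "(%x. (rep (fst U) x) ^ 4) \<in> borel_measurable lebesgue" by measurable
  have i: "integrable lebesgue (%x. (rep (fst U) x) ^ 4)"
    using im le by (intro integrableI_bounded) (auto simp: le_less_trans power_even_abs)
  show s: "sqint (%x. (rep (fst U) x)\<^sup>2)"
    unfolding sqint_def p by (intro conjI i) measurable
  have "ennreal ((norm (mk (%x. (rep (fst U) x)\<^sup>2)))\<^sup>2) <= ennreal (16 * norm (fst U) * norm (snd U) ^ 3)"
    using nn_norm_mk[OF s] le unfolding p by simp
  then show "(norm (mk (%x. (rep (fst U) x)\<^sup>2)))\<^sup>2 <= 16 * norm (fst U) * norm (snd U) ^ 3"
    by (subst (asm) ennreal_le_iff) auto
qed

section \<open>Second derivatives and tangential fields\<close>

text \<open>The domain is a parameter because \<open>wd UNIV\<close> is stronger than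
  \<open>wd \<Omega>\<close>: it says that the extension by zero stays weakly differentiable across
  the boundary.\<close>

definition wd :: "(real^'n::finite) set => 'n => (real^'n) l2 => (real^'n) l2 => bool"
  where "wd \<Omega> i u g \<longleftrightarrow> (\<forall>eta\<in>test_functions \<Omega>. inner u (mk (partial_deriv i eta)) = - inner g (mk eta))"

definition in_dom :: "(real^'n::finite) set => (real^'n) l2 => bool"
  where "in_dom \<Omega> u \<longleftrightarrow> Mop (indicator \<Omega>) u = u"

text \<open>The Hessian is an explicit component, normalised to vanish outside \<Omega> so that it
  is unique; the relation is then a closed subspace, on which Lax-Milgram applies.\<close>

definition hess :: "(real^'n::finite) set => (real^'n) l2 \<times> ((real^'n) l2 ^ 'n) => ((real^'n) l2 ^ 'n ^ 'n) => bool"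
  where "hess \<Omega> Phi H \<longleftrightarrow> Phi \<in> Sob \<Omega> & (\<forall>i j. wd \<Omega> j (snd Phi $ i) (H $ i $ j) & in_dom \<Omega> (H $ i $ j))"

lemma Mop_diff: "bmult a ==> Mop a (u - v) = Mop a u - Mop a v"
  by (rule linear_diff[OF bounded_linear.linear[OF Mop_linear]])

lemma Mop_addr: "bmult a ==> Mop a (u + v) = Mop a u + Mop a v"
  by (rule linear_add[OF bounded_linear.linear[OF Mop_linear]])

lemma Mop_sumr: "bmult a ==> Mop a (\<Sum>i\<in>I. u i) = (\<Sum>i\<in>I. Mop a (u i))"
  by (rule linear_sum[OF bounded_linear.linear[OF Mop_linear]])

lemma in_dom_eqI:
  fixes g g' :: "(real^'n::finite) l2"
  assumes \<Omega>: "open \<Omega>" and g: "in_dom \<Omega> g" "in_dom \<Omega> g'"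
    and eq: "!!eta. eta \<in> test_functions \<Omega> ==> inner g (mk eta) = inner g' (mk eta)"
  shows "g = g'"
proof -
  have \<Omega>m: "\<Omega> \<in> sets lebesgue" using \<Omega> by simp
  have 1: "AE x in lebesgue. x \<in> \<Omega> --> rep (g - g') x = 0"
    by (rule fundamental_lemma[OF \<Omega>]) (simp add: inner_diff_left eq)
  have "Mop (indicator \<Omega>) (g - g') = g - g'"
    using g by (simp add: in_dom_def Mop_diff \<Omega>m)
  with rep_Mop[OF bmult_indicator[OF \<Omega>m], of "g - g'"]
  have 2: "AE x in lebesgue. rep (g - g') x = indicator \<Omega> x * rep (g - g') x" by simp
  have "AE x in lebesgue. rep (g - g') x = rep 0 x"
    using 1 2 rep_zero
  proof eventually_elim
    case (elim x)
    then show ?case by (cases "x \<in> \<Omega>") auto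
  qed
  then have "g - g' = 0" by (rule l2_eqI)
  then show ?thesis by simp
qed

lemma hess_symmetric:
  assumes \<Omega>: "open \<Omega>" and h: "hess \<Omega> Phi H"
  shows "H $ i $ j = H $ j $ i"
proof (rule in_dom_eqI[OF \<Omega>])
  show "in_dom \<Omega> (H $ i $ j)" "in_dom \<Omega> (H $ j $ i)" using h by (auto simp: hess_def)
  fix eta assume eta: "eta \<in> test_functions \<Omega>"
  have "inner (H $ i $ j) (mk eta) = inner (fst Phi) (mk (partial_deriv i (partial_deriv j eta)))" for i j
  proof -
    have "inner (snd Phi $ i) (mk (partial_deriv j eta)) = - inner (H $ i $ j) (mk eta)"
      using h eta by (auto simp: hess_def wd_def)
    moreover have "inner (fst Phi) (mk (partial_deriv i (partial_deriv j eta))) = - inner (snd Phi $ i) (mk (partial_deriv j eta))"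
      by (rule Sob_weak_deriv[of Phi \<Omega>, OF _ test_partial[OF eta]]) (use h in \<open>simp add: hess_def\<close>)
    ultimately show ?thesis by simp
  qed
  moreover have "partial_deriv i (partial_deriv j eta) = partial_deriv j (partial_deriv i eta)"
    by (rule ext) (rule partial_deriv_symmetric[OF test_smooth[OF eta]])
  ultimately show "inner (H $ i $ j) (mk eta) = inner (H $ j $ i) (mk eta)" by simp
qed

text \<open>For fields tangential to the boundary there is no boundary term in the divergence theorem.\<close>

definition tangential :: "(real^'n::finite) set => ('n => real^'n => real) => bool"
  where "tangential \<Omega> X \<longleftrightarrow> (\<forall>l. X l \<in> test_functions UNIV) &
    (\<forall>g G eta. (\<forall>l. wd \<Omega> l g (G l)) --> in_dom \<Omega> g --> (\<forall>l. in_dom \<Omega> (G l)) --> smooth_fun eta -->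
      (\<Sum>l\<in>UNIV. inner g (mk (partial_deriv l (%x. eta x * X l x)))) = - (\<Sum>l\<in>UNIV. inner (G l) (mk (%x. eta x * X l x))))"

lemma tangential_interior:
  fixes X :: "'n::finite => real^'n => real"
  assumes X: "!!l. X l \<in> test_functions \<Omega>" shows "tangential \<Omega> X"
  unfolding tangential_def
proof (intro conjI allI impI)
  show "X l \<in> test_functions UNIV" for l by (rule test_mono[OF _ X]) simp
  fix g G and eta :: "real^'n => real" assume "\<forall>l. wd \<Omega> l g (G l)" "smooth_fun eta"
  then have "inner g (mk (partial_deriv l (%x. eta x * X l x))) = - inner (G l) (mk (%x. eta x * X l x))" for l
    using test_mult[OF _ X] by (auto simp: wd_def)
  then show "(\<Sum>l\<in>UNIV. inner g (mk (partial_deriv l (%x. eta x * X l x)))) = - (\<Sum>l\<in>UNIV. inner (G l) (mk (%x. eta x * X l x)))"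
    by (simp add: sum_negf)
qed

text \<open>The cutoffs \<open>theta\<close> below are functions of the boundary defining function \<open>b\<close>, so they are
  constant along the field and their gradients drop out.\<close>

lemma tangential_boundary:
  fixes b :: "real^'n::finite => real" and X :: "'n => real^'n => real"
  assumes \<Omega>: "open \<Omega>" "\<Omega> \<inter> ball x0 r = {y \<in> ball x0 r. b y > 0}" and b: "smooth_fun b"
    and X: "!!l. X l \<in> test_functions (ball x0 r)"
    and tang: "!!y. (\<Sum>l\<in>UNIV. X l y * partial_deriv l b y) = 0"
  shows "tangential \<Omega> X"
  unfolding tangential_def
proof (intro conjI allI impI)
  show "X l \<in> test_functions UNIV" for l by (rule test_mono[OF _ X]) simp
  fix g G and eta :: "real^'n => real" assume wd: "\<forall>l. wd \<Omega> l g (G l)" and dom: "in_dom \<Omega> g" "\<forall>l. in_dom \<Omega> (G l)" and eta: "smooth_fun eta"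
  have \<Omega>m: "\<Omega> \<in> sets lebesgue" using \<Omega>(1) by simp
  define Y where "Y l x = eta x * X l x" for l x
  have Y: "Y l \<in> test_functions (ball x0 r)" for l unfolding Y_def by (rule test_mult[OF eta X])
  define theta where "theta m y = bmp (real (Suc m) * b y - 1)" for m y
  have thetas: "smooth_fun (theta m)" for m
    unfolding theta_def by (intro smooth_fun_bmp smooth_fun_diff smooth_fun_cmult smooth_fun_const b)
  have thetad: "partial_deriv l (theta m) y = bmpD 1 (real (Suc m) * b y - 1) * real (Suc m) * partial_deriv l b y" for m l y
  proof -
    have bd: "(bmp has_real_derivative bmpD 1 t) (at t)" for t
    proof -
      have "bmpD 0 = bmp" by (auto simp: bmpD_def bmp_def fun_eq_iff)
      then show ?thesis using bmpD_deriv[of 0 t] by simp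
    qed
    have s: "smooth_fun (%y. real (Suc m) * b y - 1)" by (intro smooth_fun_diff smooth_fun_cmult smooth_fun_const b)
    have "partial_deriv l (%y. real (Suc m) * b y - 1) y = real (Suc m) * partial_deriv l b y"
    proof -
      have "partial_deriv l (%y. real (Suc m) * b y + (- 1)) y = partial_deriv l (%y. real (Suc m) * b y) y + partial_deriv l (%y. - 1) y"
        by (intro partial_deriv_add smooth_fun_differentiable smooth_fun_cmult smooth_fun_const b)
      moreover have "partial_deriv l (%y. real (Suc m) * b y) y = partial_deriv l (%y. real (Suc m)) y * b y + real (Suc m) * partial_deriv l b y"
        by (intro partial_deriv_mult smooth_fun_differentiable smooth_fun_const b)
      ultimately show ?thesis by simp
    qed
    then show ?thesis
      using partial_deriv_compose[OF smooth_fun_differentiable[OF s] bd, of l y] unfolding theta_def[abs_def] by simp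
  qed
  have test: "(%x. theta m x * Y l x) \<in> test_functions \<Omega>" for m l
  proof -
    obtain K where K: "smooth_fun (Y l)" "compact K" "K \<subseteq> ball x0 r" "!!x. x \<notin> K ==> Y l x = 0"
      using test_functionsE[OF Y] by metis
    \<comment> \<open>\<open>theta m\<close> vanishes where (m + 1) b <= 1, so inside the ball its
      support stays away from the boundary of \<Omega>.\<close>
    have cl: "closed {y. real (Suc m) * b y - 1 >= 0}"
      by (intro closed_Collect_le continuous_intros smooth_fun_continuous b)
    show ?thesis
    proof (rule test_functionsI)
      show "smooth_fun (%x. theta m x * Y l x)" by (intro smooth_fun_mult thetas K)
      show "compact (K \<inter> {y. real (Suc m) * b y - 1 >= 0})" by (rule compact_Int_closed[OF K(2) cl])
      show "K \<inter> {y. real (Suc m) * b y - 1 >= 0} \<subseteq> \<Omega>"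
      proof
        fix y assume y: "y \<in> K \<inter> {y. real (Suc m) * b y - 1 >= 0}"
        then have "real (Suc m) * b y > 0" by simp
        then have "b y > 0" by (simp add: zero_less_mult_iff)
        then show "y \<in> \<Omega>" using y K(3) \<Omega>(2) by blast
      qed
      show "theta m y * Y l y = 0" if "y \<notin> K \<inter> {y. real (Suc m) * b y - 1 >= 0}" for y
        using that K(4)[of y] by (auto simp: theta_def bmp_nonpos)
    qed
  qed
  \<comment> \<open>On the ball the cutoffs tend to the indicator of \<Omega>, which u absorbs
    because it vanishes outside \<Omega>.\<close>
  have lim: "(%m. inner u (mk (%x. theta m x * a x))) \<longlonglongrightarrow> inner u (mk a)"
    if u: "in_dom \<Omega> u" and a: "a \<in> test_functions (ball x0 r)" for u a
  proof -
    have az: "a x = 0" if "x \<notin> ball x0 r" for x using a that by (auto elim!: test_functionsE)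
    have "(%m. mk (%x. theta m x * a x)) \<longlonglongrightarrow> mk (%x. indicator \<Omega> x * a x)"
    proof (rule l2_tendsto_dominated(2))
      show "(%x. theta m x * a x) \<in> borel_measurable lebesgue" for m
        by (rule test_integrable(4)[OF test_mult[OF thetas a]])
      show "sqint (%x. \<bar>a x\<bar>)" by (rule sqint_abs[OF test_sqint[OF a]])
      show "(%x. indicator \<Omega> x * a x) \<in> borel_measurable lebesgue"
        by (rule sqint_meas[OF sqint_bmult[OF bmult_indicator[OF \<Omega>m] test_sqint[OF a]]])
      show "AE x in lebesgue. \<bar>theta m x * a x\<bar> <= \<bar>a x\<bar>" for m
      proof (rule AE_I2)
        fix x
        have "\<bar>theta m x\<bar> * \<bar>a x\<bar> <= 1 * \<bar>a x\<bar>"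
          by (intro mult_right_mono) (auto simp: theta_def abs_le_iff bmp_le1 order_trans[OF _ bmp_nonneg])
        then show "\<bar>theta m x * a x\<bar> <= \<bar>a x\<bar>" by (simp add: abs_mult)
      qed
      show "AE x in lebesgue. (%m. theta m x * a x) \<longlonglongrightarrow> indicator \<Omega> x * a x"
      proof (rule AE_I2)
        fix x
        show "(%m. theta m x * a x) \<longlonglongrightarrow> indicator \<Omega> x * a x"
        proof (cases "x \<in> ball x0 r")
          case False
          then show ?thesis by (simp add: az)
        next
          case True
          have "(%m. theta m x) \<longlonglongrightarrow> indicator \<Omega> x"
          proof (cases "b x > 0")
            case False
            then have "real (Suc m) * b x - 1 <= 0" for m
              using mult_nonneg_nonpos[of "real (Suc m)" "b x"] by simp
            moreover have "x \<notin> \<Omega>" using False True \<Omega>(2) by blast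
            ultimately show ?thesis by (simp add: theta_def bmp_nonpos)
          next
            case b0: True
            have "(%m. exp (- (1 / (real (Suc m) * b x - 1)))) \<longlonglongrightarrow> 1" using b0 by real_asymp
            moreover have "\<forall>\<^sub>F m in sequentially. exp (- (1 / (real (Suc m) * b x - 1))) = theta m x"
            proof -
              have "\<forall>\<^sub>F m in sequentially. real (Suc m) * b x - 1 > 0" using b0 by real_asymp
              then show ?thesis by eventually_elim (auto simp: theta_def bmp_def)
            qed
            ultimately have "(%m. theta m x) \<longlonglongrightarrow> 1" by (rule Lim_transform_eventually)
            moreover have "x \<in> \<Omega>" using b0 True \<Omega>(2) by blast
            ultimately show ?thesis by simp
          qed
          then show ?thesis by (intro tendsto_intros)
        qed
      qed
    qed
    then have "(%m. inner u (mk (%x. theta m x * a x))) \<longlonglongrightarrow> inner u (mk (%x. indicator \<Omega> x * a x))"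
      by (intro tendsto_intros)
    also have "mk (%x. indicator \<Omega> x * a x) = Mop (indicator \<Omega>) (mk a)"
      by (rule Mop_mk[OF bmult_indicator[OF \<Omega>m] test_sqint[OF a], symmetric])
    also have "inner u (Mop (indicator \<Omega>) (mk a)) = inner u (mk a)"
      using u inner_Mop[OF bmult_indicator[OF \<Omega>m], of u "mk a"] by (simp add: in_dom_def)
    finally show ?thesis .
  qed
  have step: "(\<Sum>l\<in>UNIV. inner g (mk (%x. theta m x * partial_deriv l (Y l) x))) = - (\<Sum>l\<in>UNIV. inner (G l) (mk (%x. theta m x * Y l x)))" for m
  proof -
    have pd: "partial_deriv l (%x. theta m x * Y l x) x = partial_deriv l (theta m) x * Y l x + theta m x * partial_deriv l (Y l) x" for l x
      by (intro partial_deriv_mult smooth_fun_differentiable thetas test_smooth[OF Y])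
    have z: "(\<Sum>l\<in>UNIV. partial_deriv l (theta m) x * Y l x) = 0" for x
    proof -
      have "(\<Sum>l\<in>UNIV. partial_deriv l (theta m) x * Y l x)
          = bmpD 1 (real (Suc m) * b x - 1) * real (Suc m) * eta x * (\<Sum>l\<in>UNIV. X l x * partial_deriv l b x)"
        by (simp add: thetad Y_def sum_distrib_left sum_distrib_right mult_ac)
      then show ?thesis by (simp add: tang)
    qed
    have t1: "(%x. theta m x * partial_deriv l (Y l) x) \<in> test_functions UNIV" for l
      by (rule test_mono[OF _ test_mult[OF thetas test_partial[OF Y]]]) simp
    have "(\<Sum>l\<in>UNIV. inner g (mk (%x. theta m x * partial_deriv l (Y l) x)))
        = inner g (mk (%x. \<Sum>l\<in>UNIV. theta m x * partial_deriv l (Y l) x))"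
      by (subst mk_sum[symmetric]) (auto simp: inner_sum_right intro: test_sqint[OF t1])
    also have "(%x. \<Sum>l\<in>UNIV. theta m x * partial_deriv l (Y l) x) = (%x. \<Sum>l\<in>UNIV. partial_deriv l (%x. theta m x * Y l x) x)"
      by (simp add: pd sum.distrib z)
    also have "inner g (mk ...) = (\<Sum>l\<in>UNIV. inner g (mk (partial_deriv l (%x. theta m x * Y l x))))"
      by (subst mk_sum[symmetric]) (auto simp: inner_sum_right intro: test_sqint[OF test_partial[OF test]])
    also have "... = (\<Sum>l\<in>UNIV. - inner (G l) (mk (%x. theta m x * Y l x)))"
      using wd test by (intro sum.cong refl) (auto simp: wd_def)
    finally show ?thesis by (simp add: sum_negf)
  qed
  have "(%m. \<Sum>l\<in>UNIV. inner g (mk (%x. theta m x * partial_deriv l (Y l) x))) \<longlonglongrightarrow> (\<Sum>l\<in>UNIV. inner g (mk (partial_deriv l (Y l))))"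
    by (intro tendsto_sum lim dom test_partial Y)
  moreover have "(%m. - (\<Sum>l\<in>UNIV. inner (G l) (mk (%x. theta m x * Y l x)))) \<longlonglongrightarrow> - (\<Sum>l\<in>UNIV. inner (G l) (mk (Y l)))"
    using dom(2) by (intro tendsto_minus tendsto_sum lim Y) auto
  ultimately have "(\<Sum>l\<in>UNIV. inner g (mk (partial_deriv l (Y l)))) = - (\<Sum>l\<in>UNIV. inner (G l) (mk (Y l)))"
    unfolding step by (rule LIMSEQ_unique)
  then show "(\<Sum>l\<in>UNIV. inner g (mk (partial_deriv l (%x. eta x * X l x)))) = - (\<Sum>l\<in>UNIV. inner (G l) (mk (%x. eta x * X l x)))"
    by (simp add: Y_def[abs_def])
qed

text \<open>A function whose zero extension is weakly differentiable lies in \<open>H\<^sup>1\<^sub>0\<close> if its support can be pushed into the domain: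
  mollify with a kernel concentrated near a small multiple of the pushing direction \<open>d\<close>.\<close>

lemma Sob_of_zero_extension:
  fixes w :: "(real^'n::finite) l2"
  assumes \<Omega>: "open \<Omega>" and K: "compact K" and wK: "in_dom K w" "!!j. in_dom K (Dw $ j)"
    and t0: "t0 > 0" and push: "!!t y. 0 < t ==> t < t0 ==> y \<in> K ==> y + t *\<^sub>R d \<in> \<Omega>"
    and zext: "!!j. wd UNIV j w (Dw $ j)"
  shows "(w, Dw) \<in> Sob \<Omega>"
proof -
  have Km: "K \<in> sets lebesgue" using compact_imp_closed[OF K] by simp
  have "\<exists>rho e. mollifier e rho & 0 <= e & e <= (norm d * t0 + 1) / (real k + 2) &
     (\<forall>u. in_dom K u --> cv rho u \<in> test_functions \<Omega>)" for k
  proof -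
    \<comment> \<open>The 2 keeps t below t0 already for k = 0.\<close>
    define t where "t = t0 / (real k + 2)"
    have t: "0 < t" using t0 by (simp add: t_def)
    have "t < t0 / 1" unfolding t_def using t0 by (intro divide_strict_left_mono) auto
    then have t': "t < t0" by simp
    have "compact ((%y. y + t *\<^sub>R d) ` K)" by (intro compact_continuous_image continuous_intros K)
    moreover have "(%y. y + t *\<^sub>R d) ` K \<subseteq> \<Omega>" using push[OF t t'] by auto
    ultimately obtain delta where delta: "delta > 0" "(\<Union>x\<in>(%y. y + t *\<^sub>R d) ` K. ball x delta) \<subseteq> \<Omega>"
      using compact_subset_open_imp_ball_epsilon_subset[OF _ \<Omega>] by metis
    define eps where "eps = min (delta / 2) (1 / (real k + 2))"
    have eps: "eps > 0" "eps < delta" "eps <= 1 / (real k + 2)" using delta(1) by (auto simp: eps_def)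
    obtain rho0 :: "real^'n => real" where m: "mollifier eps rho0" using mollifier_exists[OF eps(1)] by blast
    note rho0 = mollifierD[OF m]
    \<comment> \<open>The kernel is centred at t d: convolving with it moves the support K into an
      eps-neighbourhood of K + t d, which lies in \<Omega>.\<close>
    define rho where "rho z = rho0 (- t *\<^sub>R d + 1 *\<^sub>R z)" for z
    have rhon: "norm (z - t *\<^sub>R d) <= eps" if "rho z ~= 0" for z
      using rho0(4)[of "- t *\<^sub>R d + 1 *\<^sub>R z"] that by (simp add: rho_def)
    have s: "smooth_fun rho" unfolding rho_def by (rule smooth_fun_affine[OF test_smooth[OF rho0(1)]])
    have rhoT: "rho \<in> test_functions UNIV"
      by (rule test_functionsI[OF s, of "cball (t *\<^sub>R d) eps"]) (use rhon in \<open>auto simp: dist_norm norm_minus_commute\<close>)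
    have mol: "mollifier (norm d * t + eps) rho"
      unfolding mollifier_def
    proof (intro conjI allI impI rhoT)
      show "0 <= rho y" for y by (simp add: rho_def rho0)
      show "(\<integral>\<^sup>+y. ennreal (rho y) \<partial>lborel) = 1"
        using nn_integral_translation[of "%y. ennreal (rho0 y)" "- t *\<^sub>R d"] rho0(3) test_integrable(3)[OF rho0(1)] by (simp add: rho_def)
      show "norm y <= norm d * t + eps" if "rho y ~= 0" for y
        using rhon[OF that] norm_triangle_ineq[of "y - t *\<^sub>R d" "t *\<^sub>R d"] t by (simp add: mult.commute)
    qed
    have "cv rho u \<in> test_functions \<Omega>" if u: "in_dom K u" for u
    proof -
      define L where "L = (%p. fst p + snd p) ` (K \<times> cball (t *\<^sub>R d) eps)"
      show ?thesis
      proof (rule test_functionsI[OF smooth_cv[OF rhoT], of L])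
        show "compact L" unfolding L_def
          by (intro compact_continuous_image continuous_intros compact_Times K compact_cball)
        show "L \<subseteq> \<Omega>"
        proof
          fix x assume "x \<in> L"
          then obtain y z where yz: "y \<in> K" "norm (z - t *\<^sub>R d) <= eps" "x = y + z" by (auto simp: L_def dist_norm norm_minus_commute)
          then have "x \<in> ball (y + t *\<^sub>R d) delta" using eps(2) by (simp add: dist_norm norm_minus_commute)
          then show "x \<in> \<Omega>" using delta(2) yz(1) by blast
        qed
        fix x assume x: "x \<notin> L"
        have "(%y. indicator K y * rho (x - y)) = (%y. 0)"
        proof
          fix y
          have "rho (x - y) = 0" if "y \<in> K"
          proof (rule ccontr)
            assume "rho (x - y) ~= 0"
            then have "x - y \<in> cball (t *\<^sub>R d) eps" using rhon by (simp add: dist_norm norm_minus_commute)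
            then have "fst (y, x - y) + snd (y, x - y) \<in> L" unfolding L_def using that by (intro imageI) auto
            then show False using x by simp
          qed
          then show "indicator K y * rho (x - y) = 0" by (auto simp: indicator_def)
        qed
        then have "Mop (indicator K) (mk (%y. rho (x - y))) = 0"
          using Mop_mk[OF bmult_indicator[OF Km] test_sqint[OF test_reflect(1)[OF rhoT]], of x] by simp
        then show "cv rho u x = 0"
          using u inner_Mop[OF bmult_indicator[OF Km], of u "mk (%y. rho (x - y))"] by (simp add: cv_def in_dom_def)
      qed
    qed
    moreover have "norm d * t + eps <= (norm d * t0 + 1) / (real k + 2)"
      using eps(3) by (simp add: t_def add_divide_distrib)
    ultimately show ?thesis using mol t eps(1) by (intro exI[of _ rho] exI[of _ "norm d * t + eps"]) auto
  qed
  then obtain rho e where rho: "!!k. mollifier (e k) (rho k)" "!!k. 0 <= e k" "!!k. e k <= (norm d * t0 + 1) / (real k + 2)"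
    "!!k u. in_dom K u ==> cv (rho k) u \<in> test_functions \<Omega>" by metis
  have e0: "e \<longlonglongrightarrow> 0"
  proof (rule Lim_null_comparison[OF always_eventually])
    show "\<forall>k. norm (e k) <= (norm d * t0 + 1) / (real k + 2)" using rho(2,3) by simp
    show "(%k. (norm d * t0 + 1) / (real k + 2)) \<longlonglongrightarrow> 0" by real_asymp
  qed
  \<comment> \<open>Since w is weakly differentiable on the whole space, mollification commutes with
    differentiation even near the boundary.\<close>
  have j: "jet (cv (rho k) w) = (mk (cv (rho k) w), \<chi> j. mk (cv (rho k) (Dw $ j)))" for k
  proof -
    have rhoT: "rho k \<in> test_functions UNIV" by (rule mollifierD(1)[OF rho(1)])
    have "cv (partial_deriv j (rho k)) w x = cv (rho k) (Dw $ j) x" for j x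
    proof -
      have t: "(%y. rho k (x - y)) \<in> test_functions UNIV" by (rule test_reflect(1)[OF rhoT])
      have "partial_deriv j (%y. rho k (x - y)) = (%y. - partial_deriv j (rho k) (x - y))"
        by (rule ext) (rule test_reflect(2)[OF rhoT])
      then have "mk (partial_deriv j (%y. rho k (x - y))) = - mk (%y. partial_deriv j (rho k) (x - y))"
        using mk_uminus[OF test_sqint[OF test_reflect(1)[OF test_partial[OF rhoT]]]] by simp
      then show ?thesis using zext[of j] t by (force simp: wd_def cv_def)
    qed
    then have "cv (partial_deriv j (rho k)) w = cv (rho k) (Dw $ j)" for j by (rule ext)
    then show ?thesis by (simp add: jet_def grd_def partial_deriv_cv[OF rhoT])
  qed
  have "(%k. jet (cv (rho k) w)) \<longlonglongrightarrow> (w, \<chi> j. Dw $ j)"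
    unfolding j by (intro tendsto_Pair tendsto_vec_lambda mollify_tendsto[OF rho(1) e0 rho(2)])
  moreover have "jet (cv (rho k) w) \<in> Sob \<Omega>" for k by (rule jet_Sob[OF rho(4)[OF wK(1)]])
  ultimately have "(w, \<chi> j. Dw $ j) \<in> Sob \<Omega>"
    using Sob_closed[of \<Omega>, unfolded closed_sequential_limits, rule_format, of "%k. jet (cv (rho k) w)"] by simp
  then show ?thesis by simp
qed

section \<open>The Hessian estimate\<close>

definition field_app :: "('n::finite => real^'n => real) => (real^'n) l2 \<times> ((real^'n) l2 ^ 'n) => (real^'n) l2"
  where "field_app X Phi = (\<Sum>l\<in>UNIV. Mop (X l) (snd Phi $ l))"

text \<open>What the product rule gives for the gradient of X . grad Phi.\<close>

definition field_grad :: "('n::finite => real^'n => real) => (real^'n) l2 \<times> ((real^'n) l2 ^ 'n) =>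
    ((real^'n) l2 ^ 'n ^ 'n) => (real^'n) l2 ^ 'n"
  where "field_grad X Phi H = (\<chi> j. \<Sum>l\<in>UNIV. Mop (partial_deriv j (X l)) (snd Phi $ l) + Mop (X l) (H $ l $ j))"

lemma inner_Mop_mk:
  "bmult a ==> sqint f ==> inner (Mop a u) (mk f) = inner u (mk (%x. a x * f x))"
  by (simp add: inner_Mop Mop_mk)

text \<open>The derivative is established on the whole space. As Phi is weakly differentiable there,
  the indices j and l of the second derivatives of a test function can be exchanged; this leaves a
  divergence along X, where \<open>tangential\<close> excludes a boundary term.\<close>

lemma field_weak_derivative:
  fixes \<Omega> :: "(real^'n::finite) set"
  assumes \<Omega>: "open \<Omega>" and h: "hess \<Omega> Phi H" and t: "tangential \<Omega> X"
  shows "wd UNIV j (field_app X Phi) (field_grad X Phi H $ j)"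
  unfolding wd_def
proof
  fix eta :: "real^'n => real" assume eta: "eta \<in> test_functions UNIV"
  let ?D = "%i. snd Phi $ i"
  have Phi: "Phi \<in> Sob \<Omega>" and wdH: "wd \<Omega> l (?D i) (H $ i $ l)" "in_dom \<Omega> (H $ i $ l)" for i l using h by (auto simp: hess_def)
  have X: "X l \<in> test_functions UNIV" for l using t by (simp add: tangential_def)
  have bX: "bmult (X l)" "bmult (partial_deriv j (X l))" for l by (rule bmult_test[OF X], rule bmult_test[OF test_partial[OF X]])
  have Y: "(%x. eta x * X l x) \<in> test_functions UNIV" for l by (rule test_mult[OF test_smooth[OF eta] X])
  have dom: "in_dom \<Omega> (?D i)" for i using Sob_support(2)[OF Phi] \<Omega> by (simp add: in_dom_def)
  have seta: "sqint eta" "sqint (partial_deriv j eta)" by (rule test_sqint[OF eta], rule test_sqint[OF test_partial[OF eta]])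
  have mk1: "mk (%x. X l x * partial_deriv j eta x) = mk (partial_deriv j (%x. eta x * X l x)) - mk (%x. partial_deriv j (X l) x * eta x)" for l
  proof -
    have "partial_deriv j (%x. eta x * X l x) x = partial_deriv j eta x * X l x + eta x * partial_deriv j (X l) x" for x
      by (intro partial_deriv_mult smooth_fun_differentiable test_smooth[OF eta] test_smooth[OF X])
    then have "(%x. X l x * partial_deriv j eta x) = (%x. partial_deriv j (%x. eta x * X l x) x - partial_deriv j (X l) x * eta x)"
      by (simp add: fun_eq_iff mult.commute)
    then show ?thesis
      using mk_diff[OF test_sqint[OF test_partial[OF Y]] sqint_bmult[OF bX(2) seta(1)]] by simp
  qed
  have swap: "inner (?D l) (mk (partial_deriv j (%x. eta x * X l x))) = inner (?D j) (mk (partial_deriv l (%x. eta x * X l x)))" for l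
  proof -
    have "partial_deriv l (partial_deriv j (%x. eta x * X l x)) = partial_deriv j (partial_deriv l (%x. eta x * X l x))"
      by (rule ext) (rule partial_deriv_symmetric[OF test_smooth[OF Y]])
    then show ?thesis
      using Sob_weak_deriv[OF Phi test_partial[OF Y[of l], of j], of l] Sob_weak_deriv[OF Phi test_partial[OF Y[of l], of l], of j]
      by simp
  qed
  have "(\<Sum>l\<in>UNIV. inner (?D j) (mk (partial_deriv l (%x. eta x * X l x)))) = - (\<Sum>l\<in>UNIV. inner (H $ j $ l) (mk (%x. eta x * X l x)))"
    using t wdH dom test_smooth[OF eta] by (simp add: tangential_def)
  moreover have "inner (field_app X Phi) (mk (partial_deriv j eta)) =
      (\<Sum>l\<in>UNIV. inner (?D j) (mk (partial_deriv l (%x. eta x * X l x)))) - (\<Sum>l\<in>UNIV. inner (?D l) (mk (%x. partial_deriv j (X l) x * eta x)))"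
    by (simp add: field_app_def inner_sum_left inner_Mop_mk[OF bX(1) seta(2)] mk1 inner_diff_right swap sum_subtractf)
  moreover have "inner (field_grad X Phi H $ j) (mk eta) = (\<Sum>l\<in>UNIV. inner (?D l) (mk (%x. partial_deriv j (X l) x * eta x)))
      + (\<Sum>l\<in>UNIV. inner (H $ j $ l) (mk (%x. eta x * X l x)))"
    by (simp add: field_grad_def inner_sum_left inner_add_left inner_Mop_mk[OF bX(1) seta(1)] inner_Mop_mk[OF bX(2) seta(1)]
        sum.distrib hess_symmetric[OF \<Omega> h, of _ j] mult.commute)
  ultimately show "inner (field_app X Phi) (mk (partial_deriv j eta)) = - inner (field_grad X Phi H $ j) (mk eta)" by simp
qed

text \<open>Two integrations by parts turn H l j paired with the j-th derivative of V into H j j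
  paired with the l-th one; derivatives of X form the lower-order remainder. The identity is shown
  for test functions v, which have second derivatives, and then extended to \<open>Sob\<close> by
  density.\<close>

lemma energy_identity:
  fixes \<Omega> :: "(real^'n::finite) set"
  assumes \<Omega>: "open \<Omega>" and h: "hess \<Omega> Phi H" and X: "!!l. X l \<in> test_functions UNIV" and V: "V \<in> Sob \<Omega>"
  shows "(\<Sum>j\<in>UNIV. inner (field_grad X Phi H $ j) (snd V $ j)) =
    (\<Sum>j\<in>UNIV. \<Sum>l\<in>UNIV. inner (Mop (partial_deriv j (X l)) (snd Phi $ l)) (snd V $ j)
       - inner (Mop (partial_deriv l (X l)) (snd Phi $ j)) (snd V $ j)
       + inner (Mop (partial_deriv j (X l)) (snd Phi $ j)) (snd V $ l))
    + (\<Sum>l\<in>UNIV. inner (Mop (X l) (\<Sum>j\<in>UNIV. H $ j $ j)) (snd V $ l))" (is "?f V = ?g V")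
proof (rule Sob_induct_eq[OF V, where f = ?f and g = ?g])
  show "continuous_on UNIV ?f" "continuous_on UNIV ?g" by (intro continuous_intros)+
  fix v assume v: "v \<in> test_functions \<Omega>"
  let ?D = "%i. snd Phi $ i"
  let ?p = partial_deriv
  have wdH: "wd \<Omega> l (?D i) (H $ i $ l)" for i l using h by (auto simp: hess_def)
  have bX: "bmult (X l)" "bmult (?p j (X l))" for l j by (rule bmult_test[OF X], rule bmult_test[OF test_partial[OF X]])
  have sv: "sqint (?p j v)" "sqint (?p i (?p j v))" for i j
    by (rule test_sqint[OF test_partial[OF v]], rule test_sqint[OF test_partial[OF test_partial[OF v]]])
  have parts: "inner (?D j) (mk (%x. ?p i (X l) x * ?p m v x)) + inner (?D j) (mk (%x. X l x * ?p i (?p m v) x))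
     = - inner (H $ j $ i) (mk (%x. X l x * ?p m v x))" for i j l m
  proof -
    have tt: "(%x. X l x * ?p m v x) \<in> test_functions \<Omega>" by (rule test_mult[OF test_smooth[OF X] test_partial[OF v]])
    have "?p i (%x. X l x * ?p m v x) x = ?p i (X l) x * ?p m v x + X l x * ?p i (?p m v) x" for x
      by (intro partial_deriv_mult smooth_fun_differentiable test_smooth[OF X] test_smooth[OF test_partial[OF v]])
    then have e: "?p i (%x. X l x * ?p m v x) = (%x. ?p i (X l) x * ?p m v x + X l x * ?p i (?p m v) x)" by (rule ext)
    have "mk (?p i (%x. X l x * ?p m v x)) = mk (%x. ?p i (X l) x * ?p m v x) + mk (%x. X l x * ?p i (?p m v) x)"
      unfolding e by (rule mk_add[OF sqint_bmult[OF bX(2) sv(1)] sqint_bmult[OF bX(1) sv(2)], symmetric])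
    moreover have "inner (?D j) (mk (?p i (%x. X l x * ?p m v x))) = - inner (H $ j $ i) (mk (%x. X l x * ?p m v x))"
      using wdH tt by (auto simp: wd_def)
    ultimately show ?thesis by (simp add: inner_add_right)
  qed
  have sw: "?p l (?p j v) = ?p j (?p l v)" for l j by (rule ext) (rule partial_deriv_symmetric[OF test_smooth[OF v]])
  have key: "inner (H $ l $ j) (mk (%x. X l x * ?p j v x)) =
     - inner (?D j) (mk (%x. ?p l (X l) x * ?p j v x)) + inner (H $ j $ j) (mk (%x. X l x * ?p l v x))
     + inner (?D j) (mk (%x. ?p j (X l) x * ?p l v x))" for j l
    using parts[of j l l j] parts[of j j l l] sw[of l j] hess_symmetric[OF \<Omega> h, of l j] by simp
  have "?f (jet v) = (\<Sum>j\<in>UNIV. \<Sum>l\<in>UNIV. inner (?D l) (mk (%x. ?p j (X l) x * ?p j v x)) + inner (H $ l $ j) (mk (%x. X l x * ?p j v x)))"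
    by (simp add: field_grad_def jet_def grd_def inner_sum_left inner_add_left inner_Mop_mk[OF bX(1) sv(1)] inner_Mop_mk[OF bX(2) sv(1)])
  also have "... = (\<Sum>j\<in>UNIV. \<Sum>l\<in>UNIV. (inner (?D l) (mk (%x. ?p j (X l) x * ?p j v x))
      - inner (?D j) (mk (%x. ?p l (X l) x * ?p j v x)) + inner (?D j) (mk (%x. ?p j (X l) x * ?p l v x)))
      + inner (H $ j $ j) (mk (%x. X l x * ?p l v x)))"
    unfolding key by (simp add: algebra_simps)
  also have "... = (\<Sum>j\<in>UNIV. \<Sum>l\<in>UNIV. inner (?D l) (mk (%x. ?p j (X l) x * ?p j v x))
      - inner (?D j) (mk (%x. ?p l (X l) x * ?p j v x)) + inner (?D j) (mk (%x. ?p j (X l) x * ?p l v x)))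
      + (\<Sum>l\<in>UNIV. \<Sum>j\<in>UNIV. inner (H $ j $ j) (mk (%x. X l x * ?p l v x)))"
    unfolding sum.distrib[of _ "%j. inner (H $ j $ j) (mk (%x. X _ x * ?p _ v x))"]
    by (subst (3) sum.swap) (simp add: sum.distrib)
  also have "... = ?g (jet v)"
    by (simp add: jet_def grd_def inner_Mop_mk[OF bX(1) sv(1)] inner_Mop_mk[OF bX(2) sv(1)] inner_sum_left)
  finally show "?f (jet v) = ?g (jet v)" .
qed

text \<open>The function w = X . grad Phi is itself in \<open>Sob\<close>, because
  \<open>push\<close> moves its support into \<Omega>. Inserting V = (w, W) into the energy identity
  bounds |W|^2 by C |W| times the norms of gradient and Laplacian, and W differs from the sum of the
  X l H l j only by first-order terms.\<close>

lemma tangential_estimate: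
  fixes \<Omega> :: "(real^'n::finite) set"
  assumes \<Omega>: "open \<Omega>" and t: "tangential \<Omega> X" and K: "compact K" "!!l x. x \<notin> K ==> X l x = 0"
    and t0: "t0 > 0" and push: "!!t y. 0 < t ==> t < t0 ==> y \<in> K \<inter> closure \<Omega> ==> y + t *\<^sub>R d \<in> \<Omega>"
  shows "\<exists>C\<ge>0. \<forall>Phi H. hess \<Omega> Phi H -->
     norm (\<Sum>l\<in>UNIV. Mop (X l) (H $ l $ j)) <= C * (norm (snd Phi) + norm (\<Sum>j\<in>UNIV. H $ j $ j))"
proof -
  have X: "X l \<in> test_functions UNIV" for l using t by (simp add: tangential_def)
  have \<Omega>m: "\<Omega> \<in> sets lebesgue" using \<Omega> by simp
  \<comment> \<open>The compact set that carries products of the fields with functions on \<Omega>,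
    and to which \<open>push\<close> applies.\<close>
  define K' where "K' = K \<inter> closure \<Omega>"
  have K': "compact K'" unfolding K'_def by (intro compact_Int_closed K) simp
  have K'm: "K' \<in> sets lebesgue" using compact_imp_closed[OF K'] by simp
  have bX: "bmult (X l)" "bmult (partial_deriv i (X l))" for l i by (rule bmult_test[OF X], rule bmult_test[OF test_partial[OF X]])
  have "\<exists>B\<ge>0. (\<forall>x. \<bar>X l x\<bar> <= B) & (\<forall>i x. \<bar>partial_deriv i (X l) x\<bar> <= B)" for l
  proof -
    obtain B1 where B1: "B1 >= 0" "!!x i. \<bar>partial_deriv i (X l) x\<bar> <= B1" using test_grad_bound[OF X] by metis
    obtain B2 where B2: "!!x. \<bar>X l x\<bar> <= B2" using bX(1)[of l] by (auto simp: bmult_def)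
    show ?thesis by (intro exI[of _ "max B1 B2"]) (auto simp: B1 B2 le_max_iff_disj)
  qed
  then obtain B0 where B0: "!!l. B0 l >= 0" "!!l x. \<bar>X l x\<bar> <= B0 l" "!!l i x. \<bar>partial_deriv i (X l) x\<bar> <= B0 l" by metis
  define B where "B = (\<Sum>l\<in>UNIV. B0 l)"
  have BB: "B0 l <= B" for l unfolding B_def by (rule member_le_sum) (auto simp: B0)
  have B: "B >= 0" "!!l x. \<bar>X l x\<bar> <= B" "!!l i x. \<bar>partial_deriv i (X l) x\<bar> <= B"
    using B0 BB order_trans by (blast+)
  define n where "n = real CARD('n)"
  \<comment> \<open>Three first-order terms for each of the n^2 index pairs and one Laplacian term
    for each of the n indices, all with coefficients bounded by B.\<close>
  define C1 where "C1 = 3 * (n * (n * B)) + n * B"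
  have C1: "C1 >= 0" using B(1) by (simp add: C1_def n_def)
  have dX: "partial_deriv i (X l) x = 0" if "x \<notin> K" for i l x
    by (rule partial_deriv_off[OF compact_imp_closed[OF K(1)] K(2) that])
  have domMop: "in_dom K' (Mop a u)" if a: "bmult a" "!!x. x \<notin> K ==> a x = 0" and u: "in_dom \<Omega> u" for a u
  proof -
    have "Mop a u = Mop a (Mop (indicator \<Omega>) u)" using u by (simp add: in_dom_def)
    then have e: "Mop a u = Mop (%x. a x * indicator \<Omega> x) u" using Mop_Mop[OF a(1) bmult_indicator[OF \<Omega>m]] by simp
    have "indicator K' x * (a x * indicator \<Omega> x) = a x * indicator \<Omega> x" for x
      using a(2)[of x] closure_subset[of \<Omega>] by (auto simp: indicator_def K'_def)
    then have k: "(%x. indicator K' x * (a x * indicator \<Omega> x)) = (%x. a x * indicator \<Omega> x)" by (rule ext)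
    show ?thesis
      unfolding in_dom_def e Mop_Mop[OF bmult_indicator[OF K'm] bmult_mult[OF a(1) bmult_indicator[OF \<Omega>m]]] k by (rule refl)
  qed
  have domsum: "in_dom K' (\<Sum>i\<in>I. u i)" if "!!i. i \<in> I ==> in_dom K' (u i)" for u and I :: "'n set"
    using that by (simp add: in_dom_def Mop_sumr K'm)
  have domadd: "in_dom K' (u + v)" if "in_dom K' u" "in_dom K' v" for u v
    using that by (simp add: in_dom_def Mop_addr K'm)
  have "norm (\<Sum>l\<in>UNIV. Mop (X l) (H $ l $ j)) <= (C1 + n * B) * (norm (snd Phi) + norm (\<Sum>j\<in>UNIV. H $ j $ j))"
    if h: "hess \<Omega> Phi H" for Phi H
  proof -
    define w where "w = field_app X Phi"
    define W where "W = field_grad X Phi H"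
    define N where "N = norm (snd Phi) + norm (\<Sum>j\<in>UNIV. H $ j $ j)"
    have Phi: "Phi \<in> Sob \<Omega>" and dH: "in_dom \<Omega> (H $ i $ l)" for i l using h by (auto simp: hess_def)
    have dD: "in_dom \<Omega> (snd Phi $ i)" for i using Sob_support(2)[OF Phi \<Omega>m] by (simp add: in_dom_def)
    have "(w, W) \<in> Sob \<Omega>"
    proof (rule Sob_of_zero_extension[OF \<Omega> K' _ _ t0])
      show "in_dom K' w" unfolding w_def field_app_def by (intro domsum domMop bX K dD)
      show "in_dom K' (W $ i)" for i
        unfolding W_def field_grad_def by (simp) (intro domsum domadd domMop bX K dD dH dX)
      show "wd UNIV i w (W $ i)" for i unfolding w_def W_def by (rule field_weak_derivative[OF \<Omega> h t])
      show "y + s *\<^sub>R d \<in> \<Omega>" if "0 < s" "s < t0" "y \<in> K'" for s y using push[of s y] that by (simp add: K'_def)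
    qed
    from energy_identity[where X = X, OF \<Omega> h X this]
    have id: "(\<Sum>i\<in>UNIV. inner (W $ i) (W $ i)) =
      (\<Sum>i\<in>UNIV. \<Sum>l\<in>UNIV. inner (Mop (partial_deriv i (X l)) (snd Phi $ l)) (W $ i)
       - inner (Mop (partial_deriv l (X l)) (snd Phi $ i)) (W $ i)
       + inner (Mop (partial_deriv i (X l)) (snd Phi $ i)) (W $ l))
      + (\<Sum>l\<in>UNIV. inner (Mop (X l) (\<Sum>j\<in>UNIV. H $ j $ j)) (W $ l))"
      by (simp add: W_def[symmetric])
    have ib: "\<bar>inner (Mop a u) (W $ i)\<bar> <= B * N * norm W" if "bmult a" "!!x. \<bar>a x\<bar> <= B" "norm u <= N" for a u i
    proof -
      have "\<bar>inner (Mop a u) (W $ i)\<bar> <= norm (Mop a u) * norm (W $ i)" by (rule Cauchy_Schwarz_ineq2)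
      also have "... <= (B * N) * norm W"
      proof (intro mult_mono norm_comp_le)
        have "norm (Mop a u) <= B * norm u" by (rule Mop_norm[OF that(1,2)])
        also have "... <= B * N" by (intro mult_left_mono that B)
        finally show "norm (Mop a u) <= B * N" .
      qed (use B in \<open>auto simp: N_def\<close>)
      finally show ?thesis .
    qed
    have uN: "norm (snd Phi $ i) <= N" "norm (\<Sum>j\<in>UNIV. H $ j $ j) <= N" for i
      using norm_comp_le[of "snd Phi" i] by (auto simp: N_def intro: order_trans)
    have t3: "inner (Mop (partial_deriv i (X l)) (snd Phi $ l)) (W $ i)
       - inner (Mop (partial_deriv l (X l)) (snd Phi $ i)) (W $ i)
       + inner (Mop (partial_deriv i (X l)) (snd Phi $ i)) (W $ l) <= 3 * (B * N * norm W)" for i l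
      using ib[OF bX(2) B(3) uN(1), of i l l i] ib[OF bX(2) B(3) uN(1), of l l i i] ib[OF bX(2) B(3) uN(1), of i l i l]
      by linarith
    have "(norm W)\<^sup>2 = (\<Sum>i\<in>UNIV. inner (W $ i) (W $ i))" by (simp add: norm_vec_sq power2_norm_eq_inner)
    also have "... <= (\<Sum>i\<in>(UNIV::'n set). \<Sum>l\<in>(UNIV::'n set). 3 * (B * N * norm W)) + (\<Sum>l\<in>(UNIV::'n set). B * N * norm W)"
      unfolding id
    proof (intro add_mono sum_mono t3)
      fix l
      show "inner (Mop (X l) (\<Sum>j\<in>UNIV. H $ j $ j)) (W $ l) <= B * N * norm W"
        using ib[OF bX(1) B(2) uN(2), of l l] by linarith
    qed
    also have "... = C1 * N * norm W" by (simp add: C1_def n_def algebra_simps)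
    finally have "norm W * norm W <= C1 * N * norm W" by (simp add: power2_eq_square)
    moreover have N0: "N >= 0" by (simp add: N_def)
    ultimately have nW: "norm W <= C1 * N"
      using C1 by (cases "norm W = 0") (auto simp: mult_le_cancel_right)
    have "(\<Sum>l\<in>UNIV. Mop (X l) (H $ l $ j)) = W $ j - (\<Sum>l\<in>UNIV. Mop (partial_deriv j (X l)) (snd Phi $ l))"
      by (simp add: W_def field_grad_def sum.distrib)
    then have "norm (\<Sum>l\<in>UNIV. Mop (X l) (H $ l $ j)) <= norm (W $ j) + norm (\<Sum>l\<in>UNIV. Mop (partial_deriv j (X l)) (snd Phi $ l))"
      by (simp add: norm_triangle_ineq4)
    also have "... <= C1 * N + (\<Sum>l\<in>(UNIV::'n set). B * N)"
    proof (intro add_mono order_trans[OF norm_sum] sum_mono)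
      show "norm (W $ j) <= C1 * N" using norm_comp_le[of W j] nW by linarith
      fix l
      have "norm (Mop (partial_deriv j (X l)) (snd Phi $ l)) <= B * norm (snd Phi $ l)" by (rule Mop_norm[OF bX(2) B(3)])
      also have "... <= B * N" by (intro mult_left_mono uN B)
      finally show "norm (Mop (partial_deriv j (X l)) (snd Phi $ l)) <= B * N" .
    qed
    also have "... = (C1 + n * B) * N" by (simp add: n_def algebra_simps)
    finally show ?thesis by (simp add: N_def)
  qed
  moreover have "C1 + n * B >= 0" using C1 B(1) by (simp add: n_def)
  ultimately show ?thesis by blast
qed

text \<open>The constant is uniform in Phi and H. The closure rules below allow linear algebra with
  such estimates in place of individual constants.\<close>

definition ctl :: "(real^'n::finite) set => (((real^'n) l2 ^ 'n ^ 'n) => (real^'n) l2) => bool"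
  where "ctl \<Omega> z \<longleftrightarrow> (\<exists>C\<ge>0. \<forall>Phi H. hess \<Omega> Phi H --> norm (z H) <= C * (norm (snd Phi) + norm (\<Sum>j\<in>UNIV. H $ j $ j)))"

lemma ctl_mono:
  assumes "ctl \<Omega> z" "M >= 0" "!!Phi H. hess \<Omega> Phi H ==> norm (z' H) <= M * norm (z H)"
  shows "ctl \<Omega> z'"
proof -
  obtain C where C: "C >= 0" "!!Phi H. hess \<Omega> Phi H ==> norm (z H) <= C * (norm (snd Phi) + norm (\<Sum>j\<in>UNIV. H $ j $ j))"
    using assms(1) by (auto simp: ctl_def)
  have "norm (z' H) <= (M * C) * (norm (snd Phi) + norm (\<Sum>j\<in>UNIV. H $ j $ j))" if "hess \<Omega> Phi H" for Phi H
    using assms(3)[OF that] mult_left_mono[OF C(2)[OF that] assms(2)] by (simp add: mult.assoc)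
  then show ?thesis unfolding ctl_def using assms(2) C(1) by (intro exI[of _ "M * C"]) auto
qed

lemma ctl_cong: "ctl \<Omega> z ==> (!!Phi H. hess \<Omega> Phi H ==> z' H = z H) ==> ctl \<Omega> z'"
  by (rule ctl_mono[of \<Omega> z 1]) auto

lemma ctl_add: assumes "ctl \<Omega> z" "ctl \<Omega> z'" shows "ctl \<Omega> (%H. z H + z' H)"
proof -
  let ?N = "%Phi H. norm (snd Phi) + norm (\<Sum>j\<in>UNIV. H $ j $ j)"
  obtain C where C: "C >= 0" "!!Phi H. hess \<Omega> Phi H ==> norm (z H) <= C * ?N Phi H"
    using assms(1) by (auto simp: ctl_def)
  obtain C' where C': "C' >= 0" "!!Phi H. hess \<Omega> Phi H ==> norm (z' H) <= C' * ?N Phi H"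
    using assms(2) by (auto simp: ctl_def)
  have "norm (z H + z' H) <= (C + C') * ?N Phi H" if "hess \<Omega> Phi H" for Phi H
    using norm_triangle_ineq[of "z H" "z' H"] C(2)[OF that] C'(2)[OF that] unfolding distrib_right[of C] by linarith
  then show ?thesis unfolding ctl_def using C(1) C'(1) by (intro exI[of _ "C + C'"]) auto
qed

lemma ctl_diff: assumes "ctl \<Omega> z" "ctl \<Omega> z'" shows "ctl \<Omega> (%H. z H - z' H)"
proof -
  have "ctl \<Omega> (%H. - z' H)" by (rule ctl_mono[OF assms(2), of 1]) auto
  from ctl_add[OF assms(1) this] show ?thesis by simp
qed

lemma ctl_Mop: assumes "ctl \<Omega> z" "bmult a" shows "ctl \<Omega> (%H. Mop a (z H))"
proof -
  obtain B where B: "!!x. \<bar>a x\<bar> <= B" using assms(2) by (auto simp: bmult_def)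
  then have "B >= 0" by (meson abs_ge_zero order_trans)
  then show ?thesis by (rule ctl_mono[OF assms(1)]) (rule Mop_norm[OF assms(2) B])
qed

lemma ctl_zero: "ctl \<Omega> (%H. 0)"
  unfolding ctl_def by (intro exI[of _ 0]) auto

lemma ctl_sum: "(!!i. i \<in> I ==> ctl \<Omega> (z i)) ==> ctl \<Omega> (%H. \<Sum>i\<in>I. z i H)"
  by (induction I rule: infinite_finite_induct) (auto intro: ctl_add ctl_zero)

lemma ctl_lap: "ctl \<Omega> (%H. \<Sum>j\<in>UNIV. H $ j $ j)"
  unfolding ctl_def by (intro exI[of _ 1]) auto

lemma Mop_mono:
  assumes "bmult a" "bmult b" "M >= 0" "!!x. \<bar>a x\<bar> <= M * \<bar>b x\<bar>"
  shows "norm (Mop a u) <= M * norm (Mop b u)"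
proof -
  have "norm (Mop a u) <= norm (mk (%x. M * (b x * rep u x)))"
    unfolding Mop_def
  proof (rule norm_mk_mono)
    show "(%x. a x * rep u x) \<in> borel_measurable lebesgue" by (rule sqint_meas[OF sqint_bmult[OF assms(1) sqint_rep]])
    have "\<bar>a x\<bar> * \<bar>rep u x\<bar> <= (M * \<bar>b x\<bar>) * \<bar>rep u x\<bar>" for x by (intro mult_right_mono assms) simp
    then show "AE x in lebesgue. \<bar>a x * rep u x\<bar> <= \<bar>M * (b x * rep u x)\<bar>" using assms(3) by (simp add: abs_mult mult.assoc)
  qed (intro sqint_cmult sqint_bmult assms sqint_rep)
  also have "mk (%x. M * (b x * rep u x)) = M *\<^sub>R Mop b u"
    unfolding Mop_def by (rule mk_cmult[symmetric]) (intro sqint_bmult assms sqint_rep)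
  finally show ?thesis using assms(3) by simp
qed

text \<open>A weight may be exchanged for any weight that it dominates; this takes the place of
  division in the elimination of second derivatives.\<close>

lemma ctl_Mop_mono:
  assumes "ctl \<Omega> (%H. Mop b (z H))" "bmult a" "bmult b" "M >= 0" "!!x. \<bar>a x\<bar> <= M * \<bar>b x\<bar>"
  shows "ctl \<Omega> (%H. Mop a (z H))"
  by (rule ctl_mono[OF assms(1,4)]) (rule Mop_mono[OF assms(2-5)])

lemma Mop_addf: "bmult a ==> bmult b ==> Mop (%x. a x + b x) u = Mop a u + Mop b u"
  unfolding Mop_def by (subst mk_add) (auto intro: sqint_bmult simp: distrib_right)

lemma bmult_add: assumes "bmult a" "bmult b" shows "bmult (%x. a x + b x)"
proof -
  obtain A B where AB: "!!x. \<bar>a x\<bar> <= A" "!!x. \<bar>b x\<bar> <= B" using assms by (auto simp: bmult_def)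
  have "\<bar>a x + b x\<bar> <= A + B" for x using AB[of x] by linarith
  then show ?thesis using assms by (auto simp: bmult_def)
qed

lemma Mop_zero: "Mop (%x. 0) u = 0"
  by (simp add: Mop_def)

lemma bmult_zero: "bmult (%x. 0)"
  by (auto simp: bmult_def)

lemma bmult_sumf: "(!!i. i \<in> I ==> bmult (a i)) ==> bmult (%x. \<Sum>i\<in>I. a i x)"
  by (induction I rule: infinite_finite_induct) (auto intro: bmult_add bmult_zero)

lemma Mop_sumf: "(!!i. i \<in> I ==> bmult (a i)) ==> Mop (%x. \<Sum>i\<in>I. a i x) u = (\<Sum>i\<in>I. Mop (a i) u)"
  by (induction I rule: infinite_finite_induct) (auto simp: Mop_zero Mop_addf bmult_sumf)

text \<open>Localisation by a continuous weight that is positive at x0: finitely many such weights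
  can simply be added.\<close>

definition local_control :: "(real^'n::finite) set => real^'n => bool"
  where "local_control \<Omega> x0 \<longleftrightarrow> (\<exists>psi. continuous_on UNIV psi & bmult psi & (\<forall>x. psi x >= 0) & psi x0 > 0 &
     (\<forall>i j. ctl \<Omega> (%H. Mop psi (H $ i $ j))))"

text \<open>A bump times a coordinate direction is compactly supported in \<Omega>, hence
  tangential, so every row of the Hessian is controlled directly; the push direction is 0.\<close>

lemma local_control_interior:
  fixes \<Omega> :: "(real^'n::finite) set"
  assumes \<Omega>: "open \<Omega>" and x0: "x0 \<in> \<Omega>"
  shows "local_control \<Omega> x0"
proof -
  obtain r where r: "r > 0" "cball x0 r \<subseteq> \<Omega>" using \<Omega> x0 open_contains_cball by blast
  define psi where "psi = ball_bump x0 r"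
  have psi: "psi \<in> test_functions \<Omega>" unfolding psi_def by (rule ball_bump_test[OF r])
  have "ctl \<Omega> (%H. Mop psi (H $ i $ j))" for i j
  proof -
    define X where "X l = (if l = i then psi else (%x. 0))" for l
    have X: "X l \<in> test_functions \<Omega>" for l using psi test_zero by (auto simp: X_def)
    have "\<exists>C\<ge>0. \<forall>Phi H. hess \<Omega> Phi H -->
       norm (\<Sum>l\<in>UNIV. Mop (X l) (H $ l $ j)) <= C * (norm (snd Phi) + norm (\<Sum>j\<in>UNIV. H $ j $ j))"
    proof (rule tangential_estimate[OF \<Omega> tangential_interior[OF X] compact_cball[of x0 r] _ zero_less_one])
      show "X l x = 0" if "x \<notin> cball x0 r" for l x
        using that ball_bump(4)[OF r(1), of x x0] by (auto simp: X_def psi_def)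
      show "y + t *\<^sub>R 0 \<in> \<Omega>" if "y \<in> cball x0 r \<inter> closure \<Omega>" for t y using that r(2) by auto
    qed
    moreover have "(\<Sum>l\<in>UNIV. Mop (X l) (H $ l $ j)) = Mop psi (H $ i $ j)" for H :: "(real^'n) l2 ^ 'n ^ 'n"
    proof -
      have "(\<Sum>l\<in>UNIV. Mop (X l) (H $ l $ j)) = (\<Sum>l\<in>UNIV. if l = i then Mop psi (H $ i $ j) else 0)"
        by (intro sum.cong) (auto simp: X_def Mop_zero)
      then show ?thesis by simp
    qed
    ultimately show ?thesis by (simp add: ctl_def)
  qed
  moreover have "psi x0 > 0" unfolding psi_def by (rule ball_bump(3)[OF r(1)]) (use r(1) in simp)
  moreover have "psi x >= 0" for x unfolding psi_def by (rule ball_bump(2)[OF r(1)])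
  ultimately show ?thesis unfolding local_control_def
    using smooth_fun_continuous[OF test_smooth[OF psi]] bmult_test[OF psi] by (intro exI[of _ psi]) simp
qed

text \<open>Near the boundary, the derivatives of the tangential derivatives are controlled, and the remaining second
  normal derivative is recovered from the Laplacian.\<close>

lemma local_control_boundary:
  fixes \<Omega> :: "(real^'n::finite) set"
  assumes \<Omega>: "open \<Omega>" and sb: "smooth_boundary \<Omega>" and x0: "x0 \<in> frontier \<Omega>"
  shows "local_control \<Omega> x0"
proof -
  obtain r k s gamma where r: "r > 0" and s: "s \<in> {1, - 1 :: real}" and gamma: "smooth_fun gamma"
    and inv: "!!y t. gamma (y + t *\<^sub>R axis k 1) = gamma y" and graph: "\<Omega> \<inter> ball x0 r = {y \<in> ball x0 r. s * y $ k > gamma y}"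
    using sb x0 unfolding smooth_boundary_def by blast
  have ss: "s * s = 1" using s by auto
  \<comment> \<open>Boundary defining function: near x0 the set \<Omega> is {b > 0}, and the
    derivative of b in direction k is the constant s, since gamma is independent of that
    coordinate.\<close>
  define b where "b y = s * y $ k - gamma y" for y
  have bs: "smooth_fun b" unfolding b_def by (intro smooth_fun_diff smooth_fun_cmult smooth_fun_coord gamma)
  have graph': "\<Omega> \<inter> ball x0 r = {y \<in> ball x0 r. b y > 0}" using graph by (simp add: b_def)
  have gammak: "partial_deriv k gamma y = 0" for y
  proof -
    have "((%t. gamma (y + t *\<^sub>R axis k 1)) has_real_derivative partial_deriv k gamma y) (at 0)"
      using has_real_derivative_line[OF gamma, of y "axis k 1" 0] by (simp add: sum_axis)
    then have "((%t::real. gamma y) has_real_derivative partial_deriv k gamma y) (at 0)" by (simp add: inv)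
    then show ?thesis using DERIV_unique DERIV_const by blast
  qed
  have db: "partial_deriv l b y = (if l = k then s else 0) - partial_deriv l gamma y" for l y
  proof -
    have "partial_deriv l (%y. s * y $ k + (- 1) * gamma y) y = partial_deriv l (%y. s * y $ k) y + partial_deriv l (%y. (- 1) * gamma y) y"
      by (intro partial_deriv_add smooth_fun_differentiable smooth_fun_cmult smooth_fun_coord gamma)
    also have "partial_deriv l (%y. s * y $ k) y = partial_deriv l (%y. s) y * y $ k + s * partial_deriv l (%y. y $ k) y"
      by (intro partial_deriv_mult smooth_fun_differentiable smooth_fun_const smooth_fun_coord)
    also have "partial_deriv l (%y. (- 1) * gamma y) y = partial_deriv l (%y. - 1) y * gamma y + (- 1) * partial_deriv l gamma y"
      by (intro partial_deriv_mult smooth_fun_differentiable smooth_fun_const gamma)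
    finally show ?thesis by (simp add: b_def[abs_def] partial_deriv_coord)
  qed
  have r2: "r / 2 > 0" using r by simp
  define psi where "psi = ball_bump x0 (r / 2)"
  have sub: "cball x0 (r / 2) \<subseteq> ball x0 r" using r by auto
  have psi: "psi \<in> test_functions (ball x0 r)" unfolding psi_def by (rule ball_bump_test[OF r2 sub])
  have psi0: "psi x >= 0" for x unfolding psi_def by (rule ball_bump(2)[OF r2])
  have psioff: "psi x = 0" if "x \<notin> cball x0 (r / 2)" for x
    using that ball_bump(4)[OF r2, of x x0] by (auto simp: psi_def)
  \<comment> \<open>Chosen so that the field psi e_i + (f i) e_k annihilates b; the sign s is its
    own inverse.\<close>
  define f where "f i x = (s * partial_deriv i gamma x) * psi x" for i x
  have fT: "f i \<in> test_functions (ball x0 r)" for i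
    unfolding f_def by (rule test_mult[OF smooth_fun_cmult[OF smooth_fun_partial[OF gamma]] psi])
  have bpsi: "bmult psi" and bf: "bmult (f i)" for i by (rule bmult_test[OF psi], rule bmult_test[OF fT])
  define A where "A i j H = Mop psi (H $ i $ j) + Mop (f i) (H $ k $ j)" for i j and H :: "(real^'n) l2 ^ 'n ^ 'n"
  have ctlA: "ctl \<Omega> (A i j)" if ik: "i ~= k" for i j
  proof -
    define X where "X l = (if l = i then psi else if l = k then f i else (%x. 0))" for l
    have X: "X l \<in> test_functions (ball x0 r)" for l using psi fT test_zero by (auto simp: X_def)
    have tang: "(\<Sum>l\<in>UNIV. X l y * partial_deriv l b y) = 0" for y
    proof -
      have "(\<Sum>l\<in>UNIV. X l y * partial_deriv l b y) = (\<Sum>l\<in>UNIV. (if l = i then psi y * partial_deriv i b y else 0)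
         + (if l = k then f i y * partial_deriv k b y else 0))"
        by (intro sum.cong) (use ik in \<open>auto simp: X_def\<close>)
      also have "... = psi y * partial_deriv i b y + f i y * partial_deriv k b y" by (simp add: sum.distrib)
      also have "... = psi y * partial_deriv i gamma y * (s * s - 1)" using ik by (simp add: db gammak f_def algebra_simps)
      finally show ?thesis by (simp add: ss)
    qed
    have "\<exists>C\<ge>0. \<forall>Phi H. hess \<Omega> Phi H -->
       norm (\<Sum>l\<in>UNIV. Mop (X l) (H $ l $ j)) <= C * (norm (snd Phi) + norm (\<Sum>j\<in>UNIV. H $ j $ j))"
    proof (rule tangential_estimate[OF \<Omega> tangential_boundary[OF \<Omega> graph' bs X tang] compact_cball[of x0 "r / 2"] _ r2])
      show "X l x = 0" if "x \<notin> cball x0 (r / 2)" for l x using psioff[OF that] by (auto simp: X_def f_def)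
      fix t y assume t: "0 < t" "t < r / 2" and y: "y \<in> cball x0 (r / 2) \<inter> closure \<Omega>"
      have "y \<in> closure (ball x0 r \<inter> \<Omega>)" using open_Int_closure_subset[OF open_ball, of x0 r \<Omega>] y sub by blast
      also have "closure (ball x0 r \<inter> \<Omega>) \<subseteq> {y. b y >= 0}"
      proof (rule closure_minimal)
        show "ball x0 r \<inter> \<Omega> \<subseteq> {y. b y >= 0}" using equalityD1[OF graph'] by fastforce
        show "closed {y. b y >= 0}" by (intro closed_Collect_le continuous_on_const smooth_fun_continuous bs)
      qed
      finally have b0: "b y >= 0" by simp
      \<comment> \<open>Moving by t along s e_k raises b by exactly t, so points with b >= 0 enter
        \<Omega>.\<close>
      have e: "y + t *\<^sub>R (s *\<^sub>R axis k 1) = y + (t * s) *\<^sub>R axis k 1" by simp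
      have "b (y + t *\<^sub>R (s *\<^sub>R axis k 1)) = b y + t * (s * s)"
        unfolding e b_def inv by (simp add: algebra_simps axis_def)
      then have "b (y + t *\<^sub>R (s *\<^sub>R axis k 1)) > 0" using b0 t ss by simp
      moreover have "y + t *\<^sub>R (s *\<^sub>R axis k 1) \<in> ball x0 r"
      proof -
        have "dist x0 (y + t *\<^sub>R (s *\<^sub>R axis k 1)) <= dist x0 y + dist y (y + t *\<^sub>R (s *\<^sub>R axis k 1))" by (rule dist_triangle)
        also have "dist y (y + t *\<^sub>R (s *\<^sub>R axis k 1)) = t" using s t by (auto simp: dist_norm norm_axis_1)
        finally show ?thesis using y t by auto
      qed
      ultimately show "y + t *\<^sub>R (s *\<^sub>R axis k 1) \<in> \<Omega>" using graph' by blast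
    qed
    moreover have "(\<Sum>l\<in>UNIV. Mop (X l) (H $ l $ j)) = A i j H" for H :: "(real^'n) l2 ^ 'n ^ 'n"
    proof -
      have "(\<Sum>l\<in>UNIV. Mop (X l) (H $ l $ j)) = (\<Sum>l\<in>UNIV. (if l = i then Mop psi (H $ i $ j) else 0) + (if l = k then Mop (f i) (H $ k $ j) else 0))"
        by (intro sum.cong) (use ik in \<open>auto simp: X_def Mop_zero\<close>)
      then show ?thesis by (simp add: sum.distrib A_def)
    qed
    ultimately show ?thesis by (simp add: ctl_def)
  qed
  \<comment> \<open>f i carries the factor psi, so weights containing f i are dominated by weights
    containing psi.\<close>
  have "\<exists>M\<ge>0. \<forall>x. \<bar>f i x\<bar> <= M * psi x" for i
  proof -
    have "bounded ((%x. s * partial_deriv i gamma x) ` cball x0 (r / 2))"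
      by (intro compact_imp_bounded compact_continuous_image compact_cball continuous_intros smooth_fun_continuous smooth_fun_partial gamma)
    then obtain M where "\<forall>x\<in>cball x0 (r / 2). norm (s * partial_deriv i gamma x) <= M" unfolding bounded_iff by blast
    then have M: "!!x. x \<in> cball x0 (r / 2) ==> \<bar>s * partial_deriv i gamma x\<bar> <= M" by auto
    have "\<bar>f i x\<bar> <= \<bar>M\<bar> * psi x" for x
    proof (cases "x \<in> cball x0 (r / 2)")
      case True
      have "\<bar>s * partial_deriv i gamma x\<bar> * psi x <= \<bar>M\<bar> * psi x" using M[OF True] by (intro mult_right_mono psi0) linarith
      then show ?thesis using psi0[of x] by (simp add: f_def abs_mult)
    qed (simp add: psioff f_def)
    then show ?thesis by (intro exI[of _ "\<bar>M\<bar>"]) auto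
  qed
  then obtain M where M: "!!i. M i >= 0" "!!i x. \<bar>f i x\<bar> <= M i * psi x" by metis
  let ?c = "%x. psi x * psi x"
  have bc: "bmult ?c" by (rule bmult_mult[OF bpsi bpsi])
  have bcf: "bmult (%x. psi x * f i x)" "bmult (%x. f i x * psi x)" "bmult (%x. f i x * f j x)" for i j by (intro bmult_mult bpsi bf)+
  have cfb: "\<bar>psi x * f i x\<bar> <= M i * \<bar>?c x\<bar>" for i x
    using mult_left_mono[OF M(2)[of i x] psi0[of x]] psi0[of x] by (simp add: abs_mult mult_ac)
  \<comment> \<open>By symmetry of H, psi (A i i) - (f i) (A i k) = psi^2 H i i - (f i)^2 H k k.
    Subtracting the sum over i from psi^2 times the Laplacian leaves H k k with this weight, which
    is at least psi^2.\<close>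
  define a where "a x = ?c x + (\<Sum>i\<in>UNIV - {k}. f i x * f i x)" for x
  have ba: "bmult a" unfolding a_def by (intro bmult_add bmult_sumf bc bcf)
  have kk: "ctl \<Omega> (%H. Mop a (H $ k $ k))"
  proof (rule ctl_cong)
    show "ctl \<Omega> (%H. Mop psi (Mop psi (\<Sum>j\<in>UNIV. H $ j $ j)) - (\<Sum>i\<in>UNIV - {k}. Mop psi (A i i H) - Mop (f i) (A i k H)))"
      by (intro ctl_diff ctl_sum ctl_Mop ctl_lap ctlA bpsi bf) auto
    fix Phi H assume h: "hess \<Omega> Phi H"
    have "Mop psi (A i i H) - Mop (f i) (A i k H) = Mop ?c (H $ i $ i) - Mop (%x. f i x * f i x) (H $ k $ k)" for i
      unfolding A_def Mop_addr[OF bpsi] Mop_addr[OF bf] Mop_Mop[OF bpsi bpsi] Mop_Mop[OF bpsi bf] Mop_Mop[OF bf bpsi] Mop_Mop[OF bf bf]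
      using hess_symmetric[OF \<Omega> h, of k i] by (simp add: mult.commute)
    then have "(\<Sum>i\<in>UNIV - {k}. Mop psi (A i i H) - Mop (f i) (A i k H))
       = (\<Sum>i\<in>UNIV - {k}. Mop ?c (H $ i $ i)) - (\<Sum>i\<in>UNIV - {k}. Mop (%x. f i x * f i x) (H $ k $ k))"
      by (simp add: sum_subtractf)
    moreover have "Mop psi (Mop psi (\<Sum>j\<in>UNIV. H $ j $ j)) = Mop ?c (H $ k $ k) + (\<Sum>i\<in>UNIV - {k}. Mop ?c (H $ i $ i))"
      unfolding Mop_Mop[OF bpsi bpsi] Mop_sumr[OF bc] by (rule sum.remove) auto
    moreover have "Mop a (H $ k $ k) = Mop ?c (H $ k $ k) + (\<Sum>i\<in>UNIV - {k}. Mop (%x. f i x * f i x) (H $ k $ k))"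
      unfolding a_def by (subst Mop_addf[OF bc bmult_sumf]) (auto simp: bcf Mop_sumf)
    ultimately show "Mop a (H $ k $ k) = Mop psi (Mop psi (\<Sum>j\<in>UNIV. H $ j $ j)) - (\<Sum>i\<in>UNIV - {k}. Mop psi (A i i H) - Mop (f i) (A i k H))"
      by simp
  qed
  have ckk: "ctl \<Omega> (%H. Mop ?c (H $ k $ k))"
  proof (rule ctl_Mop_mono[OF kk bc ba zero_le_one])
    fix x
    have "0 <= (\<Sum>i\<in>UNIV - {k}. f i x * f i x)" by (intro sum_nonneg) simp
    then show "\<bar>psi x * psi x\<bar> <= 1 * \<bar>a x\<bar>" using psi0[of x] by (simp add: a_def)
  qed
  have cf: "ctl \<Omega> (%H. Mop (%x. psi x * f i x) (z H))" if "ctl \<Omega> (%H. Mop ?c (z H))" for i z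
    by (rule ctl_Mop_mono[OF that bcf(1) bc M(1) cfb])
  \<comment> \<open>A i j yields H i j once H k j is known. The order of recovery is (k,k), then
    (j,k) and by symmetry (k,j), then all remaining entries.\<close>
  have cij: "ctl \<Omega> (%H. Mop ?c (H $ i $ j))" if ik: "i ~= k" and kj: "ctl \<Omega> (%H. Mop ?c (H $ k $ j))" for i j
  proof (rule ctl_cong)
    show "ctl \<Omega> (%H. Mop psi (A i j H) - Mop (%x. psi x * f i x) (H $ k $ j))"
      by (intro ctl_diff ctl_Mop ctlA ik bpsi cf kj)
    show "Mop ?c (H $ i $ j) = Mop psi (A i j H) - Mop (%x. psi x * f i x) (H $ k $ j)" for H
      unfolding A_def Mop_addr[OF bpsi] Mop_Mop[OF bpsi bpsi] Mop_Mop[OF bpsi bf] by simp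
  qed
  have ckj: "ctl \<Omega> (%H. Mop ?c (H $ k $ j))" for j
  proof (cases "j = k")
    case False
    show ?thesis by (rule ctl_cong[OF cij[OF False ckk]]) (simp add: hess_symmetric[OF \<Omega>, of _ _ k j])
  qed (simp add: ckk)
  have all: "ctl \<Omega> (%H. Mop ?c (H $ i $ j))" for i j
    by (cases "i = k") (auto intro: ckj cij)
  show ?thesis unfolding local_control_def
  proof (intro exI[of _ ?c] conjI allI all bc)
    show "continuous_on UNIV ?c" by (intro continuous_intros smooth_fun_continuous test_smooth[OF psi])
    show "0 < psi x0 * psi x0" using ball_bump(3)[OF r2, of x0 x0] r2 by (simp add: psi_def)
  qed (simp add: psi0)
qed

text \<open>Finitely many local weights cover the compact closure of \<Omega>; their sum is
  continuous and positive, hence bounded below there, and the Hessian vanishes outside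
  \<Omega>.\<close>

theorem hessian_estimate:
  fixes \<Omega> :: "(real^'n::finite) set"
  assumes \<Omega>: "open \<Omega>" "bounded \<Omega>" "\<Omega> ~= {}" and sb: "smooth_boundary \<Omega>"
  shows "ctl \<Omega> (%H. H $ i $ j)"
proof -
  have \<Omega>m: "\<Omega> \<in> sets lebesgue" using \<Omega>(1) by simp
  have "local_control \<Omega> x" if "x \<in> closure \<Omega>" for x
    using that local_control_interior[OF \<Omega>(1)] local_control_boundary[OF \<Omega>(1) sb] by (auto simp: closure_Un_frontier)
  then have "\<exists>psi. continuous_on UNIV psi & bmult psi & (\<forall>x. psi x >= 0) & psi x0 > 0 &
     (\<forall>i j. ctl \<Omega> (%H. Mop psi (H $ i $ j)))" if "x0 \<in> closure \<Omega>" for x0 using that unfolding local_control_def by blast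
  then obtain psi where psi: "!!x0. x0 \<in> closure \<Omega> ==> continuous_on UNIV (psi x0)" "!!x0. x0 \<in> closure \<Omega> ==> bmult (psi x0)"
    "!!x0 x. x0 \<in> closure \<Omega> ==> psi x0 x >= 0" "!!x0. x0 \<in> closure \<Omega> ==> psi x0 x0 > 0"
    "!!x0 i j. x0 \<in> closure \<Omega> ==> ctl \<Omega> (%H. Mop (psi x0) (H $ i $ j))" by metis
  have comp: "compact (closure \<Omega>)" using \<Omega>(2) by (simp add: compact_closure)
  have "\<exists>F\<subseteq>closure \<Omega>. finite F & closure \<Omega> \<subseteq> (\<Union>x0\<in>F. {x. psi x0 x > 0})"
  proof (rule compactE_image[OF comp, of "closure \<Omega>" "%x0. {x. psi x0 x > 0}"])
    show "open {x. psi x0 x > 0}" if "x0 \<in> closure \<Omega>" for x0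
      by (intro open_Collect_less continuous_on_const psi(1)[OF that])
    show "closure \<Omega> \<subseteq> (\<Union>x0\<in>closure \<Omega>. {x. psi x0 x > 0})" using psi(4) by blast
  qed blast
  then obtain F where F: "F \<subseteq> closure \<Omega>" "finite F" "closure \<Omega> \<subseteq> (\<Union>x0\<in>F. {x. psi x0 x > 0})" by blast
  define a where "a x = (\<Sum>x0\<in>F. psi x0 x)" for x
  have ca: "continuous_on UNIV a" unfolding a_def using F psi(1) by (intro continuous_on_sum) auto
  have bF: "bmult (psi x0)" if "x0 \<in> F" for x0 using F(1) psi(2) that by auto
  have ba: "bmult a" unfolding a_def by (rule bmult_sumf[OF bF])
  have apos: "a x > 0" if x: "x \<in> closure \<Omega>" for x
  proof -
    obtain x0 where x0: "x0 \<in> F" "psi x0 x > 0" using F(3) x by auto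
    have "psi x0 x <= a x" unfolding a_def by (rule member_le_sum[OF x0(1)]) (use F psi(3) in auto)
    then show ?thesis using x0(2) by linarith
  qed
  have ne: "closure \<Omega> ~= {}" using \<Omega>(3) by simp
  obtain z where z: "z \<in> closure \<Omega>" "!!x. x \<in> closure \<Omega> ==> a z <= a x"
    using continuous_attains_inf[OF comp ne continuous_on_subset[OF ca subset_UNIV]] by blast
  have c: "a z > 0" by (rule apos[OF z(1)])
  have ctla: "ctl \<Omega> (%H. Mop a (H $ i $ j))"
  proof (rule ctl_cong)
    show "ctl \<Omega> (%H. \<Sum>x0\<in>F. Mop (psi x0) (H $ i $ j))" using F(1) psi(5) by (intro ctl_sum) auto
    show "Mop a (H $ i $ j) = (\<Sum>x0\<in>F. Mop (psi x0) (H $ i $ j))" for H unfolding a_def by (rule Mop_sumf[OF bF])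
  qed
  show ?thesis
  proof (rule ctl_mono[OF ctla, of "1 / a z"])
    show "0 <= 1 / a z" using c by simp
    fix Phi H assume h: "hess \<Omega> Phi H"
    then have "H $ i $ j = Mop (indicator \<Omega>) (H $ i $ j)" by (simp add: hess_def in_dom_def)
    also have "norm ... <= 1 / a z * norm (Mop a (H $ i $ j))"
    proof (rule Mop_mono[OF bmult_indicator[OF \<Omega>m] ba])
      show "0 <= 1 / a z" using c by simp
      fix x
      show "\<bar>indicator \<Omega> x\<bar> <= 1 / a z * \<bar>a x\<bar>"
      proof (cases "x \<in> \<Omega>")
        case True
        then have "a z <= a x" using z(2) closure_subset by blast
        then show ?thesis using True c by (simp add: field_simps)
      qed (use c in simp)
    qed
    finally show "norm (H $ i $ j) <= 1 / a z * norm (Mop a (H $ i $ j))" .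
  qed
qed

section \<open>The fourth order equation\<close>

definition lap :: "(real^'n::finite) l2 ^ 'n ^ 'n => (real^'n) l2"
  where "lap H = (\<Sum>j\<in>UNIV. H $ j $ j)"

lemma lap_linear: "bounded_linear lap"
  unfolding lap_def by (intro bounded_linear_sum bounded_linear_compose[OF bounded_linear_vec_nth] bounded_linear_vec_nth)

lemma norm_le_comp_sum: "norm (x :: ('b::real_normed_vector)^'n::finite) <= (\<Sum>i\<in>UNIV. norm (x $ i))"
  unfolding norm_vec_def by (rule L2_set_le_sum) simp

lemma norm_pair_le: "norm (x :: 'b::real_normed_vector \<times> 'c::real_normed_vector) <= norm (fst x) + norm (snd x)"
  using sqrt_sum_squares_le_sum[of "norm (fst x)" "norm (snd x)"] by (simp add: norm_prod_def)

lemma hess_subspace: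
  assumes \<Omega>: "\<Omega> \<in> sets lebesgue"
  shows "subspace {x. hess \<Omega> (fst x) (snd x)}"
proof -
  note b = bmult_indicator[OF \<Omega>]
  have l: "bounded_linear (Mop (indicator \<Omega> :: _ => real))" by (rule Mop_linear[OF b])
  show ?thesis
    unfolding subspace_def
    by (auto simp: hess_def wd_def in_dom_def subspace_0[OF Sob_subspace] subspace_add[OF Sob_subspace]
        subspace_scale[OF Sob_subspace] inner_add_left linear_0[OF bounded_linear.linear[OF l]]
        linear_add[OF bounded_linear.linear[OF l]] linear_scale[OF bounded_linear.linear[OF l]])
qed

lemma hess_closed:
  assumes \<Omega>: "\<Omega> \<in> sets lebesgue"
  shows "closed {x. hess \<Omega> (fst x) (snd x)}"
proof -
  have "{x. hess \<Omega> (fst x) (snd x)} = (fst -` Sob \<Omega>)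
     \<inter> (\<Inter>i. \<Inter>j. \<Inter>eta\<in>test_functions \<Omega>. {x. inner (snd (fst x) $ i) (mk (partial_deriv j eta)) = - inner (snd x $ i $ j) (mk eta)})
     \<inter> (\<Inter>i. \<Inter>j. {x. Mop (indicator \<Omega>) (snd x $ i $ j) = snd x $ i $ j})"
    by (auto simp: hess_def wd_def in_dom_def)
  also have "closed ..."
    by (intro closed_Int closed_INT ballI closed_Collect_eq continuous_Mop bmult_indicator[OF \<Omega>] continuous_intros
        closed_vimage Sob_closed)
  finally show ?thesis .
qed

text \<open>The Hessian estimate bounds H and the Poincare inequality bounds the function itself, so
  Laplacian and gradient dominate the full norm of the pair.\<close>

lemma hess_coercive:
  fixes \<Omega> :: "(real^'n::finite) set"
  assumes \<Omega>: "open \<Omega>" "bounded \<Omega>" "\<Omega> ~= {}" and sb: "smooth_boundary \<Omega>"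
  shows "\<exists>C>0. \<forall>Phi H. hess \<Omega> Phi H --> norm (Phi, H) <= C * norm (lap H, snd Phi)"
proof -
  obtain C0 where C0: "C0 > 0" "!!U. U \<in> Sob \<Omega> ==> norm (fst U) <= C0 * norm (snd U)"
    using poincare[OF \<Omega>(2)] by blast
  have "\<exists>C\<ge>0. \<forall>Phi H. hess \<Omega> Phi H --> norm (H $ i $ j) <= C * (norm (snd Phi) + norm (lap H))" for i j
    using hessian_estimate[OF \<Omega> sb, of i j] unfolding ctl_def lap_def .
  then obtain c where c: "!!i j. c i j >= 0"
    "!!i j Phi H. hess \<Omega> Phi H ==> norm (H $ i $ j) <= c i j * (norm (snd Phi) + norm (lap H))" by metis
  define c' where "c' = (\<Sum>i\<in>UNIV. \<Sum>j\<in>UNIV. c i j)"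
  have c': "c' >= 0" unfolding c'_def by (intro sum_nonneg c)
  have "norm (Phi, H) <= (2 * (C0 + 1 + c')) * norm (lap H, snd Phi)" if h: "hess \<Omega> Phi H" for Phi H
  proof -
    let ?s = "norm (snd Phi) + norm (lap H)"
    have "norm H <= (\<Sum>i\<in>UNIV. norm (H $ i))" by (rule norm_le_comp_sum)
    also have "... <= (\<Sum>i\<in>UNIV. \<Sum>j\<in>UNIV. norm (H $ i $ j))" by (intro sum_mono norm_le_comp_sum)
    also have "... <= (\<Sum>i\<in>UNIV. \<Sum>j\<in>UNIV. c i j * ?s)" by (intro sum_mono c h)
    also have "... = c' * ?s" by (simp add: c'_def sum_distrib_right)
    finally have H: "norm H <= c' * ?s" .
    have "norm (fst Phi) <= C0 * norm (snd Phi)" using h by (intro C0(2)) (simp add: hess_def)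
    also have "... <= C0 * ?s" using C0(1) by simp
    finally have "norm Phi <= C0 * ?s + ?s" using norm_pair_le[of Phi] norm_ge_zero[of "lap H"] by linarith
    then have "norm (Phi, H) <= (C0 + 1 + c') * ?s" using norm_pair_le[of "(Phi, H)"] H by (simp add: algebra_simps)
    also have "... <= (C0 + 1 + c') * (2 * norm (lap H, snd Phi))"
    proof (rule mult_left_mono)
      show "?s <= 2 * norm (lap H, snd Phi)"
        using norm_fst_le[of "lap H" "snd Phi"] norm_snd_le[of "snd Phi" "lap H"] by linarith
    qed (use C0(1) c' in simp)
    finally show ?thesis by (simp only: mult.assoc mult.left_commute)
  qed
  then show ?thesis using C0(1) c' by (intro exI[of _ "2 * (C0 + 1 + c')"]) simp
qed

text \<open>Lax-Milgram on the closed subspace of pairs (Phi, H), with the form given by Laplacian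
  and gradient. Uniqueness makes the chosen solution linear in f, and inner g (G f) = a (sol g) (sol
  f) yields symmetry and positivity of \<open>G\<close>.\<close>

theorem biharmonic_solution_operator:
  fixes \<Omega> :: "(real^'n::finite) set"
  assumes \<Omega>: "open \<Omega>" "bounded \<Omega>" "\<Omega> ~= {}" and sb: "smooth_boundary \<Omega>"
  shows "\<exists>G :: (real^'n) l2 => (real^'n) l2. bounded_linear G & (\<forall>f g. inner f (G g) = inner (G f) g) & (\<forall>f. 0 <= inner f (G f)) &
    (\<forall>f. \<exists>D H. hess \<Omega> (G f, D) H &
       (\<forall>\<Xi> H'. hess \<Omega> \<Xi> H' --> inner (lap H) (lap H') + inner D (snd \<Xi>) = inner f (fst \<Xi>)))"
proof -
  have \<Omega>m: "\<Omega> \<in> sets lebesgue" using \<Omega>(1) by simp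
  define X where "X = {x :: ((real^'n) l2 \<times> ((real^'n) l2 ^ 'n)) \<times> ((real^'n) l2 ^ 'n ^ 'n). hess \<Omega> (fst x) (snd x)}"
  have X: "subspace X" "closed X" unfolding X_def by (rule hess_subspace[OF \<Omega>m], rule hess_closed[OF \<Omega>m])
  define L where "L x = (lap (snd x), snd (fst x))" for x :: "((real^'n) l2 \<times> ((real^'n) l2 ^ 'n)) \<times> ((real^'n) l2 ^ 'n ^ 'n)"
  have L: "bounded_linear L" unfolding L_def
    by (intro bounded_linear_Pair bounded_linear_compose[OF lap_linear] bounded_linear_compose[OF bounded_linear_snd]
        bounded_linear_snd bounded_linear_fst)
  define a where "a x y = inner (L x) (L y)" for x y
  have a: "bounded_bilinear a" unfolding a_def by (rule bounded_bilinear.comp[OF bounded_bilinear_inner L L])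
  have sym: "a x y = a y x" for x y by (simp add: a_def inner_commute)
  obtain C where C: "C > 0" "!!Phi H. hess \<Omega> Phi H ==> norm (Phi, H) <= C * norm (lap H, snd Phi)"
    using hess_coercive[OF \<Omega> sb] by blast
  have coer: "(1 / C\<^sup>2) * (norm x)\<^sup>2 <= a x x" if "x \<in> X" for x
  proof -
    have "norm x <= C * norm (L x)" using C(2)[of "fst x" "snd x"] that by (simp add: X_def L_def)
    then have "(norm x)\<^sup>2 <= (C * norm (L x))\<^sup>2" by (intro power_mono) auto
    also have "... = C\<^sup>2 * a x x" unfolding a_def power_mult_distrib power2_norm_eq_inner by (rule refl)
    finally show ?thesis using C(1) by (simp add: field_simps)
  qed
  have ex: "\<exists>x\<in>X. \<forall>y\<in>X. a x y = inner f (fst (fst y))" for f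
  proof (rule lax_milgram_symmetric[OF X a sym _ coer, where L = "norm f"])
    show "0 < 1 / C\<^sup>2" using C(1) by simp
    fix x :: "((real^'n) l2 \<times> ((real^'n) l2 ^ 'n)) \<times> ((real^'n) l2 ^ 'n ^ 'n)"
    have "\<bar>inner f (fst (fst x))\<bar> <= norm f * norm (fst (fst x))" by (rule Cauchy_Schwarz_ineq2)
    also have "norm (fst (fst x)) <= norm x"
      by (rule order_trans[OF norm_fst_le[of "fst (fst x)" "snd (fst x)", simplified] norm_fst_le[of "fst x" "snd x", simplified]])
    finally show "\<bar>inner f (fst (fst x))\<bar> <= norm f * norm x" by (simp add: mult_left_mono)
  qed (auto simp: inner_add_right)
  define sol where "sol f = (SOME x. x \<in> X & (\<forall>y\<in>X. a x y = inner f (fst (fst y))))" for f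
  have sol: "sol f \<in> X & (\<forall>y\<in>X. a (sol f) y = inner f (fst (fst y)))" for f
    unfolding sol_def by (rule someI_ex) (use ex[of f] in blast)
  note solX = conjunct1[OF sol] and sola = conjunct2[OF sol, rule_format]
  interpret a: bounded_bilinear a by (rule a)
  have uniq: "x = sol f" if x: "x \<in> X" "!!y. y \<in> X ==> a x y = inner f (fst (fst y))" for x f
  proof -
    have d: "x - sol f \<in> X" by (rule subspace_diff[OF X(1) x(1) solX])
    have "a (x - sol f) (x - sol f) = 0" unfolding a.diff_left using x(2)[OF d] sola[OF d, of f] by simp
    then have "(1 / C\<^sup>2) * (norm (x - sol f))\<^sup>2 <= 0" using coer[OF d] by simp
    then have "(norm (x - sol f))\<^sup>2 <= 0" using C(1) by (simp add: divide_le_0_iff)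
    then show ?thesis by simp
  qed
  have add: "sol (f + g) = sol f + sol g" for f g
    by (rule uniq[symmetric]) (simp_all add: subspace_add[OF X(1)] solX a.add_left sola inner_add_left)
  have scale: "sol (r *\<^sub>R f) = r *\<^sub>R sol f" for r f
    by (rule uniq[symmetric]) (simp_all add: subspace_scale[OF X(1)] solX a.scaleR_left sola)
  define G where "G f = fst (fst (sol f))" for f
  have nG: "norm (G f) <= norm (sol f)" for f unfolding G_def
    by (rule order_trans[OF norm_fst_le[of "fst (fst (sol f))" "snd (fst (sol f))", simplified] norm_fst_le[of "fst (sol f)" "snd (sol f)", simplified]])
  have pair: "inner g (G f) = a (sol g) (sol f)" for f g unfolding G_def by (rule sola[OF solX, symmetric])
  have bd: "norm (G f) <= norm f * C\<^sup>2" for f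
  proof (cases "norm (sol f) = 0")
    case True
    then show ?thesis using order_trans[OF nG[of f]] by simp
  next
    case False
    have "(1 / C\<^sup>2) * (norm (sol f))\<^sup>2 <= inner f (G f)" unfolding pair by (rule coer[OF solX])
    also have "... <= norm f * norm (G f)" by (rule norm_cauchy_schwarz)
    also have "... <= norm f * norm (sol f)" by (intro mult_left_mono nG) simp
    finally have "norm (sol f) <= norm f * C\<^sup>2" using C(1) False by (simp add: field_simps power2_eq_square)
    then show ?thesis using nG[of f] by simp
  qed
  have "bounded_linear G"
    by (rule bounded_linear_intro[OF _ _ bd]) (simp_all add: G_def add scale)
  moreover have "inner f (G g) = inner (G f) g" for f g
    using pair[of f g] pair[of g f] sym[of "sol f" "sol g"] inner_commute[of "G f" g] by simp
  moreover have "0 <= inner f (G f)" for f unfolding pair a_def by simp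
  moreover have "\<exists>D H. hess \<Omega> (G f, D) H &
       (\<forall>\<Xi> H'. hess \<Omega> \<Xi> H' --> inner (lap H) (lap H') + inner D (snd \<Xi>) = inner f (fst \<Xi>))" for f
  proof (intro exI[of _ "snd (fst (sol f))"] exI[of _ "snd (sol f)"] conjI allI impI)
    show "hess \<Omega> (G f, snd (fst (sol f))) (snd (sol f))" using solX[of f] by (simp add: G_def X_def)
    fix \<Xi> H' assume "hess \<Omega> \<Xi> H'"
    then have "(\<Xi>, H') \<in> X" by (simp add: X_def)
    from sola[OF this, of f]
    show "inner (lap (snd (sol f))) (lap H') + inner (snd (fst (sol f))) (snd \<Xi>) = inner f (fst \<Xi>)"
      by (simp add: a_def L_def inner_prod_def)
  qed
  ultimately show ?thesis by (intro exI[of _ G] conjI allI)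
qed

section \<open>Power nonlinearities\<close>

definition pw :: "real => real => real"
  where "pw p t = \<bar>t\<bar> powr (p - 2) * t"

lemma pw_minus: "pw p (- t) = - pw p t"
  by (simp add: pw_def)

lemma powr_le_one_plus_sq:
  fixes t p :: real
  assumes "2 < p" "p < 4" shows "\<bar>t\<bar> powr (p - 2) <= 1 + t\<^sup>2"
proof (cases "\<bar>t\<bar> <= 1")
  case True
  then have "\<bar>t\<bar> powr (p - 2) <= 1" using assms by (intro powr_le1) auto
  then show ?thesis by (simp add: add_increasing2)
next
  case False
  then have "\<bar>t\<bar> powr (p - 2) <= \<bar>t\<bar> powr 2" using assms by (intro powr_mono) auto
  also have "... = t\<^sup>2" using False by simp
  finally show ?thesis by simp
qed

lemma pw_deriv:
  assumes p: "2 < p"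
  shows "(pw p has_real_derivative (p - 1) * \<bar>t\<bar> powr (p - 2)) (at t)"
proof (cases "t = 0")
  case False
  define s where "s = sgn t"
  have "((%x. s * (s * x) powr (p - 1)) has_real_derivative (p - 1) * \<bar>t\<bar> powr (p - 2)) (at t)"
    using False by (auto intro!: derivative_eq_intros simp: s_def sgn_if abs_if algebra_simps)
  moreover have "s * (s * x) powr (p - 1) = pw p x" if "x \<in> {x. s * x > 0}" for x
  proof -
    have e: "s * x = \<bar>x\<bar>" "\<bar>x\<bar> > 0" using that by (auto simp: s_def sgn_if abs_if zero_less_mult_iff split: if_splits)
    have "\<bar>x\<bar> powr (p - 1) = \<bar>x\<bar> powr (p - 2) * \<bar>x\<bar>" using powr_add[of "\<bar>x\<bar>" "p - 2" 1] e(2) by simp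
    moreover have "s * \<bar>x\<bar> = x" using e by (auto simp: s_def sgn_if split: if_splits)
    ultimately show ?thesis unfolding e(1) pw_def by (metis mult.left_commute)
  qed
  moreover have "open {x. s * x > 0}" "t \<in> {x. s * x > 0}"
    using False by (auto intro!: open_Collect_less continuous_intros simp: s_def sgn_if)
  ultimately show ?thesis using has_field_derivative_transform_within_open by blast
next
  case True
  have "((%h. \<bar>h\<bar> powr (p - 2)) \<longlongrightarrow> \<bar>0\<bar> powr (p - 2)) (at (0::real))"
    using p by (intro tendsto_powr' tendsto_intros) auto
  moreover have "\<forall>\<^sub>F h in at 0. \<bar>h\<bar> powr (p - 2) = (pw p (0 + h) - pw p 0) / h"
    by (auto simp: eventually_at_filter pw_def)
  ultimately have "((%h. (pw p (0 + h) - pw p 0) / h) \<longlongrightarrow> 0) (at 0)"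
    by (simp add: tendsto_cong)
  then show ?thesis using True by (simp add: DERIV_def)
qed

lemma pw_meas [measurable]: "2 < p ==> pw p \<in> borel_measurable borel"
  unfolding pw_def by measurable

text \<open>Mean value theorem: the derivative grows at most quadratically because p - 2 <
  2.\<close>

lemma pw_lipschitz:
  assumes p: "2 < p" "p < 4"
  shows "\<bar>pw p t - pw p s\<bar> <= (p - 1) * \<bar>t - s\<bar> * (1 + t\<^sup>2 + s\<^sup>2)"
proof -
  have "norm (pw p t - pw p s) <= ((p - 1) * (1 + t\<^sup>2 + s\<^sup>2)) * norm (t - s)"
  proof (rule field_differentiable_bound[of "closed_segment s t"])
    show "(pw p has_real_derivative (p - 1) * \<bar>z\<bar> powr (p - 2)) (at z within closed_segment s t)" for z
      by (rule has_field_derivative_at_within[OF pw_deriv[OF p(1)]])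
    fix z assume z: "z \<in> closed_segment s t"
    have "\<bar>z\<bar> <= max \<bar>s\<bar> \<bar>t\<bar>" using z by (auto simp: closed_segment_eq_real_ivl split: if_splits)
    then have "\<bar>z\<bar>\<^sup>2 <= (max \<bar>s\<bar> \<bar>t\<bar>)\<^sup>2" by (intro power_mono) auto
    also have "... <= t\<^sup>2 + s\<^sup>2" by (auto simp: max_def)
    finally have "z\<^sup>2 <= t\<^sup>2 + s\<^sup>2" by simp
    then have "\<bar>z\<bar> powr (p - 2) <= 1 + t\<^sup>2 + s\<^sup>2" using powr_le_one_plus_sq[OF p, of z] by linarith
    then show "norm ((p - 1) * \<bar>z\<bar> powr (p - 2)) <= (p - 1) * (1 + t\<^sup>2 + s\<^sup>2)"
      using p by (simp add: abs_mult mult_left_mono)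
  qed auto
  then show ?thesis by (simp add: mult_ac)
qed

text \<open>\<open>pw p t * t\<close> is |t|^p, with derivative p times \<open>pw p t\<close>.
  Subtracting the linear part first turns the mean value bound into a quadratic one, by
  \<open>pw_lipschitz\<close> on the segment.\<close>

lemma pw_taylor:
  assumes p: "2 < p" "p < 4"
  shows "\<bar>pw p (t + s) * (t + s) - pw p t * t - p * pw p t * s\<bar> <= 4 * p * (p - 1) * (1 + t\<^sup>2 + s\<^sup>2) * s\<^sup>2"
proof -
  \<comment> \<open>On the segment z^2 <= 2 t^2 + 2 s^2, so 1 + z^2 + t^2 is at most 1 + 4 t^2 + 2
    s^2.\<close>
  define B where "B = p * ((p - 1) * \<bar>s\<bar> * (1 + 4 * t\<^sup>2 + 2 * s\<^sup>2))"
  have "norm ((pw p (t + s) * (t + s) - p * pw p t * (t + s)) - (pw p t * t - p * pw p t * t)) <= B * norm ((t + s) - t)"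
  proof (rule field_differentiable_bound[of "closed_segment t (t + s)" "%y. pw p y * y - p * pw p t * y"])
    fix z assume z: "z \<in> closed_segment t (t + s)"
    have e: "z * \<bar>z\<bar> powr (p - 2) = pw p z" by (simp add: pw_def)
    have "((%y. pw p y * y - p * pw p t * y) has_real_derivative p * (pw p z - pw p t)) (at z)"
      by (rule DERIV_cong[OF DERIV_diff[OF DERIV_mult[OF pw_deriv[OF p(1), of z] DERIV_ident] DERIV_cmult[OF DERIV_ident]]])
        (simp add: e algebra_simps)
    then show "((%y. pw p y * y - p * pw p t * y) has_real_derivative p * (pw p z - pw p t)) (at z within closed_segment t (t + s))"
      by (rule has_field_derivative_at_within)
    have d: "\<bar>z - t\<bar> <= \<bar>s\<bar>" using z by (auto simp: closed_segment_eq_real_ivl split: if_splits)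
    have "z\<^sup>2 = (t + (z - t))\<^sup>2" by simp
    also have "... <= 2 * t\<^sup>2 + 2 * (z - t)\<^sup>2" using zero_le_power2[of "t - (z - t)"] by (simp add: power2_eq_square algebra_simps)
    also have "(z - t)\<^sup>2 <= s\<^sup>2" using d by (simp add: abs_le_square_iff)
    finally have zz: "z\<^sup>2 <= 2 * t\<^sup>2 + 2 * s\<^sup>2" by simp
    have "\<bar>pw p z - pw p t\<bar> <= (p - 1) * \<bar>z - t\<bar> * (1 + z\<^sup>2 + t\<^sup>2)" by (rule pw_lipschitz[OF p])
    also have "... <= (p - 1) * \<bar>s\<bar> * (1 + 4 * t\<^sup>2 + 2 * s\<^sup>2)"
    proof (intro mult_mono mult_nonneg_nonneg add_nonneg_nonneg)
      show "1 + z\<^sup>2 + t\<^sup>2 <= 1 + 4 * t\<^sup>2 + 2 * s\<^sup>2" using zz zero_le_power2[of t] by linarith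
    qed (use p d in auto)
    finally show "norm (p * (pw p z - pw p t)) <= B" unfolding B_def using p by (simp add: abs_mult)
  qed auto
  moreover have "B * \<bar>s\<bar> <= 4 * p * (p - 1) * (1 + t\<^sup>2 + s\<^sup>2) * s\<^sup>2"
  proof -
    have "B * \<bar>s\<bar> = (p * (p - 1) * s\<^sup>2) * (1 + 4 * t\<^sup>2 + 2 * s\<^sup>2)"
      by (simp add: B_def power2_eq_square mult_ac flip: abs_mult)
    also have "... <= (p * (p - 1) * s\<^sup>2) * (4 * (1 + t\<^sup>2 + s\<^sup>2))" using p by (intro mult_left_mono) auto
    finally show ?thesis by (simp only: mult_ac)
  qed
  ultimately show ?thesis by (simp add: algebra_simps)
qed

text \<open>Split at |t| = l: below, |t|^p is at most l^(p-2) t^2; above, it is at most l^(p-4) t^4.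
  The level l is chosen later to balance the two.\<close>

lemma pw_interpolation:
  assumes p: "2 < p" "p < 4" and l: "l > 0"
  shows "pw p t * t <= l powr (p - 2) * t\<^sup>2 + l powr (p - 4) * (t\<^sup>2)\<^sup>2"
proof -
  have e: "pw p t * t = \<bar>t\<bar> powr (p - 2) * t\<^sup>2" by (simp add: pw_def power2_eq_square)
  show ?thesis
  proof (cases "\<bar>t\<bar> <= l")
    case True
    then have "\<bar>t\<bar> powr (p - 2) <= l powr (p - 2)" using p by (intro powr_mono2) auto
    then have "pw p t * t <= l powr (p - 2) * t\<^sup>2" unfolding e by (rule mult_right_mono) simp
    then show ?thesis by (simp add: add_increasing2)
  next
    case False
    have "\<bar>t\<bar> powr (p - 2) = \<bar>t\<bar> powr (p - 4) * \<bar>t\<bar> powr 2" unfolding powr_add[symmetric] by simp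
    also have "\<bar>t\<bar> powr 2 = t\<^sup>2" using False l by simp
    finally have "pw p t * t = \<bar>t\<bar> powr (p - 4) * (t\<^sup>2)\<^sup>2" unfolding e by (simp add: power2_eq_square)
    also have "... <= l powr (p - 4) * (t\<^sup>2)\<^sup>2"
      using False p l by (intro mult_right_mono powr_mono2') auto
    finally show ?thesis by (simp add: add_increasing)
  qed
qed

lemma pw_bound:
  assumes p: "2 < p" "p < 4" shows "\<bar>pw p t * s\<bar> <= (1 + t\<^sup>2) * \<bar>t * s\<bar>"
  using mult_right_mono[OF powr_le_one_plus_sq[OF p, of t] abs_ge_zero[of "t * s"]] by (simp add: pw_def abs_mult mult_ac)

section \<open>Products in L2 and fourth powers\<close>

definition prd :: "'a::euclidean_space l2 => 'a l2 => 'a l2"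
  where "prd u v = mk (%x. rep u x * rep v x)"

definition l4 :: "'a::euclidean_space l2 => bool"
  where "l4 u \<longleftrightarrow> sqint (%x. rep u x * rep u x)"

lemma sqint_prd:
  assumes "l4 u" "l4 v" shows "sqint (%x. rep u x * rep v x)"
proof (rule sqint_bound)
  show "sqint (%x. rep u x * rep u x + rep v x * rep v x)" using assms by (intro sqint_add) (auto simp: l4_def)
  show "AE x in lebesgue. \<bar>rep u x * rep v x\<bar> <= \<bar>rep u x * rep u x + rep v x * rep v x\<bar>"
  proof (rule AE_I2)
    fix x
    have "2 * \<bar>rep u x\<bar> * \<bar>rep v x\<bar> <= (rep u x)\<^sup>2 + (rep v x)\<^sup>2"
      using sum_squares_bound[of "\<bar>rep u x\<bar>" "\<bar>rep v x\<bar>"] by simp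
    moreover have "0 <= \<bar>rep u x\<bar> * \<bar>rep v x\<bar>" by simp
    ultimately have "\<bar>rep u x\<bar> * \<bar>rep v x\<bar> <= (rep u x)\<^sup>2 + (rep v x)\<^sup>2" by linarith
    then show "\<bar>rep u x * rep v x\<bar> <= \<bar>rep u x * rep u x + rep v x * rep v x\<bar>"
      by (simp add: abs_mult power2_eq_square)
  qed
qed simp

lemma l4_add: assumes "l4 u" "l4 v" shows "l4 (u + v)"
  unfolding l4_def
proof (rule sqint_bound)
  show "sqint (%x. 2 * (rep u x * rep u x) + 2 * (rep v x * rep v x))"
    using assms by (intro sqint_add sqint_cmult) (auto simp: l4_def)
  show "AE x in lebesgue. \<bar>rep (u + v) x * rep (u + v) x\<bar> <= \<bar>2 * (rep u x * rep u x) + 2 * (rep v x * rep v x)\<bar>"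
    using rep_add[of u v]
  proof eventually_elim
    case (elim x)
    have "\<bar>(rep u x + rep v x) * (rep u x + rep v x)\<bar> = (rep u x + rep v x)\<^sup>2" by (simp add: power2_eq_square)
    also have "... <= 2 * (rep u x * rep u x) + 2 * (rep v x * rep v x)"
      using zero_le_power2[of "rep u x - rep v x"] by (simp add: power2_eq_square algebra_simps)
    finally show ?case unfolding elim by linarith
  qed
qed simp

lemma l4_scaleR: assumes "l4 u" shows "l4 (c *\<^sub>R u)"
  unfolding l4_def
proof (rule sqint_bound)
  show "sqint (%x. c * c * (rep u x * rep u x))" using assms by (intro sqint_cmult) (auto simp: l4_def)
  show "AE x in lebesgue. \<bar>rep (c *\<^sub>R u) x * rep (c *\<^sub>R u) x\<bar> <= \<bar>c * c * (rep u x * rep u x)\<bar>"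
    using rep_scaleR[of c u] by eventually_elim (simp add: mult_ac)
qed simp

lemma prd_commute: "prd u v = prd v u"
  by (simp add: prd_def mult.commute)

lemma prd_add_left:
  assumes "l4 u" "l4 v" "l4 w" shows "prd (u + v) w = prd u w + prd v w"
  unfolding prd_def mk_add[OF sqint_prd[OF assms(1,3)] sqint_prd[OF assms(2,3)]]
proof (rule mk_cong_AE[OF sqint_prd[OF l4_add[OF assms(1,2)] assms(3)] sqint_add[OF sqint_prd[OF assms(1,3)] sqint_prd[OF assms(2,3)]]])
  show "AE x in lebesgue. rep (u + v) x * rep w x = rep u x * rep w x + rep v x * rep w x"
    using rep_add[of u v] by eventually_elim (simp add: distrib_right)
qed

lemma prd_scaleR_left:
  assumes "l4 u" "l4 w" shows "prd (c *\<^sub>R u) w = c *\<^sub>R prd u w"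
  unfolding prd_def mk_cmult[OF sqint_prd[OF assms]]
proof (rule mk_cong_AE[OF sqint_prd[OF l4_scaleR[OF assms(1)] assms(2)] sqint_cmult[OF sqint_prd[OF assms]]])
  show "AE x in lebesgue. rep (c *\<^sub>R u) x * rep w x = c * (rep u x * rep w x)"
    using rep_scaleR[of c u] by eventually_elim simp
qed

text \<open>The left side is also the inner product of u^2 and v^2.\<close>

lemma norm_prd_sq:
  assumes "l4 u" "l4 v" shows "(norm (prd u v))\<^sup>2 <= norm (prd u u) * norm (prd v v)"
proof -
  have "(norm (prd u v))\<^sup>2 = inner (prd u u) (prd v v)"
    unfolding prd_def norm_mk_sq[OF sqint_prd[OF assms]] inner_mk[OF sqint_prd[OF assms(1,1)] sqint_prd[OF assms(2,2)]]
    by (simp add: power2_eq_square mult_ac)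
  also have "... <= norm (prd u u) * norm (prd v v)" by (rule norm_cauchy_schwarz)
  finally show ?thesis .
qed

text \<open>The growth 1 + t^2 + w^2 of the nonlinearity is integrated with Cauchy-Schwarz: the
  constant part leads to L2 norms, the squares to L2 norms of products, which on \<open>Sob\<close>
  are controlled by Ladyzhenskaya's inequality.\<close>

lemma weighted_integral_bound:
  assumes l: "l4 t" "l4 w" "l4 u" "l4 v" and F: "F \<in> borel_measurable lebesgue" and c: "c >= 0"
    and b: "AE x in lebesgue. \<bar>F x\<bar> <= c * (1 + (rep t x)\<^sup>2 + (rep w x)\<^sup>2) * \<bar>rep u x * rep v x\<bar>"
  shows "integrable lebesgue F"
    "\<bar>LINT x|lebesgue. F x\<bar> <= c * (norm u * norm v + (norm (prd t t) + norm (prd w w)) * norm (prd u v))"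
proof -
  define A where "A = (%x. \<bar>rep u x\<bar> * \<bar>rep v x\<bar>)"
  have sA: "sqint A" unfolding A_def using sqint_abs[OF sqint_prd[OF l(3,4)]] by (simp add: abs_mult)
  have nA: "norm (mk A) = norm (prd u v)"
  proof -
    have "(norm (mk A))\<^sup>2 = (norm (prd u v))\<^sup>2"
      unfolding prd_def norm_mk_sq[OF sA] norm_mk_sq[OF sqint_prd[OF l(3,4)]] by (simp add: A_def power_mult_distrib)
    then show ?thesis by simp
  qed
  have nabs: "norm (mk (%x. \<bar>rep z x\<bar>)) = norm z" for z :: "'a l2"
  proof -
    have "(norm (mk (%x. \<bar>rep z x\<bar>)))\<^sup>2 = (norm z)\<^sup>2"
      unfolding norm_mk_sq[OF sqint_abs[OF sqint_rep]] norm_l2_sq[of z] by simp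
    then show ?thesis by simp
  qed
  note st = l(1,2)[unfolded l4_def]
  have i1: "integrable lebesgue A" unfolding A_def by (intro sqint_mult sqint_abs) simp_all
  have i2: "integrable lebesgue (%x. rep t x * rep t x * A x)" "integrable lebesgue (%x. rep w x * rep w x * A x)"
    by (intro sqint_mult st sA)+
  have b1: "(LINT x|lebesgue. A x) <= norm u * norm v"
  proof -
    have "(LINT x|lebesgue. A x) = inner (mk (%x. \<bar>rep u x\<bar>)) (mk (%x. \<bar>rep v x\<bar>))"
      unfolding A_def by (rule inner_mk[symmetric]) (intro sqint_abs sqint_rep)+
    also have "... <= norm u * norm v" using norm_cauchy_schwarz[of "mk (%x. \<bar>rep u x\<bar>)" "mk (%x. \<bar>rep v x\<bar>)"] by (simp add: nabs)
    finally show ?thesis .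
  qed
  have b2: "(LINT x|lebesgue. rep z x * rep z x * A x) <= norm (prd z z) * norm (prd u v)" if "l4 z" for z
  proof -
    have "(LINT x|lebesgue. rep z x * rep z x * A x) = inner (prd z z) (mk A)"
      unfolding prd_def by (rule inner_mk[symmetric]) (use that sA in \<open>auto simp: l4_def\<close>)
    also have "... <= norm (prd z z) * norm (prd u v)" unfolding nA[symmetric] by (rule norm_cauchy_schwarz)
    finally show ?thesis .
  qed
  let ?M = "%x. c * (A x + rep t x * rep t x * A x + rep w x * rep w x * A x)"
  have iM: "integrable lebesgue ?M" by (intro integrable_mult_right Bochner_Integration.integrable_add i1 i2)
  have b': "AE x in lebesgue. norm (F x) <= ?M x"
    using b by eventually_elim (simp add: A_def abs_mult power2_eq_square algebra_simps)
  then have b'': "AE x in lebesgue. norm (F x) <= norm (?M x)" by eventually_elim (unfold real_norm_def, linarith)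
  show iF: "integrable lebesgue F" by (rule Bochner_Integration.integrable_bound[OF iM F b''])
  have "\<bar>LINT x|lebesgue. F x\<bar> <= (LINT x|lebesgue. norm (F x))"
    using integral_norm_bound[of lebesgue F] by simp
  also have "... <= (LINT x|lebesgue. ?M x)"
    by (rule integral_mono_AE[OF integrable_norm[OF iF] iM b'])
  also have "... = c * ((LINT x|lebesgue. A x) + (LINT x|lebesgue. rep t x * rep t x * A x) + (LINT x|lebesgue. rep w x * rep w x * A x))"
    using i1 i2 by simp
  also have "... <= c * (norm u * norm v + (norm (prd t t) + norm (prd w w)) * norm (prd u v))"
    using b1 b2[OF l(1)] b2[OF l(2)] by (intro mult_left_mono c) (simp add: distrib_right)
  finally show "\<bar>LINT x|lebesgue. F x\<bar> <= c * (norm u * norm v + (norm (prd t t) + norm (prd w w)) * norm (prd u v))" .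
qed

text \<open>Normalised bumps with disjoint supports, lined up inside a ball in \<Omega>.\<close>

lemma orthonormal_tests:
  fixes \<Omega> :: "(real^'n::finite) set"
  assumes \<Omega>: "open \<Omega>" "\<Omega> ~= {}"
  shows "\<exists>e::nat => (real^'n) l2 \<times> ((real^'n) l2 ^ 'n). (\<forall>i\<le>n. e i \<in> Sob \<Omega>) &
          (\<forall>i\<le>n. \<forall>j\<le>n. inner (fst (e i)) (fst (e j)) = (if i = j then 1 else 0))"
proof -
  obtain a where a: "a \<in> \<Omega>" using \<Omega>(2) by blast
  obtain r where r: "r > 0" "ball a r \<subseteq> \<Omega>" using openE[OF \<Omega>(1) a] .
  define N where "N = real n + 1"
  define k where "k = (SOME k::'n. True)"
  define c where "c i = a + (real i * (r / (2 * N))) *\<^sub>R axis k 1" for i :: nat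
  \<comment> \<open>Neighbouring centres are r / (2 N) = 4 rho apart, more than the diameter 2 rho,
    and all centres stay within r / 2 of a.\<close>
  define rho where "rho = r / (8 * N)"
  have N: "N >= 1" by (simp add: N_def)
  have rho: "rho > 0" using r N by (simp add: rho_def)
  have sub: "cball (c i) rho \<subseteq> \<Omega>" if "i <= n" for i
  proof
    fix x assume "x \<in> cball (c i) rho"
    then have "norm (x - c i) <= rho" by (simp add: dist_norm norm_minus_commute)
    moreover have "norm (c i - a) <= r / 2"
    proof -
      have "norm (c i - a) = real i * (r / (2 * N))" using r N by (simp add: c_def)
      also have "... <= N * (r / (2 * N))" using that r N by (intro mult_right_mono) (auto simp: N_def)
      finally show ?thesis using N by simp
    qed
    moreover have "rho <= r / 8" using r N by (simp add: rho_def field_simps)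
    ultimately have "norm (x - a) < r" using norm_triangle_ineq[of "x - c i" "c i - a"] r by simp
    then show "x \<in> \<Omega>" using r(2) by (auto simp: dist_norm norm_minus_commute)
  qed
  define b where "b i = ball_bump (c i) rho" for i
  have bt: "b i \<in> test_functions \<Omega>" if "i <= n" for i unfolding b_def by (rule ball_bump_test[OF rho sub[OF that]])
  have disj: "b i x * b j x = 0" if "i ~= j" for i j x
  proof (rule ccontr)
    assume "b i x * b j x ~= 0"
    then have "x \<in> ball (c i) rho" "x \<in> ball (c j) rho" using ball_bump(4)[OF rho] unfolding b_def by auto
    then have "dist (c i) (c j) < 2 * rho" using dist_triangle2[of "c i" "c j" x] by (simp add: dist_commute)
    moreover have "dist (c i) (c j) = \<bar>real i - real j\<bar> * (r / (2 * N))"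
    proof -
      have "c i - c j = ((real i - real j) * (r / (2 * N))) *\<^sub>R axis k 1" by (simp add: c_def left_diff_distrib diff_divide_distrib scaleR_left_diff_distrib)
      then show ?thesis using r N by (simp add: dist_norm abs_mult)
    qed
    moreover have "r / (2 * N) = 4 * rho" by (simp add: rho_def)
    moreover have "1 * (4 * rho) <= \<bar>real i - real j\<bar> * (4 * rho)" using that rho by (intro mult_right_mono) auto
    ultimately show False using rho by simp
  qed
  have nz: "norm (mk (b i)) ~= 0" if "i <= n" for i
  proof
    assume "norm (mk (b i)) = 0"
    then have "mk (b i) = mk (%x. 0)" by simp
    then have "AE x in lebesgue. b i x = 0" using test_sqint[OF bt[OF that]] by (subst (asm) mk_eq_iff) auto
    then have "AE x in lebesgue. x \<notin> ball (c i) rho"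
    proof eventually_elim
      case (elim x)
      show ?case using ball_bump(3)[OF rho, of x "c i"] elim unfolding b_def by linarith
    qed
    then have "negligible (ball (c i) rho)"
      by (simp add: negligible_iff_null_sets AE_iff_null_sets)
    then show False using open_not_negligible[OF open_ball, of "c i" rho] rho by simp
  qed
  define e where "e i = (1 / norm (mk (b i))) *\<^sub>R jet (b i)" for i
  show ?thesis
  proof (intro exI[of _ e] conjI allI impI)
    show "e i \<in> Sob \<Omega>" if "i <= n" for i
      unfolding e_def by (rule subspace_scale[OF Sob_subspace jet_Sob[OF bt[OF that]]])
    fix i j assume ij: "i <= n" "j <= n"
    have "inner (mk (b i)) (mk (b j)) = (if i = j then (norm (mk (b i)))\<^sup>2 else 0)"
    proof (cases "i = j")
      case False
      then show ?thesis using inner_mk[OF test_sqint[OF bt[OF ij(1)]] test_sqint[OF bt[OF ij(2)]]] disj[OF False] by simp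
    qed (simp add: power2_norm_eq_inner)
    then show "inner (fst (e i)) (fst (e j)) = (if i = j then 1 else 0)"
      using nz[OF ij(1)] by (auto simp: e_def jet_def power2_eq_square)
  qed
qed

section \<open>The energy functional\<close>

lemma norm_pair_sq: "(norm U)\<^sup>2 = (norm (fst U))\<^sup>2 + (norm (snd U))\<^sup>2"
  for U :: "'b::real_normed_vector \<times> 'c::real_normed_vector"
  by (simp add: norm_prod_def)

locale coupled_energy =
  fixes \<Omega> :: "(real^3) set" and a :: "real^3 => real" and G :: "(real^3) l2 => (real^3) l2" and p :: real
  assumes \<Omega>: "open \<Omega>" "bounded \<Omega>" "\<Omega> ~= {}" and a: "bmult a"
    and G: "bounded_linear G" and G_sym: "!!f g. inner f (G g) = inner (G f) g" and G_nonneg: "!!f. 0 <= inner f (G f)"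
    and p: "2 < p" "p < 10 / 3"
begin

abbreviation S :: "((real^3) l2 \<times> ((real^3) l2 ^ 3)) set" where "S \<equiv> Sob \<Omega>"

lemma p4: "p < 4" using p by simp

lemma S_diff: "U \<in> S ==> V \<in> S ==> U - V \<in> S" by (rule subspace_diff[OF Sob_subspace])
lemma S_neg: "U \<in> S ==> - U \<in> S" by (rule subspace_neg[OF Sob_subspace])

lemma norm_fst: "norm (fst U) <= norm U" and norm_snd: "norm (snd U) <= norm U"
  for U :: "'b::real_normed_vector \<times> 'c::real_normed_vector"
  using norm_fst_le[of "fst U" "snd U"] norm_snd_le[of "snd U" "fst U"] by simp_all

text \<open>\<open>m4\<close> is the square of the L4 norm of the function part, and
  \<open>mu\<close> is the L4 norm itself; Ladyzhenskaya's inequality controls both by the norm of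
  \<open>U\<close>.\<close>

definition m4 :: "(real^3) l2 \<times> ((real^3) l2 ^ 3) => real" where "m4 U = norm (prd (fst U) (fst U))"
definition mu :: "(real^3) l2 \<times> ((real^3) l2 ^ 3) => real" where "mu U = sqrt (m4 U)"

lemma m4_nonneg: "0 <= m4 U" and mu_nonneg: "0 <= mu U" and m4_eq: "m4 U = (mu U)\<^sup>2"
  by (simp_all add: m4_def mu_def)

lemma l4S: "U \<in> S ==> l4 (fst U)"
  using ladyzhenskaya(1)[of U \<Omega>] by (simp add: l4_def power2_eq_square)

lemma m4_sq: "U \<in> S ==> (m4 U)\<^sup>2 <= 16 * norm (fst U) * norm (snd U) ^ 3"
  using ladyzhenskaya(2)[of U \<Omega>] by (simp add: m4_def prd_def power2_eq_square)

lemma mu_pow4: assumes "U \<in> S" shows "mu U ^ 4 <= 16 * norm (fst U) * norm U ^ 3"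
proof -
  have "mu U ^ 4 = (m4 U)\<^sup>2" by (simp add: m4_eq flip: power_mult)
  also have "... <= 16 * norm (fst U) * norm (snd U) ^ 3" by (rule m4_sq[OF assms])
  also have "... <= 16 * norm (fst U) * norm U ^ 3" by (intro mult_left_mono power_mono norm_snd) auto
  finally show ?thesis .
qed

lemma mu_le: assumes "U \<in> S" shows "mu U <= 2 * norm U"
proof (rule power_le_imp_le_base[where n = 3])
  have "mu U ^ 4 <= 16 * norm (fst U) * norm U ^ 3" by (rule mu_pow4[OF assms])
  also have "... <= 16 * norm U * norm U ^ 3" by (intro mult_right_mono mult_left_mono norm_fst) auto
  also have "... = (2 * norm U) ^ 4" by (simp add: power_mult_distrib eval_nat_numeral)
  finally show "mu U ^ Suc 3 <= (2 * norm U) ^ Suc 3" by simp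
qed simp

lemma prd_le: assumes "U \<in> S" "V \<in> S" shows "norm (prd (fst U) (fst V)) <= mu U * mu V"
  unfolding mu_def real_sqrt_mult[symmetric]
  by (rule real_le_rsqrt) (use norm_prd_sq[OF l4S[OF assms(1)] l4S[OF assms(2)]] in \<open>simp add: m4_def\<close>)

definition f :: "(real^3) l2 \<times> ((real^3) l2 ^ 3) => (real^3) l2 \<times> ((real^3) l2 ^ 3) => (real^3) l2"
  where "f U V = Mop a (prd (fst U) (fst V))"

lemma f_commute: "f U V = f V U" by (simp add: f_def prd_commute)

lemma f_add: "U \<in> S ==> V \<in> S ==> W \<in> S ==> f (U + V) W = f U W + f V W"
  by (simp add: f_def prd_add_left l4S Mop_addr[OF a])

lemma f_scale: "U \<in> S ==> W \<in> S ==> f (c *\<^sub>R U) W = c *\<^sub>R f U W"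
  by (simp add: f_def prd_scaleR_left l4S linear_scale[OF bounded_linear.linear[OF Mop_linear[OF a]]])

lemma f_neg: "U \<in> S ==> W \<in> S ==> f (- U) W = - f U W"
  using f_scale[of U W "-1"] by simp

text \<open>The nonlocal interaction as a form in four arguments: \<open>q4 U U U U\<close> pairs q
  u^2 with its potential, and \<open>q4 U V U U\<close> is the term q phi u v of the first
  equation.\<close>

definition q4 where "q4 U V X Y = inner (f U V) (G (f X Y))"

lemma q4_bound_ex: "\<exists>C\<ge>0. \<forall>U\<in>S. \<forall>V\<in>S. \<forall>X\<in>S. \<forall>Y\<in>S. \<bar>q4 U V X Y\<bar> <= C * ((mu U * mu V) * (mu X * mu Y))"
proof -
  obtain B where B: "!!x. \<bar>a x\<bar> <= B" using a by (auto simp: bmult_def)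
  have B0: "B >= 0" using B[of undefined] abs_ge_zero[of "a undefined"] by linarith
  obtain g where g: "g >= 0" "!!x. norm (G x) <= norm x * g" using bounded_linear.nonneg_bounded[OF G] by blast
  have nf: "norm (f U V) <= B * (mu U * mu V)" if "U \<in> S" "V \<in> S" for U V
  proof -
    have "norm (f U V) <= B * norm (prd (fst U) (fst V))" unfolding f_def by (rule Mop_norm[OF a B])
    also have "... <= B * (mu U * mu V)" by (intro mult_left_mono prd_le that B0)
    finally show ?thesis .
  qed
  have "\<bar>q4 U V X Y\<bar> <= (B * B * g) * ((mu U * mu V) * (mu X * mu Y))" if "U \<in> S" "V \<in> S" "X \<in> S" "Y \<in> S" for U V X Y
  proof -
    have "\<bar>q4 U V X Y\<bar> <= norm (f U V) * norm (G (f X Y))" unfolding q4_def by (rule Cauchy_Schwarz_ineq2)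
    also have "... <= norm (f U V) * (norm (f X Y) * g)" by (intro mult_left_mono g(2)) simp
    also have "... <= (B * (mu U * mu V)) * ((B * (mu X * mu Y)) * g)"
      using that B0 g(1) mu_nonneg by (intro mult_mono nf mult_nonneg_nonneg) auto
    finally show ?thesis by (simp only: mult_ac)
  qed
  then show ?thesis using B0 g(1) by (intro exI[of _ "B * B * g"]) simp
qed

definition kap :: real
  where "kap = (SOME C. C >= 0 & (\<forall>U\<in>S. \<forall>V\<in>S. \<forall>X\<in>S. \<forall>Y\<in>S. \<bar>q4 U V X Y\<bar> <= C * ((mu U * mu V) * (mu X * mu Y))))"

lemma kap: "kap >= 0 & (\<forall>U\<in>S. \<forall>V\<in>S. \<forall>X\<in>S. \<forall>Y\<in>S. \<bar>q4 U V X Y\<bar> <= kap * ((mu U * mu V) * (mu X * mu Y)))"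
  unfolding kap_def by (rule someI_ex[OF q4_bound_ex])

lemma kap_nonneg: "kap >= 0" using kap by blast

lemma q4_bound:
  assumes "U \<in> S" "V \<in> S" "X \<in> S" "Y \<in> S" "mu U * mu V <= s" "mu X * mu Y <= t"
  shows "\<bar>q4 U V X Y\<bar> <= kap * (s * t)"
proof -
  have "0 <= s" using assms(5) mult_nonneg_nonneg[OF mu_nonneg[of U] mu_nonneg[of V]] by linarith
  have "\<bar>q4 U V X Y\<bar> <= kap * ((mu U * mu V) * (mu X * mu Y))" using kap assms(1-4) by blast
  also have "... <= kap * (s * t)"
    using mu_nonneg \<open>0 <= s\<close> by (intro mult_left_mono mult_mono assms kap_nonneg mult_nonneg_nonneg)
  finally show ?thesis .
qed

definition NP where "NP U V = (LINT x|lebesgue. pw p (rep (fst U) x) * rep (fst V) x)"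

lemma pw_rep_meas: "(%x. pw p (rep u x) * rep v x) \<in> borel_measurable lebesgue"
  by (intro borel_measurable_times measurable_compose[OF rep_meas pw_meas[OF p(1)]] rep_meas)

lemma NP_bound:
  assumes U: "U \<in> S" and V: "V \<in> S"
  shows NP_integrable: "integrable lebesgue (%x. pw p (rep (fst U) x) * rep (fst V) x)"
    and NP_bd: "\<bar>NP U V\<bar> <= norm (fst U) * norm (fst V) + 2 * m4 U * (mu U * mu V)"
proof -
  have b: "AE x in lebesgue. \<bar>pw p (rep (fst U) x) * rep (fst V) x\<bar>
      <= 1 * (1 + (rep (fst U) x)\<^sup>2 + (rep (fst U) x)\<^sup>2) * \<bar>rep (fst U) x * rep (fst V) x\<bar>"
  proof (rule AE_I2)
    fix x
    show "\<bar>pw p (rep (fst U) x) * rep (fst V) x\<bar>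
      <= 1 * (1 + (rep (fst U) x)\<^sup>2 + (rep (fst U) x)\<^sup>2) * \<bar>rep (fst U) x * rep (fst V) x\<bar>"
      by (rule order_trans[OF pw_bound[OF p(1) p4]]) (intro mult_right_mono, simp_all)
  qed
  note l = l4S[OF U] l4S[OF V]
  note w = weighted_integral_bound[OF l(1) l(1) l(1) l(2) pw_rep_meas zero_le_one b]
  show "integrable lebesgue (%x. pw p (rep (fst U) x) * rep (fst V) x)" by (rule w(1))
  have "\<bar>NP U V\<bar> <= norm (fst U) * norm (fst V) + (m4 U + m4 U) * norm (prd (fst U) (fst V))"
    using w(2) by (simp add: NP_def m4_def)
  also have "... <= norm (fst U) * norm (fst V) + (m4 U + m4 U) * (mu U * mu V)"
    by (intro add_left_mono mult_left_mono prd_le U V add_nonneg_nonneg m4_nonneg)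
  finally show "\<bar>NP U V\<bar> <= norm (fst U) * norm (fst V) + 2 * m4 U * (mu U * mu V)" by simp
qed

lemma NP_add: assumes "U \<in> S" "V \<in> S" "W \<in> S" shows "NP U (V + W) = NP U V + NP U W"
proof -
  have "NP U (V + W) = (LINT x|lebesgue. pw p (rep (fst U) x) * rep (fst V) x + pw p (rep (fst U) x) * rep (fst W) x)"
    unfolding NP_def
  proof (rule integral_cong_AE[OF pw_rep_meas borel_measurable_add[OF pw_rep_meas pw_rep_meas]])
    show "AE x in lebesgue. pw p (rep (fst U) x) * rep (fst (V + W)) x =
       pw p (rep (fst U) x) * rep (fst V) x + pw p (rep (fst U) x) * rep (fst W) x"
      using rep_add[of "fst V" "fst W"] by eventually_elim (simp add: distrib_left)
  qed
  then show ?thesis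
    using Bochner_Integration.integral_add[OF NP_integrable[OF assms(1,2)] NP_integrable[OF assms(1,3)]] by (simp add: NP_def)
qed

lemma NP_scale: "NP U (c *\<^sub>R V) = c * NP U V"
proof -
  have "NP U (c *\<^sub>R V) = (LINT x|lebesgue. c * (pw p (rep (fst U) x) * rep (fst V) x))"
    unfolding NP_def
  proof (rule integral_cong_AE[OF pw_rep_meas borel_measurable_times[OF borel_measurable_const pw_rep_meas]])
    show "AE x in lebesgue. pw p (rep (fst U) x) * rep (fst (c *\<^sub>R V)) x = c * (pw p (rep (fst U) x) * rep (fst V) x)"
      using rep_scaleR[of c "fst V"] by eventually_elim simp
  qed
  then show ?thesis by (simp add: NP_def)
qed

lemma NP_neg: "NP (- U) V = - NP U V"
proof -
  have "NP (- U) V = (LINT x|lebesgue. - (pw p (rep (fst U) x) * rep (fst V) x))"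
    unfolding NP_def
  proof (rule integral_cong_AE[OF pw_rep_meas borel_measurable_uminus[OF pw_rep_meas]])
    show "AE x in lebesgue. pw p (rep (fst (- U)) x) * rep (fst V) x = - (pw p (rep (fst U) x) * rep (fst V) x)"
      using rep_uminus[of "fst U"] by eventually_elim (simp add: pw_minus)
  qed
  then show ?thesis by (simp add: NP_def)
qed

lemma NP_diff:
  assumes U: "U \<in> S" and W: "W \<in> S" and Z: "Z \<in> S"
  shows "\<bar>NP U Z - NP W Z\<bar> <= (p - 1) * (norm (fst (U - W)) * norm (fst Z) + (m4 U + m4 W) * (mu (U - W) * mu Z))"
proof -
  let ?F = "%x. pw p (rep (fst U) x) * rep (fst Z) x - pw p (rep (fst W) x) * rep (fst Z) x"
  have b: "AE x in lebesgue. \<bar>?F x\<bar> <= (p - 1) * (1 + (rep (fst U) x)\<^sup>2 + (rep (fst W) x)\<^sup>2) * \<bar>rep (fst (U - W)) x * rep (fst Z) x\<bar>"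
    using rep_diff[of "fst U" "fst W"]
  proof eventually_elim
    case (elim x)
    have "\<bar>?F x\<bar> = \<bar>pw p (rep (fst U) x) - pw p (rep (fst W) x)\<bar> * \<bar>rep (fst Z) x\<bar>"
      by (simp flip: left_diff_distrib abs_mult)
    also have "... <= ((p - 1) * \<bar>rep (fst U) x - rep (fst W) x\<bar> * (1 + (rep (fst U) x)\<^sup>2 + (rep (fst W) x)\<^sup>2)) * \<bar>rep (fst Z) x\<bar>"
      by (intro mult_right_mono pw_lipschitz[OF p(1) p4]) simp
    finally show ?case by (simp add: elim abs_mult mult_ac)
  qed
  have m: "?F \<in> borel_measurable lebesgue" by (intro borel_measurable_diff pw_rep_meas)
  have p1: "0 <= p - 1" using p by simp
  have "NP U Z - NP W Z = (LINT x|lebesgue. ?F x)"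
    unfolding NP_def by (rule Bochner_Integration.integral_diff[symmetric]) (intro NP_integrable U W Z)+
  also have "\<bar>...\<bar> <= (p - 1) * (norm (fst (U - W)) * norm (fst Z) + (m4 U + m4 W) * norm (prd (fst (U - W)) (fst Z)))"
    unfolding m4_def by (rule weighted_integral_bound(2)[OF l4S[OF U] l4S[OF W] l4S[OF S_diff[OF U W]] l4S[OF Z] m p1 b])
  also have "... <= (p - 1) * (norm (fst (U - W)) * norm (fst Z) + (m4 U + m4 W) * (mu (U - W) * mu Z))"
    by (intro mult_left_mono add_left_mono prd_le S_diff U W Z add_nonneg_nonneg m4_nonneg p1)
  finally show ?thesis .
qed

lemma NP_taylor:
  assumes U: "U \<in> S" and V: "V \<in> S"
  shows "\<bar>NP V V - NP U U - p * NP U (V - U)\<bar> <= 4 * p * (p - 1) * ((norm (fst (V - U)))\<^sup>2 + (m4 U + m4 (V - U)) * m4 (V - U))"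
proof -
  let ?u = "%x. rep (fst U) x" and ?v = "%x. rep (fst V) x" and ?d = "%x. rep (fst (V - U)) x"
  let ?F = "%x. pw p (?v x) * ?v x - pw p (?u x) * ?u x - p * (pw p (?u x) * ?d x)"
  note D = S_diff[OF V U]
  have b: "AE x in lebesgue. \<bar>?F x\<bar> <= (4 * p * (p - 1)) * (1 + (?u x)\<^sup>2 + (?d x)\<^sup>2) * \<bar>?d x * ?d x\<bar>"
    using rep_diff[of "fst V" "fst U"]
  proof eventually_elim
    case (elim x)
    have e: "?v x = ?u x + ?d x" using elim by simp
    show ?case unfolding e using pw_taylor[OF p(1) p4, of "?u x" "?d x"] by (simp add: power2_eq_square mult.assoc)
  qed
  have m: "?F \<in> borel_measurable lebesgue"
    by (intro borel_measurable_diff borel_measurable_times borel_measurable_const measurable_compose[OF rep_meas pw_meas[OF p(1)]] rep_meas)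
  have p1: "0 <= 4 * p * (p - 1)" using p by simp
  note i = NP_integrable[OF V V] NP_integrable[OF U U] integrable_mult_right[OF NP_integrable[OF U D], of p]
  have "NP V V - NP U U - p * NP U (V - U) = (LINT x|lebesgue. ?F x)"
    unfolding NP_def using Bochner_Integration.integral_diff[OF Bochner_Integration.integrable_diff[OF i(1,2)] i(3)]
      Bochner_Integration.integral_diff[OF i(1,2)] by simp
  also have "\<bar>...\<bar> <= (4 * p * (p - 1)) * (norm (fst (V - U)) * norm (fst (V - U)) + (m4 U + m4 (V - U)) * norm (prd (fst (V - U)) (fst (V - U))))"
    unfolding m4_def by (rule weighted_integral_bound(2)[OF l4S[OF U] l4S[OF D] l4S[OF D] l4S[OF D] m p1 b])
  finally show ?thesis by (simp add: m4_def power2_eq_square)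
qed

text \<open>\<open>F U\<close> is the derivative of \<open>Psi\<close> at \<open>U\<close>. The term
  |u|^2 / 2 appears in \<open>Psi\<close> because the norm of \<open>S\<close> contains the function
  part: half the squared norm minus \<open>Psi\<close> then has only the gradient as its quadratic
  part.\<close>

definition F where "F U V = inner (fst U) (fst V) - q4 U V U U + NP U V"
definition Psi where "Psi U = (norm (fst U))\<^sup>2 / 2 - q4 U U U U / 4 + NP U U / p"

lemma q4_add2: "U \<in> S ==> V \<in> S ==> W \<in> S ==> q4 U (V + W) X Y = q4 U V X Y + q4 U W X Y"
  unfolding q4_def by (simp add: f_commute[of U] f_add inner_add_left)

lemma q4_scale2: "U \<in> S ==> V \<in> S ==> q4 U (c *\<^sub>R V) X Y = c * q4 U V X Y"
  unfolding q4_def by (simp add: f_commute[of U] f_scale)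

lemma mu_prod_le: "U \<in> S ==> V \<in> S ==> mu U * mu V <= (2 * norm U) * (2 * norm V)"
  by (intro mult_mono mu_le mu_nonneg) auto

lemma m4_le: "U \<in> S ==> m4 U <= 4 * (norm U)\<^sup>2"
  using mu_prod_le[of U U] by (simp add: m4_eq power2_eq_square)

lemma F_bound:
  assumes U: "U \<in> S" and V: "V \<in> S"
  shows "\<bar>F U V\<bar> <= (2 * norm U + 16 * kap * norm U ^ 3 + 32 * norm U ^ 3) * norm V"
proof -
  have "\<bar>inner (fst U) (fst V)\<bar> <= norm (fst U) * norm (fst V)" by (rule Cauchy_Schwarz_ineq2)
  moreover have uv: "norm (fst U) * norm (fst V) <= norm U * norm V" by (intro mult_mono norm_fst) auto
  moreover have "\<bar>q4 U V U U\<bar> <= kap * (((2 * norm U) * (2 * norm V)) * ((2 * norm U) * (2 * norm U)))"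
    by (intro q4_bound U V mu_prod_le)
  moreover have "2 * m4 U * (mu U * mu V) <= 2 * (4 * (norm U)\<^sup>2) * ((2 * norm U) * (2 * norm V))"
    using mu_nonneg by (intro mult_mono mu_prod_le U V m4_le order_refl mult_nonneg_nonneg m4_nonneg) auto
  moreover note NP_bd[OF U V]
  ultimately have "\<bar>F U V\<bar> <= norm U * norm V + kap * (((2 * norm U) * (2 * norm V)) * ((2 * norm U) * (2 * norm U)))
     + (norm U * norm V + 2 * (4 * (norm U)\<^sup>2) * ((2 * norm U) * (2 * norm V)))"
    unfolding F_def by linarith
  also have "... = (2 * norm U + 16 * kap * norm U ^ 3 + 32 * norm U ^ 3) * norm V"
    by (simp add: power2_eq_square power3_eq_cube algebra_simps)
  finally show ?thesis .
qed

lemma F_add2: "U \<in> S ==> V \<in> S ==> W \<in> S ==> F U (V + W) = F U V + F U W"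
  unfolding F_def by (simp add: q4_add2 NP_add inner_add_right)

lemma F_scale2: "U \<in> S ==> V \<in> S ==> F U (c *\<^sub>R V) = c * F U V"
  unfolding F_def by (simp add: q4_scale2 NP_scale right_diff_distrib distrib_left)

definition K where "K U = (SOME Z. Z \<in> S & (\<forall>V\<in>S. inner Z V = F U V))"

lemma K: assumes U: "U \<in> S" shows "K U \<in> S & (\<forall>V\<in>S. inner (K U) V = F U V)"
proof -
  have "\<exists>Z\<in>S. \<forall>V\<in>S. inner Z V = F U V"
    by (rule riesz_subspace[where l = "F U", OF Sob_subspace Sob_closed F_add2[OF U] F_scale2[OF U] F_bound[OF U]])
  then have "\<exists>Z. Z \<in> S & (\<forall>V\<in>S. inner Z V = F U V)" unfolding Bex_def .
  then show ?thesis unfolding K_def by (rule someI_ex)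
qed

lemma K_in: "U \<in> S ==> K U \<in> S" and K_inner: "U \<in> S ==> V \<in> S ==> inner (K U) V = F U V"
  using K by blast+

lemma F_neg: assumes "U \<in> S" "V \<in> S" shows "F (- U) V = - F U V"
proof -
  have "f (- U) (- U) = f U U" using assms by (simp add: f_neg S_neg f_commute[of U "- U"])
  then show ?thesis using assms unfolding F_def by (simp add: q4_def f_neg NP_neg)
qed

lemma Psi_even: assumes "U \<in> S" shows "Psi (- U) = Psi U"
proof -
  have "f (- U) (- U) = f U U" using assms by (simp add: f_neg S_neg f_commute[of U "- U"])
  moreover have "NP (- U) (- U) = NP U U" using NP_neg[of U "- U"] NP_scale[of U "-1" U] by simp
  ultimately show ?thesis by (simp add: Psi_def q4_def)
qed

lemma K_odd: assumes "U \<in> S" shows "K (- U) = - K U"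
  by (rule riesz_subspace_unique[OF Sob_subspace K_in[OF S_neg[OF assms]] S_neg[OF K_in[OF assms]]])
    (simp add: K_inner assms S_neg F_neg)

text \<open>Expanding f V V around U and using symmetry of \<open>G\<close>, the terms linear in d =
  V - U cancel. The rest is at least quadratic: two factors mu d are kept, the others are bounded by
  mu U <= 2 R and mu d <= 4 R. The constant is 288 = 72 times 4, the 4 coming from
  \<open>m4_le\<close>.\<close>

lemma q4_taylor:
  assumes U: "U \<in> S" and V: "V \<in> S" and R: "norm U <= R" "norm V <= R"
  shows "\<bar>q4 V V V V - q4 U U U U - 4 * q4 U (V - U) U U\<bar> <= 288 * kap * R\<^sup>2 * (norm (V - U))\<^sup>2"
proof -
  define d where "d = V - U"
  have d: "d \<in> S" unfolding d_def by (rule S_diff[OF V U])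
  interpret G: bounded_linear G by (rule G)
  have fV: "f V V = f U U + 2 *\<^sub>R f U d + f d d"
  proof -
    have Vd: "V = U + d" by (simp add: d_def)
    have "f V X = f U X + f d X" if "X \<in> S" for X unfolding Vd by (rule f_add[OF U d that])
    note e = this[OF V] this[OF U] this[OF d]
    show ?thesis unfolding e(1) f_commute[of U V] f_commute[of d V] e(2,3) f_commute[of d U] by (simp add: scaleR_2)
  qed
  have s: "inner x (G y) = inner y (G x)" for x y using G_sym[of x y] inner_commute[of "G x" y] by simp
  have e: "q4 V V V V - q4 U U U U - 4 * q4 U d U U = 2 * q4 d d U U + 4 * q4 U d U d + 4 * q4 U d d d + q4 d d d d"
    unfolding q4_def fV
    by (simp add: G.add G.scaleR inner_add_left inner_add_right s[of "f U U" "f U d"] s[of "f U U" "f d d"] s[of "f d d" "f U d"])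
  have R0: "0 <= R" using R(1) norm_ge_zero[of U] by linarith
  have mU: "mu U <= 2 * R" using mu_le[OF U] R(1) by simp
  have nd: "norm d <= 2 * R" unfolding d_def using norm_triangle_ineq4[of V U] R by linarith
  have md: "mu d <= 4 * R" using mu_le[OF d] nd by simp
  note n = mu_nonneg R0
  have UU: "mu U * mu U <= (2 * R) * (2 * R)" by (intro mult_mono mU) (use n in auto)
  have Ud: "mu U * mu d <= (2 * R) * mu d" by (intro mult_right_mono mU n)
  have dd: "mu d * mu d <= (4 * R) * mu d" by (intro mult_right_mono md n)
  have "\<bar>q4 d d U U\<bar> <= kap * ((mu d * mu d) * ((2 * R) * (2 * R)))" by (intro q4_bound d U order_refl UU)
  moreover have "\<bar>q4 U d U d\<bar> <= kap * (((2 * R) * mu d) * ((2 * R) * mu d))" by (intro q4_bound d U Ud)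
  moreover have "\<bar>q4 U d d d\<bar> <= kap * (((2 * R) * mu d) * ((4 * R) * mu d))" by (intro q4_bound d U Ud dd)
  moreover have "\<bar>q4 d d d d\<bar> <= kap * (((4 * R) * mu d) * ((4 * R) * mu d))" by (intro q4_bound d U dd)
  ultimately have "\<bar>2 * q4 d d U U + 4 * q4 U d U d + 4 * q4 U d d d + q4 d d d d\<bar> <=
     2 * (kap * ((mu d * mu d) * ((2 * R) * (2 * R)))) + 4 * (kap * (((2 * R) * mu d) * ((2 * R) * mu d)))
     + 4 * (kap * (((2 * R) * mu d) * ((4 * R) * mu d))) + kap * (((4 * R) * mu d) * ((4 * R) * mu d))" by linarith
  also have "... = 72 * kap * R\<^sup>2 * (mu d)\<^sup>2" by (simp add: power2_eq_square algebra_simps)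
  also have "... <= 72 * kap * R\<^sup>2 * (4 * (norm d)\<^sup>2)"
    using m4_le[OF d] kap_nonneg by (intro mult_left_mono mult_nonneg_nonneg) (auto simp: m4_eq)
  finally show ?thesis unfolding d_def[symmetric] e by simp
qed

lemma taylor: "\<exists>C\<ge>0. \<forall>U\<in>S. \<forall>V\<in>S. norm U <= R --> norm V <= R -->
    \<bar>Psi V - Psi U - inner (K U) (V - U)\<bar> <= C * (norm (V - U))\<^sup>2"
proof -
  define C where "C = 1 / 2 + 72 * kap * R\<^sup>2 + 4 * (p - 1) * (1 + 80 * R\<^sup>2)"
  have "\<bar>Psi V - Psi U - inner (K U) (V - U)\<bar> <= C * (norm (V - U))\<^sup>2"
    if U: "U \<in> S" and V: "V \<in> S" and R: "norm U <= R" "norm V <= R" for U V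
  proof -
    define d where "d = V - U"
    have d: "d \<in> S" unfolding d_def by (rule S_diff[OF V U])
    have R0: "0 <= R" using R(1) norm_ge_zero[of U] by linarith
    have nd: "norm d <= 2 * R" unfolding d_def using norm_triangle_ineq4[of V U] R by linarith
    have fd: "(norm (fst d))\<^sup>2 <= (norm d)\<^sup>2" by (intro power_mono norm_fst) simp
    have sq: "(norm (fst V))\<^sup>2 / 2 - (norm (fst U))\<^sup>2 / 2 - inner (fst U) (fst d) = (norm (fst d))\<^sup>2 / 2"
      unfolding d_def power2_norm_eq_inner by (simp add: inner_diff_left inner_diff_right inner_commute field_simps)
    have m4U: "m4 U <= 4 * R\<^sup>2"
    proof (rule order_trans[OF m4_le[OF U]])
      show "4 * (norm U)\<^sup>2 <= 4 * R\<^sup>2" using power_mono[OF R(1) norm_ge_zero, of 2] by simp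
    qed
    have m4d: "m4 d <= 16 * R\<^sup>2"
    proof (rule order_trans[OF m4_le[OF d]])
      show "4 * (norm d)\<^sup>2 <= 16 * R\<^sup>2" using power_mono[OF nd norm_ge_zero, of 2] by (simp add: power_mult_distrib)
    qed
    have "(norm (fst d))\<^sup>2 + (m4 U + m4 d) * m4 d <= (norm d)\<^sup>2 + (20 * R\<^sup>2) * (4 * (norm d)\<^sup>2)"
      using m4U m4d by (intro add_mono fd mult_mono m4_le d) (auto simp: m4_nonneg)
    also have "... = (1 + 80 * R\<^sup>2) * (norm d)\<^sup>2" by (simp add: algebra_simps)
    finally have "4 * p * (p - 1) * ((norm (fst d))\<^sup>2 + (m4 U + m4 d) * m4 d) <= 4 * p * (p - 1) * ((1 + 80 * R\<^sup>2) * (norm d)\<^sup>2)"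
      using p by (intro mult_left_mono) auto
    then have "\<bar>NP V V - NP U U - p * NP U d\<bar> <= 4 * p * (p - 1) * ((1 + 80 * R\<^sup>2) * (norm d)\<^sup>2)"
      using NP_taylor[OF U V] unfolding d_def[symmetric] by linarith
    moreover define X where "X = NP V V - NP U U - p * NP U d"
    ultimately have X: "\<bar>X\<bar> <= p * (4 * (p - 1) * ((1 + 80 * R\<^sup>2) * (norm d)\<^sup>2))" by (simp only: mult_ac)
    have pp: "p > 0" using p by simp
    have Xp: "X / p = NP V V / p - NP U U / p - NP U d" unfolding X_def using pp by (simp add: diff_divide_distrib)
    have "\<bar>X / p\<bar> = \<bar>X\<bar> / p" using pp by simp
    also have "... <= 4 * (p - 1) * ((1 + 80 * R\<^sup>2) * (norm d)\<^sup>2)" unfolding pos_divide_le_eq[OF pp] using X by (simp only: mult_ac)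
    finally have np: "\<bar>NP V V / p - NP U U / p - NP U d\<bar> <= 4 * (p - 1) * ((1 + 80 * R\<^sup>2) * (norm d)\<^sup>2)" unfolding Xp .
    have "Psi V - Psi U - inner (K U) d = (norm (fst d))\<^sup>2 / 2 - (q4 V V V V - q4 U U U U - 4 * q4 U d U U) / 4
        + (NP V V / p - NP U U / p - NP U d)"
      unfolding K_inner[OF U d] F_def Psi_def sq[symmetric] by (simp add: field_simps)
    moreover have "\<bar>x\<bar> <= c / 2 + b / 4 + e" if "x = t / 2 - y / 4 + z" "\<bar>z\<bar> <= e" "\<bar>y\<bar> <= b" "t <= c" "0 <= t"
      for x y z t e b c :: real using that by linarith
    ultimately have "\<bar>Psi V - Psi U - inner (K U) d\<bar> <= (norm d)\<^sup>2 / 2 + (288 * kap * R\<^sup>2 * (norm d)\<^sup>2) / 4 + 4 * (p - 1) * ((1 + 80 * R\<^sup>2) * (norm d)\<^sup>2)"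
      using np q4_taylor[OF U V R] fd zero_le_power2[of "norm (fst d)"] unfolding d_def[symmetric] by blast
    also have "... = C * (norm d)\<^sup>2" by (simp add: C_def algebra_simps)
    finally show ?thesis unfolding d_def .
  qed
  moreover have "C >= 0" using kap_nonneg p by (simp add: C_def)
  ultimately show ?thesis by blast
qed

text \<open>The difference of the arguments enters only through the L2 and L4 norms of its function
  part, which makes \<open>K\<close> continuous for L2 convergence on bounded sets.\<close>

lemma F_diff:
  assumes U: "U \<in> S" and W: "W \<in> S" and Z: "Z \<in> S" and R: "norm U <= R" "norm W <= R"
  shows "\<bar>F U Z - F W Z\<bar> <= (p + 24 * kap * R\<^sup>2 * 2 + 16 * (p - 1) * R\<^sup>2) * (norm (fst (U - W)) + mu (U - W)) * norm Z"
proof -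
  define d where "d = U - W"
  have d: "d \<in> S" unfolding d_def by (rule S_diff[OF U W])
  have R0: "0 <= R" using R(1) norm_ge_zero[of U] by linarith
  interpret G: bounded_linear G by (rule G)
  have Ud: "U = d + W" by (simp add: d_def)
  have "f U Z = f d Z + f W Z" unfolding Ud by (rule f_add[OF d W Z])
  moreover have "f U U = f W W + f d U + f d W"
  proof -
    have "f U U = f d U + f W U" by (subst (1) Ud) (rule f_add[OF d W U])
    also have "f W U = f d W + f W W" unfolding f_commute[of W U] by (subst Ud) (rule f_add[OF d W W])
    finally show ?thesis by simp
  qed
  ultimately have e: "q4 U Z U U - q4 W Z W W = q4 d Z U U + (q4 W Z d U + q4 W Z d W)"
    unfolding q4_def by (simp add: G.add inner_add_left inner_add_right)
  have mU: "mu U <= 2 * R" using mu_le[OF U] R(1) by simp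
  have mW: "mu W <= 2 * R" using mu_le[OF W] R(2) by simp
  note n = mu_nonneg R0
  have dZ: "mu d * mu Z <= mu d * (2 * norm Z)" by (intro mult_left_mono mu_le Z n)
  have b1: "\<bar>q4 d Z U U\<bar> <= kap * ((mu d * (2 * norm Z)) * ((2 * R) * (2 * R)))"
    by (intro q4_bound d U Z dZ mult_mono mU) (use n in auto)
  have b2: "\<bar>q4 W Z d X\<bar> <= kap * (((2 * R) * (2 * norm Z)) * (mu d * (2 * R)))" if X: "X \<in> S" "mu X <= 2 * R" for X
    by (intro q4_bound d W Z X mult_mono mu_le mW) (use n in auto)
  have q: "\<bar>q4 U Z U U - q4 W Z W W\<bar> <= (24 * kap * R\<^sup>2) * (mu d * norm Z)"
    using b1 b2[OF U mU] b2[OF W mW] unfolding e by (simp add: power2_eq_square algebra_simps)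
  have m4: "m4 U + m4 W <= 8 * R\<^sup>2"
    using m4_le[OF U] m4_le[OF W] power_mono[OF R(1) norm_ge_zero, of 2] power_mono[OF R(2) norm_ge_zero, of 2] by linarith
  have fz: "norm (fst d) * norm (fst Z) <= norm (fst d) * norm Z" by (intro mult_left_mono norm_fst) simp
  have "\<bar>NP U Z - NP W Z\<bar> <= (p - 1) * (norm (fst d) * norm (fst Z) + (m4 U + m4 W) * (mu d * mu Z))"
    unfolding d_def by (rule NP_diff[OF U W Z])
  also have "... <= (p - 1) * (norm (fst d) * norm Z + (8 * R\<^sup>2) * (mu d * (2 * norm Z)))"
    using p mu_nonneg by (intro mult_left_mono[OF add_mono[OF fz mult_mono[OF m4 dZ]]] mult_nonneg_nonneg) auto
  finally have np: "\<bar>NP U Z - NP W Z\<bar> <= (p - 1) * (norm (fst d) * norm Z + (8 * R\<^sup>2) * (mu d * (2 * norm Z)))" .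
  have i: "\<bar>inner (fst U) (fst Z) - inner (fst W) (fst Z)\<bar> <= norm (fst d) * norm Z"
    using Cauchy_Schwarz_ineq2[of "fst d" "fst Z"] fz by (simp add: d_def inner_diff_left)
  have "\<bar>F U Z - F W Z\<bar> <= norm (fst d) * norm Z + (24 * kap * R\<^sup>2) * (mu d * norm Z)
      + (p - 1) * (norm (fst d) * norm Z + (8 * R\<^sup>2) * (mu d * (2 * norm Z)))"
    using i q np unfolding F_def by linarith
  also have "... = p * (norm (fst d) * norm Z) + (24 * kap * R\<^sup>2 + 16 * (p - 1) * R\<^sup>2) * (mu d * norm Z)"
    by (simp add: algebra_simps)
  also have "... <= (p + 24 * kap * R\<^sup>2 * 2 + 16 * (p - 1) * R\<^sup>2) * (norm (fst d) * norm Z)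
      + (p + 24 * kap * R\<^sup>2 * 2 + 16 * (p - 1) * R\<^sup>2) * (mu d * norm Z)"
    using p kap_nonneg mu_nonneg by (intro add_mono mult_right_mono mult_nonneg_nonneg) auto
  finally show ?thesis unfolding d_def by (simp add: algebra_simps)
qed

lemma K_cont:
  assumes e: "e > 0"
  shows "\<exists>delta>0. \<forall>U\<in>S. \<forall>V\<in>S. norm U <= R --> norm V <= R --> norm (fst U - fst V) < delta --> norm (K U - K V) < e"
proof -
  define C where "C = p + 24 * kap * R\<^sup>2 * 2 + 16 * (p - 1) * R\<^sup>2"
  have C: "C > 0" unfolding C_def using p kap_nonneg by (intro add_pos_nonneg mult_nonneg_nonneg) auto
  define m where "m = e / (3 * C)"
  have m: "m > 0" using e C by (simp add: m_def)
  \<comment> \<open>For |d| <= 2 R, Ladyzhenskaya's inequality gives (mu d)^4 <= 16 (2 R)^3 |fst d|,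
    so this choice makes both the L2 and the L4 norm at most m; the 1 avoids division by
    zero.\<close>
  define delta where "delta = min m (m ^ 4 / (128 * \<bar>R\<bar> ^ 3 + 1))"
  have den: "128 * \<bar>R\<bar> ^ 3 + 1 > 0" by (simp add: add_nonneg_pos)
  have delta: "delta > 0" using m den by (simp add: delta_def)
  have "norm (K U - K V) < e" if U: "U \<in> S" and V: "V \<in> S" and R: "norm U <= R" "norm V <= R" and s: "norm (fst U - fst V) < delta" for U V
  proof -
    define Z where "Z = K U - K V"
    define d where "d = U - V"
    have Z: "Z \<in> S" unfolding Z_def by (intro S_diff K_in U V)
    have d: "d \<in> S" unfolding d_def by (rule S_diff[OF U V])
    have R0: "0 <= R" using R(1) norm_ge_zero[of U] by linarith
    have nd: "norm d <= 2 * R" unfolding d_def using norm_triangle_ineq4[of U V] R by linarith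
    have fd: "norm (fst d) < delta" using s by (simp add: d_def)
    have "mu d ^ 4 <= 16 * norm (fst d) * norm d ^ 3" by (rule mu_pow4[OF d])
    also have "... <= 16 * delta * (2 * R) ^ 3" using fd nd delta by (intro mult_mono power_mono) auto
    also have "... = (128 * \<bar>R\<bar> ^ 3) * delta" using R0 by (simp add: power_mult_distrib)
    also have "... <= (128 * \<bar>R\<bar> ^ 3 + 1) * delta" using delta by simp
    also have "... <= (128 * \<bar>R\<bar> ^ 3 + 1) * (m ^ 4 / (128 * \<bar>R\<bar> ^ 3 + 1))"
      using den by (intro mult_left_mono) (auto simp: delta_def)
    also have "... = m ^ 4" using den by simp
    finally have "mu d ^ Suc 3 <= m ^ Suc 3" by simp
    then have md: "mu d <= m" by (rule power_le_imp_le_base) (use m in simp)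
    have fm: "norm (fst d) <= m" using fd by (simp add: delta_def)
    have "(norm Z)\<^sup>2 = F U Z - F V Z"
      unfolding power2_norm_eq_inner K_inner[OF U Z, symmetric] K_inner[OF V Z, symmetric] by (simp add: Z_def inner_diff_left)
    also have "... <= C * (norm (fst d) + mu d) * norm Z" using F_diff[OF U V Z R] unfolding C_def d_def by linarith
    also have "... <= C * (m + m) * norm Z" using C md fm by (intro mult_right_mono mult_left_mono add_mono) auto
    finally have "norm Z * norm Z <= C * (m + m) * norm Z" by (simp add: power2_eq_square)
    then have "norm Z <= C * (m + m)" using C m by (cases "norm Z = 0") auto
    also have "... = 2 * e / 3" using C by (simp add: m_def)
    also have "... < e" using e by simp
    finally show ?thesis unfolding Z_def .
  qed
  then show ?thesis using delta by blast
qed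

lemma K_bdd: "\<exists>C\<ge>0. \<forall>U\<in>S. norm U <= R --> norm (K U) <= C"
proof -
  define C where "C = 2 * \<bar>R\<bar> + 16 * kap * \<bar>R\<bar> ^ 3 + 32 * \<bar>R\<bar> ^ 3"
  have "norm (K U) <= C" if U: "U \<in> S" and R: "norm U <= R" for U
  proof -
    have "(norm (K U))\<^sup>2 = F U (K U)" unfolding power2_norm_eq_inner by (rule K_inner[OF U K_in[OF U]])
    also have "... <= (2 * norm U + 16 * kap * norm U ^ 3 + 32 * norm U ^ 3) * norm (K U)" using F_bound[OF U K_in[OF U]] by linarith
    also have "... <= C * norm (K U)"
      unfolding C_def using R kap_nonneg by (intro mult_right_mono add_mono mult_left_mono power_mono) auto
    finally show ?thesis using kap_nonneg by (cases "norm (K U) = 0") (auto simp: power2_eq_square C_def)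
  qed
  moreover have "C >= 0" using kap_nonneg by (simp add: C_def)
  ultimately show ?thesis by blast
qed

section \<open>Subcritical growth and coercivity\<close>

lemma NP_interpolation:
  assumes U: "U \<in> S" and l: "l > 0"
  shows "NP U U <= l powr (p - 2) * (norm (fst U))\<^sup>2 + l powr (p - 4) * (m4 U)\<^sup>2"
proof -
  let ?u = "rep (fst U)"
  have s: "sqint (%x. ?u x * ?u x)" using l4S[OF U] by (simp add: l4_def)
  have i1: "integrable lebesgue (%x. (?u x)\<^sup>2)" using sqint_rep[of "fst U"] by (simp add: sqint_def del: sqint_rep)
  have i2: "integrable lebesgue (%x. (?u x * ?u x)\<^sup>2)" using s by (simp add: sqint_def)
  have "NP U U <= (LINT x|lebesgue. l powr (p - 2) * (?u x)\<^sup>2 + l powr (p - 4) * (?u x * ?u x)\<^sup>2)"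
    unfolding NP_def
  proof (rule integral_mono[OF NP_integrable[OF U U]])
    show "integrable lebesgue (%x. l powr (p - 2) * (?u x)\<^sup>2 + l powr (p - 4) * (?u x * ?u x)\<^sup>2)"
      by (intro Bochner_Integration.integrable_add integrable_mult_right i1 i2)
    show "pw p (?u x) * ?u x <= l powr (p - 2) * (?u x)\<^sup>2 + l powr (p - 4) * (?u x * ?u x)\<^sup>2" for x
      using pw_interpolation[OF p(1) p4 l, of "?u x"] by (simp add: power2_eq_square)
  qed
  also have "... = l powr (p - 2) * (norm (fst U))\<^sup>2 + l powr (p - 4) * (m4 U)\<^sup>2"
    unfolding m4_def prd_def norm_mk_sq[OF s] norm_l2_sq[of "fst U"] using i1 i2 by simp
  finally show ?thesis .
qed

text \<open>On the unit sphere the power term is at most 17 D^beta, where beta = 3 (p - 2) / 2 is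
  below 2 because p < 10 / 3.\<close>

lemma NP_subquadratic:
  "\<exists>C. \<forall>U\<in>S. norm (fst U) = 1 --> NP U U <= (norm (snd U))\<^sup>2 / 2 + C"
proof -
  define beta where "beta = 3 * (p - 2) / 2"
  have beta: "0 < beta" "beta < 2" using p by (auto simp: beta_def)
  \<comment> \<open>Beyond x0, D^(2 - beta) >= 34, that is 17 D^beta <= D^2 / 2; up to x0 the
    constant C takes over.\<close>
  define x0 where "x0 = max 1 (34 powr (1 / (2 - beta)))"
  define C where "C = 17 * x0 powr beta"
  have x0: "x0 >= 1" by (simp add: x0_def)
  have "NP U U <= (norm (snd U))\<^sup>2 / 2 + C" if U: "U \<in> S" and u: "norm (fst U) = 1" for U
  proof -
    define D where "D = max 1 (norm (snd U))"
    have D: "D >= 1" by (simp add: D_def)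
    \<comment> \<open>Balances l^(p - 2) against l^(p - 4) D^3, as l^2 = D^3.\<close>
    define l where "l = D powr (3 / 2)"
    have l: "l > 0" using D by (simp add: l_def)
    have "(m4 U)\<^sup>2 <= 16 * D ^ 3"
    proof -
      have "(m4 U)\<^sup>2 <= 16 * norm (snd U) ^ 3" using m4_sq[OF U] u by simp
      also have "... <= 16 * D ^ 3" by (intro mult_left_mono power_mono) (auto simp: D_def)
      finally show ?thesis .
    qed
    then have "NP U U <= l powr (p - 2) * 1 + l powr (p - 4) * (16 * D ^ 3)"
      using NP_interpolation[OF U l] mult_left_mono[of "(m4 U)\<^sup>2" "16 * D ^ 3" "l powr (p - 4)"] u by simp
    also have "l powr (p - 2) = D powr beta" by (simp add: l_def powr_powr beta_def field_simps)
    also have "l powr (p - 4) * (16 * D ^ 3) = 16 * D powr beta"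
    proof -
      have "D ^ 3 = D powr 3" using D by simp
      then have "l powr (p - 4) * D ^ 3 = D powr (3 / 2 * (p - 4) + 3)" by (simp add: l_def powr_powr powr_add)
      also have "3 / 2 * (p - 4) + 3 = beta" by (simp add: beta_def field_simps)
      finally show ?thesis by simp
    qed
    finally have N: "NP U U <= 17 * D powr beta" by simp
    show ?thesis
    proof (cases "D <= x0")
      case True
      then have "17 * D powr beta <= C" unfolding C_def using D beta by (intro mult_left_mono powr_mono2) auto
      then show ?thesis using N zero_le_power2[of "norm (snd U)"] by linarith
    next
      case False
      then have nD: "D = norm (snd U)" using x0 by (auto simp: D_def max_def split: if_splits)
      have "34 = (34 powr (1 / (2 - beta))) powr (2 - beta)" using beta by (simp add: powr_powr)
      also have "... <= D powr (2 - beta)" using False beta by (intro powr_mono2) (auto simp: x0_def)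
      finally have "34 * D powr beta <= D powr (2 - beta) * D powr beta" by (intro mult_right_mono) auto
      also have "... = D\<^sup>2" using D by (simp flip: powr_add)
      finally have "17 * D powr beta <= D\<^sup>2 / 2" by simp
      moreover have "C >= 0" by (simp add: C_def)
      ultimately show ?thesis using N unfolding nD by linarith
    qed
  qed
  then show ?thesis by blast
qed

lemma q4_nonneg: "0 <= q4 U U U U" unfolding q4_def by (rule G_nonneg)

lemma energy_eq: "(norm U)\<^sup>2 / 2 - Psi U = (norm (snd U))\<^sup>2 / 2 + q4 U U U U / 4 - NP U U / p"
  unfolding Psi_def norm_pair_sq by (simp add: field_simps)

lemma NP_div: assumes "NP U U <= t" "0 <= t" shows "NP U U / p <= t / 2"
proof -
  have "NP U U / p <= t / p" using assms(1) p by (intro divide_right_mono) auto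
  also have "... <= t / 2" using assms(2) p by (intro divide_left_mono) auto
  finally show ?thesis .
qed

lemma coercive: "\<exists>R. \<forall>U\<in>S. norm (fst U) = 1 --> (norm U)\<^sup>2 / 2 - Psi U <= b --> norm U <= R"
proof -
  obtain C where C: "!!U. U \<in> S ==> norm (fst U) = 1 ==> NP U U <= (norm (snd U))\<^sup>2 / 2 + C" using NP_subquadratic by blast
  have "norm U <= 1 + (4 * \<bar>b\<bar> + 2 * \<bar>C\<bar>)" if U: "U \<in> S" "norm (fst U) = 1" and b: "(norm U)\<^sup>2 / 2 - Psi U <= b" for U
  proof -
    have "NP U U / p <= ((norm (snd U))\<^sup>2 / 2 + \<bar>C\<bar>) / 2" using C[OF U] by (intro NP_div) auto
    moreover have "x <= 4 * \<bar>b\<bar> + 2 * \<bar>C\<bar>" if "t <= (x / 2 + \<bar>C\<bar>) / 2" "x / 2 + y / 4 - t <= b" "0 <= y"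
      for x y t :: real using that by (simp add: field_simps)
    ultimately have "(norm (snd U))\<^sup>2 <= 4 * \<bar>b\<bar> + 2 * \<bar>C\<bar>"
      using b q4_nonneg[of U] unfolding energy_eq by blast
    then have "(norm U)\<^sup>2 <= 1 + (4 * \<bar>b\<bar> + 2 * \<bar>C\<bar>)" unfolding norm_pair_sq U(2) by simp
    also have "... <= (1 + (4 * \<bar>b\<bar> + 2 * \<bar>C\<bar>))\<^sup>2"
      using self_le_power[of "1 + (4 * \<bar>b\<bar> + 2 * \<bar>C\<bar>)" 2] by simp
    finally show ?thesis by (rule power2_le_imp_le) simp
  qed
  then show ?thesis by blast
qed

sublocale constrained_functional S fst Psi K
proof
  show "subspace S" "closed S" by (rule Sob_subspace, rule Sob_closed)
  show "\<exists>r. \<forall>x. norm (fst x) <= norm x * r" for r :: real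
    using norm_fst by (intro exI[of _ 1]) auto
  show "\<exists>C\<ge>0. \<forall>U\<in>S. \<forall>V\<in>S. norm U <= R --> norm V <= R -->
    \<bar>Psi V - Psi U - inner (K U) (V - U)\<bar> <= C * (norm (V - U))\<^sup>2" for R by (rule taylor)
  show "\<exists>d>0. \<forall>U\<in>S. \<forall>V\<in>S. norm U <= R --> norm V <= R --> norm (fst U - fst V) < d --> norm (K U - K V) < e"
    if "e > 0" for R e by (rule K_cont[OF that])
qed (auto simp: Psi_even K_in K_odd K_bdd rellich[OF \<Omega>(1,2)] coercive orthonormal_tests[OF \<Omega>(1,3)])

text \<open>Testing with U itself gives \<omega> = D^2 + q4 - NP, and comparison with J U >= A
  through the subquadratic bound gives \<omega> >= A - |C|. Ladyzhenskaya's inequality bounds q4 by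
  a multiple of D^3, so J U is at most cubic in 1 + D and a high level forces a large
  gradient.\<close>

theorem high_energy_solutions:
  "\<exists>C1 C2. \<forall>A. \<exists>U\<in>S. \<exists>\<omega>. norm (fst U) = 1 & A - C1 <= \<omega> & A <= C2 * (1 + norm (snd U)) ^ 3 &
     (\<forall>V\<in>S. inner (snd U) (snd V) + q4 U V U U - NP U V = \<omega> * inner (fst U) (fst V))"
proof -
  obtain C where C: "!!U. U \<in> S ==> norm (fst U) = 1 ==> NP U U <= (norm (snd U))\<^sup>2 / 2 + C" using NP_subquadratic by blast
  have "\<exists>U\<in>S. \<exists>\<omega>. norm (fst U) = 1 & A - \<bar>C\<bar> <= \<omega> & A <= (1 + 16 * kap) * (1 + norm (snd U)) ^ 3 &
     (\<forall>V\<in>S. inner (snd U) (snd V) + q4 U V U U - NP U V = \<omega> * inner (fst U) (fst V))" for A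
  proof -
    obtain U \<omega> where U: "U \<in> S" "norm (fst U) = 1" "A <= J U"
      and eq: "\<forall>V\<in>S. inner (U - K U) V = \<omega> * inner (fst U) (fst V)" using critical_point[of A] by blast
    have eq': "inner (snd U) (snd V) + q4 U V U U - NP U V = \<omega> * inner (fst U) (fst V)" if V: "V \<in> S" for V
    proof -
      have "inner (U - K U) V = inner U V - inner (K U) V" by (rule inner_diff_left)
      also have "... = inner (snd U) (snd V) + q4 U V U U - NP U V"
        unfolding K_inner[OF U(1) V] F_def inner_prod_def[of U] by simp
      finally show ?thesis using eq V by simp
    qed
    define D where "D = norm (snd U)"
    have D0: "D >= 0" by (simp add: D_def)
    have A: "A <= D\<^sup>2 / 2 + q4 U U U U / 4 - NP U U / p" using U(3) unfolding J_def energy_eq D_def .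
    have NP0: "NP U U >= 0" unfolding NP_def
      by (rule Bochner_Integration.integral_nonneg) (simp add: pw_def mult.assoc)
    then have NPp: "NP U U / p >= 0" using p by simp
    have "inner (fst U) (fst U) = 1" "inner (snd U) (snd U) = D\<^sup>2"
      unfolding power2_norm_eq_inner[symmetric] D_def U(2) by simp_all
    then have \<omega>: "\<omega> = D\<^sup>2 + q4 U U U U - NP U U" using eq'[OF U(1)] by simp
    have "A - \<bar>C\<bar> <= \<omega>" using A NPp C[OF U(1,2)] q4_nonneg[of U] unfolding \<omega> D_def by linarith
    moreover have "A <= (1 + 16 * kap) * (1 + D) ^ 3"
    proof -
      have "q4 U U U U <= kap * (m4 U * m4 U)"
        using q4_bound[OF U(1) U(1) U(1) U(1) order_refl order_refl] by (simp add: m4_eq power2_eq_square)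
      also have "m4 U * m4 U <= 16 * D ^ 3" using m4_sq[OF U(1)] U(2) by (simp add: D_def power2_eq_square)
      finally have q: "q4 U U U U <= kap * (16 * D ^ 3)" using kap_nonneg by (simp add: mult_left_mono)
      have D3: "D ^ 3 <= (1 + D) ^ 3" "D\<^sup>2 <= (1 + D) ^ 3"
        using D0 by (simp_all add: power2_eq_square power3_eq_cube algebra_simps)
      have "kap * (16 * D ^ 3) <= kap * (16 * (1 + D) ^ 3)" using D3 kap_nonneg by (intro mult_left_mono) auto
      moreover have "A <= c + m" if "A <= x / 2 + y / 4 - t" "0 <= t" "y <= k" "k <= m" "x <= c" "0 <= y" "0 <= x"
        for x y t k m c :: real using that by linarith
      ultimately have "A <= (1 + D) ^ 3 + kap * (16 * (1 + D) ^ 3)"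
        using A NPp q D3(2) zero_le_power2[of D] q4_nonneg[of U] by blast
      also have "... = (1 + 16 * kap) * (1 + D) ^ 3" by (simp add: distrib_right)
      finally show ?thesis .
    qed
    ultimately show ?thesis using U(1,2) eq' unfolding D_def by blast
  qed
  then show ?thesis by blast
qed

end

section \<open>Weak solutions\<close>

text \<open>Passage from the functions of the statement, of which only the values in \<Omega>
  matter, to elements of L2 that vanish outside \<Omega>.\<close>

definition emb :: "(real^'n::finite) set => (real^'n => real) => (real^'n) l2"
  where "emb \<Omega> u = mk (%x. indicator \<Omega> x * u x)"

lemma LINT_lebesgue_on:
  fixes h :: "real^'n::finite => real"
  assumes "open \<Omega>" shows "(LINT x|lebesgue_on \<Omega>. h x) = (LINT x|lebesgue. indicator \<Omega> x * h x)"
  using assms by (subst integral_restrict_space) auto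

lemma integrable_lebesgue_on:
  fixes h :: "real^'n::finite => real"
  assumes "open \<Omega>" shows "integrable (lebesgue_on \<Omega>) h \<longleftrightarrow> integrable lebesgue (%x. indicator \<Omega> x * h x)"
  using assms by (subst integrable_restrict_space) auto

lemma L2_iff:
  fixes u :: "real^'n::finite => real"
  assumes "open \<Omega>" shows "u \<in> L2 \<Omega> \<longleftrightarrow> sqint (%x. indicator \<Omega> x * u x)"
proof -
  have "u \<in> borel_measurable (lebesgue_on \<Omega>) \<longleftrightarrow> (%x. indicator \<Omega> x * u x) \<in> borel_measurable lebesgue"
    using assms by (subst borel_measurable_restrict_space_iff) auto
  moreover have "(%x. (indicator \<Omega> x * u x)\<^sup>2) = (%x. indicator \<Omega> x * (u x)\<^sup>2)"
    by (auto simp: indicator_def)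
  ultimately show ?thesis by (simp add: L2_def sqint_def integrable_lebesgue_on[OF assms])
qed

lemma emb_rep: "emb \<Omega> (rep g) = Mop (indicator \<Omega>) g"
  by (simp add: emb_def Mop_def)

lemma rep_L2: "open \<Omega> ==> rep g \<in> L2 \<Omega>"
  unfolding L2_iff by (intro sqint_bmult bmult_indicator sqint_rep) auto

lemma emb_rep_in_dom: "in_dom \<Omega> g ==> emb \<Omega> (rep g) = g"
  by (simp add: emb_rep in_dom_def)

lemma in_dom_emb:
  assumes "open \<Omega>" "u \<in> L2 \<Omega>" shows "in_dom \<Omega> (emb \<Omega> u)"
proof -
  have "\<Omega> \<in> sets lebesgue" using assms(1) by simp
  then have "Mop (indicator \<Omega>) (emb \<Omega> u) = mk (%x. indicator \<Omega> x * (indicator \<Omega> x * u x))"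
    unfolding emb_def by (intro Mop_mk) (use assms L2_iff in auto)
  also have "(%x. indicator \<Omega> x * (indicator \<Omega> x * u x)) = (%x. indicator \<Omega> x * u x)" by (auto simp: indicator_def)
  finally show ?thesis by (simp add: in_dom_def emb_def)
qed

lemma inner_emb_mk:
  assumes "open \<Omega>" "u \<in> L2 \<Omega>" "sqint eta"
  shows "inner (emb \<Omega> u) (mk eta) = (LINT x|lebesgue_on \<Omega>. u x * eta x)"
  unfolding emb_def LINT_lebesgue_on[OF assms(1)]
  using inner_mk[of "%x. indicator \<Omega> x * u x" eta] assms by (simp add: L2_iff mult.assoc)

lemma inner_emb:
  assumes "open \<Omega>" "u \<in> L2 \<Omega>" "v \<in> L2 \<Omega>"
  shows "inner (emb \<Omega> u) (emb \<Omega> v) = (LINT x|lebesgue_on \<Omega>. u x * v x)"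
    "integrable (lebesgue_on \<Omega>) (%x. u x * v x)"
proof -
  have e: "(%x. indicator \<Omega> x * u x * (indicator \<Omega> x * v x)) = (%x. indicator \<Omega> x * (u x * v x))"
    by (auto simp: indicator_def)
  have s: "sqint (%x. indicator \<Omega> x * u x)" "sqint (%x. indicator \<Omega> x * v x)" using assms by (simp_all add: L2_iff)
  show "inner (emb \<Omega> u) (emb \<Omega> v) = (LINT x|lebesgue_on \<Omega>. u x * v x)"
    unfolding emb_def LINT_lebesgue_on[OF assms(1)] inner_mk[OF s] e by (rule refl)
  show "integrable (lebesgue_on \<Omega>) (%x. u x * v x)"
    using sqint_mult[OF s] unfolding integrable_lebesgue_on[OF assms(1)] e .
qed

lemma emb_diff:
  assumes "open \<Omega>" "u \<in> L2 \<Omega>" "v \<in> L2 \<Omega>"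
  shows "(%x. u x - v x) \<in> L2 \<Omega>" "emb \<Omega> (%x. u x - v x) = emb \<Omega> u - emb \<Omega> v"
proof -
  have s: "sqint (%x. indicator \<Omega> x * u x)" "sqint (%x. indicator \<Omega> x * v x)" using assms by (simp_all add: L2_iff)
  show "(%x. u x - v x) \<in> L2 \<Omega>" using sqint_diff[OF s] assms(1) by (simp add: L2_iff right_diff_distrib)
  show "emb \<Omega> (%x. u x - v x) = emb \<Omega> u - emb \<Omega> v" using mk_diff[OF s] by (simp add: emb_def right_diff_distrib)
qed

lemma emb_sum:
  assumes \<Omega>: "open \<Omega>" and u: "!!i. i \<in> I ==> u i \<in> L2 \<Omega>"
  shows "(%x. \<Sum>i\<in>I. u i x) \<in> L2 \<Omega>" "emb \<Omega> (%x. \<Sum>i\<in>I. u i x) = (\<Sum>i\<in>I. emb \<Omega> (u i))"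
proof -
  have s: "sqint (%x. indicator \<Omega> x * u i x)" if "i \<in> I" for i using u[OF that] \<Omega> by (simp add: L2_iff)
  show "(%x. \<Sum>i\<in>I. u i x) \<in> L2 \<Omega>"
    using sqint_sum[of I "%i x. indicator \<Omega> x * u i x", OF s] \<Omega> by (simp add: L2_iff sum_distrib_left)
  show "emb \<Omega> (%x. \<Sum>i\<in>I. u i x) = (\<Sum>i\<in>I. emb \<Omega> (u i))"
    using mk_sum[of I "%i x. indicator \<Omega> x * u i x", OF s] by (simp add: emb_def sum_distrib_left)
qed

lemma test_L2:
  assumes "open \<Omega>" "eta \<in> test_functions \<Omega>" shows "eta \<in> L2 \<Omega>" "emb \<Omega> eta = mk eta"
proof -
  have m: "\<Omega> \<in> sets lebesgue" using assms(1) by simp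
  show "eta \<in> L2 \<Omega>" unfolding L2_iff[OF assms(1)] by (intro sqint_bmult bmult_indicator m test_sqint[OF assms(2)])
  show "emb \<Omega> eta = mk eta"
    using Mop_indicator_test[OF assms(2) m] Mop_mk[OF bmult_indicator[OF m] test_sqint[OF assms(2)]] by (simp add: emb_def)
qed

section \<open>Weak derivatives as identities in L2\<close>

lemma test_iter_partial: "eta \<in> test_functions \<Omega> ==> iter_partial is eta \<in> test_functions \<Omega>"
  by (induction "is") (auto simp: test_partial)

lemma has_weak_deriv_iff:
  assumes \<Omega>: "open \<Omega>" and u: "u \<in> L2 \<Omega>"
  shows "has_weak_deriv \<Omega> is u g \<longleftrightarrow> g \<in> L2 \<Omega> & (\<forall>eta\<in>test_functions \<Omega>.
     inner (emb \<Omega> u) (mk (iter_partial is eta)) = (-1) ^ length is * inner (emb \<Omega> g) (mk eta))"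
  unfolding has_weak_deriv_def
  using inner_emb_mk[OF \<Omega> u test_sqint[OF test_iter_partial]] inner_emb_mk[OF \<Omega> _ test_sqint] by auto

text \<open>Two weak derivatives pair equally with all test functions in \<Omega>, so in L2 the
  derivative chosen by \<open>weak_deriv\<close> agrees with any given one.\<close>

lemma weak_deriv_emb:
  assumes \<Omega>: "open \<Omega>" and u: "u \<in> L2 \<Omega>" and g: "has_weak_deriv \<Omega> is u g"
  shows "has_weak_deriv \<Omega> is u (weak_deriv \<Omega> is u)" "emb \<Omega> (weak_deriv \<Omega> is u) = emb \<Omega> g"
proof -
  show w: "has_weak_deriv \<Omega> is u (weak_deriv \<Omega> is u)" unfolding weak_deriv_def by (rule someI[of _ g]) (rule g)
  note a = w[unfolded has_weak_deriv_iff[OF \<Omega> u]] g[unfolded has_weak_deriv_iff[OF \<Omega> u]]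
  show "emb \<Omega> (weak_deriv \<Omega> is u) = emb \<Omega> g"
  proof (rule in_dom_eqI[OF \<Omega>])
    show "in_dom \<Omega> (emb \<Omega> (weak_deriv \<Omega> is u))" "in_dom \<Omega> (emb \<Omega> g)" using a in_dom_emb[OF \<Omega>] by auto
    fix eta assume eta: "eta \<in> test_functions \<Omega>"
    have "(-1) ^ length is * inner (emb \<Omega> (weak_deriv \<Omega> is u)) (mk eta) = (-1) ^ length is * inner (emb \<Omega> g) (mk eta)"
      using a eta by auto
    then show "inner (emb \<Omega> (weak_deriv \<Omega> is u)) (mk eta) = inner (emb \<Omega> g) (mk eta)" by simp
  qed
qed

definition jt :: "(real^'n::finite) set => (real^'n => real) => (real^'n) l2 \<times> ((real^'n) l2 ^ 'n)"
  where "jt \<Omega> u = (emb \<Omega> u, \<chi> i. emb \<Omega> (weak_deriv \<Omega> [i] u))"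

definition H1 :: "(real^'n::finite) set => (real^'n => real) => bool"
  where "H1 \<Omega> u \<longleftrightarrow> u \<in> L2 \<Omega> & (\<forall>i. has_weak_deriv \<Omega> [i] u (weak_deriv \<Omega> [i] u))"

lemma H1_L2: "H1 \<Omega> u ==> u \<in> L2 \<Omega>" "H1 \<Omega> u ==> weak_deriv \<Omega> [i] u \<in> L2 \<Omega>"
  by (auto simp: H1_def has_weak_deriv_def)

lemma inner_weak_grad:
  assumes \<Omega>: "open \<Omega>" and u: "H1 \<Omega> u" "H1 \<Omega> v"
  shows "(LINT x|lebesgue_on \<Omega>. inner (weak_grad \<Omega> u x) (weak_grad \<Omega> v x)) = inner (snd (jt \<Omega> u)) (snd (jt \<Omega> v))"
proof -
  note i = inner_emb[OF \<Omega> H1_L2(2)[OF u(1)] H1_L2(2)[OF u(2)]]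
  have "(LINT x|lebesgue_on \<Omega>. inner (weak_grad \<Omega> u x) (weak_grad \<Omega> v x))
    = (\<Sum>i\<in>UNIV. LINT x|lebesgue_on \<Omega>. weak_deriv \<Omega> [i] u x * weak_deriv \<Omega> [i] v x)"
    unfolding inner_vec_def weak_grad_def
    by (subst Bochner_Integration.integral_sum[symmetric]) (use i(2) in \<open>auto\<close>)
  then show ?thesis unfolding inner_vec_def jt_def by (simp add: i(1))
qed

lemma H1_diff_test:
  assumes \<Omega>: "open \<Omega>" and u: "H1 \<Omega> u" and eta: "eta \<in> test_functions \<Omega>"
  shows "H1 \<Omega> (%x. u x - eta x)" "jt \<Omega> (%x. u x - eta x) = jt \<Omega> u - jet eta"
proof -
  note uL = H1_L2(1)[OF u] and t = test_L2[OF \<Omega> eta]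
  note d = emb_diff[OF \<Omega> uL t(1)]
  have w: "has_weak_deriv \<Omega> [i] (%x. u x - eta x) (%x. weak_deriv \<Omega> [i] u x - partial_deriv i eta x)"
    and e: "emb \<Omega> (%x. weak_deriv \<Omega> [i] u x - partial_deriv i eta x) = emb \<Omega> (weak_deriv \<Omega> [i] u) - mk (partial_deriv i eta)" for i
  proof -
    note t' = test_L2[OF \<Omega> test_partial[OF eta, of i]]
    note d' = emb_diff[OF \<Omega> H1_L2(2)[OF u] t'(1)]
    have wu: "has_weak_deriv \<Omega> [i] u (weak_deriv \<Omega> [i] u)" using u by (simp add: H1_def)
    show "has_weak_deriv \<Omega> [i] (%x. u x - eta x) (%x. weak_deriv \<Omega> [i] u x - partial_deriv i eta x)"
      unfolding has_weak_deriv_iff[OF \<Omega> d(1)]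
    proof (intro conjI ballI d'(1))
      fix zeta assume zeta: "zeta \<in> test_functions \<Omega>"
      have "inner (emb \<Omega> u) (mk (partial_deriv i zeta)) = - inner (emb \<Omega> (weak_deriv \<Omega> [i] u)) (mk zeta)"
        using wu[unfolded has_weak_deriv_iff[OF \<Omega> uL]] zeta by simp
      then show "inner (emb \<Omega> (%x. u x - eta x)) (mk (iter_partial [i] zeta)) =
          (-1) ^ length [i] * inner (emb \<Omega> (%x. weak_deriv \<Omega> [i] u x - partial_deriv i eta x)) (mk zeta)"
        unfolding d(2) d'(2) t(2) t'(2) using inner_parts_test[OF eta zeta, of i] by (simp add: inner_diff_left)
    qed
    show "emb \<Omega> (%x. weak_deriv \<Omega> [i] u x - partial_deriv i eta x) = emb \<Omega> (weak_deriv \<Omega> [i] u) - mk (partial_deriv i eta)"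
      unfolding d'(2) t'(2) by (rule refl)
  qed
  note we = weak_deriv_emb[OF \<Omega> d(1) w]
  show "H1 \<Omega> (%x. u x - eta x)" unfolding H1_def using d(1) we(1) by blast
  show "jt \<Omega> (%x. u x - eta x) = jt \<Omega> u - jet eta"
    unfolding jt_def jet_def grd_def we(2) e d(2) t(2) by (simp add: vec_eq_iff)
qed

text \<open>The convergence required in \<open>H10\<close> is convergence of jets, which identifies
  \<open>H10\<close> with the closure \<open>Sob\<close>.\<close>

lemma H10_dist:
  assumes \<Omega>: "open \<Omega>" and u: "H1 \<Omega> u" and eta: "eta \<in> test_functions \<Omega>"
  shows "(LINT x|lebesgue_on \<Omega>. (u x - eta x)\<^sup>2) + (LINT x|lebesgue_on \<Omega>. (norm (weak_grad \<Omega> (%y. u y - eta y) x))\<^sup>2)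
    = (norm (jt \<Omega> u - jet eta))\<^sup>2"
proof -
  note d = H1_diff_test[OF \<Omega> u eta]
  show ?thesis
    unfolding d(2)[symmetric] norm_pair_sq power2_norm_eq_inner inner_weak_grad[OF \<Omega> d(1) d(1)]
    using inner_emb(1)[OF \<Omega> H1_L2(1)[OF d(1)] H1_L2(1)[OF d(1)]] by (simp add: jt_def power2_eq_square)
qed

lemma H10_D:
  assumes \<Omega>: "open \<Omega>" and u: "u \<in> H10 \<Omega>"
  shows "H1 \<Omega> u" "jt \<Omega> u \<in> Sob \<Omega>"
proof -
  have uL: "u \<in> L2 \<Omega>" and ex: "!!i. \<exists>g. has_weak_deriv \<Omega> [i] u g" using u by (auto simp: H10_def sobolev_H_def)
  have "has_weak_deriv \<Omega> [i] u (weak_deriv \<Omega> [i] u)" for i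
    using ex[of i] weak_deriv_emb(1)[OF \<Omega> uL] by blast
  then show h: "H1 \<Omega> u" using uL by (simp add: H1_def)
  obtain eta :: "nat => _" where eta: "!!m. eta m \<in> test_functions \<Omega>"
    and l: "(%m. (LINT x|lebesgue_on \<Omega>. (u x - eta m x)\<^sup>2)
          + (LINT x|lebesgue_on \<Omega>. (norm (weak_grad \<Omega> (%y. u y - eta m y) x))\<^sup>2)) \<longlonglongrightarrow> 0"
    using u unfolding H10_def by blast
  have "(%m. (norm (jt \<Omega> u - jet (eta m)))\<^sup>2) \<longlonglongrightarrow> 0" using l unfolding H10_dist[OF \<Omega> h eta] .
  then have "(%m. sqrt ((norm (jt \<Omega> u - jet (eta m)))\<^sup>2)) \<longlonglongrightarrow> sqrt 0" by (rule tendsto_real_sqrt)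
  then have "(%m. norm (jet (eta m) - jt \<Omega> u)) \<longlonglongrightarrow> 0" by (simp add: norm_minus_commute)
  then have "(%m. jet (eta m)) \<longlonglongrightarrow> jt \<Omega> u" by (rule LIM_zero_cancel[OF tendsto_norm_zero_cancel])
  moreover have "jet (eta m) \<in> jet ` test_functions \<Omega>" for m using eta by blast
  ultimately show "jt \<Omega> u \<in> Sob \<Omega>" unfolding Sob_def closure_sequential by (intro exI[of _ "%m. jet (eta m)"]) simp
qed

text \<open>Converse of \<open>H10_D\<close>: the components of the second part of U serve as weak
  derivatives of u.\<close>

lemma H10_I:
  assumes \<Omega>: "open \<Omega>" and u: "u \<in> L2 \<Omega>" and U: "U \<in> Sob \<Omega>" and e: "emb \<Omega> u = fst U"
  shows "u \<in> H10 \<Omega>" "jt \<Omega> u = U"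
proof -
  have m: "\<Omega> \<in> sets lebesgue" using \<Omega> by simp
  have er: "emb \<Omega> (rep (snd U $ i)) = snd U $ i" for i
    unfolding emb_rep by (rule Sob_support(2)[OF U m])
  have w: "has_weak_deriv \<Omega> [i] u (rep (snd U $ i))" for i
    unfolding has_weak_deriv_iff[OF \<Omega> u] e er using Sob_weak_deriv[OF U] rep_L2[OF \<Omega>] by simp
  note we = weak_deriv_emb[OF \<Omega> u w]
  have h: "H1 \<Omega> u" unfolding H1_def using u we(1) by blast
  show j: "jt \<Omega> u = U" unfolding jt_def we(2) er e by (simp add: prod_eq_iff vec_eq_iff)
  have "\<exists>g. has_weak_deriv \<Omega> is u g" if "length is <= 1" for "is"
  proof (cases "is")
    case Nil
    then show ?thesis using u by (intro exI[of _ u]) (simp add: has_weak_deriv_def)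
  next
    case (Cons i js)
    then show ?thesis using that w by auto
  qed
  then have s: "u \<in> sobolev_H 1 \<Omega>" using u by (simp add: sobolev_H_def)
  obtain X where X: "!!m. X m \<in> jet ` test_functions \<Omega>" "X \<longlonglongrightarrow> U"
    using U unfolding Sob_def closure_sequential by blast
  have "\<forall>m. \<exists>eta. eta \<in> test_functions \<Omega> & X m = jet eta" using X(1) by blast
  then obtain eta where eta: "!!m. eta m \<in> test_functions \<Omega>" "!!m. X m = jet (eta m)" by metis
  have "(%m. (norm (jt \<Omega> u - X m))\<^sup>2) \<longlonglongrightarrow> (norm (jt \<Omega> u - U))\<^sup>2"
    by (intro tendsto_intros X(2))
  then have "(%m. (norm (jt \<Omega> u - jet (eta m)))\<^sup>2) \<longlonglongrightarrow> 0" unfolding j eta(2) by simp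
  then have "(%m. (LINT x|lebesgue_on \<Omega>. (u x - eta m x)\<^sup>2)
          + (LINT x|lebesgue_on \<Omega>. (norm (weak_grad \<Omega> (%y. u y - eta m y) x))\<^sup>2)) \<longlonglongrightarrow> 0"
    unfolding H10_dist[OF \<Omega> h eta(1)] .
  then show "u \<in> H10 \<Omega>" unfolding H10_def using s eta(1) by blast
qed

text \<open>Pairing u with mixed second derivatives of a test function is rewritten through the
  gradient, which turns the second weak derivatives into weak derivatives of the gradient, as
  \<open>hess\<close> demands.\<close>

lemma HH_D:
  assumes \<Omega>: "open \<Omega>" and u: "u \<in> HH \<Omega>"
  shows "hess \<Omega> (jt \<Omega> u) (\<chi> i j. emb \<Omega> (weak_deriv \<Omega> [i, j] u))" "weak_laplacian \<Omega> u \<in> L2 \<Omega>"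
    "emb \<Omega> (weak_laplacian \<Omega> u) = lap (\<chi> i j. emb \<Omega> (weak_deriv \<Omega> [i, j] u))"
proof -
  have u10: "u \<in> H10 \<Omega>" and ex: "!!i j. \<exists>g. has_weak_deriv \<Omega> [i, j] u g" using u by (auto simp: HH_def sobolev_H_def)
  note h = H10_D[OF \<Omega> u10]
  note uL = H1_L2(1)[OF h(1)]
  have w: "has_weak_deriv \<Omega> [i, j] u (weak_deriv \<Omega> [i, j] u)" for i j
    using ex[of i j] weak_deriv_emb(1)[OF \<Omega> uL] by blast
  note w' = w[unfolded has_weak_deriv_iff[OF \<Omega> uL]]
  have L: "weak_deriv \<Omega> [i, j] u \<in> L2 \<Omega>" for i j using w' by blast
  have "wd \<Omega> j (snd (jt \<Omega> u) $ i) (emb \<Omega> (weak_deriv \<Omega> [i, j] u))" for i j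
    unfolding wd_def
  proof
    fix eta assume eta: "eta \<in> test_functions \<Omega>"
    have "inner (emb \<Omega> u) (mk (partial_deriv i (partial_deriv j eta))) = inner (emb \<Omega> (weak_deriv \<Omega> [i, j] u)) (mk eta)"
      using w'[of i j] eta by simp
    moreover have "inner (emb \<Omega> u) (mk (partial_deriv i (partial_deriv j eta))) = - inner (snd (jt \<Omega> u) $ i) (mk (partial_deriv j eta))"
      using Sob_weak_deriv[OF h(2) test_partial[OF eta], of i j] by (simp add: jt_def)
    ultimately show "inner (snd (jt \<Omega> u) $ i) (mk (partial_deriv j eta)) = - inner (emb \<Omega> (weak_deriv \<Omega> [i, j] u)) (mk eta)" by simp
  qed
  then show "hess \<Omega> (jt \<Omega> u) (\<chi> i j. emb \<Omega> (weak_deriv \<Omega> [i, j] u))"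
    unfolding hess_def using h(2) in_dom_emb[OF \<Omega> L] by simp
  have wl: "weak_laplacian \<Omega> u = (%x. \<Sum>i\<in>UNIV. weak_deriv \<Omega> [i, i] u x)" by (rule ext) (rule weak_laplacian_def)
  show "weak_laplacian \<Omega> u \<in> L2 \<Omega>" unfolding wl by (rule emb_sum(1)[OF \<Omega> L])
  show "emb \<Omega> (weak_laplacian \<Omega> u) = lap (\<chi> i j. emb \<Omega> (weak_deriv \<Omega> [i, j] u))"
    unfolding wl emb_sum(2)[OF \<Omega> L] lap_def by simp
qed

lemma HH_I:
  assumes \<Omega>: "open \<Omega>" and u: "u \<in> L2 \<Omega>" and h: "hess \<Omega> Phi H" and e: "emb \<Omega> u = fst Phi"
  shows "u \<in> HH \<Omega>" "weak_laplacian \<Omega> u \<in> L2 \<Omega>" "emb \<Omega> (weak_laplacian \<Omega> u) = lap H"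
proof -
  have Phi: "Phi \<in> Sob \<Omega>" using h by (simp add: hess_def)
  note h10 = H10_I[OF \<Omega> u Phi e]
  have er: "emb \<Omega> (rep (H $ i $ j)) = H $ i $ j" for i j using h by (intro emb_rep_in_dom) (simp add: hess_def)
  have w: "has_weak_deriv \<Omega> [i, j] u (rep (H $ i $ j))" for i j
    unfolding has_weak_deriv_iff[OF \<Omega> u] er
  proof (intro conjI ballI rep_L2[OF \<Omega>])
    fix eta assume eta: "eta \<in> test_functions \<Omega>"
    have "inner (snd Phi $ i) (mk (partial_deriv j eta)) = - inner (H $ i $ j) (mk eta)" using h eta by (simp add: hess_def wd_def)
    then show "inner (emb \<Omega> u) (mk (iter_partial [i, j] eta)) = (-1) ^ length [i, j] * inner (H $ i $ j) (mk eta)"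
      using Sob_weak_deriv[OF Phi test_partial[OF eta], of i j] by (simp add: e)
  qed
  have s1: "\<exists>g. has_weak_deriv \<Omega> is u g" if "length is <= 1" for "is" using h10(1) that by (auto simp: H10_def sobolev_H_def)
  have "\<exists>g. has_weak_deriv \<Omega> is u g" if l: "length is <= 2" for "is"
  proof (cases "length is <= 1")
    case False
    then have "length is = Suc (Suc 0)" using l by simp
    then obtain i j where "is = [i, j]" by (auto simp: length_Suc_conv)
    then show ?thesis using w by blast
  qed (rule s1)
  then show hh: "u \<in> HH \<Omega>" using u h10(1) by (simp add: HH_def sobolev_H_def)
  show "weak_laplacian \<Omega> u \<in> L2 \<Omega>" by (rule HH_D(2)[OF \<Omega> hh])
  show "emb \<Omega> (weak_laplacian \<Omega> u) = lap H"
    unfolding HH_D(3)[OF \<Omega> hh] lap_def by (simp add: weak_deriv_emb(2)[OF \<Omega> u w] er)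
qed

theorem theorem1p1:
  fixes \<Omega> :: "(real^3) set" and q :: "real^3 \<Rightarrow> real" and p :: real
  assumes "bounded_smooth_domain \<Omega>"
    and "continuous_on (closure \<Omega>) q" and "\<exists>x\<in>closure \<Omega>. q x \<noteq> 0"
    and "2 < p" and "p < 10 / 3"
  shows "\<exists>(u :: nat \<Rightarrow> real^3 \<Rightarrow> real) (\<omega> :: nat \<Rightarrow> real) (\<phi> :: nat \<Rightarrow> real^3 \<Rightarrow> real).
    (\<forall>n. weak_solution \<Omega> q p (u n) (\<omega> n) (\<phi> n)) \<and>
    filterlim \<omega> at_top sequentially \<and>
    filterlim (\<lambda>n. H10_norm \<Omega> (u n)) at_top sequentially"
proof -
  have \<Omega>: "open \<Omega>" "bounded \<Omega>" "\<Omega> ~= {}" and sb: "smooth_boundary \<Omega>"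
    using assms(1) by (auto simp: bounded_smooth_domain_def)
  have \<Omega>m: "\<Omega> \<in> sets lebesgue" using \<Omega>(1) by simp
  \<comment> \<open>q is controlled only on the closure of \<Omega>; cut off by the indicator it is
    a bounded measurable multiplier on the whole space.\<close>
  define a where "a x = indicator \<Omega> x * q x" for x
  have a: "bmult a"
  proof -
    have "q \<in> borel_measurable (lebesgue_on \<Omega>)"
      by (rule continuous_imp_measurable_on_sets_lebesgue[OF continuous_on_subset[OF assms(2) closure_subset] \<Omega>m])
    then have "a \<in> borel_measurable lebesgue"
      using \<Omega>m unfolding a_def by (subst (asm) borel_measurable_restrict_space_iff) auto
    moreover have "bounded (q ` closure \<Omega>)"
      using \<Omega>(2) by (intro compact_imp_bounded compact_continuous_image assms(2)) (simp add: compact_closure)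
    then obtain B where B: "!!x. x \<in> closure \<Omega> ==> \<bar>q x\<bar> <= B" by (auto simp: bounded_iff)
    have "\<bar>a x\<bar> <= \<bar>B\<bar>" for x
      using B[of x] closure_subset[of \<Omega>] by (cases "x \<in> \<Omega>") (auto simp: a_def)
    ultimately show ?thesis unfolding bmult_def by blast
  qed
  obtain G :: "(real^3) l2 => (real^3) l2" where G: "bounded_linear G" "!!f g. inner f (G g) = inner (G f) g" "!!f. 0 <= inner f (G f)"
    and Gs: "!!f. \<exists>D H. hess \<Omega> (G f, D) H &
       (\<forall>\<Xi> H'. hess \<Omega> \<Xi> H' --> inner (lap H) (lap H') + inner D (snd \<Xi>) = inner f (fst \<Xi>))"
    using biharmonic_solution_operator[OF \<Omega> sb] by auto
  interpret E: coupled_energy \<Omega> a G p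
    by unfold_locales (use \<Omega> a G assms(4,5) in \<open>auto simp: bounded_linear.bounded linear_simps\<close>)
  obtain C1 C2 where C: "!!A. \<exists>U\<in>Sob \<Omega>. \<exists>\<omega>. norm (fst U) = 1 & A - C1 <= \<omega> & A <= C2 * (1 + norm (snd U)) ^ 3 &
     (\<forall>V\<in>Sob \<Omega>. inner (snd U) (snd V) + E.q4 U V U U - E.NP U V = \<omega> * inner (fst U) (fst V))"
    using E.high_energy_solutions by blast
  have "\<exists>u \<omega> phi. weak_solution \<Omega> q p u \<omega> phi & A - C1 <= \<omega> & A <= C2 * (1 + H10_norm \<Omega> u) ^ 3" for A
  proof -
    obtain U \<omega> where U: "U \<in> Sob \<Omega>" "norm (fst U) = 1" and \<omega>: "A - C1 <= \<omega>" and A: "A <= C2 * (1 + norm (snd U)) ^ 3"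
      and eq: "!!V. V \<in> Sob \<Omega> ==> inner (snd U) (snd V) + E.q4 U V U U - E.NP U V = \<omega> * inner (fst U) (fst V)"
      using C[of A] by auto
    define u where "u = rep (fst U)"
    have uL: "u \<in> L2 \<Omega>" unfolding u_def by (rule rep_L2[OF \<Omega>(1)])
    have eu: "emb \<Omega> u = fst U" unfolding u_def emb_rep by (rule Sob_support(1)[OF U(1) \<Omega>m])
    note u10 = H10_I[OF \<Omega>(1) uL U(1) eu]
    note uH1 = H10_D(1)[OF \<Omega>(1) u10(1)]
    obtain D H where DH: "hess \<Omega> (G (E.f U U), D) H"
      "!!\<Xi> H'. hess \<Omega> \<Xi> H' ==> inner (lap H) (lap H') + inner D (snd \<Xi>) = inner (E.f U U) (fst \<Xi>)"
      using Gs[of "E.f U U"] by blast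
    \<comment> \<open>The potential of q u^2: \<open>E.f U U\<close> is q u^2 cut off to
      \<Omega>.\<close>
    define phi where "phi = rep (G (E.f U U))"
    have phiL: "phi \<in> L2 \<Omega>" unfolding phi_def by (rule rep_L2[OF \<Omega>(1)])
    have phiS: "(G (E.f U U), D) \<in> Sob \<Omega>" using DH(1) by (simp add: hess_def)
    have ephi: "emb \<Omega> phi = fst (G (E.f U U), D)"
      unfolding phi_def emb_rep using Sob_support(1)[OF phiS \<Omega>m] by simp
    note phihh = HH_I[OF \<Omega>(1) phiL DH(1) ephi]
    note phi10 = H10_I[OF \<Omega>(1) phiL phiS ephi]
    note phiH1 = H10_D(1)[OF \<Omega>(1) phi10(1)]
    have ff: "AE x in lebesgue. rep (E.f U V) x = a x * (rep (fst U) x * rep (fst V) x)" if V: "V \<in> Sob \<Omega>" for V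
    proof -
      note s = sqint_prd[OF E.l4S[OF U(1)] E.l4S[OF V]]
      show ?thesis unfolding E.f_def prd_def Mop_mk[OF a s] by (rule rep_mk[OF sqint_bmult[OF a s]])
    qed
    have re: "AE x in lebesgue. rep (emb \<Omega> v) x = indicator \<Omega> x * v x" if "v \<in> L2 \<Omega>" for v
      unfolding emb_def by (rule rep_mk) (use that \<Omega>(1) L2_iff in blast)
    have B: "u \<in> B_set \<Omega>"
    proof -
      have "(LINT x|lebesgue_on \<Omega>. (u x)\<^sup>2) = inner (fst U) (fst U)"
        using inner_emb(1)[OF \<Omega>(1) uL uL] by (simp add: eu power2_eq_square)
      also have "... = 1" using U(2) by (simp flip: power2_norm_eq_inner)
      finally show ?thesis using u10(1) by (simp add: B_set_def)
    qed
    have eq1: "(LINT x|lebesgue_on \<Omega>. inner (weak_grad \<Omega> u x) (weak_grad \<Omega> v x))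
       + (LINT x|lebesgue_on \<Omega>. q x * phi x * u x * v x)
       - (LINT x|lebesgue_on \<Omega>. \<bar>u x\<bar> powr (p - 2) * u x * v x)
       = \<omega> * (LINT x|lebesgue_on \<Omega>. u x * v x)" if v: "v \<in> H10 \<Omega>" for v
    proof -
      note vH = H10_D[OF \<Omega>(1) v]
      note vL = H1_L2(1)[OF vH(1)]
      have fv: "fst (jt \<Omega> v) = emb \<Omega> v" by (simp add: jt_def)
      have g: "(LINT x|lebesgue_on \<Omega>. inner (weak_grad \<Omega> u x) (weak_grad \<Omega> v x)) = inner (snd U) (snd (jt \<Omega> v))"
        unfolding inner_weak_grad[OF \<Omega>(1) uH1 vH(1)] u10(2) by (rule refl)
      have q: "(LINT x|lebesgue_on \<Omega>. q x * phi x * u x * v x) = E.q4 U (jt \<Omega> v) U U"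
      proof -
        have "E.q4 U (jt \<Omega> v) U U = (LINT x|lebesgue. rep (E.f U (jt \<Omega> v)) x * phi x)"
          unfolding E.q4_def inner_rep phi_def by (rule refl)
        also have "... = (LINT x|lebesgue. a x * (u x * rep (fst (jt \<Omega> v)) x) * phi x)"
          by (rule integral_cong_AE) (use ff[OF vH(2)] a in \<open>auto simp: u_def phi_def bmult_def\<close>)
        also have "... = (LINT x|lebesgue. a x * (u x * rep (emb \<Omega> v) x) * phi x)" by (simp add: fv)
        also have "... = (LINT x|lebesgue. indicator \<Omega> x * (q x * phi x * u x * v x))"
        proof (rule integral_cong_AE)
          show "(%x. a x * (u x * rep (emb \<Omega> v) x) * phi x) \<in> borel_measurable lebesgue"
            using a by (auto simp: u_def phi_def bmult_def)
          have "(%x. a x * (u x * (indicator \<Omega> x * v x)) * phi x) \<in> borel_measurable lebesgue"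
            using a vL by (auto simp: u_def phi_def bmult_def L2_iff[OF \<Omega>(1)] sqint_def)
          then show "(%x. indicator \<Omega> x * (q x * phi x * u x * v x)) \<in> borel_measurable lebesgue"
            by (rule measurable_cong[THEN iffD1, rotated]) (simp add: a_def indicator_def)
          show "AE x in lebesgue. a x * (u x * rep (emb \<Omega> v) x) * phi x = indicator \<Omega> x * (q x * phi x * u x * v x)"
            using re[OF vL] by eventually_elim (simp add: a_def indicator_def)
        qed
        finally show ?thesis unfolding LINT_lebesgue_on[OF \<Omega>(1)] by simp
      qed
      have n: "(LINT x|lebesgue_on \<Omega>. \<bar>u x\<bar> powr (p - 2) * u x * v x) = E.NP U (jt \<Omega> v)"
      proof -
        have "E.NP U (jt \<Omega> v) = (LINT x|lebesgue. indicator \<Omega> x * (\<bar>u x\<bar> powr (p - 2) * u x * v x))"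
          unfolding E.NP_def fv
        proof (rule integral_cong_AE[OF E.pw_rep_meas])
          have "(%x. pw p (u x) * (indicator \<Omega> x * v x)) \<in> borel_measurable lebesgue"
            unfolding u_def by (rule borel_measurable_times[OF measurable_compose[OF rep_meas pw_meas[OF assms(4)]]
                  sqint_meas[OF L2_iff[OF \<Omega>(1), THEN iffD1, OF vL]]])
          then show "(%x. indicator \<Omega> x * (\<bar>u x\<bar> powr (p - 2) * u x * v x)) \<in> borel_measurable lebesgue"
            by (rule measurable_cong[THEN iffD1, rotated]) (simp add: pw_def)
          show "AE x in lebesgue. pw p (rep (fst U) x) * rep (emb \<Omega> v) x = indicator \<Omega> x * (\<bar>u x\<bar> powr (p - 2) * u x * v x)"
            using re[OF vL] by eventually_elim (simp add: pw_def u_def)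
        qed
        then show ?thesis unfolding LINT_lebesgue_on[OF \<Omega>(1)] by simp
      qed
      have i: "(LINT x|lebesgue_on \<Omega>. u x * v x) = inner (fst U) (fst (jt \<Omega> v))"
        unfolding fv eu[symmetric] by (rule inner_emb(1)[OF \<Omega>(1) uL vL, symmetric])
      show ?thesis unfolding g q n i by (rule eq[OF vH(2)])
    qed
    have eq2: "(LINT x|lebesgue_on \<Omega>. weak_laplacian \<Omega> phi x * weak_laplacian \<Omega> \<xi> x)
       + (LINT x|lebesgue_on \<Omega>. inner (weak_grad \<Omega> phi x) (weak_grad \<Omega> \<xi> x))
       = (LINT x|lebesgue_on \<Omega>. q x * (u x)\<^sup>2 * \<xi> x)" if \<xi>: "\<xi> \<in> HH \<Omega>" for \<xi>
    proof -
      note h = HH_D[OF \<Omega>(1) \<xi>]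
      have \<xi>10: "\<xi> \<in> H10 \<Omega>" using \<xi> by (simp add: HH_def)
      note \<xi>H1 = H10_D(1)[OF \<Omega>(1) \<xi>10]
      note \<xi>L = H1_L2(1)[OF \<xi>H1]
      have "(LINT x|lebesgue_on \<Omega>. weak_laplacian \<Omega> phi x * weak_laplacian \<Omega> \<xi> x)
         = inner (lap H) (lap (\<chi> i j. emb \<Omega> (weak_deriv \<Omega> [i, j] \<xi>)))"
        unfolding phihh(3)[symmetric] h(3)[symmetric] by (rule inner_emb(1)[OF \<Omega>(1) phihh(2) h(2), symmetric])
      moreover have "(LINT x|lebesgue_on \<Omega>. inner (weak_grad \<Omega> phi x) (weak_grad \<Omega> \<xi> x)) = inner D (snd (jt \<Omega> \<xi>))"
        unfolding inner_weak_grad[OF \<Omega>(1) phiH1 \<xi>H1] phi10(2) by simp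
      moreover have "(LINT x|lebesgue_on \<Omega>. q x * (u x)\<^sup>2 * \<xi> x) = inner (E.f U U) (fst (jt \<Omega> \<xi>))"
      proof -
        have "inner (E.f U U) (fst (jt \<Omega> \<xi>)) = (LINT x|lebesgue. rep (E.f U U) x * rep (emb \<Omega> \<xi>) x)"
          unfolding inner_rep by (simp add: jt_def)
        also have "... = (LINT x|lebesgue. indicator \<Omega> x * (q x * (u x)\<^sup>2 * \<xi> x))"
        proof (rule integral_cong_AE)
          show "(%x. rep (E.f U U) x * rep (emb \<Omega> \<xi>) x) \<in> borel_measurable lebesgue" by simp
          have "(%x. a x * (u x * u x) * (indicator \<Omega> x * \<xi> x)) \<in> borel_measurable lebesgue"
            using a \<xi>L by (auto simp: u_def bmult_def L2_iff[OF \<Omega>(1)] sqint_def)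
          then show "(%x. indicator \<Omega> x * (q x * (u x)\<^sup>2 * \<xi> x)) \<in> borel_measurable lebesgue"
            by (rule measurable_cong[THEN iffD1, rotated]) (simp add: a_def indicator_def power2_eq_square)
          show "AE x in lebesgue. rep (E.f U U) x * rep (emb \<Omega> \<xi>) x = indicator \<Omega> x * (q x * (u x)\<^sup>2 * \<xi> x)"
            using re[OF \<xi>L] ff[OF U(1)] by eventually_elim (simp add: a_def u_def indicator_def power2_eq_square)
        qed
        finally show ?thesis unfolding LINT_lebesgue_on[OF \<Omega>(1)] by simp
      qed
      ultimately show ?thesis using DH(2)[OF h(1)] by simp
    qed
    have "H10_norm \<Omega> u = norm (snd U)"
      unfolding H10_norm_def power2_norm_eq_inner inner_weak_grad[OF \<Omega>(1) uH1 uH1] u10(2) by (simp add: norm_eq_sqrt_inner)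
    moreover have "weak_solution \<Omega> q p u \<omega> phi"
      unfolding weak_solution_def using B phihh(1) eq1 eq2 by blast
    ultimately have "weak_solution \<Omega> q p u \<omega> phi & A - C1 <= \<omega> & A <= C2 * (1 + H10_norm \<Omega> u) ^ 3" using \<omega> A by simp
    then show ?thesis by blast
  qed
  \<comment> \<open>The n-th solution is taken at a level of at least n.\<close>
  then have "\<forall>n. \<exists>u \<omega> phi. weak_solution \<Omega> q p u \<omega> phi & real n - C1 <= \<omega> & real n <= C2 * (1 + H10_norm \<Omega> u) ^ 3" by blast
  then obtain u \<omega> phi where s: "!!n. weak_solution \<Omega> q p (u n) (\<omega> n) (phi n)" "!!n. real n - C1 <= \<omega> n"
    "!!n. real n <= C2 * (1 + H10_norm \<Omega> (u n)) ^ 3" by metis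
  have "filterlim (%n. real n - C1) at_top sequentially" by real_asymp
  then have w: "filterlim \<omega> at_top sequentially" by (rule filterlim_at_top_mono) (use s(2) in simp)
  have "filterlim (%n. H10_norm \<Omega> (u n)) at_top sequentially"
    unfolding filterlim_at_top
  proof
    fix Z :: real
    \<comment> \<open>The cubic bound is inverted: a norm below Z would keep n at most |C2| (1 +
      |Z|)^3.\<close>
    have "H10_norm \<Omega> (u n) >= Z" if n: "real n > \<bar>C2\<bar> * (1 + \<bar>Z\<bar>) ^ 3" for n
    proof (rule ccontr)
      assume z: "\<not> H10_norm \<Omega> (u n) >= Z"
      have h0: "H10_norm \<Omega> (u n) >= 0" by (simp add: H10_norm_def)
      have "real n <= C2 * (1 + H10_norm \<Omega> (u n)) ^ 3" by (rule s(3))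
      also have "... <= \<bar>C2\<bar> * (1 + H10_norm \<Omega> (u n)) ^ 3" using h0 by (intro mult_right_mono) auto
      also have "... <= \<bar>C2\<bar> * (1 + \<bar>Z\<bar>) ^ 3" using h0 z by (intro mult_left_mono power_mono) auto
      finally show False using n by simp
    qed
    moreover have "\<forall>\<^sub>F n in sequentially. real n > \<bar>C2\<bar> * (1 + \<bar>Z\<bar>) ^ 3"
      using filterlim_real_sequentially unfolding filterlim_at_top_dense by blast
    ultimately show "\<forall>\<^sub>F n in sequentially. Z <= H10_norm \<Omega> (u n)" by (auto elim: eventually_mono)
  qed
  then show ?thesis using s(1) w by blast
qed

end
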